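(* Let $k\ge1$. The $k$-th order multipoint flux mixed finite element (MFMFE) method: find $(\mathbf u_h,p_h)\in\mathbf V_h^k\times W_h^{k-1}$ such that $$(K^{-1}\mathbf u_h,\mathbf v)_Q-(p_h,\nabla\cdot\mathbf v)=-\langle\mathcal R_h^{k-1}g,\mathbf v\cdot\mathbf n\rangle_{\Gamma_D}\quad\forall\mathbf v\in\mathbf V_h^k,\qquad(\nabla\cdot\mathbf u_h,w)=(f,w)\quad\forall w\in W_h^{k-1},$$ has a unique solution.
   Context: Domain and data: $\Omega\subset\mathbb R^d$ ($d=2,3$) is an open bounded polytopal domain, $\partial\Omega=\bar\Gamma_D\cup\bar\Gamma_N$, $\Gamma_D\cap\Gamma_N=\emptyset$, $\mathrm{measure}(\Gamma_D)>0$, $\mathbf n$ the outward unit normal. $K$ is a symmetric tensor with $k_0\xi^T\xi\le\xi^TK(\mathbf x)\xi\le k_1\xi^T\xi$ for all $\mathbf x\in\Omega$, $\xi\in\mathbb R^d$, for some $0<k_0<k_1<\infty$. $f\in L^2(\Omega)$, $g\in L^2(\Gamma_D)$. $(\cdot,\cdot)$ is the $L^2(\Omega)$ inner product, $\langle\cdot,\cdot\rangle_S$ that of $L^2(S)$. $\mathbf V=\{\mathbf v\in H(\mathrm{div};\Omega):\mathbf v\cdot\mathbf n=0\text{ on }\Gamma_N\}$, $W=L^2(\Omega)$. Mesh: $\mathcal T_h$ is a shape regular, quasi-uniform finite element partition of $\Omega$ into quadrilaterals ($d=2$) or hexahedra ($d=3$, possibly with nonplanar faces), $h=\max_E\mathrm{diam}(E)$.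 $\hat E=[-1,1]^d$; for $E\in\mathcal T_h$, $F_E:\hat E\to E$ is the bilinear (trilinear) bijection mapping the vertices of $\hat E$ to the corresponding vertices of $E$; $DF_E$ is its Jacobian matrix, $J_E=|\det DF_E|$. Shape regularity and quasi-uniformity imply $\|DF_E\|_{0,\infty,\hat E}\sim h$, $\|J_E\|_{0,\infty,\hat E}\sim h^d$, $\|DF_E^{-1}\|_{0,\infty,E}\sim h^{-1}$, $\|J_{F_E^{-1}}\|_{0,\infty,E}\sim h^{-d}$, where $J_{F_E^{-1}}=|\det DF_E^{-1}|$ ($\sim$: two-sided bounds with constants independent of $h$). Spaces: $\mathcal Q^m$ = polynomials of degree $\le m$ in each variable. $\hat{\mathbf V}^{m}_{RT}(\hat E)=(\mathcal Q^m+\hat x\mathcal Q^m)\times(\mathcal Q^m+\hat y\mathcal Q^m)\times(\mathcal Q^m+\hat z\mathcal Q^m)$ (third component omitted if $d=2$). For $i=1,\dots,d$, $\mathcal B_i^k$ is spanned by the vectors whose only nonzero entry is the $i$-th, equal to a monomial of degree $\le k$ in each variable and of degree exactly $k$ in at least one variable other than the $i$-th; $\tilde{\mathcal B}^k=\sum_{i=1}^d\hat\nabla\times(\hat{\mathbf x}\times\mathcal B^k_i)$ (in 2d, $\hat{\mathbf x}\times\hat{\mathbf q}=\hat xq_2-\hat yq_1$ and $\hat\nabla\times\phi=(-\partial_2\phi,\partial_1\phi)^T$). $\hat{\mathbf V}^k(\hat E)=\hat{\mathbf V}^{k-1}_{RT}(\hat E)\oplus\tilde{\mathcal B}^k(\hat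 E)$, $\hat W^{k-1}(\hat E)=\mathcal Q^{k-1}(\hat E)$. Transformations: $\mathbf v\leftrightarrow\hat{\mathbf v}$ means $\mathbf v=\big(\frac1{J_E}DF_E\hat{\mathbf v}\big)\circ F_E^{-1}$ (Piola), $w\leftrightarrow\hat w$ means $w=\hat w\circ F_E^{-1}$. $\mathbf V^k_h=\{\mathbf v\in\mathbf V:\mathbf v|_E\leftrightarrow\hat{\mathbf v}\in\hat{\mathbf V}^k(\hat E)\ \forall E\in\mathcal T_h\}$, $W^{k-1}_h=\{w\in W:w|_E\leftrightarrow\hat w\in\hat W^{k-1}(\hat E)\ \forall E\in\mathcal T_h\}$. Quadrature: with $\{\xi_k(i)\}_{i=0}^k$, $\{\lambda_k(i)\}_{i=0}^k$ the Gauss–Lobatto points and weights on $[-1,1]$, for $\boldsymbol i\in\{0,\dots,k\}^d$ put $\hat{\mathbf p}_{\boldsymbol i}=(\xi_k(\boldsymbol i_1),\dots,\xi_k(\boldsymbol i_d))$ and $w_k(\boldsymbol i)=\prod_j\lambda_k(\boldsymbol i_j)$. With $\mathcal K^{-1}=\frac1{J_E}DF_E^T(K^{-1}\circ F_E)DF_E$, $(K^{-1}\mathbf q,\mathbf v)_Q=\sum_{E\in\mathcal T_h}\sum_{\boldsymbol i}w_k(\boldsymbol i)\,\mathcal K^{-1}(\hat{\mathbf p}_{\boldsymbol i})\hat{\mathbf q}(\hat{\mathbf p}_{\boldsymbol i})\cdot\hat{\mathbf v}(\hat{\mathbf p}_{\boldsymbol i})$. Boundary data: on a boundary facet $e=F_E(\hat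 e)$, $\mathcal R_h^{k-1}\phi=(\hat{\mathcal R}^{k-1}_{\hat e}\hat\phi)\circ F_E^{-1}$ with $\hat\phi=\phi\circ F_E$ and $\hat{\mathcal R}^{k-1}_{\hat e}$ the $L^2(\hat e)$-orthogonal projection onto $\mathcal Q^{k-1}(\hat e)$. *)

theory Defs
  imports "HOL-Analysis.Analysis" "HOL-Computational_Algebra.Polynomial"
begin

section \<open>Calculus on Euclidean space\<close>

definition pd :: "'d \<Rightarrow> (real^'d \<Rightarrow> real) \<Rightarrow> real^'d::finite \<Rightarrow> real" where
  "pd i f x = frechet_derivative f (at x) (axis i 1)"

definition grad :: "(real^'d \<Rightarrow> real) \<Rightarrow> real^'d::finite \<Rightarrow> real^'d" where
  "grad f x = (\<chi> i. pd i f x)"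

definition jac :: "(real^'d \<Rightarrow> real^'d) \<Rightarrow> real^'d::finite \<Rightarrow> real^'d^'d" where
  "jac G x = matrix (frechet_derivative G (at x))"

definition absdet_jac :: "(real^'d \<Rightarrow> real^'d) \<Rightarrow> real^'d::finite \<Rightarrow> real" where
  "absdet_jac G x = \<bar>det (jac G x)\<bar>"

primrec C_diff :: "nat \<Rightarrow> (real^'d::finite \<Rightarrow> real) \<Rightarrow> bool" where
  "C_diff 0 f \<longleftrightarrow> continuous_on UNIV f"
| "C_diff (Suc n) f \<longleftrightarrow> f differentiable_on UNIV \<and> (\<forall>i. C_diff n (pd i f))"

definition smooth :: "(real^'d::finite \<Rightarrow> real) \<Rightarrow> bool" where
  "smooth f \<longleftrightarrow> (\<forall>n. C_diff n f)"

definition test_function :: "(real^'d::finite) set \<Rightarrow> (real^'d \<Rightarrow> real) \<Rightarrow> bool" where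
  "test_function \<Omega> \<phi> \<longleftrightarrow> smooth \<phi> \<and> compact (closure {x. \<phi> x \<noteq> 0}) \<and> closure {x. \<phi> x \<noteq> 0} \<subseteq> \<Omega>"

section \<open>Surface measure and L2 spaces\<close>

text \<open>The Hausdorff outer measure of integer dimension m > 0, normalised so that it agrees with
  m-dimensional area on m-dimensional surfaces.\<close>

definition hausdorff_outer :: "nat \<Rightarrow> 'a::metric_space set \<Rightarrow> ennreal" where
  "hausdorff_outer m A = (SUP \<delta>\<in>{0<..}.
     INF U\<in>{U :: nat \<Rightarrow> 'a set. A \<subseteq> (\<Union>n. U n) \<and> (\<forall>n. bounded (U n) \<and> diameter (U n) \<le> \<delta>)}.
       (\<Sum>n. ennreal (unit_ball_vol (real m) / 2 ^ m * diameter (U n) ^ m)))"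

text \<open>Completed, in analogy with \<^const>\<open>lebesgue\<close> as the completion of \<^const>\<open>lborel\<close>.\<close>

definition surface_measure :: "(real^'d::finite) measure" where
  "surface_measure = completion (measure_of UNIV (sets borel) (hausdorff_outer (CARD('d) - 1)))"

text \<open>Elements of L2 are represented by functions; identities between them hold almost everywhere.\<close>

definition L2 :: "'a measure \<Rightarrow> ('a \<Rightarrow> 'b::{real_normed_vector, second_countable_topology}) \<Rightarrow> bool" where
  "L2 M f \<longleftrightarrow> f \<in> borel_measurable M \<and> integrable M (\<lambda>x. (norm (f x))\<^sup>2)"

definition L2_inner :: "'a measure \<Rightarrow> ('a \<Rightarrow> real) \<Rightarrow> ('a \<Rightarrow> real) \<Rightarrow> real" where
  "L2_inner M f g = (\<integral>x. f x * g x \<partial>M)"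

section \<open>H(div) and the velocity space\<close>

definition has_weak_div ::
    "(real^'d::finite) set \<Rightarrow> (real^'d \<Rightarrow> real^'d) \<Rightarrow> (real^'d \<Rightarrow> real) \<Rightarrow> bool" where
  "has_weak_div \<Omega> v \<psi> \<longleftrightarrow> L2 (lebesgue_on \<Omega>) \<psi> \<and>
     (\<forall>\<phi>. test_function \<Omega> \<phi> \<longrightarrow>
        (\<integral>x. v x \<bullet> grad \<phi> x \<partial>lebesgue_on \<Omega>) = - (\<integral>x. \<psi> x * \<phi> x \<partial>lebesgue_on \<Omega>))"

definition Hdiv :: "(real^'d::finite) set \<Rightarrow> (real^'d \<Rightarrow> real^'d) set" where
  "Hdiv \<Omega> = {v. L2 (lebesgue_on \<Omega>) v \<and> (\<exists>\<psi>. has_weak_div \<Omega> v \<psi>)}"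

text \<open>The weak divergence is determined only up to a null set.\<close>

definition weak_div :: "(real^'d::finite) set \<Rightarrow> (real^'d \<Rightarrow> real^'d) \<Rightarrow> real^'d \<Rightarrow> real" where
  "weak_div \<Omega> v = (SOME \<psi>. has_weak_div \<Omega> v \<psi>)"

text \<open>The normal trace of a field in H(div) is a functional on the boundary, defined through Green's
  formula; that it vanishes on S is tested with the functions which vanish near the rest of the
  boundary.\<close>

definition normal_trace_zero_on ::
    "(real^'d::finite) set \<Rightarrow> (real^'d) set \<Rightarrow> (real^'d \<Rightarrow> real^'d) \<Rightarrow> bool" where
  "normal_trace_zero_on \<Omega> S v \<longleftrightarrow>
     (\<forall>\<phi> U. smooth \<phi> \<and> open U \<and> frontier \<Omega> - S \<subseteq> U \<and> (\<forall>x\<in>U. \<phi> x = 0) \<longrightarrow>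
        (\<integral>x. v x \<bullet> grad \<phi> x + weak_div \<Omega> v x * \<phi> x \<partial>lebesgue_on \<Omega>) = 0)"

definition vel_space :: "(real^'d::finite) set \<Rightarrow> (real^'d) set \<Rightarrow> (real^'d \<Rightarrow> real^'d) set" where
  "vel_space \<Omega> \<Gamma>N = {v \<in> Hdiv \<Omega>. normal_trace_zero_on \<Omega> \<Gamma>N v}"

section \<open>The domain\<close>

text \<open>The last condition says that the domain has no slits or punctures: it lies on one side of its
  boundary.\<close>

definition polytopal_domain :: "(real^'d::finite) set \<Rightarrow> bool" where
  "polytopal_domain \<Omega> \<longleftrightarrow> open \<Omega> \<and> connected \<Omega> \<and> bounded \<Omega> \<and> \<Omega> \<noteq> {} \<and>
     (\<exists>\<P>. finite \<P> \<and> (\<forall>P\<in>\<P>. polytope P) \<and> closure \<Omega> = \<Union>\<P>) \<and> interior (closure \<Omega>) = \<Omega>"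

text \<open>Well defined at the points where the boundary is locally flat, that is, at almost all boundary
  points of a polytopal domain.\<close>

definition outward_normal :: "(real^'d::finite) set \<Rightarrow> real^'d \<Rightarrow> real^'d" where
  "outward_normal \<Omega> x =
     (THE n. norm n = 1 \<and> (\<exists>r>0. \<forall>y\<in>ball x r. y \<in> \<Omega> \<longleftrightarrow> (y - x) \<bullet> n < 0))"

section \<open>Polynomial spaces on the reference element\<close>

definition monom_fun :: "('d \<Rightarrow> nat) \<Rightarrow> real^'d::finite \<Rightarrow> real" where
  "monom_fun \<alpha> x = (\<Prod>i\<in>UNIV. x $ i ^ \<alpha> i)"

definition Qpoly :: "nat \<Rightarrow> (real^'d::finite \<Rightarrow> real) set" where
  "Qpoly m = {f. \<exists>c. f = (\<lambda>x. \<Sum>\<alpha> | \<forall>i. \<alpha> i \<le> m. c \<alpha> * monom_fun \<alpha> x)}"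

definition RT :: "nat \<Rightarrow> (real^'d::finite \<Rightarrow> real^'d) set" where
  "RT m = {v. \<forall>i. \<exists>a\<in>Qpoly m. \<exists>b\<in>Qpoly m. \<forall>x. v x $ i = a x + x $ i * b x}"

definition Bpoly :: "nat \<Rightarrow> 'd \<Rightarrow> (real^'d::finite \<Rightarrow> real^'d) set" where
  "Bpoly k i = {q. \<exists>c. q = (\<lambda>x. axis i
     (\<Sum>\<alpha> | (\<forall>j. \<alpha> j \<le> k) \<and> (\<exists>j. j \<noteq> i \<and> \<alpha> j = k). c \<alpha> * monom_fun \<alpha> x))}"

definition cross2 :: "real^2 \<Rightarrow> real^2 \<Rightarrow> real" where
  "cross2 x q = x $ 1 * q $ 2 - x $ 2 * q $ 1"

definition curl2 :: "(real^2 \<Rightarrow> real) \<Rightarrow> real^2 \<Rightarrow> real^2" where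
  "curl2 \<phi> x = vector [- pd 2 \<phi> x, pd 1 \<phi> x]"

definition curl3 :: "(real^3 \<Rightarrow> real^3) \<Rightarrow> real^3 \<Rightarrow> real^3" where
  "curl3 G x = vector
     [pd 2 (\<lambda>y. G y $ 3) x - pd 3 (\<lambda>y. G y $ 2) x,
      pd 3 (\<lambda>y. G y $ 1) x - pd 1 (\<lambda>y. G y $ 3) x,
      pd 1 (\<lambda>y. G y $ 2) x - pd 2 (\<lambda>y. G y $ 1) x]"

definition Btilde2 :: "nat \<Rightarrow> (real^2 \<Rightarrow> real^2) set" where
  "Btilde2 k = {v. \<exists>q. (\<forall>i. q i \<in> Bpoly k i) \<and>
     v = (\<lambda>x. \<Sum>i\<in>UNIV. curl2 (\<lambda>y. cross2 y (q i y)) x)}"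

definition Btilde3 :: "nat \<Rightarrow> (real^3 \<Rightarrow> real^3) set" where
  "Btilde3 k = {v. \<exists>q. (\<forall>i. q i \<in> Bpoly k i) \<and>
     v = (\<lambda>x. \<Sum>i\<in>UNIV. curl3 (\<lambda>y. cross3 y (q i y)) x)}"

definition Vhat2 :: "nat \<Rightarrow> (real^2 \<Rightarrow> real^2) set" where
  "Vhat2 k = {v. \<exists>a\<in>RT (k - 1). \<exists>b\<in>Btilde2 k. v = (\<lambda>x. a x + b x)}"

definition Vhat3 :: "nat \<Rightarrow> (real^3 \<Rightarrow> real^3) set" where
  "Vhat3 k = {v. \<exists>a\<in>RT (k - 1). \<exists>b\<in>Btilde3 k. v = (\<lambda>x. a x + b x)}"

section \<open>Meshes\<close>

definition ref_cube :: "(real^'d::finite) set" where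
  "ref_cube = cbox (-1) 1"

text \<open>The faces of all dimensions are indexed by sign vectors, a zero entry marking a free
  coordinate; the zero vector gives the cube itself.\<close>

definition face_index :: "(real^'d::finite) set" where
  "face_index = {s. \<forall>i. s $ i \<in> {-1, 0, 1}}"

definition ref_face :: "real^'d::finite \<Rightarrow> (real^'d) set" where
  "ref_face s = {x \<in> ref_cube. \<forall>i. s $ i \<noteq> 0 \<longrightarrow> x $ i = s $ i}"

definition ref_facet :: "'d \<Rightarrow> real \<Rightarrow> (real^'d::finite) set" where
  "ref_facet i s = {x \<in> ref_cube. x $ i = s}"

definition ref_facet_int :: "'d \<Rightarrow> real \<Rightarrow> (real^'d::finite) set" where
  "ref_facet_int i s = {x \<in> ref_facet i s. \<forall>j. j \<noteq> i \<longrightarrow> \<bar>x $ j\<bar> < 1}"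

definition subfaces :: "(real^'d \<Rightarrow> real^'d) \<Rightarrow> real^'d::finite \<Rightarrow> (real^'d) set set" where
  "subfaces G s = (\<lambda>t. G ` ref_face t) ` {t \<in> face_index. ref_face t \<subseteq> ref_face s}"

text \<open>Two elements, parametrised by G and G', are disjoint or meet in a common vertex, edge or face.
  A common face has the same vertices and edges with respect to both parametrisations.\<close>

definition conforming ::
    "(real^'d \<Rightarrow> real^'d) \<Rightarrow> (real^'d \<Rightarrow> real^'d::finite) \<Rightarrow> bool" where
  "conforming G G' \<longleftrightarrow> G ` ref_cube \<inter> G' ` ref_cube = {} \<or>
     (\<exists>s\<in>face_index. \<exists>s'\<in>face_index.
        G ` ref_cube \<inter> G' ` ref_cube = G ` ref_face s \<and>
        G ` ref_cube \<inter> G' ` ref_cube = G' ` ref_face s' \<and>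
        subfaces G s = subfaces G' s')"

text \<open>An element is the image of the reference cube under its multilinear map.\<close>

definition fe_partition ::
    "(real^'d::finite) set \<Rightarrow> (real^'d) set set \<Rightarrow> ((real^'d) set \<Rightarrow> real^'d \<Rightarrow> real^'d) \<Rightarrow> bool" where
  "fe_partition \<Omega> T F \<longleftrightarrow> finite T \<and> \<Union>T = closure \<Omega> \<and>
     (\<forall>E\<in>T. (\<forall>i. (\<lambda>x. F E x $ i) \<in> Qpoly 1) \<and> bij_betw (F E) ref_cube E) \<and>
     (\<forall>E\<in>T. \<forall>E'\<in>T. E \<noteq> E' \<longrightarrow>
        interior E \<inter> interior E' = {} \<and> conforming (F E) (F E'))"

definition sup_norm_mat :: "(real^'d) set \<Rightarrow> (real^'d \<Rightarrow> real^'d^'d::finite) \<Rightarrow> real" where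
  "sup_norm_mat S A = (SUP x\<in>S. onorm (\<lambda>y. A x *v y))"

definition equivalent_up_to :: "real \<Rightarrow> real \<Rightarrow> real \<Rightarrow> real \<Rightarrow> bool" where
  "equivalent_up_to c C a b \<longleftrightarrow> c * b \<le> a \<and> a \<le> C * b"

text \<open>Shape regularity and quasi-uniformity with constants c and C. The quantities belonging to the
  inverse map are pulled back to the reference cube: at the image of x its Jacobian matrix is the
  inverse of \<^term>\<open>jac (F E) x\<close>.\<close>

definition regular_mesh ::
    "real \<Rightarrow> real \<Rightarrow> real \<Rightarrow> (real^'d::finite) set set \<Rightarrow> ((real^'d) set \<Rightarrow> real^'d \<Rightarrow> real^'d) \<Rightarrow> bool" where
  "regular_mesh c C h T F \<longleftrightarrow> (\<forall>E\<in>T.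
     c * h \<le> diameter E \<and>
     (\<forall>x\<in>ref_cube. invertible (jac (F E) x)) \<and>
     equivalent_up_to c C (sup_norm_mat ref_cube (jac (F E))) h \<and>
     equivalent_up_to c C (SUP x\<in>ref_cube. absdet_jac (F E) x) (h ^ CARD('d)) \<and>
     equivalent_up_to c C (sup_norm_mat ref_cube (\<lambda>x. matrix_inv (jac (F E) x))) (inverse h) \<and>
     equivalent_up_to c C (SUP x\<in>ref_cube. \<bar>det (matrix_inv (jac (F E) x))\<bar>)
       (inverse (h ^ CARD('d))))"

text \<open>\<^term>\<open>boundary_facets \<Omega> S T F\<close> lists the facets on the boundary whose relative interior lies
  in S.\<close>

definition boundary_facets ::
    "(real^'d::finite) set \<Rightarrow> (real^'d) set \<Rightarrow> (real^'d) set set \<Rightarrow>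
     ((real^'d) set \<Rightarrow> real^'d \<Rightarrow> real^'d) \<Rightarrow> ((real^'d) set \<times> 'd \<times> real) set" where
  "boundary_facets \<Omega> S T F = {(E, i, s). E \<in> T \<and> s \<in> {-1, 1} \<and>
     F E ` ref_facet i s \<subseteq> frontier \<Omega> \<and> F E ` ref_facet_int i s \<subseteq> S}"

section \<open>Finite element spaces\<close>

definition piola :: "(real^'d \<Rightarrow> real^'d) \<Rightarrow> (real^'d \<Rightarrow> real^'d) \<Rightarrow> real^'d \<Rightarrow> real^'d::finite" where
  "piola G vh x = (let y = inv_into ref_cube G x in (1 / absdet_jac G y) *\<^sub>R (jac G y *v vh y))"

definition Vh ::
    "(real^'d \<Rightarrow> real^'d::finite) set \<Rightarrow> (real^'d) set \<Rightarrow> (real^'d) set \<Rightarrow> (real^'d) set set \<Rightarrow>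
     ((real^'d) set \<Rightarrow> real^'d \<Rightarrow> real^'d) \<Rightarrow> (real^'d \<Rightarrow> real^'d) set" where
  "Vh Vhat \<Omega> \<Gamma>N T F = {v \<in> vel_space \<Omega> \<Gamma>N.
     \<forall>E\<in>T. \<exists>vh\<in>Vhat. AE x in lebesgue_on E. v x = piola (F E) vh x}"

definition Wh ::
    "nat \<Rightarrow> (real^'d::finite) set \<Rightarrow> (real^'d) set set \<Rightarrow>
     ((real^'d) set \<Rightarrow> real^'d \<Rightarrow> real^'d) \<Rightarrow> (real^'d \<Rightarrow> real) set" where
  "Wh m \<Omega> T F = {w. L2 (lebesgue_on \<Omega>) w \<and>
     (\<forall>E\<in>T. \<exists>wh\<in>Qpoly m. AE x in lebesgue_on E. w x = wh (inv_into ref_cube (F E) x))}"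

text \<open>The polynomial field on the reference element corresponding to v on E. For v in
  \<^const>\<open>Vh\<close> it exists and is unique.\<close>

definition ref_field ::
    "(real^'d \<Rightarrow> real^'d::finite) set \<Rightarrow> ((real^'d) set \<Rightarrow> real^'d \<Rightarrow> real^'d) \<Rightarrow>
     (real^'d \<Rightarrow> real^'d) \<Rightarrow> (real^'d) set \<Rightarrow> real^'d \<Rightarrow> real^'d" where
  "ref_field Vhat F v E =
     (SOME vh. vh \<in> Vhat \<and> (AE x in lebesgue_on E. v x = piola (F E) vh x))"

section \<open>Quadrature rule and boundary data\<close>

text \<open>The rule with k + 1 nodes, two of them the end points, of degree of exactness 2 k - 1; this
  determines nodes and weights.\<close>

definition gauss_lobatto :: "nat \<Rightarrow> (nat \<Rightarrow> real) \<Rightarrow> (nat \<Rightarrow> real) \<Rightarrow> bool" where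
  "gauss_lobatto k \<xi> \<omega> \<longleftrightarrow> strict_mono_on {..k} \<xi> \<and> \<xi> 0 = -1 \<and> \<xi> k = 1 \<and>
     (\<forall>p :: real poly. degree p \<le> 2 * k - 1 \<longrightarrow>
        (\<Sum>i\<le>k. \<omega> i * poly p (\<xi> i)) = integral {-1..1} (poly p))"

definition calK_inv ::
    "(real^'d \<Rightarrow> real^'d^'d) \<Rightarrow> (real^'d \<Rightarrow> real^'d) \<Rightarrow> real^'d::finite \<Rightarrow> real^'d^'d" where
  "calK_inv K G x =
     (1 / absdet_jac G x) *\<^sub>R (transpose (jac G x) ** matrix_inv (K (G x)) ** jac G x)"

definition quad_form ::
    "(real^'d \<Rightarrow> real^'d::finite) set \<Rightarrow> nat \<Rightarrow> (nat \<Rightarrow> real) \<Rightarrow> (nat \<Rightarrow> real) \<Rightarrow>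
     (real^'d \<Rightarrow> real^'d^'d) \<Rightarrow> (real^'d) set set \<Rightarrow> ((real^'d) set \<Rightarrow> real^'d \<Rightarrow> real^'d) \<Rightarrow>
     (real^'d \<Rightarrow> real^'d) \<Rightarrow> (real^'d \<Rightarrow> real^'d) \<Rightarrow> real" where
  "quad_form Vhat k \<xi> \<omega> K T F q v =
     (\<Sum>E\<in>T. \<Sum>\<iota> | \<forall>j::'d. \<iota> j \<le> k.
        let p = (\<chi> j. \<xi> (\<iota> j)) in
        (\<Prod>j\<in>UNIV. \<omega> (\<iota> j)) *
        ((calK_inv K (F E) p *v ref_field Vhat F q E p) \<bullet> ref_field Vhat F v E p))"

text \<open>On a reference facet the elements of \<^const>\<open>Qpoly\<close> restrict to the polynomials of the same
  degree in the remaining variables, so only the values on the facet are determined.\<close>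

definition ref_facet_proj :: "nat \<Rightarrow> 'd \<Rightarrow> real \<Rightarrow> (real^'d \<Rightarrow> real) \<Rightarrow> real^'d::finite \<Rightarrow> real" where
  "ref_facet_proj m i s \<phi> = (SOME q. q \<in> Qpoly m \<and> (\<forall>r\<in>Qpoly m.
     L2_inner (restrict_space surface_measure (ref_facet i s)) (\<lambda>x. \<phi> x - q x) r = 0))"

definition Rh ::
    "nat \<Rightarrow> (real^'d \<Rightarrow> real^'d) \<Rightarrow> 'd \<Rightarrow> real \<Rightarrow> (real^'d \<Rightarrow> real) \<Rightarrow> real^'d::finite \<Rightarrow> real" where
  "Rh m G i s \<phi> x = ref_facet_proj m i s (\<phi> \<circ> G) (inv_into ref_cube G x)"

text \<open>The boundary pairing, summed over the facets making up the Dirichlet part; the value of v on a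
  facet of E is that of its polynomial representation on E.\<close>

definition dirichlet_term ::
    "(real^'d \<Rightarrow> real^'d::finite) set \<Rightarrow> nat \<Rightarrow> (real^'d) set \<Rightarrow> (real^'d) set \<Rightarrow> (real^'d) set set \<Rightarrow>
     ((real^'d) set \<Rightarrow> real^'d \<Rightarrow> real^'d) \<Rightarrow> (real^'d \<Rightarrow> real) \<Rightarrow> (real^'d \<Rightarrow> real^'d) \<Rightarrow> real" where
  "dirichlet_term Vhat k \<Omega> \<Gamma>D T F g v =
     (\<Sum>(E, i, s) \<in> boundary_facets \<Omega> \<Gamma>D T F.
        L2_inner (restrict_space surface_measure (F E ` ref_facet i s))
          (Rh (k - 1) (F E) i s g)
          (\<lambda>x. piola (F E) (ref_field Vhat F v E) x \<bullet> outward_normal \<Omega> x))"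

section \<open>The multipoint flux mixed finite element method\<close>

definition mfmfe_solution ::
    "(real^'d \<Rightarrow> real^'d::finite) set \<Rightarrow> nat \<Rightarrow> (nat \<Rightarrow> real) \<Rightarrow> (nat \<Rightarrow> real) \<Rightarrow>
     (real^'d) set \<Rightarrow> (real^'d) set \<Rightarrow> (real^'d) set \<Rightarrow> (real^'d \<Rightarrow> real^'d^'d) \<Rightarrow>
     (real^'d \<Rightarrow> real) \<Rightarrow> (real^'d \<Rightarrow> real) \<Rightarrow>
     (real^'d) set set \<Rightarrow> ((real^'d) set \<Rightarrow> real^'d \<Rightarrow> real^'d) \<Rightarrow>
     (real^'d \<Rightarrow> real^'d) \<Rightarrow> (real^'d \<Rightarrow> real) \<Rightarrow> bool" where
  "mfmfe_solution Vhat k \<xi> \<omega> \<Omega> \<Gamma>D \<Gamma>N K f g T F u p \<longleftrightarrow>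
     u \<in> Vh Vhat \<Omega> \<Gamma>N T F \<and> p \<in> Wh (k - 1) \<Omega> T F \<and>
     (\<forall>v\<in>Vh Vhat \<Omega> \<Gamma>N T F.
        quad_form Vhat k \<xi> \<omega> K T F u v - L2_inner (lebesgue_on \<Omega>) p (weak_div \<Omega> v)
          = - dirichlet_term Vhat k \<Omega> \<Gamma>D T F g v) \<and>
     (\<forall>w\<in>Wh (k - 1) \<Omega> T F.
        L2_inner (lebesgue_on \<Omega>) (weak_div \<Omega> u) w = L2_inner (lebesgue_on \<Omega>) f w)"

definition mfmfe_uniquely_solvable ::
    "(real^'d \<Rightarrow> real^'d::finite) set \<Rightarrow> nat \<Rightarrow> (nat \<Rightarrow> real) \<Rightarrow> (nat \<Rightarrow> real) \<Rightarrow>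
     (real^'d) set \<Rightarrow> (real^'d) set \<Rightarrow> (real^'d) set \<Rightarrow> (real^'d \<Rightarrow> real^'d^'d) \<Rightarrow>
     (real^'d \<Rightarrow> real) \<Rightarrow> (real^'d \<Rightarrow> real) \<Rightarrow>
     (real^'d) set set \<Rightarrow> ((real^'d) set \<Rightarrow> real^'d \<Rightarrow> real^'d) \<Rightarrow> bool" where
  "mfmfe_uniquely_solvable Vhat k \<xi> \<omega> \<Omega> \<Gamma>D \<Gamma>N K f g T F \<longleftrightarrow>
     (\<exists>u p. mfmfe_solution Vhat k \<xi> \<omega> \<Omega> \<Gamma>D \<Gamma>N K f g T F u p) \<and>
     (\<forall>u p u' p'. mfmfe_solution Vhat k \<xi> \<omega> \<Omega> \<Gamma>D \<Gamma>N K f g T F u p \<and>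
        mfmfe_solution Vhat k \<xi> \<omega> \<Omega> \<Gamma>D \<Gamma>N K f g T F u' p' \<longrightarrow>
        (AE x in lebesgue_on \<Omega>. u x = u' x) \<and> (AE x in lebesgue_on \<Omega>. p x = p' x))"

text \<open>Since the quadrature rule uses point values of K up to the boundary, K is given on the closed
  domain. H is the set of mesh sizes; the regularity constants do not depend on the mesh size. The
  meshes resolve the splitting of the boundary into a Dirichlet and a Neumann part.\<close>

locale mfmfe_setting =
  fixes \<Omega> \<Gamma>D \<Gamma>N :: "(real^'d::finite) set"
    and K :: "real^'d \<Rightarrow> real^'d^'d"
    and f g :: "real^'d \<Rightarrow> real"
    and H :: "real set"
    and T :: "real \<Rightarrow> (real^'d) set set"
    and F :: "real \<Rightarrow> (real^'d) set \<Rightarrow> real^'d \<Rightarrow> real^'d"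
  assumes domain: "polytopal_domain \<Omega>"
    and boundary: "frontier \<Omega> = closure \<Gamma>D \<union> closure \<Gamma>N" "\<Gamma>D \<inter> \<Gamma>N = {}"
    and dirichlet_pos: "emeasure surface_measure \<Gamma>D > 0"
    and K_sym: "\<And>x. x \<in> closure \<Omega> \<Longrightarrow> transpose (K x) = K x"
    and K_bounds: "\<exists>k0 k1. 0 < k0 \<and> k0 < k1 \<and>
      (\<forall>x\<in>closure \<Omega>. \<forall>y. k0 * (y \<bullet> y) \<le> y \<bullet> (K x *v y) \<and> y \<bullet> (K x *v y) \<le> k1 * (y \<bullet> y))"
    and f_L2: "L2 (lebesgue_on \<Omega>) f"
    and g_L2: "L2 (restrict_space surface_measure \<Gamma>D) g"
    and partition: "\<And>h. h \<in> H \<Longrightarrow> fe_partition \<Omega> (T h) (F h)"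
    and mesh_size: "\<And>h. h \<in> H \<Longrightarrow> h = Max (diameter ` T h)"
    and regular: "\<exists>c C. 0 < c \<and> (\<forall>h\<in>H. regular_mesh c C h (T h) (F h))"
    and resolved: "\<And>h E i s. h \<in> H \<Longrightarrow> E \<in> T h \<Longrightarrow> s \<in> {-1, 1} \<Longrightarrow>
      F h E ` ref_facet i s \<subseteq> frontier \<Omega> \<Longrightarrow>
      F h E ` ref_facet_int i s \<subseteq> \<Gamma>D \<or> F h E ` ref_facet_int i s \<subseteq> \<Gamma>N"

end

theory Submission
  imports Defs
begin

text \<open>The method is a square linear system, so it suffices to show that the homogeneous problem has only
  the trivial solution. Let (v, w) solve it. Testing with (v, w) itself cancels the two pressure terms
  and leaves the quadrature form at v, which is a sum over elements and nodes of positive weights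
  (\<open>gauss_lobatto_weight_pos\<close>) times a positive definite form of the value of the reference field at the
  node (\<open>calK_inv_positive_definite\<close>). Hence all nodal values vanish, and so does v, because the enhanced
  Raviart-Thomas space is unisolvent on the tensor grid of the nodes (\<open>enhanced_RT_unisolvent\<close>).

  What remains of the equations says that w is orthogonal to the divergence of every discrete
  velocity, and then w is zero (\<open>pressure_zero\<close>). Raviart-Thomas fields suffice for this: bubbles
  without flux through the facets make w constant on every element; a field supported by two
  neighbouring elements, with flux through the common facet only, makes the two constants equal; the
  domain is connected through facets (\<open>facet_connected\<close>), so w is constant; and a field with flux through
  a facet in the Dirichlet boundary makes this constant zero.

  Three points need care beyond this.

  \<^item> The discrete spaces consist of functions, identified only up to null sets, and are not
    finite-dimensional as sets of functions. The linear algebra is therefore done with the nodal values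
    as finitely many coordinates (\<open>bilinear_system_solvable\<close>).

  \<^item> The normal trace is defined by Green's formula, which is pulled back to the reference cube element
    by element (\<open>green_cell\<close>). The contributions of a common facet cancel because the two
    parametrisations of it differ by a symmetry of the cube. This is derived from the conformity of
    the mesh: the symmetry is read off from the correspondence of the faces (\<open>common_facet\<close>).

  \<^item> The Dirichlet boundary is only known to have positive surface measure. It contains a facet because
    the skeleton of codimension two is a null set and the boundary consists of whole facets elsewhere
    (\<open>dirichlet_facet_exists\<close>). The boundary term is linear because the outward normal is measurable
    and the projected data are polynomial (\<open>boundary_pairing_linear\<close>).

  Two and three dimensions are treated together, since the curls of \<open>x \<times> q\<close> have the same
  description in both (\<open>enh_field\<close>).\<close>

section \<open>Finite systems of linear equations on function spaces\<close>

definition lin_space :: "('x \<Rightarrow> 'b::real_vector) set \<Rightarrow> bool" where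
  "lin_space Z \<longleftrightarrow> (\<lambda>x. 0) \<in> Z \<and>
     (\<forall>f\<in>Z. \<forall>g\<in>Z. (\<lambda>x. f x + g x) \<in> Z) \<and> (\<forall>f\<in>Z. \<forall>c::real. (\<lambda>x. c *\<^sub>R f x) \<in> Z)"

definition lin_functional :: "('x \<Rightarrow> 'b::real_vector) set \<Rightarrow> (('x \<Rightarrow> 'b) \<Rightarrow> real) \<Rightarrow> bool" where
  "lin_functional Z L \<longleftrightarrow> (\<forall>f\<in>Z. \<forall>g\<in>Z. L (\<lambda>x. f x + g x) = L f + L g) \<and>
     (\<forall>f\<in>Z. \<forall>c. L (\<lambda>x. c *\<^sub>R f x) = c * L f)"

lemma lin_space_zero: "lin_space Z \<Longrightarrow> (\<lambda>x. 0) \<in> Z"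
  by (simp add: lin_space_def)

lemma lin_space_add: "lin_space Z \<Longrightarrow> f \<in> Z \<Longrightarrow> g \<in> Z \<Longrightarrow> (\<lambda>x. f x + g x) \<in> Z"
  by (simp add: lin_space_def)

lemma lin_space_scale: "lin_space Z \<Longrightarrow> f \<in> Z \<Longrightarrow> (\<lambda>x. c *\<^sub>R f x) \<in> Z"
  by (simp add: lin_space_def)

lemma lin_space_diff:
  assumes "lin_space Z" "f \<in> Z" "g \<in> Z" shows "(\<lambda>x. f x - g x) \<in> Z"
  using lin_space_add[OF assms(1,2) lin_space_scale[OF assms(1,3), of "-1"]] by simp

lemma lin_space_sum:
  assumes "lin_space Z" "\<And>i. i \<in> I \<Longrightarrow> f i \<in> Z"
  shows "(\<lambda>x. \<Sum>i\<in>I. c i *\<^sub>R f i x) \<in> Z"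
  using assms(2)
proof (induction I rule: infinite_finite_induct)
  case (insert a I)
  have "f a \<in> Z" "(\<lambda>x. \<Sum>i\<in>I. c i *\<^sub>R f i x) \<in> Z"
    using insert by auto
  then show ?case
    using lin_space_add[OF assms(1) lin_space_scale[OF assms(1)]] insert.hyps by simp
qed (use assms in \<open>simp_all add: lin_space_zero\<close>)

lemma lin_functional_add:
  "lin_functional Z L \<Longrightarrow> f \<in> Z \<Longrightarrow> g \<in> Z \<Longrightarrow> L (\<lambda>x. f x + g x) = L f + L g"
  by (simp add: lin_functional_def)

lemma lin_functional_scale: "lin_functional Z L \<Longrightarrow> f \<in> Z \<Longrightarrow> L (\<lambda>x. c *\<^sub>R f x) = c * L f"
  by (simp add: lin_functional_def)

lemma lin_functional_diff:
  assumes "lin_space Z" "lin_functional Z L" "f \<in> Z" "g \<in> Z"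
  shows "L (\<lambda>x. f x - g x) = L f - L g"
  using lin_functional_add[OF assms(2,3) lin_space_scale[OF assms(1,4), of "-1"]]
    lin_functional_scale[OF assms(2,4), of "-1"] by simp

lemma lin_functional_sum:
  assumes "lin_space Z" "lin_functional Z L" "\<And>i. i \<in> I \<Longrightarrow> f i \<in> Z"
  shows "L (\<lambda>x. \<Sum>i\<in>I. c i *\<^sub>R f i x) = (\<Sum>i\<in>I. c i * L (f i))"
  using assms(3)
proof (induction I rule: infinite_finite_induct)
  case (insert a I)
  have "(\<lambda>x. \<Sum>i\<in>I. c i *\<^sub>R f i x) \<in> Z"
    using insert.prems by (intro lin_space_sum assms(1)) auto
  then show ?case
    using lin_functional_add[OF assms(2) lin_space_scale[OF assms(1), of "f a" "c a"], of "\<lambda>x. \<Sum>i\<in>I. c i *\<^sub>R f i x"]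
      lin_functional_scale[OF assms(2), of "f a" "c a"] insert
    by (simp cong: sum.cong)
qed (use lin_functional_scale[OF assms(2) lin_space_zero[OF assms(1)], of 0] in simp_all)

lemma lin_functional_plus:
  "lin_functional Z L \<Longrightarrow> lin_functional Z L' \<Longrightarrow> lin_functional Z (\<lambda>f. L f + L' f)"
  by (simp add: lin_functional_def algebra_simps)

lemma lin_functional_cong:
  assumes "lin_space Z" "lin_functional Z L" "\<And>f. f \<in> Z \<Longrightarrow> L f = L' f"
  shows "lin_functional Z L'"
  using assms by (simp add: lin_functional_def lin_space_def)

lemma lin_functional_uminus: "lin_functional Y L \<Longrightarrow> lin_functional Y (\<lambda>y. - L y)"
  by (simp add: lin_functional_def)

lemma lin_functional_zero: "lin_space Y \<Longrightarrow> lin_functional Y L \<Longrightarrow> L (\<lambda>x. 0) = 0"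
  using lin_functional_scale[of Y L "\<lambda>x. 0" 0] lin_space_zero[of Y] by simp

text \<open>Gaussian elimination: a functional that vanishes on the common kernel of those chosen so far is a
  combination of them; any other one extends the dual family.\<close>

lemma dual_family:
  assumes Z: "lin_space Z" and "finite J" "\<And>j. j \<in> J \<Longrightarrow> lin_functional Z (L j)"
  shows "\<exists>I\<subseteq>J. \<exists>z. (\<forall>i\<in>I. z i \<in> Z \<and> (\<forall>j\<in>I. L j (z i) = (if i = j then 1 else 0))) \<and>
     (\<forall>j\<in>J. \<exists>c. \<forall>y\<in>Z. L j y = (\<Sum>i\<in>I. c i * L i y))"
  using assms(2,3)
proof (induction J)
  case empty
  then show ?case by auto
next
  case (insert a J)
  have "lin_functional Z (L j)" if "j \<in> J" for j using insert.prems that by blast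
  from insert.IH[OF this] obtain I where I: "I \<subseteq> J"
    and "\<exists>z. (\<forall>i\<in>I. z i \<in> Z \<and> (\<forall>j\<in>I. L j (z i) = (if i = j then 1 else 0))) \<and>
      (\<forall>j\<in>J. \<exists>c. \<forall>y\<in>Z. L j y = (\<Sum>i\<in>I. c i * L i y))" by blast
  then obtain z where z: "\<And>i. i \<in> I \<Longrightarrow> z i \<in> Z"
    and dual: "\<And>i j. i \<in> I \<Longrightarrow> j \<in> I \<Longrightarrow> L j (z i) = (if i = j then 1 else 0)"
    and gen: "\<And>j. j \<in> J \<Longrightarrow> \<exists>c. \<forall>y\<in>Z. L j y = (\<Sum>i\<in>I. c i * L i y)"
    by blast
  have finI: "finite I" using I insert finite_subset by blast
  have aI: "a \<notin> I" using I insert by auto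
  have LI: "lin_functional Z (L j)" if "j \<in> insert a I" for j
    using that I insert by auto
  \<comment> \<open>The projection onto the common kernel of the functionals in I.\<close>
  define P where "P = (\<lambda>y x. y x - (\<Sum>i\<in>I. L i y *\<^sub>R z i x))"
  have PZ: "P y \<in> Z" if "y \<in> Z" for y
    unfolding P_def by (intro lin_space_diff lin_space_sum Z that z)
  have LP: "L j (P y) = L j y - (\<Sum>i\<in>I. L i y * L j (z i))" if "y \<in> Z" "j \<in> insert a I" for y j
    unfolding P_def
    by (subst lin_functional_diff[OF Z LI[OF that(2)] that(1)])
      (use z in \<open>auto intro!: lin_space_sum Z lin_functional_sum LI that\<close>)
  have LP0: "L j (P y) = 0" if "y \<in> Z" "j \<in> I" for y j
    using that finI by (simp add: LP dual if_distrib[of "\<lambda>t. _ * t"] cong: if_cong)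
  show ?case
  proof (cases "\<forall>y\<in>Z. L a (P y) = 0")
    case True
    then have "\<forall>y\<in>Z. L a y = (\<Sum>i\<in>I. L a (z i) * L i y)"
      using LP[of _ a] by (auto simp: mult.commute)
    then have "\<exists>c. \<forall>y\<in>Z. L a y = (\<Sum>i\<in>I. c i * L i y)"
      by (intro exI[of _ "\<lambda>i. L a (z i)"])
    then have "\<forall>j\<in>insert a J. \<exists>c. \<forall>y\<in>Z. L j y = (\<Sum>i\<in>I. c i * L i y)"
      using gen by simp
    moreover have "\<forall>i\<in>I. z i \<in> Z \<and> (\<forall>j\<in>I. L j (z i) = (if i = j then 1 else 0))"
      using z dual by auto
    ultimately show ?thesis using I by (intro exI[of _ I]) auto
  next
    case False
    then obtain y where y: "y \<in> Z" "L a (P y) \<noteq> 0" by blast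
    define w where "w = (\<lambda>x. (1 / L a (P y)) *\<^sub>R P y x)"
    have wZ: "w \<in> Z" unfolding w_def by (intro lin_space_scale Z PZ y)
    have wa: "L a w = 1"
      unfolding w_def using y by (subst lin_functional_scale[OF LI PZ]) auto
    have wI: "L j w = 0" if "j \<in> I" for j
      unfolding w_def using y that LP0[OF y(1) that]
      by (subst lin_functional_scale[OF LI PZ]) auto
    define z' where "z' = (\<lambda>i. if i = a then w else (\<lambda>x. z i x - L a (z i) *\<^sub>R w x))"
    have z'Z: "z' i \<in> Z" if "i \<in> insert a I" for i
      using that z wZ by (auto simp: z'_def intro!: lin_space_diff lin_space_scale Z)
    have Lz': "L j (z' i) = L j (z i) - L a (z i) * L j w" if "i \<in> I" "j \<in> insert a I" for i j
    proof -
      have "L j (\<lambda>x. z i x - L a (z i) *\<^sub>R w x) = L j (z i) - L j (\<lambda>x. L a (z i) *\<^sub>R w x)"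
        by (rule lin_functional_diff[OF Z LI[OF that(2)] z[OF that(1)] lin_space_scale[OF Z wZ]])
      also have "\<dots> = L j (z i) - L a (z i) * L j w"
        by (simp add: lin_functional_scale[OF LI[OF that(2)] wZ])
      finally show ?thesis using that aI by (auto simp: z'_def)
    qed
    have "L j (z' i) = (if i = j then 1 else 0)" if "i \<in> insert a I" "j \<in> insert a I" for i j
    proof (cases "i = a")
      case True
      then show ?thesis using that wa wI by (auto simp: z'_def)
    next
      case False
      then show ?thesis using that aI wa wI dual by (auto simp: Lz')
    qed
    moreover have "\<exists>c. \<forall>y\<in>Z. L j y = (\<Sum>i\<in>insert a I. c i * L i y)" if "j \<in> insert a J" for j
    proof (cases "j = a")
      case True
      have "\<forall>y\<in>Z. L j y = (\<Sum>i\<in>insert a I. (if i = a then 1 else 0) * L i y)"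
        using True finI aI by (simp add: if_distrib[of "\<lambda>t. t * _"] cong: if_cong)
      then show ?thesis by (intro exI[of _ "\<lambda>i. if i = a then 1 else 0"])
    next
      case False
      then obtain c where c: "\<forall>y\<in>Z. L j y = (\<Sum>i\<in>I. c i * L i y)"
        using gen[of j] \<open>j \<in> insert a J\<close> by auto
      have "(\<Sum>i\<in>insert a I. (c(a := 0)) i * L i y) = (\<Sum>i\<in>I. c i * L i y)" for y
        using finI aI by (simp, intro sum.cong) auto
      then have "\<forall>y\<in>Z. L j y = (\<Sum>i\<in>insert a I. (c(a := 0)) i * L i y)"
        using c by simp
      then show ?thesis by (intro exI[of _ "c(a := 0)"])
    qed
    ultimately show ?thesis
      using I z'Z by (intro exI[of _ "insert a I"]) (auto intro!: exI[of _ z'])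
  qed
qed

text \<open>Uniqueness implies existence for a bilinear form on a space that is finite-dimensional only
  up to elements invisible to the form. The elements dual to a maximal independent family of the
  coordinates L represent every test function, so that the equation becomes a square system, whose
  rows are independent by \<open>nondeg\<close>.\<close>

lemma bilinear_system_solvable:
  assumes Z: "lin_space Z" and J: "finite J" and L: "\<And>j. j \<in> J \<Longrightarrow> lin_functional Z (L j)"
    and B1: "\<And>y. y \<in> Z \<Longrightarrow> lin_functional Z (\<lambda>z. B z y)"
    and B2: "\<And>z. z \<in> Z \<Longrightarrow> lin_functional Z (B z)"
    and l: "lin_functional Z l"
    and null: "\<And>y. y \<in> Z \<Longrightarrow> \<forall>j\<in>J. L j y = 0 \<Longrightarrow> l y = 0 \<and> (\<forall>z\<in>Z. B z y = 0)"
    and nondeg: "\<And>y j. y \<in> Z \<Longrightarrow> \<forall>z\<in>Z. B z y = 0 \<Longrightarrow> j \<in> J \<Longrightarrow> L j y = 0"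
  shows "\<exists>z\<in>Z. \<forall>y\<in>Z. B z y = l y"
proof -
  from dual_family[where L=L, OF Z J L] obtain I where I: "I \<subseteq> J"
    and "\<exists>e. (\<forall>i\<in>I. e i \<in> Z \<and> (\<forall>j\<in>I. L j (e i) = (if i = j then 1 else 0))) \<and>
      (\<forall>j\<in>J. \<exists>c. \<forall>y\<in>Z. L j y = (\<Sum>i\<in>I. c i * L i y))" by blast
  then obtain e where e: "\<And>i. i \<in> I \<Longrightarrow> e i \<in> Z"
    and dual: "\<And>i j. i \<in> I \<Longrightarrow> j \<in> I \<Longrightarrow> L j (e i) = (if i = j then 1 else 0)"
    and gen: "\<And>j. j \<in> J \<Longrightarrow> \<exists>c. \<forall>y\<in>Z. L j y = (\<Sum>i\<in>I. c i * L i y)"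
    by blast
  have finI: "finite I" using I J finite_subset by blast
  have expand: "M y = (\<Sum>i\<in>I. L i y * M (e i))"
    if M: "lin_functional Z M" and Mnull: "\<And>y. y \<in> Z \<Longrightarrow> \<forall>j\<in>J. L j y = 0 \<Longrightarrow> M y = 0" and y: "y \<in> Z" for M y
  proof -
    let ?s = "\<lambda>x. \<Sum>i\<in>I. L i y *\<^sub>R e i x"
    have s: "?s \<in> Z" by (intro lin_space_sum Z e)
    have Ms: "M' ?s = (\<Sum>i\<in>I. L i y * M' (e i))" if "lin_functional Z M'" for M'
      by (intro lin_functional_sum[OF Z that] e)
    have d: "(\<lambda>x. y x - ?s x) \<in> Z" by (intro lin_space_diff Z y s)
    have "L j (\<lambda>x. y x - ?s x) = 0" if j: "j \<in> J" for j
    proof -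
      have I0: "L i (\<lambda>x. y x - ?s x) = 0" if "i \<in> I" for i
        using that finI I by (subst lin_functional_diff[OF Z L y s])
          (auto simp: Ms L dual subset_iff if_distrib[of "\<lambda>t. _ * t"] cong: if_cong)
      then show ?thesis using gen[OF j] d by auto
    qed
    then have "M (\<lambda>x. y x - ?s x) = 0" using Mnull d by blast
    then show ?thesis using lin_functional_diff[OF Z M y s] Ms[OF M] by simp
  qed
  \<comment> \<open>A second elimination, now for the rows of the system.\<close>
  from dual_family[where L="\<lambda>i z. B z (e i)", OF Z finI B1[OF e]] obtain I' where I': "I' \<subseteq> I"
    and "\<exists>z. (\<forall>i\<in>I'. z i \<in> Z \<and> (\<forall>j\<in>I'. B (z i) (e j) = (if i = j then 1 else 0))) \<and>
      (\<forall>j\<in>I. \<exists>c. \<forall>y\<in>Z. B y (e j) = (\<Sum>i\<in>I'. c i * B y (e i)))" by blast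
  then obtain z where z: "\<And>i. i \<in> I' \<Longrightarrow> z i \<in> Z"
    and dual': "\<And>i j. i \<in> I' \<Longrightarrow> j \<in> I' \<Longrightarrow> B (z i) (e j) = (if i = j then 1 else 0)"
    and gen': "\<And>j. j \<in> I \<Longrightarrow> \<exists>c. \<forall>y\<in>Z. B y (e j) = (\<Sum>i\<in>I'. c i * B y (e i))"
    by blast
  have "I \<subseteq> I'"
  proof (rule ccontr)
    assume "\<not> I \<subseteq> I'"
    then obtain a where a: "a \<in> I" "a \<notin> I'" by blast
    then obtain c where c: "\<And>y. y \<in> Z \<Longrightarrow> B y (e a) = (\<Sum>i\<in>I'. c i * B y (e i))"
      using gen' by blast
    let ?s = "\<lambda>x. \<Sum>i\<in>I'. c i *\<^sub>R e i x"
    have s: "?s \<in> Z" using I' by (intro lin_space_sum Z e) auto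
    let ?d = "\<lambda>x. e a x - ?s x"
    have d: "?d \<in> Z" using s a by (intro lin_space_diff Z e)
    have "B y ?d = 0" if y: "y \<in> Z" for y
      using I' a
      by (subst lin_functional_diff[OF Z B2[OF y] e[OF a(1)] s], subst lin_functional_sum[OF Z B2[OF y]])
        (auto simp: c y e)
    then have "L a ?d = 0" using nondeg[OF d] a I by auto
    moreover have "L a ?d = 1"
      using I' I a
      by (subst lin_functional_diff[OF Z L e[OF a(1)] s], blast, subst lin_functional_sum[OF Z L])
        (auto simp: e dual subset_iff intro!: sum.neutral)
    ultimately show False by simp
  qed
  then have II: "I' = I" using I' by auto
  let ?z = "\<lambda>x. \<Sum>i\<in>I. l (e i) *\<^sub>R z i x"
  have zZ: "?z \<in> Z" using z II by (intro lin_space_sum Z) auto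
  have Bze: "B ?z (e i) = l (e i)" if "i \<in> I" for i
    using that II finI
    by (subst lin_functional_sum[OF Z B1[OF e[OF that]]])
      (auto simp: z dual' if_distrib[of "\<lambda>t. _ * t"] cong: if_cong)
  have "B ?z y = l y" if y: "y \<in> Z" for y
    using expand[OF B2[OF zZ] _ y] expand[OF l _ y] null zZ Bze by (auto cong: sum.cong)
  then show ?thesis using zZ by blast
qed

section \<open>Polynomials in several variables and their values on a grid\<close>

lemma finite_multi_index [simp]: "finite {\<alpha> :: 'd::finite \<Rightarrow> nat. \<forall>i. \<alpha> i \<le> m}"
proof -
  have "{\<alpha> :: 'd \<Rightarrow> nat. \<forall>i. \<alpha> i \<le> m} = (\<Pi>\<^sub>E i\<in>UNIV. {..m})" by (auto simp: PiE_def)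
  then show ?thesis by (simp add: finite_PiE)
qed

definition dual_weights :: "nat \<Rightarrow> (nat \<Rightarrow> real) \<Rightarrow> (nat \<Rightarrow> nat \<Rightarrow> real) \<Rightarrow> bool" where
  "dual_weights k \<xi> \<mu> \<longleftrightarrow> (\<forall>a\<le>k. \<forall>b\<le>k. (\<Sum>m\<le>k. \<mu> b m * \<xi> m ^ a) = (if a = b then 1 else 0))"

text \<open>The weights are the coefficients of the Lagrange basis.\<close>

lemma dual_weights_exist:
  assumes "inj_on \<xi> {..k}"
  shows "\<exists>\<mu>. dual_weights k \<xi> \<mu>"
proof -
  define L where "L = (\<lambda>j. \<Prod>i\<in>{..k} - {j}. smult (1 / (\<xi> j - \<xi> i)) [:- \<xi> i, 1:])"
  have degL: "degree (L j) \<le> k" if "j \<le> k" for j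
  proof -
    have "degree (L j) \<le> sum (degree \<circ> (\<lambda>i. smult (1 / (\<xi> j - \<xi> i)) [:- \<xi> i, 1:])) ({..k} - {j})"
      unfolding L_def by (rule degree_prod_sum_le) simp
    also have "\<dots> \<le> (\<Sum>i\<in>{..k} - {j}. 1)" by (intro sum_mono) auto
    finally show ?thesis using that by simp
  qed
  have L: "poly (L j) (\<xi> m) = (if m = j then 1 else 0)" if "j \<le> k" "m \<le> k" for j m
  proof (cases "m = j")
    case True
    have "\<xi> j \<noteq> \<xi> i" if "i \<in> {..k} - {j}" for i
      using assms \<open>j \<le> k\<close> that by (auto simp: inj_on_def)
    then show ?thesis using True
      by (auto simp: L_def poly_prod diff_divide_distrib[symmetric] intro!: prod.neutral)
  next
    case False
    then show ?thesis using that by (auto simp: L_def poly_prod intro!: prod_zero)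
  qed
  have "(\<Sum>m\<le>k. coeff (L m) b * \<xi> m ^ a) = (if a = b then 1 else 0)" if "a \<le> k" "b \<le> k" for a b
  proof -
    have "monom 1 a = (\<Sum>m\<le>k. smult (\<xi> m ^ a) (L m))"
    proof (rule poly_eqI_degree[of "\<xi> ` {..k}"])
      show "degree (\<Sum>m\<le>k. smult (\<xi> m ^ a) (L m)) < card (\<xi> ` {..k})"
        using assms degL
        by (subst card_image, simp)
          (auto intro!: le_imp_less_Suc degree_sum_le order_trans[OF degree_smult_le])
      show "degree (monom (1::real) a) < card (\<xi> ` {..k})"
        using assms that by (subst card_image) (auto simp: degree_monom_eq)
    qed (auto simp: poly_monom poly_sum L if_distrib[of "\<lambda>t. _ * t"] cong: if_cong)
    then have "coeff (monom 1 a) b = coeff (\<Sum>m\<le>k. smult (\<xi> m ^ a) (L m)) b" by simp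
    then show ?thesis by (simp add: coeff_sum mult.commute eq_commute)
  qed
  then show ?thesis unfolding dual_weights_def by (intro exI[of _ "\<lambda>b m. coeff (L m) b"]) auto
qed

text \<open>This functional uses the values on the grid only; on polynomials of degree at most k in each
  variable it is the coefficient of the monomial with exponent \<open>\<gamma>\<close>.\<close>

definition grid_coeff ::
    "nat \<Rightarrow> (nat \<Rightarrow> real) \<Rightarrow> (nat \<Rightarrow> nat \<Rightarrow> real) \<Rightarrow> ('d::finite \<Rightarrow> nat) \<Rightarrow> (real^'d \<Rightarrow> real) \<Rightarrow> real" where
  "grid_coeff k \<xi> \<mu> \<gamma> f =
     (\<Sum>\<iota> | \<forall>j. \<iota> j \<le> k. (\<Prod>j\<in>UNIV. \<mu> (\<gamma> j) (\<iota> j)) * f (\<chi> j. \<xi> (\<iota> j)))"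

lemma grid_coeff_add:
  "grid_coeff k \<xi> \<mu> \<gamma> (\<lambda>x. f x + g x) = grid_coeff k \<xi> \<mu> \<gamma> f + grid_coeff k \<xi> \<mu> \<gamma> g"
  by (simp add: grid_coeff_def ring_distribs sum.distrib)

lemma grid_coeff_cmult: "grid_coeff k \<xi> \<mu> \<gamma> (\<lambda>x. c * f x) = c * grid_coeff k \<xi> \<mu> \<gamma> f"
  by (simp add: grid_coeff_def sum_distrib_left mult_ac)

lemma grid_coeff_sum:
  "grid_coeff k \<xi> \<mu> \<gamma> (\<lambda>x. \<Sum>i\<in>I. f i x) = (\<Sum>i\<in>I. grid_coeff k \<xi> \<mu> \<gamma> (f i))"
  unfolding grid_coeff_def sum_distrib_left by (rule sum.swap)

lemma grid_coeff_eq_0: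
  "(\<And>\<iota>. (\<forall>j. \<iota> j \<le> k) \<Longrightarrow> f (\<chi> j. \<xi> (\<iota> j)) = 0) \<Longrightarrow> grid_coeff k \<xi> \<mu> \<gamma> f = 0"
  by (simp add: grid_coeff_def)

lemma grid_coeff_monom_prod:
  "grid_coeff k \<xi> \<mu> \<gamma> (monom_fun \<alpha>) = (\<Prod>j\<in>UNIV. \<Sum>m\<le>k. \<mu> (\<gamma> j) m * \<xi> m ^ \<alpha> j)"
proof -
  have "{\<iota> :: 'a \<Rightarrow> nat. \<forall>j. \<iota> j \<le> k} = (\<Pi>\<^sub>E i\<in>UNIV. {..k})" by (auto simp: PiE_def)
  then show ?thesis
    by (simp add: grid_coeff_def monom_fun_def prod_sum_PiE prod.distrib)
qed

text \<open>The functional is a product of one-dimensional ones, so one variable in which the exponents differ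
  is enough; the other exponents of the monomial may exceed k.\<close>

lemma grid_coeff_monom_eq_0:
  assumes "dual_weights k \<xi> \<mu>" "\<alpha> j \<le> k" "\<gamma> j \<le> k" "\<alpha> j \<noteq> \<gamma> j"
  shows "grid_coeff k \<xi> \<mu> \<gamma> (monom_fun \<alpha>) = 0"
proof -
  have "(\<Sum>m\<le>k. \<mu> (\<gamma> j) m * \<xi> m ^ \<alpha> j) = 0" using assms unfolding dual_weights_def by auto
  then show ?thesis unfolding grid_coeff_monom_prod by (auto intro!: prod_zero)
qed

lemma grid_coeff_monom:
  assumes "dual_weights k \<xi> \<mu>" "\<forall>j. \<alpha> j \<le> k" "\<forall>j. \<gamma> j \<le> k"
  shows "grid_coeff k \<xi> \<mu> \<gamma> (monom_fun \<alpha>) = (if \<alpha> = \<gamma> then 1 else 0)"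
proof (cases "\<alpha> = \<gamma>")
  case True
  then show ?thesis using assms by (simp add: grid_coeff_monom_prod dual_weights_def)
next
  case False
  then obtain j where "\<alpha> j \<noteq> \<gamma> j" by auto
  then show ?thesis using assms grid_coeff_monom_eq_0[of k \<xi> \<mu> \<alpha> j \<gamma>] False by auto
qed

lemma QpolyE:
  assumes "f \<in> Qpoly m"
  obtains c where "f = (\<lambda>x. \<Sum>\<alpha> | \<forall>i. \<alpha> i \<le> m. c \<alpha> * monom_fun \<alpha> x)"
  using assms by (auto simp: Qpoly_def)

lemma Qpoly_eq_0_if_grid:
  assumes "inj_on \<xi> {..k}" "f \<in> Qpoly k" "\<And>\<iota>. (\<forall>j. \<iota> j \<le> k) \<Longrightarrow> f (\<chi> j. \<xi> (\<iota> j)) = 0"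
  shows "f x = 0"
proof -
  obtain \<mu> where \<mu>: "dual_weights k \<xi> \<mu>" using dual_weights_exist assms by blast
  obtain c where c: "f = (\<lambda>x. \<Sum>\<alpha> | \<forall>i. \<alpha> i \<le> k. c \<alpha> * monom_fun \<alpha> x)" by (rule QpolyE[OF assms(2)])
  have "c \<gamma> = 0" if "\<forall>j. \<gamma> j \<le> k" for \<gamma>
  proof -
    have "0 = grid_coeff k \<xi> \<mu> \<gamma> f" using assms by (simp add: grid_coeff_eq_0)
    also have "\<dots> = (\<Sum>\<alpha> | \<forall>i. \<alpha> i \<le> k. c \<alpha> * (if \<alpha> = \<gamma> then 1 else 0))"
      unfolding c using \<mu> that by (auto simp: grid_coeff_sum grid_coeff_cmult grid_coeff_monom intro!: sum.cong)
    also have "\<dots> = c \<gamma>" using that by (simp add: if_distrib[of "\<lambda>t. _ * t"] cong: if_cong)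
    finally show ?thesis by simp
  qed
  then show ?thesis by (simp add: c)
qed

lemma Qpoly_add: "f \<in> Qpoly m \<Longrightarrow> g \<in> Qpoly m \<Longrightarrow> (\<lambda>x. f x + g x) \<in> Qpoly m"
proof -
  assume "f \<in> Qpoly m" "g \<in> Qpoly m"
  then obtain a b where "f = (\<lambda>x. \<Sum>\<alpha> | \<forall>i. \<alpha> i \<le> m. a \<alpha> * monom_fun \<alpha> x)"
    "g = (\<lambda>x. \<Sum>\<alpha> | \<forall>i. \<alpha> i \<le> m. b \<alpha> * monom_fun \<alpha> x)" by (auto simp: Qpoly_def)
  then show ?thesis
    unfolding Qpoly_def by (intro CollectI exI[of _ "\<lambda>\<alpha>. a \<alpha> + b \<alpha>"]) (simp add: ring_distribs sum.distrib)
qed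

lemma Qpoly_cmult: "f \<in> Qpoly m \<Longrightarrow> (\<lambda>x. c * f x) \<in> Qpoly m"
proof -
  assume "f \<in> Qpoly m"
  then obtain a where "f = (\<lambda>x. \<Sum>\<alpha> | \<forall>i. \<alpha> i \<le> m. a \<alpha> * monom_fun \<alpha> x)" by (rule QpolyE)
  then show ?thesis
    unfolding Qpoly_def by (intro CollectI exI[of _ "\<lambda>\<alpha>. c * a \<alpha>"]) (simp add: sum_distrib_left mult_ac)
qed

lemma Qpoly_monom: "\<forall>i. \<alpha> i \<le> m \<Longrightarrow> monom_fun \<alpha> \<in> Qpoly m"
  unfolding Qpoly_def
  by (intro CollectI exI[of _ "\<lambda>\<beta>. if \<beta> = \<alpha> then 1 else 0"] ext)
    (simp add: if_distrib[of "\<lambda>t. t * _"] cong: if_cong)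

lemma Qpoly_const: "(\<lambda>x. c) \<in> Qpoly m"
proof -
  have "monom_fun (\<lambda>i::'a. 0) = (\<lambda>x. 1)" by (auto simp: monom_fun_def)
  then have "(\<lambda>x. 1) \<in> (Qpoly m :: (real^'a \<Rightarrow> real) set)" using Qpoly_monom[of "\<lambda>_::'a. 0" m] by simp
  from Qpoly_cmult[OF this, of c] show ?thesis by simp
qed

lemma Qpoly_sum: "(\<And>i. i \<in> I \<Longrightarrow> f i \<in> Qpoly m) \<Longrightarrow> (\<lambda>x. \<Sum>i\<in>I. f i x) \<in> Qpoly m"
proof (induction I rule: infinite_finite_induct)
  case (insert a I)
  then show ?case by (simp add: Qpoly_add)
qed (use Qpoly_const[of 0] in simp_all)

lemma monom_fun_mult_coord: "x $ i * monom_fun \<alpha> x = monom_fun (\<alpha>(i := Suc (\<alpha> i))) x"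
proof -
  have "monom_fun (\<alpha>(i := Suc (\<alpha> i))) x = (\<Prod>j\<in>UNIV. (if j = i then x $ i else 1) * x $ j ^ \<alpha> j)"
    unfolding monom_fun_def by (intro prod.cong) auto
  also have "\<dots> = x $ i * monom_fun \<alpha> x"
    unfolding prod.distrib monom_fun_def by simp
  finally show ?thesis by simp
qed

lemma Qpoly_mono: "f \<in> Qpoly m \<Longrightarrow> m \<le> n \<Longrightarrow> f \<in> Qpoly n"
  by (elim QpolyE) (auto intro!: Qpoly_sum Qpoly_cmult Qpoly_monom intro: order_trans)

lemma Qpoly_mult_coord: "f \<in> Qpoly m \<Longrightarrow> (\<lambda>x. x $ i * f x) \<in> Qpoly (Suc m)"
proof (elim QpolyE)
  fix c assume f: "f = (\<lambda>x. \<Sum>\<alpha> | \<forall>i. \<alpha> i \<le> m. c \<alpha> * monom_fun \<alpha> x)"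
  have "(\<lambda>x. x $ i * f x) = (\<lambda>x. \<Sum>\<alpha> | \<forall>i. \<alpha> i \<le> m. c \<alpha> * monom_fun (\<alpha>(i := Suc (\<alpha> i))) x)"
    by (simp add: f sum_distrib_left monom_fun_mult_coord[symmetric] mult_ac)
  moreover have "(\<lambda>x. \<Sum>\<alpha> | \<forall>i. \<alpha> i \<le> m. c \<alpha> * monom_fun (\<alpha>(i := Suc (\<alpha> i))) x) \<in> Qpoly (Suc m)"
    by (intro Qpoly_sum Qpoly_cmult Qpoly_monom) (auto intro: le_SucI)
  ultimately show ?thesis by simp
qed

lemma RT_component: "v \<in> RT m \<Longrightarrow> (\<lambda>x. v x $ i) \<in> Qpoly (Suc m)"
proof -
  assume "v \<in> RT m"
  then obtain a b where "a \<in> Qpoly m" "b \<in> Qpoly m" "\<And>x. v x $ i = a x + x $ i * b x"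
    unfolding RT_def by blast
  then show ?thesis
    using Qpoly_add[OF Qpoly_mono[of a m "Suc m"] Qpoly_mult_coord[of b m i]] by simp
qed

section \<open>Unisolvence of the enhanced Raviart-Thomas space on the grid\<close>

definition enh_index :: "nat \<Rightarrow> 'd \<Rightarrow> ('d \<Rightarrow> nat) set" where
  "enh_index k i = {\<alpha>. (\<forall>j. \<alpha> j \<le> k) \<and> (\<exists>j. j \<noteq> i \<and> \<alpha> j = k)}"

lemma finite_enh_index [simp]: "finite (enh_index k (i::'d::finite))"
  by (rule finite_subset[OF _ finite_multi_index[of k]]) (auto simp: enh_index_def)

text \<open>For a field q the vector field \<open>x div q - (x \<bullet> \<nabla>) q - (d - 1) q\<close> is, up to sign, the curl of
  \<open>x \<times> q\<close> in two and in three dimensions. This is its i-th component when q is the monomial with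
  exponent \<open>\<alpha>\<close> in direction l.\<close>

definition enh_monom :: "'d \<Rightarrow> 'd \<Rightarrow> ('d::finite \<Rightarrow> nat) \<Rightarrow> real^'d \<Rightarrow> real" where
  "enh_monom i l \<alpha> x =
     (if i = l then - (real (\<Sum>j\<in>UNIV - {i}. \<alpha> j) + real CARD('d) - 1) * monom_fun \<alpha> x
      else real (\<alpha> l) * monom_fun (\<alpha>(l := \<alpha> l - 1, i := Suc (\<alpha> i))) x)"

definition enh_field :: "nat \<Rightarrow> ('d::finite \<Rightarrow> ('d \<Rightarrow> nat) \<Rightarrow> real) \<Rightarrow> real^'d \<Rightarrow> real^'d" where
  "enh_field k c x = (\<chi> i. \<Sum>l\<in>UNIV. \<Sum>\<alpha>\<in>enh_index k l. c l \<alpha> * enh_monom i l \<alpha> x)"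

lemma sum_fun_upd2:
  fixes \<alpha> :: "'d::finite \<Rightarrow> nat"
  assumes "i \<noteq> l" "\<alpha> l \<ge> 1"
  shows "sum (\<alpha>(l := \<alpha> l - 1, i := Suc (\<alpha> i))) UNIV = sum \<alpha> UNIV"
proof -
  have *: "sum f UNIV = f i + f l + sum f (UNIV - {i} - {l})" for f :: "'d \<Rightarrow> nat"
    using assms by (simp add: sum.remove[of UNIV i] sum.remove[of "UNIV - {i}" l])
  have "sum (\<alpha>(l := \<alpha> l - 1, i := Suc (\<alpha> i))) (UNIV - {i} - {l}) = sum \<alpha> (UNIV - {i} - {l})"
    by (intro sum.cong) auto
  then show ?thesis using assms unfolding *[of \<alpha>] *[of "\<alpha>(l := \<alpha> l - 1, i := Suc (\<alpha> i))"] by simp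
qed

text \<open>The exponent \<open>\<gamma>\<close> equals k in some variable other than i, where the i-th component of a
  Raviart-Thomas field has degree at most k - 1.\<close>

lemma RT_grid_coeff_eq_0:
  assumes "dual_weights k \<xi> \<mu>" "k \<ge> 1" "r \<in> RT (k - 1)" "\<gamma> \<in> enh_index k i"
  shows "grid_coeff k \<xi> \<mu> \<gamma> (\<lambda>x. r x $ i) = 0"
proof -
  obtain a b where a: "a \<in> Qpoly (k - 1)" and b: "b \<in> Qpoly (k - 1)"
    and r: "\<And>x. r x $ i = a x + x $ i * b x"
    using assms(3) unfolding RT_def by blast
  obtain ca where ca: "a = (\<lambda>x. \<Sum>\<alpha> | \<forall>j. \<alpha> j \<le> k - 1. ca \<alpha> * monom_fun \<alpha> x)" by (rule QpolyE[OF a])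
  obtain cb where cb: "b = (\<lambda>x. \<Sum>\<alpha> | \<forall>j. \<alpha> j \<le> k - 1. cb \<alpha> * monom_fun \<alpha> x)" by (rule QpolyE[OF b])
  obtain j where j: "j \<noteq> i" "\<gamma> j = k" and \<gamma>: "\<forall>j. \<gamma> j \<le> k" using assms(4) by (auto simp: enh_index_def)
  have lt: "\<alpha> j \<le> k \<and> \<alpha> j \<noteq> \<gamma> j" if "\<forall>j. \<alpha> j \<le> k - 1" for \<alpha> :: "'a \<Rightarrow> nat"
    using that[rule_format, of j] j assms(2) by auto
  have 1: "grid_coeff k \<xi> \<mu> \<gamma> (monom_fun \<alpha>) = 0" if "\<forall>j. \<alpha> j \<le> k - 1" for \<alpha>
    by (rule grid_coeff_monom_eq_0[of k \<xi> \<mu> \<alpha> j]) (use lt[OF that] \<gamma> assms in auto)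
  have 2: "grid_coeff k \<xi> \<mu> \<gamma> (monom_fun (\<alpha>(i := Suc (\<alpha> i)))) = 0" if "\<forall>j. \<alpha> j \<le> k - 1" for \<alpha>
    by (rule grid_coeff_monom_eq_0[of k \<xi> \<mu> _ j]) (use lt[OF that] \<gamma> assms j in auto)
  have "(\<lambda>x. r x $ i) = (\<lambda>x. (\<Sum>\<alpha> | \<forall>j. \<alpha> j \<le> k - 1. ca \<alpha> * monom_fun \<alpha> x)
      + (\<Sum>\<alpha> | \<forall>j. \<alpha> j \<le> k - 1. cb \<alpha> * monom_fun (\<alpha>(i := Suc (\<alpha> i))) x))"
    by (simp add: r ca cb sum_distrib_left monom_fun_mult_coord[symmetric] mult_ac)
  then show ?thesis by (simp add: grid_coeff_add grid_coeff_sum grid_coeff_cmult 1 2)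
qed

text \<open>By the previous lemma the coefficients of the curl part at the exponents in \<open>enh_index\<close> vanish by
  themselves. Let N be the largest total degree in q. In degree N these equations read
  \<open>(N + d - 1) q\<^sub>i = x\<^sub>i p\<close> with \<open>p = div q\<close>, restricted to the exponents that \<open>q\<^sub>i\<close> may have. Taking the
  divergence again multiplies the coefficient of p at \<open>\<delta>\<close> by the sum of \<open>\<delta>\<^sub>l + 1\<close> over the permitted
  directions l only. Over all directions this sum is N + d - 1, but a direction j with \<open>\<delta>\<^sub>j = k\<close> is not
  permitted. So p = 0 and q has no terms of degree N.\<close>

lemma enhanced_RT_unisolvent:
  fixes c :: "'d::finite \<Rightarrow> ('d \<Rightarrow> nat) \<Rightarrow> real"
  assumes k: "k \<ge> 1" and inj: "inj_on \<xi> {..k}" and r: "r \<in> RT (k - 1)" and s: "s \<noteq> 0"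
    and v: "\<And>x. v x = r x + s *\<^sub>R enh_field k c x"
    and grid: "\<And>\<iota>. (\<forall>j. \<iota> j \<le> k) \<Longrightarrow> v (\<chi> j. \<xi> (\<iota> j)) = 0"
  shows "v x = 0"
proof -
  obtain \<mu> where \<mu>: "dual_weights k \<xi> \<mu>" using dual_weights_exist inj by blast
  let ?\<Lambda> = "grid_coeff k \<xi> \<mu> :: ('d \<Rightarrow> nat) \<Rightarrow> _"
  have key: "(\<Sum>l\<in>UNIV. \<Sum>\<alpha>\<in>enh_index k l. c l \<alpha> * ?\<Lambda> \<gamma> (enh_monom i l \<alpha>)) = 0"
    if "\<gamma> \<in> enh_index k i" for i \<gamma>
  proof -
    have "0 = ?\<Lambda> \<gamma> (\<lambda>x. v x $ i)" using grid by (simp add: grid_coeff_eq_0)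
    also have "(\<lambda>x. v x $ i) =
        (\<lambda>x. r x $ i + s * (\<Sum>l\<in>UNIV. \<Sum>\<alpha>\<in>enh_index k l. c l \<alpha> * enh_monom i l \<alpha> x))"
      by (simp add: v enh_field_def)
    finally show ?thesis
      using RT_grid_coeff_eq_0[OF \<mu> k r that] s
      by (simp add: grid_coeff_add grid_coeff_sum grid_coeff_cmult)
  qed
  have c0: "c l \<alpha> = 0" if "\<alpha> \<in> enh_index k l" for l \<alpha>
  proof (rule ccontr)
    assume "c l \<alpha> \<noteq> 0"
    let ?P = "\<lambda>(l, \<alpha>). \<alpha> \<in> enh_index k l \<and> c l \<alpha> \<noteq> 0"
    have "?P (l, \<alpha>)" using that \<open>c l \<alpha> \<noteq> 0\<close> by simp
    moreover have "\<forall>y. ?P y \<longrightarrow> sum (snd y) UNIV < CARD('d) * k + 1"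
    proof safe
      fix l :: 'd and \<alpha> assume "\<alpha> \<in> enh_index k l"
      then have "sum \<alpha> UNIV \<le> (\<Sum>i\<in>(UNIV::'d set). k)"
        by (intro sum_mono[of UNIV \<alpha> "\<lambda>_. k"]) (auto simp: enh_index_def)
      then show "sum (snd (l, \<alpha>)) UNIV < CARD('d) * k + 1" by simp
    qed
    ultimately obtain y where "?P y" "\<And>z. ?P z \<Longrightarrow> sum (snd z) UNIV \<le> sum (snd y) UNIV"
      using ex_has_greatest_nat[of ?P "(l, \<alpha>)" "\<lambda>y. sum (snd y) UNIV"] by blast
    then obtain i \<gamma> where \<gamma>: "\<gamma> \<in> enh_index k i" "c i \<gamma> \<noteq> 0"
      and max: "\<And>l \<alpha>. \<alpha> \<in> enh_index k l \<Longrightarrow> c l \<alpha> \<noteq> 0 \<Longrightarrow> sum \<alpha> UNIV \<le> sum \<gamma> UNIV"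
      by (cases y) force
    define N where "N = sum \<gamma> UNIV"
    define C where "C = (\<lambda>l \<alpha>. if \<alpha> \<in> enh_index k l then c l \<alpha> else 0)"
    define p where "p = (\<lambda>\<delta>. \<Sum>l\<in>UNIV. real (Suc (\<delta> l)) * C l (\<delta>(l := Suc (\<delta> l))))"
    have off: "(\<Sum>\<alpha>\<in>enh_index k l. c l \<alpha> * ?\<Lambda> \<gamma> (enh_monom i l \<alpha>)) =
        (if \<gamma> i = 0 then 0 else real (Suc (\<gamma> l)) * C l (\<gamma>(i := \<gamma> i - 1, l := Suc (\<gamma> l))))"
      if \<gamma>: "\<gamma> \<in> enh_index k i" "sum \<gamma> UNIV = N" and il: "i \<noteq> l" for i l \<gamma>
    proof -
      let ?\<beta> = "\<gamma>(i := \<gamma> i - 1, l := Suc (\<gamma> l))"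
      have \<gamma>k: "\<forall>j. \<gamma> j \<le> k" using \<gamma> by (auto simp: enh_index_def)
      have summand: "c l \<alpha> * ?\<Lambda> \<gamma> (enh_monom i l \<alpha>) =
          (if \<alpha> = ?\<beta> \<and> \<gamma> i \<noteq> 0 then real (Suc (\<gamma> l)) * C l ?\<beta> else 0)" (is "?L = ?R")
        if \<alpha>: "\<alpha> \<in> enh_index k l" for \<alpha>
      proof -
        let ?\<alpha> = "\<alpha>(l := \<alpha> l - 1, i := Suc (\<alpha> i))"
        have \<alpha>k: "\<forall>j. \<alpha> j \<le> k" using \<alpha> by (auto simp: enh_index_def)
        have L: "?L = c l \<alpha> * (real (\<alpha> l) * ?\<Lambda> \<gamma> (monom_fun ?\<alpha>))"
          using il unfolding enh_monom_def by (simp add: grid_coeff_cmult)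
        consider "\<alpha> l = 0" | "\<alpha> l \<noteq> 0" "\<alpha> i < k" | "\<alpha> l \<noteq> 0" "\<alpha> i = k"
          using \<alpha>k[rule_format, of i] by linarith
        then show ?thesis
        proof cases
          case 1
          then show ?thesis using L by (auto simp: fun_eq_iff)
        next
          case 2
          have "\<forall>j. ?\<alpha> j \<le> k" using \<alpha>k 2 by (auto intro: le_trans[OF diff_le_self])
          then have \<Lambda>\<alpha>: "?\<Lambda> \<gamma> (monom_fun ?\<alpha>) = (if ?\<alpha> = \<gamma> then 1 else 0)"
            using grid_coeff_monom[OF \<mu>] \<gamma>k by blast
          have iff: "?\<alpha> = \<gamma> \<longleftrightarrow> \<alpha> = ?\<beta> \<and> \<gamma> i \<noteq> 0"
            using il 2 by (auto simp: fun_eq_iff split: if_splits)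
          show ?thesis
          proof (cases "?\<alpha> = \<gamma>")
            case True
            have \<beta>: "\<alpha> = ?\<beta> \<and> \<gamma> i \<noteq> 0" using iff True by blast
            then have "C l ?\<beta> = c l \<alpha>" using \<alpha> unfolding C_def by metis
            moreover have "Suc (\<gamma> l) = \<alpha> l" using \<beta> by (metis fun_upd_same)
            moreover have "?R = real (Suc (\<gamma> l)) * C l ?\<beta>" using \<beta> by (rule if_P)
            moreover have "?L = real (\<alpha> l) * c l \<alpha>" unfolding L \<Lambda>\<alpha> if_P[OF True] by simp
            ultimately show ?thesis by simp
          next
            case False
            have "?L = 0" unfolding L \<Lambda>\<alpha> if_not_P[OF False] by simp
            moreover have "?R = 0" using False iff by (intro if_not_P) blast
            ultimately show ?thesis by simp
          qed
        next
          \<comment> \<open>Here the monomial lies outside the range of the grid functional; its value there is not known, but it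
            can matter only if \<open>\<alpha>\<close> has total degree greater than N.\<close>
          case 3
          have ne: "\<not> (\<alpha> = ?\<beta> \<and> \<gamma> i \<noteq> 0)"
          proof
            assume *: "\<alpha> = ?\<beta> \<and> \<gamma> i \<noteq> 0"
            then have "\<alpha> i = \<gamma> i - 1" using il by (metis fun_upd_apply)
            then show False using * 3 \<gamma>k[rule_format, of i] by linarith
          qed
          have "c l \<alpha> = 0 \<or> ?\<Lambda> \<gamma> (monom_fun ?\<alpha>) = 0"
          proof (cases "\<exists>j. j \<noteq> i \<and> ?\<alpha> j \<noteq> \<gamma> j")
            case True
            then obtain j where j: "j \<noteq> i" "?\<alpha> j \<noteq> \<gamma> j" by blast
            have "?\<alpha> j \<le> k" using j \<alpha>k by (auto intro: le_trans[OF diff_le_self])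
            then show ?thesis using grid_coeff_monom_eq_0[OF \<mu>, of ?\<alpha> j \<gamma>] j \<gamma>k by blast
          next
            case False
            then have eq: "?\<alpha> j = \<gamma> j" if "j \<noteq> i" for j using that by blast
            have "sum ?\<alpha> UNIV = Suc k + sum \<gamma> (UNIV - {i})"
              using eq 3 by (simp add: sum.remove[of UNIV i])
            moreover have "sum \<gamma> UNIV = \<gamma> i + sum \<gamma> (UNIV - {i})" by (simp add: sum.remove[of UNIV i])
            moreover have "sum ?\<alpha> UNIV = sum \<alpha> UNIV" by (rule sum_fun_upd2) (use il 3 in auto)
            ultimately have "sum \<alpha> UNIV > N" using \<gamma>(2) \<gamma>k[rule_format, of i] by linarith
            then show ?thesis using max[OF \<alpha>] unfolding N_def by fastforce
          qed
          then show ?thesis using L ne by auto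
        qed
      qed
      have "(\<Sum>\<alpha>\<in>enh_index k l. c l \<alpha> * ?\<Lambda> \<gamma> (enh_monom i l \<alpha>)) =
        (\<Sum>\<alpha>\<in>enh_index k l. if \<alpha> = ?\<beta> then (if \<gamma> i \<noteq> 0 then real (Suc (\<gamma> l)) * C l ?\<beta> else 0) else 0)"
        using summand by (intro sum.cong) auto
      also have "\<dots> = (if \<gamma> i = 0 then 0 else real (Suc (\<gamma> l)) * C l ?\<beta>)"
        by (simp add: C_def)
      finally show ?thesis .
    qed
    have diag: "(\<Sum>\<alpha>\<in>enh_index k i. c i \<alpha> * ?\<Lambda> \<gamma> (enh_monom i i \<alpha>)) =
        - (real (\<Sum>j\<in>UNIV - {i}. \<gamma> j) + real CARD('d) - 1) * c i \<gamma>"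
      if \<gamma>: "\<gamma> \<in> enh_index k i" for i \<gamma>
    proof -
      have "c i \<alpha> * ?\<Lambda> \<gamma> (enh_monom i i \<alpha>) =
          (if \<alpha> = \<gamma> then - (real (\<Sum>j\<in>UNIV - {i}. \<gamma> j) + real CARD('d) - 1) * c i \<gamma> else 0)"
        if "\<alpha> \<in> enh_index k i" for \<alpha>
        unfolding enh_monom_def using that \<gamma>
        by (simp add: grid_coeff_cmult grid_coeff_monom[OF \<mu>] enh_index_def del: of_nat_sum)
      then have "(\<Sum>\<alpha>\<in>enh_index k i. c i \<alpha> * ?\<Lambda> \<gamma> (enh_monom i i \<alpha>)) =
        (\<Sum>\<alpha>\<in>enh_index k i. if \<alpha> = \<gamma> then - (real (\<Sum>j\<in>UNIV - {i}. \<gamma> j) + real CARD('d) - 1) * c i \<gamma> else 0)"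
        by (intro sum.cong) auto
      then show ?thesis using \<gamma> by (simp del: of_nat_sum)
    qed
    \<comment> \<open>The coefficients of \<open>(N + d - 1) q\<^sub>i = x\<^sub>i p\<close>.\<close>
    have rel: "(real N + real CARD('d) - 1) * c i \<gamma> = (if \<gamma> i = 0 then 0 else p (\<gamma>(i := \<gamma> i - 1)))"
      if \<gamma>: "\<gamma> \<in> enh_index k i" "sum \<gamma> UNIV = N" for i \<gamma>
    proof -
      let ?S = "\<Sum>l\<in>UNIV - {i}. if \<gamma> i = 0 then 0 else real (Suc (\<gamma> l)) * C l (\<gamma>(i := \<gamma> i - 1, l := Suc (\<gamma> l)))"
      have "0 = (\<Sum>\<alpha>\<in>enh_index k i. c i \<alpha> * ?\<Lambda> \<gamma> (enh_monom i i \<alpha>)) +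
          (\<Sum>l\<in>UNIV - {i}. \<Sum>\<alpha>\<in>enh_index k l. c l \<alpha> * ?\<Lambda> \<gamma> (enh_monom i l \<alpha>))"
        using key[OF \<gamma>(1)] by (simp add: sum.remove[of UNIV i])
      also have "(\<Sum>l\<in>UNIV - {i}. \<Sum>\<alpha>\<in>enh_index k l. c l \<alpha> * ?\<Lambda> \<gamma> (enh_monom i l \<alpha>)) = ?S"
        by (intro sum.cong refl off \<gamma>) auto
      finally have S: "(real (\<Sum>j\<in>UNIV - {i}. \<gamma> j) + real CARD('d) - 1) * c i \<gamma> = ?S"
        unfolding diag[OF \<gamma>(1)] by (simp add: algebra_simps del: of_nat_sum)
      have N: "real N = real (\<gamma> i) + real (\<Sum>j\<in>UNIV - {i}. \<gamma> j)"
        using \<gamma>(2) by (simp add: sum.remove[of UNIV i] flip: of_nat_add of_nat_sum)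
      show ?thesis
      proof (cases "\<gamma> i = 0")
        case True
        then show ?thesis using S N by simp
      next
        case False
        have "p (\<gamma>(i := \<gamma> i - 1)) = real (\<gamma> i) * C i (\<gamma>(i := \<gamma> i)) + ?S"
          unfolding p_def using False
          by (subst sum.remove[of UNIV i]) (auto intro!: sum.cong)
        also have "C i (\<gamma>(i := \<gamma> i)) = c i \<gamma>" using \<gamma> by (simp add: C_def)
        finally have P: "p (\<gamma>(i := \<gamma> i - 1)) = real (\<gamma> i) * c i \<gamma> + ?S" .
        have "(real N + real CARD('d) - 1) * c i \<gamma> =
            real (\<gamma> i) * c i \<gamma> + (real (\<Sum>j\<in>UNIV - {i}. \<gamma> j) + real CARD('d) - 1) * c i \<gamma>"
          unfolding N by (simp add: algebra_simps del: of_nat_sum)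
        then show ?thesis unfolding if_not_P[OF False] P S .
      qed
    qed
    obtain j where j: "j \<noteq> i" "\<gamma> j = k" using \<gamma> by (auto simp: enh_index_def)
    have "N \<ge> k" unfolding N_def using j member_le_sum[of j UNIV \<gamma>] by auto
    then have Npos: "real N + real CARD('d) - 1 > 0"
      using k zero_less_card_finite[where 'a='d] by linarith
    define \<delta> where "\<delta> = \<gamma>(i := \<gamma> i - 1)"
    have \<gamma>i: "\<gamma> i \<noteq> 0" using rel[OF \<gamma>(1) N_def[symmetric]] \<gamma>(2) Npos by (auto split: if_splits)
    have p0: "p \<delta> \<noteq> 0"
      using rel[OF \<gamma>(1) N_def[symmetric]] \<gamma>(2) Npos \<gamma>i by (auto simp: \<delta>_def)
    have sum\<delta>: "(\<Sum>l\<in>UNIV. real (Suc (\<delta> l))) = real N + real CARD('d) - 1"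
    proof -
      have "Suc (sum \<delta> UNIV) = N"
        using \<gamma>i unfolding N_def \<delta>_def by (simp add: sum.remove[of UNIV i])
      then show ?thesis by (simp add: sum.distrib flip: of_nat_sum)
    qed
    \<comment> \<open>The permitted directions.\<close>
    let ?G = "{l. \<delta>(l := Suc (\<delta> l)) \<in> enh_index k l}"
    have CG: "(real N + real CARD('d) - 1) * C l (\<delta>(l := Suc (\<delta> l))) = (if l \<in> ?G then p \<delta> else 0)" for l
    proof (cases "l \<in> ?G")
      case True
      have "sum (\<delta>(l := Suc (\<delta> l))) UNIV = Suc (sum \<delta> UNIV)" by (simp add: sum.remove[of UNIV l])
      also have "\<dots> = N" using \<gamma>i unfolding N_def \<delta>_def by (simp add: sum.remove[of UNIV i])
      finally show ?thesis using rel[of "\<delta>(l := Suc (\<delta> l))" l] True by (simp add: C_def)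
    qed (simp add: C_def)
    have "(real N + real CARD('d) - 1) * p \<delta> =
        (\<Sum>l\<in>UNIV. (real N + real CARD('d) - 1) * (real (Suc (\<delta> l)) * C l (\<delta>(l := Suc (\<delta> l)))))"
      by (simp only: p_def sum_distrib_left)
    also have "\<dots> = (\<Sum>l\<in>UNIV. real (Suc (\<delta> l)) * (if l \<in> ?G then p \<delta> else 0))"
      by (intro sum.cong refl) (simp only: mult.left_commute[of _ "real (Suc _)"] CG)
    also have "\<dots> = p \<delta> * (\<Sum>l\<in>?G. real (Suc (\<delta> l)))"
      unfolding sum_distrib_left
      by (rule sum.mono_neutral_cong_right) auto
    finally have "(\<Sum>l\<in>?G. real (Suc (\<delta> l))) = (\<Sum>l\<in>UNIV. real (Suc (\<delta> l)))" using p0 sum\<delta> by simp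
    moreover have "j \<notin> ?G" using j by (auto simp: enh_index_def \<delta>_def)
    then have "(\<Sum>l\<in>?G. real (Suc (\<delta> l))) < (\<Sum>l\<in>UNIV. real (Suc (\<delta> l)))"
      by (intro sum_strict_mono2[of _ _ j]) auto
    ultimately show False by simp
  qed
  have "enh_field k c x = 0" for x unfolding enh_field_def by (simp add: vec_eq_iff c0)
  then have vr: "v = r" using v by auto
  have "v x $ i = 0" for i
    using Qpoly_eq_0_if_grid[OF inj, of "\<lambda>x. v x $ i" x] RT_component[OF r, of i] grid k vr by simp
  then show ?thesis by (simp add: vec_eq_iff)
qed

section \<open>The reference spaces in two and three dimensions\<close>

lemma has_derivative_monom_fun:
  "(monom_fun \<alpha> has_derivative
     (\<lambda>h. \<Sum>j\<in>UNIV. h $ j * (real (\<alpha> j) * monom_fun (\<alpha>(j := \<alpha> j - 1)) x))) (at x)"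
proof -
  have "((\<lambda>x. \<Prod>i\<in>UNIV. x $ i ^ \<alpha> i) has_derivative
     (\<lambda>h. \<Sum>j\<in>UNIV. (real (\<alpha> j) * (h $ j * x $ j ^ (\<alpha> j - 1))) * (\<Prod>i\<in>UNIV - {j}. x $ i ^ \<alpha> i))) (at x)"
    by (intro has_derivative_prod) (auto intro!: derivative_eq_intros bounded_linear.has_derivative[OF bounded_linear_vec_nth])
  moreover have "(real (\<alpha> j) * (h $ j * x $ j ^ (\<alpha> j - 1))) * (\<Prod>i\<in>UNIV - {j}. x $ i ^ \<alpha> i)
      = h $ j * (real (\<alpha> j) * monom_fun (\<alpha>(j := \<alpha> j - 1)) x)" for h :: "real^'a" and j
  proof -
    have "monom_fun (\<alpha>(j := \<alpha> j - 1)) x = x $ j ^ (\<alpha> j - 1) * (\<Prod>i\<in>UNIV - {j}. x $ i ^ \<alpha> i)"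
      unfolding monom_fun_def by (subst prod.remove[of UNIV j]) (auto intro!: prod.cong)
    then show ?thesis by simp
  qed
  ultimately have "((\<lambda>x. \<Prod>i\<in>UNIV. x $ i ^ \<alpha> i) has_derivative
      (\<lambda>h. \<Sum>j\<in>UNIV. h $ j * (real (\<alpha> j) * monom_fun (\<alpha>(j := \<alpha> j - 1)) x))) (at x)"
    by (simp only:)
  moreover have "monom_fun \<alpha> = (\<lambda>x. \<Prod>i\<in>UNIV. x $ i ^ \<alpha> i)" by (rule ext) (rule monom_fun_def)
  ultimately show ?thesis by (simp only:)
qed

lemma pd_eqI: "(f has_derivative f') (at x) \<Longrightarrow> pd j f x = f' (axis j 1)"
  unfolding pd_def by (metis frechet_derivative_at)

lemma has_derivative_poly:
  "((\<lambda>y. \<Sum>\<alpha>\<in>A. c \<alpha> * monom_fun (g \<alpha>) y) has_derivative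
     (\<lambda>h. \<Sum>\<alpha>\<in>A. c \<alpha> * (\<Sum>j\<in>UNIV. h $ j * (real (g \<alpha> j) * monom_fun ((g \<alpha>)(j := g \<alpha> j - 1)) x)))) (at x)"
  by (intro has_derivative_sum has_derivative_mult_right has_derivative_monom_fun)

lemma pd_poly:
  "pd j (\<lambda>y. \<Sum>\<alpha>\<in>A. c \<alpha> * monom_fun (g \<alpha>) y) x =
     (\<Sum>\<alpha>\<in>A. c \<alpha> * (real (g \<alpha> j) * monom_fun ((g \<alpha>)(j := g \<alpha> j - 1)) x))"
proof -
  have "(\<Sum>i\<in>UNIV. axis j (1::real) $ i * t i) = t j" for t :: "'a \<Rightarrow> real"
    by (simp add: axis_def if_distrib[of "\<lambda>z. z * _"] cong: if_cong)
  then show ?thesis by (simp add: pd_eqI[OF has_derivative_poly])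
qed

lemma pd_coord_mult_poly:
  "pd j (\<lambda>y. y $ a * (\<Sum>\<alpha>\<in>A. c \<alpha> * monom_fun \<alpha> y)) x =
     (\<Sum>\<alpha>\<in>A. c \<alpha> * (real ((\<alpha>(a := Suc (\<alpha> a))) j) *
        monom_fun ((\<alpha>(a := Suc (\<alpha> a)))(j := (\<alpha>(a := Suc (\<alpha> a))) j - 1)) x))"
proof -
  have "(\<lambda>y. y $ a * (\<Sum>\<alpha>\<in>A. c \<alpha> * monom_fun \<alpha> y)) =
      (\<lambda>y. \<Sum>\<alpha>\<in>A. c \<alpha> * monom_fun (\<alpha>(a := Suc (\<alpha> a))) y)"
    by (simp add: sum_distrib_left monom_fun_mult_coord[symmetric] mult_ac)
  then show ?thesis by (simp only: pd_poly)
qed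

lemma pd_minus: "pd j (\<lambda>y. - f y) x = - pd j f x" if "f differentiable at x"
  using pd_eqI[OF has_derivative_minus[OF that[unfolded frechet_derivative_works]]]
  by (simp add: pd_def)

lemma differentiable_coord_mult_poly:
  "(\<lambda>y. y $ a * (\<Sum>\<alpha>\<in>A. c \<alpha> * monom_fun \<alpha> y)) differentiable at x"
proof -
  have "(\<lambda>y. \<Sum>\<alpha>\<in>A. c \<alpha> * monom_fun (\<alpha>(a := Suc (\<alpha> a))) y) differentiable at x"
    using has_derivative_poly[where A=A and c=c and g="\<lambda>\<alpha>. \<alpha>(a := Suc (\<alpha> a))"] unfolding differentiable_def by blast
  moreover have "(\<lambda>y. y $ a * (\<Sum>\<alpha>\<in>A. c \<alpha> * monom_fun \<alpha> y)) =
      (\<lambda>y. \<Sum>\<alpha>\<in>A. c \<alpha> * monom_fun (\<alpha>(a := Suc (\<alpha> a))) y)"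
    by (simp add: sum_distrib_left monom_fun_mult_coord[symmetric] mult_ac)
  ultimately show ?thesis by simp
qed

definition enh_space :: "nat \<Rightarrow> real \<Rightarrow> (real^'d \<Rightarrow> real^'d::finite) set" where
  "enh_space k s = {\<lambda>x. r x + s *\<^sub>R enh_field k c x | r c. r \<in> RT (k - 1)}"

lemma curl2_cross2:
  fixes c :: "2 \<Rightarrow> (2 \<Rightarrow> nat) \<Rightarrow> real"
  shows "(\<Sum>l\<in>UNIV. curl2 (\<lambda>y. cross2 y (axis l (\<Sum>\<alpha>\<in>enh_index k l. c l \<alpha> * monom_fun \<alpha> y))) x)
    = (-1) *\<^sub>R enh_field k c x"
proof -
  have 1: "cross2 y (axis 1 t) = - (y $ 2 * t)" "cross2 y (axis 2 t) = y $ 1 * t" for y t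
    by (simp_all add: cross2_def axis_def)
  have 2: "\<alpha>(2 := Suc (\<alpha> 2), 1 := \<alpha> 1 - Suc 0) = \<alpha>(1 := \<alpha> 1 - Suc 0, 2 := Suc (\<alpha> 2))" for \<alpha> :: "2 \<Rightarrow> nat"
    by (auto simp: fun_eq_iff)
  have 3: "\<alpha>(1 := Suc (\<alpha> 1), 2 := \<alpha> 2 - Suc 0) = \<alpha>(2 := \<alpha> 2 - Suc 0, 1 := Suc (\<alpha> 1))" for \<alpha> :: "2 \<Rightarrow> nat"
    by (auto simp: fun_eq_iff)
  have 4: "UNIV - {1::2} = {2}" "UNIV - {2::2} = {1}" unfolding UNIV_2 by auto
  show ?thesis
    by (simp add: vec_eq_iff forall_2 sum_2 curl2_def 1 pd_minus differentiable_coord_mult_poly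
        pd_coord_mult_poly enh_field_def enh_monom_def 2 3 4)
      (simp add: algebra_simps sum_negf sum.distrib sum_subtractf sum_distrib_left)
qed

lemma curl3_cross3:
  fixes c :: "3 \<Rightarrow> (3 \<Rightarrow> nat) \<Rightarrow> real"
  shows "(\<Sum>l\<in>UNIV. curl3 (\<lambda>y. cross3 y (axis l (\<Sum>\<alpha>\<in>enh_index k l. c l \<alpha> * monom_fun \<alpha> y))) x)
    = enh_field k c x"
proof -
  have 1: "cross3 y (axis 1 t) = vector [0, y $ 3 * t, - (y $ 2 * t)]"
    "cross3 y (axis 2 t) = vector [- (y $ 3 * t), 0, y $ 1 * t]"
    "cross3 y (axis 3 t) = vector [y $ 2 * t, - (y $ 1 * t), 0]" for y t
    by (simp_all add: cross3_def axis_def vec_eq_iff forall_3)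
  have 2: "\<alpha>(i := Suc (\<alpha> i), l := \<alpha> l - Suc 0) = \<alpha>(l := \<alpha> l - Suc 0, i := Suc (\<alpha> i))"
    if "i \<noteq> l" for i l and \<alpha> :: "3 \<Rightarrow> nat"
    using that by (auto simp: fun_eq_iff)
  have 4: "UNIV - {1::3} = {2, 3}" "UNIV - {2::3} = {1, 3}" "UNIV - {3::3} = {1, 2}" unfolding UNIV_3 by auto
  have 5: "pd j (\<lambda>y. 0) x = 0" for j and x :: "real^3" by (simp add: pd_eqI[OF has_derivative_const])
  show ?thesis
    by (simp add: vec_eq_iff forall_3 sum_3 curl3_def 1 pd_minus differentiable_coord_mult_poly
        pd_coord_mult_poly enh_field_def enh_monom_def 2 4 5)
      (simp add: algebra_simps sum_negf sum.distrib sum_subtractf sum_distrib_left)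
qed

lemma Bpoly_eq: "Bpoly k i = {q. \<exists>c. q = (\<lambda>x. axis i (\<Sum>\<alpha>\<in>enh_index k i. c \<alpha> * monom_fun \<alpha> x))}"
  by (simp add: Bpoly_def enh_index_def)

lemma Collect_sums_of_range:
  "{v. \<exists>a\<in>A. \<exists>b\<in>{g c |c. True}. v = h a b} = {h a (g c) |a c. a \<in> A}"
  by blast

lemma Vhat2_eq: "Vhat2 k = enh_space k (-1)"
proof -
  have "Btilde2 k = {\<lambda>x. (-1) *\<^sub>R enh_field k c x | c. True}"
  proof (intro equalityI subsetI)
    fix v assume "v \<in> Btilde2 k"
    then obtain q where q: "\<forall>i. q i \<in> Bpoly k i"
      and v: "v = (\<lambda>x. \<Sum>i\<in>UNIV. curl2 (\<lambda>y. cross2 y (q i y)) x)" by (auto simp: Btilde2_def)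
    from q obtain c where "\<And>i. q i = (\<lambda>x. axis i (\<Sum>\<alpha>\<in>enh_index k i. c i \<alpha> * monom_fun \<alpha> x))"
      unfolding Bpoly_eq by simp metis
    then show "v \<in> {\<lambda>x. (-1) *\<^sub>R enh_field k c x | c. True}" unfolding v by (auto simp only: curl2_cross2)
  next
    fix v assume "v \<in> {\<lambda>x. (-1) *\<^sub>R enh_field k c x :: real^2 | c. True}"
    then obtain c where "v = (\<lambda>x. (-1) *\<^sub>R enh_field k c x)" by blast
    then show "v \<in> Btilde2 k" unfolding Btilde2_def
      by (intro CollectI exI[of _ "\<lambda>i x. axis i (\<Sum>\<alpha>\<in>enh_index k i. c i \<alpha> * monom_fun \<alpha> x)"])
        (auto simp only: curl2_cross2 Bpoly_eq)
  qed
  then show ?thesis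
    by (simp only: Vhat2_def enh_space_def Collect_sums_of_range[where h="\<lambda>a b x. a x + b x"])
qed

lemma Vhat3_eq: "Vhat3 k = enh_space k 1"
proof -
  have "Btilde3 k = {enh_field k c | c. True}"
  proof (intro equalityI subsetI)
    fix v assume "v \<in> Btilde3 k"
    then obtain q where q: "\<forall>i. q i \<in> Bpoly k i"
      and v: "v = (\<lambda>x. \<Sum>i\<in>UNIV. curl3 (\<lambda>y. cross3 y (q i y)) x)" by (auto simp: Btilde3_def)
    from q obtain c where "\<And>i. q i = (\<lambda>x. axis i (\<Sum>\<alpha>\<in>enh_index k i. c i \<alpha> * monom_fun \<alpha> x))"
      unfolding Bpoly_eq by simp metis
    then show "v \<in> {enh_field k c | c. True}" unfolding v by (auto simp only: curl3_cross3)
  next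
    fix v assume "v \<in> {enh_field k c :: real^3 \<Rightarrow> real^3 | c. True}"
    then obtain c where "v = enh_field k c" by blast
    then show "v \<in> Btilde3 k" unfolding Btilde3_def
      by (intro CollectI exI[of _ "\<lambda>i x. axis i (\<Sum>\<alpha>\<in>enh_index k i. c i \<alpha> * monom_fun \<alpha> x)"])
        (auto simp only: curl3_cross3 Bpoly_eq)
  qed
  then show ?thesis
    by (simp only: Vhat3_def enh_space_def scaleR_one Collect_sums_of_range[where h="\<lambda>a b x. a x + b x"])
qed

text \<open>All that the rest of the argument uses of the reference space.\<close>

definition ref_space :: "nat \<Rightarrow> (real^'d \<Rightarrow> real^'d::finite) set \<Rightarrow> bool" where
  "ref_space k V \<longleftrightarrow> lin_space V \<and> RT (k - 1) \<subseteq> V \<and> (\<forall>v\<in>V. continuous_on UNIV v) \<and>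
     (\<forall>\<xi>. inj_on \<xi> {..k} \<longrightarrow> (\<forall>v\<in>V. (\<forall>\<iota>. (\<forall>j. \<iota> j \<le> k) \<longrightarrow> v (\<chi> j. \<xi> (\<iota> j)) = 0) \<longrightarrow> (\<forall>x. v x = 0)))"

lemma continuous_on_monom_fun [continuous_intros]: "continuous_on S (monom_fun \<alpha>)"
  unfolding monom_fun_def[abs_def] by (intro continuous_intros)

lemma Qpoly_continuous: "f \<in> Qpoly m \<Longrightarrow> continuous_on S f"
  by (elim QpolyE) (auto intro!: continuous_intros)

lemma lin_space_RT: "lin_space (RT m)"
  unfolding lin_space_def
proof (intro conjI ballI allI)
  show "(\<lambda>x. 0) \<in> (RT m :: (real^'a \<Rightarrow> real^'a) set)"
    unfolding RT_def using Qpoly_const[of 0 m] by (auto intro!: bexI[of _ "\<lambda>x. 0"])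
next
  fix f g :: "real^'a \<Rightarrow> real^'a" assume f: "f \<in> RT m" and g: "g \<in> RT m"
  show "(\<lambda>x. f x + g x) \<in> RT m" unfolding RT_def
  proof (intro CollectI allI)
    fix i
    obtain a b where "a \<in> Qpoly m" "b \<in> Qpoly m" "\<forall>x. f x $ i = a x + x $ i * b x"
      using f unfolding RT_def by blast
    moreover obtain a' b' where "a' \<in> Qpoly m" "b' \<in> Qpoly m" "\<forall>x. g x $ i = a' x + x $ i * b' x"
      using g unfolding RT_def by blast
    ultimately show "\<exists>a\<in>Qpoly m. \<exists>b\<in>Qpoly m. \<forall>x. (f x + g x) $ i = a x + x $ i * b x"
      by (intro bexI[of _ "\<lambda>x. a x + a' x"] bexI[of _ "\<lambda>x. b x + b' x"])
        (auto simp: algebra_simps intro: Qpoly_add)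
  qed
next
  fix f :: "real^'a \<Rightarrow> real^'a" and c assume f: "f \<in> RT m"
  show "(\<lambda>x. c *\<^sub>R f x) \<in> RT m" unfolding RT_def
  proof (intro CollectI allI)
    fix i
    obtain a b where "a \<in> Qpoly m" "b \<in> Qpoly m" "\<forall>x. f x $ i = a x + x $ i * b x"
      using f unfolding RT_def by blast
    then show "\<exists>a\<in>Qpoly m. \<exists>b\<in>Qpoly m. \<forall>x. (c *\<^sub>R f x) $ i = a x + x $ i * b x"
      by (intro bexI[of _ "\<lambda>x. c * a x"] bexI[of _ "\<lambda>x. c * b x"])
        (auto simp: algebra_simps intro: Qpoly_cmult)
  qed
qed

lemma continuous_on_vec_componentwise:
  fixes f :: "'a::topological_space \<Rightarrow> real^'n"
  assumes "\<And>i. continuous_on S (\<lambda>x. f x $ i)" shows "continuous_on S f"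
  using continuous_on_vec_lambda[of S "\<lambda>i x. f x $ i"] assms by simp

lemma enh_field_add: "enh_field k (\<lambda>l \<alpha>. c l \<alpha> + c' l \<alpha>) x = enh_field k c x + enh_field k c' x"
  by (simp add: enh_field_def vec_eq_iff ring_distribs sum.distrib)

lemma enh_field_scale: "enh_field k (\<lambda>l \<alpha>. t * c l \<alpha>) x = t *\<^sub>R enh_field k c x"
  by (simp add: enh_field_def vec_eq_iff sum_distrib_left mult_ac)

lemma ref_space_enh_space:
  assumes "k \<ge> 1" "s \<noteq> 0"
  shows "ref_space k (enh_space k s :: (real^'a \<Rightarrow> real^'a::finite) set)"
  unfolding ref_space_def
proof (intro conjI ballI allI impI subsetI)
  show "lin_space (enh_space k s :: (real^'a \<Rightarrow> real^'a) set)"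
    unfolding lin_space_def
  proof (intro conjI ballI allI)
    show "(\<lambda>x. 0) \<in> (enh_space k s :: (real^'a \<Rightarrow> real^'a) set)"
      unfolding enh_space_def using lin_space_zero[OF lin_space_RT]
      by (intro CollectI exI[of _ "\<lambda>x. 0"] exI[of _ "\<lambda>l \<alpha>. 0"]) (auto simp: enh_field_def vec_eq_iff)
  next
    fix f g :: "real^'a \<Rightarrow> real^'a" assume "f \<in> enh_space k s" "g \<in> enh_space k s"
    then obtain r c r' c' where "r \<in> RT (k - 1)" "r' \<in> RT (k - 1)" "f = (\<lambda>x. r x + s *\<^sub>R enh_field k c x)"
      "g = (\<lambda>x. r' x + s *\<^sub>R enh_field k c' x)" by (auto simp: enh_space_def)
    then show "(\<lambda>x. f x + g x) \<in> enh_space k s"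
      unfolding enh_space_def
      by (intro CollectI exI[of _ "\<lambda>x. r x + r' x"] exI[of _ "\<lambda>l \<alpha>. c l \<alpha> + c' l \<alpha>"])
        (auto simp: enh_field_add algebra_simps intro: lin_space_add[OF lin_space_RT])
  next
    fix f :: "real^'a \<Rightarrow> real^'a" and t assume "f \<in> enh_space k s"
    then obtain r c where "r \<in> RT (k - 1)" "f = (\<lambda>x. r x + s *\<^sub>R enh_field k c x)" by (auto simp: enh_space_def)
    then show "(\<lambda>x. t *\<^sub>R f x) \<in> enh_space k s"
      unfolding enh_space_def
      by (intro CollectI exI[of _ "\<lambda>x. t *\<^sub>R r x"] exI[of _ "\<lambda>l \<alpha>. t * c l \<alpha>"])
        (auto simp: enh_field_scale algebra_simps intro: lin_space_scale[OF lin_space_RT])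
  qed
next
  fix v :: "real^'a \<Rightarrow> real^'a" assume "v \<in> RT (k - 1)"
  then show "v \<in> enh_space k s"
    unfolding enh_space_def
    by (intro CollectI exI[of _ v] exI[of _ "\<lambda>l \<alpha>. 0"]) (auto simp: enh_field_def vec_eq_iff)
next
  fix v :: "real^'a \<Rightarrow> real^'a" assume "v \<in> enh_space k s"
  then obtain r c where r: "r \<in> RT (k - 1)" and v: "v = (\<lambda>x. r x + s *\<^sub>R enh_field k c x)" by (auto simp: enh_space_def)
  have "continuous_on UNIV (\<lambda>x. r x $ i)" for i using Qpoly_continuous[OF RT_component[OF r]] .
  moreover have "continuous_on UNIV (enh_monom i l \<alpha>)" for i l and \<alpha> :: "'a \<Rightarrow> nat"
    unfolding enh_monom_def by (cases "i = l") (auto intro!: continuous_intros)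
  ultimately have "continuous_on UNIV (\<lambda>x. r x $ i +
      s * (\<Sum>l\<in>UNIV. \<Sum>\<alpha>\<in>enh_index k l. c l \<alpha> * enh_monom i l \<alpha> x))" for i
    by (intro continuous_on_add continuous_on_mult continuous_on_sum continuous_on_const) auto
  then show "continuous_on UNIV v"
    by (intro continuous_on_vec_componentwise) (simp add: v enh_field_def)
next
  fix \<xi> :: "nat \<Rightarrow> real" and v :: "real^'a \<Rightarrow> real^'a" and x :: "real^'a"
  assume inj: "inj_on \<xi> {..k}" and v: "v \<in> enh_space k s"
    and grid: "\<forall>\<iota>. (\<forall>j. \<iota> j \<le> k) \<longrightarrow> v (\<chi> j. \<xi> (\<iota> j)) = 0"
  obtain r c where r: "r \<in> RT (k - 1)" and v: "v = (\<lambda>x. r x + s *\<^sub>R enh_field k c x)"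
    using v by (auto simp: enh_space_def)
  show "v x = 0"
    by (rule enhanced_RT_unisolvent[OF assms(1) inj r assms(2), of v c]) (use grid v in auto)
qed

section \<open>Positivity of the quadrature weights\<close>

lemma gauss_lobatto_inj: "gauss_lobatto k \<xi> \<omega> \<Longrightarrow> inj_on \<xi> {..k}"
  using strict_mono_on_imp_inj_on by (auto simp: gauss_lobatto_def)

lemma gauss_lobatto_range:
  assumes "gauss_lobatto k \<xi> \<omega>" "i \<le> k" shows "-1 \<le> \<xi> i" "\<xi> i \<le> 1"
proof -
  have "mono_on {..k} \<xi>" using assms by (auto simp: gauss_lobatto_def strict_mono_on_imp_mono_on)
  then have "\<xi> 0 \<le> \<xi> i" "\<xi> i \<le> \<xi> k" using assms by (auto simp: mono_on_def)
  then show "-1 \<le> \<xi> i" "\<xi> i \<le> 1" using assms by (auto simp: gauss_lobatto_def)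
qed

text \<open>The polynomial that vanishes at all other nodes, doubly at the interior ones, is nonnegative on the
  interval and has degree at most 2 k - 1, so the rule integrates it exactly.\<close>

lemma gauss_lobatto_weight_pos:
  assumes gl: "gauss_lobatto k \<xi> \<omega>" and k: "k \<ge> 1" and i: "i \<le> k"
  shows "\<omega> i > 0"
proof -
  let ?J = "{1..<k} - {i}"
  define p where "p = (if i = k then 1 else [:1, -1:]) * (if i = 0 then 1 else [:1, 1:]) *
     (\<Prod>j\<in>?J. [:- \<xi> j, 1:] ^ 2)"
  have inj: "\<xi> a = \<xi> b \<longleftrightarrow> a = b" if "a \<le> k" "b \<le> k" for a b
    using gauss_lobatto_inj[OF gl] that by (auto simp: inj_on_def)
  have ends: "\<xi> 0 = -1" "\<xi> k = 1" using gl by (auto simp: gauss_lobatto_def)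
  have p: "poly p x = (if i = k then 1 else 1 - x) * (if i = 0 then 1 else 1 + x) * (\<Prod>j\<in>?J. (x - \<xi> j) ^ 2)" for x
    by (simp add: p_def poly_prod)
  have "degree (\<Prod>j\<in>?J. [:- \<xi> j, 1:] ^ 2) \<le> sum (degree \<circ> (\<lambda>j. [:- \<xi> j, 1:] ^ 2)) ?J"
    by (rule degree_prod_sum_le) simp
  also have "\<dots> \<le> (\<Sum>j\<in>?J. 2)" by (intro sum_mono) (auto intro: order_trans[OF degree_power_le])
  also have "\<dots> = 2 * card ?J" by simp
  finally have 1: "degree (\<Prod>j\<in>?J. [:- \<xi> j, 1:] ^ 2) \<le> 2 * card ?J" .
  have "degree p \<le> degree (if i = k then 1 else [:1, -1::real:]) + degree (if i = 0 then 1 else [:1, 1::real:])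
      + degree (\<Prod>j\<in>?J. [:- \<xi> j, 1:] ^ 2)"
    unfolding p_def by (intro order_trans[OF degree_mult_le] add_mono degree_mult_le order_refl)
  also have "\<dots> \<le> (if i = k then 0 else 1) + (if i = 0 then 0 else 1) + 2 * card ?J"
    using 1 by (intro add_mono) auto
  also have "\<dots> \<le> 2 * k - 1"
  proof (cases "i = 0 \<or> i = k")
    case True
    then have J: "?J = {1..<k}" by auto
    have "card {1..<k} = k - 1" by simp
    then show ?thesis unfolding J using True k by (elim disjE) simp_all
  next
    case False
    then have "card ?J = k - 1 - 1" using i by (subst card_Diff_singleton) auto
    then show ?thesis using False i k by auto
  qed
  finally have "(\<Sum>m\<le>k. \<omega> m * poly p (\<xi> m)) = integral {-1..1} (poly p)"
    using gl by (auto simp: gauss_lobatto_def)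
  moreover have "poly p (\<xi> m) = 0" if "m \<le> k" "m \<noteq> i" for m
    using that ends by (cases "m = 0"; cases "m = k") (auto simp: p intro!: prod_zero bexI[of _ m])
  then have "(\<Sum>m\<le>k. \<omega> m * poly p (\<xi> m)) = \<omega> i * poly p (\<xi> i)"
    using i by (subst sum.remove[of _ i]) (auto intro!: sum.neutral)
  moreover have pos: "poly p (\<xi> i) > 0"
  proof -
    have "(\<Prod>j\<in>?J. (\<xi> i - \<xi> j) ^ 2) > 0" using i inj by (intro prod_pos) auto
    moreover have "(if i = k then 1 else 1 - \<xi> i) > 0"
    proof (cases "i = k")
      case False
      then have "\<xi> i \<noteq> 1" using inj[OF i order_refl] ends(2) by metis
      then show ?thesis using gauss_lobatto_range[OF gl i] False by simp
    qed simp
    moreover have "(if i = 0 then 1 else 1 + \<xi> i) > 0"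
    proof (cases "i = 0")
      case False
      then have "\<xi> i \<noteq> - 1" using inj[OF i le0] ends(1) by metis
      then show ?thesis using gauss_lobatto_range[OF gl i] False by simp
    qed simp
    ultimately show ?thesis by (simp add: p)
  qed
  moreover have "integral {-1..1} (poly p) > 0"
  proof -
    have nn: "poly p x \<ge> 0" if "x \<in> {-1..1}" for x
      using that unfolding p by (intro mult_nonneg_nonneg prod_nonneg) auto
    have cont: "continuous_on {-1..1} (poly p)" by (intro continuous_intros)
    have "integral {-1..1} (poly p) \<noteq> 0"
      using integral_eq_0_iff[OF cont _ nn] pos gauss_lobatto_range[OF gl i] by force
    moreover have "integral {-1..1} (poly p) \<ge> 0" using nn by (intro integral_nonneg integrable_continuous_interval cont)
    ultimately show ?thesis by simp
  qed
  ultimately have "0 < \<omega> i * poly p (\<xi> i)" by simp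
  then show ?thesis using pos by (rule zero_less_mult_pos2)
qed

section \<open>Test functions\<close>

lemma frechet_inner_grad:
  assumes "f differentiable at x"
  shows "frechet_derivative f (at x) h = h \<bullet> grad f x"
proof -
  interpret D: linear "frechet_derivative f (at x)" using assms by (rule linear_frechet_derivative)
  have "frechet_derivative f (at x) h = frechet_derivative f (at x) (\<Sum>i\<in>UNIV. h $ i *\<^sub>R axis i 1)"
    by (simp add: basis_expansion scalar_mult_eq_scaleR[symmetric])
  also have "\<dots> = h \<bullet> grad f x"
    by (simp add: D.sum D.scale inner_vec_def grad_def pd_def)
  finally show ?thesis .
qed

lemma C_diff_continuous: "C_diff n f \<Longrightarrow> continuous_on UNIV f"
  by (cases n) (auto intro: differentiable_imp_continuous_on)

lemma C_diff_SucD: "C_diff (Suc n) f \<Longrightarrow> C_diff n f"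
proof (induction n arbitrary: f)
  case 0
  then show ?case by (auto intro: differentiable_imp_continuous_on)
next
  case (Suc n)
  then show ?case by (metis C_diff.simps(2))
qed

lemma differentiable_on_UNIVD: "f differentiable_on UNIV \<Longrightarrow> f differentiable at x"
  by (simp add: differentiable_on_def)

lemma pd_add:
  assumes "f differentiable at x" "g differentiable at x"
  shows "pd i (\<lambda>x. f x + g x) x = pd i f x + pd i g x"
  using pd_eqI[OF has_derivative_add[OF assms[unfolded frechet_derivative_works]]]
  by (simp add: pd_def)

lemma pd_mult:
  assumes "f differentiable at x" "g differentiable at x"
  shows "pd i (\<lambda>x. f x * g x) x = f x * pd i g x + pd i f x * g x"
  using pd_eqI[OF has_derivative_mult[OF assms[unfolded frechet_derivative_works]]]
  by (simp add: pd_def)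

lemma C_diff_add: "C_diff n f \<Longrightarrow> C_diff n g \<Longrightarrow> C_diff n (\<lambda>x. f x + g x)"
proof (induction n arbitrary: f g)
  case (Suc n)
  then have "pd i (\<lambda>x. f x + g x) = (\<lambda>x. pd i f x + pd i g x)" for i
    by (intro ext pd_add differentiable_on_UNIVD) auto
  then show ?case using Suc by (auto intro: differentiable_on_add)
qed (auto intro: continuous_on_add)

lemma C_diff_mult: "C_diff n f \<Longrightarrow> C_diff n g \<Longrightarrow> C_diff n (\<lambda>x. f x * g x)"
proof (induction n arbitrary: f g)
  case (Suc n)
  then have "pd i (\<lambda>x. f x * g x) = (\<lambda>x. f x * pd i g x + pd i f x * g x)" for i
    by (intro ext pd_mult differentiable_on_UNIVD) auto
  moreover have "(\<lambda>x. f x * g x) differentiable_on UNIV"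
    using Suc.prems by (intro differentiable_on_mult) auto
  moreover have "C_diff n f" "C_diff n g" using Suc.prems C_diff_SucD by blast+
  then have "C_diff n (\<lambda>x. f x * pd i g x + pd i f x * g x)" for i
    using Suc.prems by (intro C_diff_add Suc.IH) auto
  ultimately show ?case by simp
qed (auto intro: continuous_on_mult)

lemma C_diff_const: "C_diff n (\<lambda>x. c)"
proof (induction n arbitrary: c)
  case (Suc n)
  have "pd i (\<lambda>x. c) = (\<lambda>x. 0)" for i :: 'a by (intro ext) (simp add: pd_eqI[OF has_derivative_const])
  then show ?case using Suc by simp
qed simp

lemma smooth_prod: "(\<And>i. i \<in> I \<Longrightarrow> smooth (f i)) \<Longrightarrow> smooth (\<lambda>x. \<Prod>i\<in>I. f i x)"
proof (induction I rule: infinite_finite_induct)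
  case (insert a I)
  then show ?case by (simp add: smooth_def C_diff_mult)
qed (simp_all add: smooth_def C_diff_const)

lemma smooth_differentiable: "smooth f \<Longrightarrow> f differentiable at x"
  by (metis smooth_def C_diff.simps(2) differentiable_on_UNIVD)

lemma smooth_continuous: "smooth f \<Longrightarrow> continuous_on S f"
  by (metis smooth_def C_diff_continuous continuous_on_subset subset_UNIV)

lemma smooth_grad_continuous:
  assumes "smooth f" shows "continuous_on S (grad f)"
proof -
  have "C_diff (Suc 0) f" using assms smooth_def by blast
  then have "continuous_on UNIV (\<lambda>x. \<chi> i. pd i f x)" by (intro continuous_on_vec_lambda) auto
  then show ?thesis unfolding grad_def[abs_def] by (rule continuous_on_subset) simp
qed

text \<open>The functions \<open>P (1 / t) exp (- 1 / t)\<close> for positive t, extended by zero; they are closed under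
  differentiation.\<close>

definition exp_tail :: "real poly \<Rightarrow> real \<Rightarrow> real" where
  "exp_tail P t = (if t > 0 then poly P (1 / t) * exp (- (1 / t)) else 0)"

lemma poly_mult_exp_tendsto_0: "((\<lambda>u. poly P u * exp (- u)) \<longlongrightarrow> 0) at_top" for P :: "real poly"
proof -
  have "((\<lambda>u. \<Sum>i\<le>degree P. coeff P i * (u ^ i / exp u)) \<longlongrightarrow> (\<Sum>i\<le>degree P. coeff P i * 0)) at_top"
    by (intro tendsto_sum tendsto_mult tendsto_const tendsto_power_div_exp_0)
  moreover have "(\<lambda>u. \<Sum>i\<le>degree P. coeff P i * (u ^ i / exp u)) = (\<lambda>u. poly P u * exp (- u))"
    by (simp add: poly_altdef sum_distrib_right exp_minus divide_inverse mult.assoc)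
  ultimately show ?thesis by simp
qed

text \<open>At 0 the exponential beats every power of \<open>1 / t\<close>; elsewhere this is the chain rule for \<open>u = 1 / t\<close>,
  whose derivative is \<open>- u\<^sup>2\<close>.\<close>

lemma exp_tail_derivative:
  "(exp_tail P has_real_derivative exp_tail (monom 1 2 * (P - pderiv P)) t) (at t)"
proof -
  consider "t > 0" | "t < 0" | "t = 0" by linarith
  then show ?thesis
  proof cases
    case 1
    have "((\<lambda>t. poly P (1 / t) * exp (- (1 / t))) has_real_derivative
        exp_tail (monom 1 2 * (P - pderiv P)) t) (at t)"
      using 1 unfolding exp_tail_def
      by (auto intro!: derivative_eq_intros poly_DERIV[THEN DERIV_chain2] simp: poly_monom field_simps power2_eq_square)
    moreover have "eventually (\<lambda>t. poly P (1 / t) * exp (- (1 / t)) = exp_tail P t) (nhds t)"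
      using eventually_nhds_in_open[of "{0<..}" t] 1 by (auto elim!: eventually_mono simp: exp_tail_def)
    ultimately show ?thesis by (rule DERIV_cong_ev[OF refl _ refl, THEN iffD1, rotated])
  next
    case 2
    have "((\<lambda>t. 0) has_real_derivative exp_tail (monom 1 2 * (P - pderiv P)) t) (at t)"
      using 2 by (simp add: exp_tail_def)
    moreover have "eventually (\<lambda>t. 0 = exp_tail P t) (nhds t)"
      using eventually_nhds_in_open[of "{..<0}" t] 2 by (auto elim!: eventually_mono simp: exp_tail_def)
    ultimately show ?thesis by (rule DERIV_cong_ev[OF refl _ refl, THEN iffD1, rotated])
  next
    case 3
    have "((\<lambda>h. exp_tail P h / h) \<longlongrightarrow> 0) (at_right 0)"
    proof -
      have "((\<lambda>h. poly (pCons 0 P) (inverse h) * exp (- inverse h)) \<longlongrightarrow> 0) (at_right 0)"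
        by (rule filterlim_compose[OF poly_mult_exp_tendsto_0 filterlim_inverse_at_top_right])
      moreover have "eventually (\<lambda>h. poly (pCons 0 P) (inverse h) * exp (- inverse h) = exp_tail P h / h) (at_right 0)"
        using eventually_at_right_less[of "0::real"]
        by (auto elim!: eventually_mono simp: exp_tail_def divide_inverse)
      ultimately show ?thesis by (rule Lim_transform_eventually)
    qed
    moreover have "((\<lambda>h. exp_tail P h / h) \<longlongrightarrow> 0) (at_left 0)"
    proof -
      have "eventually (\<lambda>h. 0 = exp_tail P h / h) (at_left 0)"
        by (auto simp: eventually_at_filter exp_tail_def intro!: always_eventually)
      with tendsto_const[of 0] show ?thesis by (rule Lim_transform_eventually)
    qed
    ultimately have "((\<lambda>h. exp_tail P h / h) \<longlongrightarrow> 0) (at 0)" using filterlim_split_at by blast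
    then show ?thesis using 3 by (simp add: DERIV_def exp_tail_def)
  qed
qed

lemma C_diff_exp_tail: "C_diff n (\<lambda>x. a * exp_tail P (c * x $ i + d))"
proof (induction n arbitrary: a P)
  case 0
  have "continuous_on UNIV (exp_tail P)"
    using exp_tail_derivative by (intro continuous_at_imp_continuous_on ballI DERIV_isCont) auto
  moreover have "continuous_on UNIV (\<lambda>x::real^'a. c * x $ i + d)" by (intro continuous_intros)
  ultimately have "continuous_on UNIV (\<lambda>x. exp_tail P (c * x $ i + d))"
    by (rule continuous_on_compose2) simp
  then show ?case by (simp add: continuous_on_mult_left)
next
  case (Suc n)
  let ?Q = "monom 1 2 * (P - pderiv P)"
  have D: "((\<lambda>x. a * exp_tail P (c * x $ i + d)) has_derivative
      (\<lambda>h. (a * c * exp_tail ?Q (c * x $ i + d)) * h $ i)) (at x)" for x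
  proof -
    have 1: "((\<lambda>x. c * x $ i + d) has_derivative (\<lambda>h. c * h $ i)) (at x)"
      by (auto intro!: derivative_eq_intros bounded_linear.has_derivative[OF bounded_linear_vec_nth])
    have 2: "(exp_tail P has_derivative (*) (exp_tail ?Q (c * x $ i + d))) (at (c * x $ i + d))"
      using exp_tail_derivative[of P "c * x $ i + d"] unfolding has_field_derivative_def .
    show ?thesis
      using has_derivative_mult_right[OF has_derivative_compose[OF 1 2], of a] by (simp add: mult_ac)
  qed
  have "pd j (\<lambda>x. a * exp_tail P (c * x $ i + d)) =
      (\<lambda>x. (a * c * (if i = j then 1 else 0)) * exp_tail ?Q (c * x $ i + d))" for j
    by (intro ext) (simp add: pd_eqI[OF D] axis_def)
  moreover have "(\<lambda>x. a * exp_tail P (c * x $ i + d)) differentiable_on UNIV"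
    using D by (auto simp: differentiable_on_def differentiable_def)
  ultimately show ?case using Suc by simp
qed

text \<open>Smooth functions supported in a box which increase, for growing n, to its indicator function.\<close>

definition box_bump :: "nat \<Rightarrow> real^'d \<Rightarrow> real^'d \<Rightarrow> real^'d::finite \<Rightarrow> real" where
  "box_bump n a b x =
     (\<Prod>i\<in>UNIV. exp_tail 1 (real n * (x $ i - a $ i)) * exp_tail 1 (real n * (b $ i - x $ i)))"

lemma exp_tail_1: "0 \<le> exp_tail 1 t" "exp_tail 1 t \<le> 1" "t \<le> 0 \<Longrightarrow> exp_tail 1 t = 0"
  by (auto simp: exp_tail_def)

lemma smooth_box_bump: "smooth (box_bump n a b)"
proof -
  have 1: "smooth (\<lambda>x. exp_tail 1 (real n * (x $ i - a $ i)))" for i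
    using C_diff_exp_tail[of _ 1 1 "real n" i "- real n * a $ i"] by (simp add: smooth_def algebra_simps)
  have 2: "smooth (\<lambda>x. exp_tail 1 (real n * (b $ i - x $ i)))" for i
    using C_diff_exp_tail[of _ 1 1 "- real n" i "real n * b $ i"] by (simp add: smooth_def algebra_simps)
  show ?thesis unfolding box_bump_def[abs_def]
    by (intro smooth_prod) (use 1 2 in \<open>auto simp: smooth_def intro!: C_diff_mult\<close>)
qed

lemma box_bump_bounds: "0 \<le> box_bump n a b x" "box_bump n a b x \<le> 1"
  unfolding box_bump_def
  by (auto intro!: prod_nonneg prod_le_1 mult_le_one exp_tail_1 mult_nonneg_nonneg)

lemma box_bump_outside: "x \<notin> box a b \<Longrightarrow> box_bump n a b x = 0"
proof -
  assume "x \<notin> box a b"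
  then obtain i where "x $ i \<le> a $ i \<or> b $ i \<le> x $ i" by (auto simp: mem_box_cart not_less)
  then have "exp_tail 1 (real n * (x $ i - a $ i)) * exp_tail 1 (real n * (b $ i - x $ i)) = 0"
    by (auto simp: exp_tail_1 mult_nonneg_nonpos)
  then show ?thesis unfolding box_bump_def by (auto intro!: prod_zero)
qed

lemma test_function_box_bump:
  assumes "cbox a b \<subseteq> \<Omega>" shows "test_function \<Omega> (box_bump n a b)"
proof -
  have "{x. box_bump n a b x \<noteq> 0} \<subseteq> cbox a b" using box_bump_outside box_subset_cbox by blast
  then have sub: "closure {x. box_bump n a b x \<noteq> 0} \<subseteq> cbox a b"
    by (rule closure_minimal) (rule closed_cbox)
  then have "bounded {x. box_bump n a b x \<noteq> 0}"
    using bounded_subset[OF bounded_cbox] closure_subset by (metis order_trans)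
  then show ?thesis using assms smooth_box_bump sub by (auto simp: test_function_def)
qed

lemma exp_tail_tendsto_1: "t > 0 \<Longrightarrow> (\<lambda>n. exp_tail 1 (real n * t)) \<longlonglongrightarrow> 1"
proof -
  assume t: "t > 0"
  have "(\<lambda>n. exp (- ((1 / real n) * (1 / t)))) \<longlonglongrightarrow> exp (- (0 * (1 / t)))"
    by (intro tendsto_intros lim_1_over_n)
  moreover have "eventually (\<lambda>n. exp (- ((1 / real n) * (1 / t))) = exp_tail 1 (real n * t)) sequentially"
    using eventually_gt_at_top[of "0::nat"] by eventually_elim (use t in \<open>simp add: exp_tail_def\<close>)
  ultimately have "(\<lambda>n. exp_tail 1 (real n * t)) \<longlonglongrightarrow> exp (- (0 * (1 / t)))"
    by (rule Lim_transform_eventually)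
  then show ?thesis by simp
qed

lemma box_bump_tendsto: "(\<lambda>n. box_bump n a b x) \<longlonglongrightarrow> indicator (box a b) x"
proof (cases "x \<in> box a b")
  case True
  then have "a $ i < x $ i \<and> x $ i < b $ i" for i by (simp add: mem_box_cart)
  then have "(\<lambda>n. exp_tail 1 (real n * (x $ i - a $ i)) * exp_tail 1 (real n * (b $ i - x $ i))) \<longlonglongrightarrow> 1 * 1" for i
    by (intro tendsto_mult exp_tail_tendsto_1) auto
  then have "(\<lambda>n. \<Prod>i\<in>UNIV. exp_tail 1 (real n * (x $ i - a $ i)) * exp_tail 1 (real n * (b $ i - x $ i))) \<longlonglongrightarrow> (\<Prod>i\<in>(UNIV :: 'a set). 1 * 1)"
    by (intro tendsto_prod)
  then show ?thesis unfolding box_bump_def using True by simp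
qed (simp add: box_bump_outside)

section \<open>Uniqueness of the weak divergence\<close>

text \<open>The positive and the negative part are densities of measures that agree on boxes, which generate
  the Borel sets.\<close>

lemma AE_lborel_0_if_box_integrals_0:
  fixes f :: "'a::euclidean_space \<Rightarrow> real"
  assumes f: "integrable lborel f" and 0: "\<And>a b. (\<integral>x. f x * indicator (box a b) x \<partial>lborel) = 0"
  shows "AE x in lborel. f x = 0"
proof -
  have [measurable]: "f \<in> borel_measurable borel" using borel_measurable_integrable[OF f] by simp
  let ?M = "\<lambda>f. density lborel (\<lambda>x. ennreal (f x))"
  have ind: "integrable lborel (\<lambda>x. g x * indicator (box a b) x)" if "integrable lborel g" for g :: "'a \<Rightarrow> real" and a b
    using integrable_mult_indicator[of "box a b" lborel g] that by (simp add: mult.commute)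
  have em: "emeasure (?M (\<lambda>x. max 0 (g x))) (box a b) = ennreal (\<integral>x. max 0 (g x) * indicator (box a b) x \<partial>lborel)"
    if g: "integrable lborel g" for g :: "'a \<Rightarrow> real" and a b
  proof -
    have [measurable]: "g \<in> borel_measurable borel" using borel_measurable_integrable[OF g] by simp
    have "emeasure (?M (\<lambda>x. max 0 (g x))) (box a b) = (\<integral>\<^sup>+x. ennreal (max 0 (g x)) * indicator (box a b) x \<partial>lborel)"
      by (rule emeasure_density) auto
    also have "\<dots> = (\<integral>\<^sup>+x. ennreal (max 0 (g x) * indicator (box a b) x) \<partial>lborel)"
      by (intro nn_integral_cong) (auto simp: indicator_def)
    also have "\<dots> = ennreal (\<integral>x. max 0 (g x) * indicator (box a b) x \<partial>lborel)"
      by (rule nn_integral_eq_integral[OF ind[OF integrable_max[OF integrable_zero g]]]) simp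
    finally show ?thesis .
  qed
  have "?M (\<lambda>x. max 0 (f x)) = ?M (\<lambda>x. max 0 (- f x))"
  proof (rule measure_eqI_generator_eq)
    let ?E = "range (\<lambda>(a, b). box a b::'a set)"
    show "Int_stable ?E" by (auto simp: Int_stable_def box_Int_box)
    show "?E \<subseteq> Pow UNIV" "sets (?M (\<lambda>x. max 0 (f x))) = sigma_sets UNIV ?E"
      "sets (?M (\<lambda>x. max 0 (- f x))) = sigma_sets UNIV ?E"
      by (simp_all add: borel_eq_box)
    let ?A = "\<lambda>n::nat. box (- (real n *\<^sub>R One)) (real n *\<^sub>R One) :: 'a set"
    show "range ?A \<subseteq> ?E" "(\<Union>i. ?A i) = UNIV" unfolding UN_box_eq_UNIV by auto
    show "emeasure (?M (\<lambda>x. max 0 (f x))) (?A i) \<noteq> \<infinity>" for i unfolding em[OF f] by simp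
    fix X assume "X \<in> ?E"
    then obtain a b where X: "X = box a b" by auto
    have i: "integrable lborel (\<lambda>x. max 0 (g x) * indicator (box a b) x)" if "integrable lborel g" for g :: "'a \<Rightarrow> real"
      by (intro ind integrable_max that) simp
    have "(\<integral>x. max 0 (f x) * indicator (box a b) x \<partial>lborel) - (\<integral>x. max 0 (- f x) * indicator (box a b) x \<partial>lborel)
        = (\<integral>x. max 0 (f x) * indicator (box a b) x - max 0 (- f x) * indicator (box a b) x \<partial>lborel)"
      by (intro Bochner_Integration.integral_diff[symmetric] i f integrable_minus)
    also have "\<dots> = (\<integral>x. f x * indicator (box a b) x \<partial>lborel)"
      by (intro Bochner_Integration.integral_cong) (auto simp: max_def indicator_def)
    finally show "emeasure (?M (\<lambda>x. max 0 (f x))) X = emeasure (?M (\<lambda>x. max 0 (- f x))) X"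
      unfolding X em[OF f] em[OF integrable_minus[OF f]] using 0 by simp
  qed
  then have "AE x in lborel. ennreal (max 0 (f x)) = ennreal (max 0 (- f x))"
    by (intro sigma_finite_measure.density_unique[OF sigma_finite_lborel]) auto
  then show ?thesis by (rule AE_mp) (auto intro!: AE_I2 simp: max_def split: if_splits)
qed

text \<open>The bumps converge to the indicator functions of boxes, so the integrals of \<open>\<psi>\<close> over boxes inside the
  domain vanish. Countably many boxes exhaust the domain.\<close>

lemma fundamental_lemma:
  fixes \<psi> :: "real^'d::finite \<Rightarrow> real"
  assumes \<Omega>: "open \<Omega>" and \<psi>: "integrable (lebesgue_on \<Omega>) \<psi>"
    and 0: "\<And>\<phi>. test_function \<Omega> \<phi> \<Longrightarrow> (\<integral>x. \<psi> x * \<phi> x \<partial>lebesgue_on \<Omega>) = 0"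
  shows "AE x in lebesgue_on \<Omega>. \<psi> x = 0"
proof -
  have \<Omega>m: "\<Omega> \<in> sets lebesgue" using \<Omega> by (simp add: borel_open)
  define f where "f = (\<lambda>x. indicator \<Omega> x * \<psi> x)"
  have f: "integrable lebesgue f" using \<psi> \<Omega>m by (simp add: integrable_restrict_space f_def)
  \<comment> \<open>The argument with boxes needs a Borel representative.\<close>
  obtain f' where f'm: "f' \<in> borel_measurable lborel" and ff': "AE x in lborel. f x = f' x"
    using completion_ex_borel_measurable_real borel_measurable_integrable[OF f] by blast
  have f'm'[measurable]: "f' \<in> borel_measurable borel" using f'm by simp
  have f'int: "integrable lborel f'"
  proof -
    have "integrable lebesgue f'"
      by (rule integrable_cong_AE_imp[OF f]) (use measurable_completion[OF f'm] AE_completion[OF ff'] in auto)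
    then show ?thesis using integrable_completion[OF f'm] by simp
  qed
  have box_lebesgue: "indicat_real (box a b) \<in> borel_measurable lebesgue" for a b :: "real^'d"
    by (intro measurable_completion) simp
  have box0: "(\<integral>x. f' x * indicator (box a b) x \<partial>lborel) = 0" if ab: "cbox a b \<subseteq> \<Omega>" for a b
  proof -
    have meas: "(\<lambda>x. f x * box_bump n a b x) \<in> borel_measurable lebesgue" for n
      using borel_measurable_integrable[OF f] smooth_continuous[OF smooth_box_bump, of UNIV]
      by (intro borel_measurable_times) (auto intro!: measurable_completion borel_measurable_continuous_onI)
    have "(\<lambda>n. \<integral>x. f x * box_bump n a b x \<partial>lebesgue) \<longlonglongrightarrow> (\<integral>x. f x * indicator (box a b) x \<partial>lebesgue)"
    proof (rule integral_dominated_convergence[where w="\<lambda>x. \<bar>f x\<bar>"])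
      show "(\<lambda>x. f x * indicator (box a b) x) \<in> borel_measurable lebesgue"
        using borel_measurable_integrable[OF f] box_lebesgue by (intro borel_measurable_times) auto
      show "AE x in lebesgue. (\<lambda>n. f x * box_bump n a b x) \<longlonglongrightarrow> f x * indicator (box a b) x"
        by (intro AE_I2 tendsto_mult tendsto_const box_bump_tendsto)
      show "AE x in lebesgue. norm (f x * box_bump n a b x) \<le> \<bar>f x\<bar>" for n
        using box_bump_bounds by (intro AE_I2) (auto simp: abs_mult abs_of_nonneg[OF box_bump_bounds(1)] intro!: mult_left_le)
    qed (use meas f in auto)
    moreover have "(\<integral>x. f x * box_bump n a b x \<partial>lebesgue) = 0" for n
    proof -
      have "(\<integral>x. f x * box_bump n a b x \<partial>lebesgue) = (\<integral>x. \<psi> x * box_bump n a b x \<partial>lebesgue_on \<Omega>)"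
        using \<Omega>m by (simp add: integral_restrict_space f_def mult_ac)
      then show ?thesis using 0[OF test_function_box_bump[OF ab]] by simp
    qed
    ultimately have "(\<lambda>n::nat. 0) \<longlonglongrightarrow> (\<integral>x. f x * indicator (box a b) x \<partial>lebesgue)" by (simp only:)
    then have "(\<integral>x. f x * indicator (box a b) x \<partial>lebesgue) = 0" by (simp add: LIMSEQ_const_iff)
    also have "(\<integral>x. f x * indicator (box a b) x \<partial>lebesgue) = (\<integral>x. f' x * indicator (box a b) x \<partial>lebesgue)"
    proof (rule integral_cong_AE)
      show "(\<lambda>x. f x * indicator (box a b) x) \<in> borel_measurable lebesgue"
        using borel_measurable_integrable[OF f] box_lebesgue by (intro borel_measurable_times) auto
      show "(\<lambda>x. f' x * indicator (box a b) x) \<in> borel_measurable lebesgue"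
        by (intro measurable_completion) simp
      show "AE x in lebesgue. f x * indicator (box a b) x = f' x * indicator (box a b) x"
        using AE_completion[OF ff'] by (rule AE_mp) (auto intro!: AE_I2)
    qed
    also have "\<dots> = (\<integral>x. f' x * indicator (box a b) x \<partial>lborel)"
      by (rule integral_completion) simp
    finally show ?thesis by simp
  qed
  have local: "AE x in lborel. x \<in> box a b \<longrightarrow> f' x = 0" if ab: "cbox a b \<subseteq> \<Omega>" for a b
  proof -
    have "AE x in lborel. f' x * indicator (box a b) x = 0"
    proof (rule AE_lborel_0_if_box_integrals_0)
      show "integrable lborel (\<lambda>x. f' x * indicator (box a b) x)"
        using integrable_mult_indicator[of "box a b" lborel f'] f'int by (simp add: mult.commute)
      fix c d :: "real^'d"
      obtain l u where lu: "box a b \<inter> box c d = box l u" by (auto simp: box_Int_box)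
      have "(\<integral>x. f' x * indicator (box l u) x \<partial>lborel) = 0"
      proof (cases "box l u = {}")
        case False
        then have "closure (box l u) = cbox l u" by (rule closure_box)
        moreover have "closure (box l u) \<subseteq> cbox a b"
          using lu by (intro closure_minimal closed_cbox) (use box_subset_cbox in blast)
        ultimately show ?thesis using box0[of l u] ab by blast
      qed simp
      then show "(\<integral>x. f' x * indicator (box a b) x * indicator (box c d) x \<partial>lborel) = 0"
        by (simp add: mult.assoc indicator_inter_arith[symmetric] lu)
    qed
    then show ?thesis by (rule AE_mp) (auto intro!: AE_I2)
  qed
  obtain \<D> where \<D>: "countable \<D>" "\<D> \<subseteq> Pow \<Omega>" "\<And>X. X \<in> \<D> \<Longrightarrow> \<exists>a b. X = cbox a b" "\<Union>\<D> = \<Omega>"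
    using open_countable_Union_open_cbox[OF \<Omega>] by blast
  have "AE x in lborel. \<forall>X\<in>\<D>. x \<in> X \<longrightarrow> f' x = 0"
  proof (subst AE_ball_countable[OF \<D>(1)], intro ballI)
    fix X assume "X \<in> \<D>"
    then obtain a b where X: "X = cbox a b" "cbox a b \<subseteq> \<Omega>" using \<D>(2,3) by blast
    have "AE x in lborel. x \<notin> cbox a b - box a b"
      using null_sets_cbox_Diff_box[of a b] by (rule AE_not_in)
    then show "AE x in lborel. x \<in> X \<longrightarrow> f' x = 0"
      using local[OF X(2)] by eventually_elim (auto simp: X)
  qed
  then have "AE x in lborel. x \<in> \<Omega> \<longrightarrow> f x = 0"
    using ff' by eventually_elim (use \<D>(4) in auto)
  then have "AE x in lebesgue. x \<in> \<Omega> \<longrightarrow> f x = 0" by (rule AE_completion)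
  then have "AE x in lebesgue_on \<Omega>. f x = 0" using \<Omega>m by (simp add: AE_restrict_space_iff)
  then show ?thesis
    by (rule AE_mp) (auto intro!: AE_I2 simp: f_def)
qed

section \<open>Linearity of the velocity space and of the weak divergence\<close>

lemma L2_add:
  assumes "L2 M f" "L2 M g" shows "L2 M (\<lambda>x. f x + g x)"
  unfolding L2_def
proof
  have [measurable]: "f \<in> borel_measurable M" "g \<in> borel_measurable M" using assms by (auto simp: L2_def)
  show "(\<lambda>x. f x + g x) \<in> borel_measurable M" by measurable
  have "integrable M (\<lambda>x. 2 * (norm (f x))\<^sup>2 + 2 * (norm (g x))\<^sup>2)" using assms by (auto simp: L2_def)
  then show "integrable M (\<lambda>x. (norm (f x + g x))\<^sup>2)"
  proof (rule Bochner_Integration.integrable_bound)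
    have "(norm (f x + g x))\<^sup>2 \<le> 2 * (norm (f x))\<^sup>2 + 2 * (norm (g x))\<^sup>2" for x
    proof -
      have "(norm (f x + g x))\<^sup>2 \<le> (norm (f x) + norm (g x))\<^sup>2" by (intro power_mono norm_triangle_ineq) auto
      also have "\<dots> \<le> 2 * (norm (f x))\<^sup>2 + 2 * (norm (g x))\<^sup>2"
        using sum_squares_bound[of "norm (f x)" "norm (g x)"] by (simp add: power2_sum)
      finally show ?thesis .
    qed
    then show "AE x in M. norm ((norm (f x + g x))\<^sup>2) \<le> norm (2 * (norm (f x))\<^sup>2 + 2 * (norm (g x))\<^sup>2)" by simp
  qed measurable
qed

lemma L2_scaleR: "L2 M f \<Longrightarrow> L2 M (\<lambda>x. c *\<^sub>R f x)"
  by (auto simp: L2_def power_mult_distrib)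

lemma L2_zero: "L2 M (\<lambda>x. 0)" by (simp add: L2_def)

lemma L2_inner_integrable:
  fixes f g :: "'a \<Rightarrow> 'b::euclidean_space"
  assumes "L2 M f" "L2 M g" shows "integrable M (\<lambda>x. f x \<bullet> g x)"
proof (rule Bochner_Integration.integrable_bound)
  show "integrable M (\<lambda>x. (norm (f x))\<^sup>2 + (norm (g x))\<^sup>2)" using assms by (auto simp: L2_def)
  show "(\<lambda>x. f x \<bullet> g x) \<in> borel_measurable M" using assms by (auto simp: L2_def)
  have "\<bar>f x \<bullet> g x\<bar> \<le> (norm (f x))\<^sup>2 + (norm (g x))\<^sup>2" for x
    using Cauchy_Schwarz_ineq2[of "f x" "g x"] sum_squares_bound[of "norm (f x)" "norm (g x)"]
      mult_nonneg_nonneg[of "norm (f x)" "norm (g x)"] by simp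
  then show "AE x in M. norm (f x \<bullet> g x) \<le> norm ((norm (f x))\<^sup>2 + (norm (g x))\<^sup>2)" by simp
qed

lemma L2_mult_integrable: "L2 M f \<Longrightarrow> L2 M g \<Longrightarrow> integrable M (\<lambda>x. f x * g x :: real)"
  using L2_inner_integrable[of M f g] by simp

lemma L2_inner_integrable':
  fixes f g :: "'a \<Rightarrow> real^'d::finite"
  shows "L2 M f \<Longrightarrow> L2 M g \<Longrightarrow> integrable M (\<lambda>x. f x \<bullet> g x)"
  by (rule L2_inner_integrable)

lemma finite_measure_lebesgue_on_bounded:
  "open \<Omega> \<Longrightarrow> bounded \<Omega> \<Longrightarrow> finite_measure (lebesgue_on \<Omega>)"
  by (rule finite_measure_lebesgue_on) (simp add: lmeasurable_open)

lemma L2_bounded: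
  fixes h :: "real^'d::finite \<Rightarrow> 'b::euclidean_space"
  assumes "open \<Omega>" "bounded \<Omega>" "h \<in> borel_measurable (lebesgue_on \<Omega>)" "\<And>x. x \<in> \<Omega> \<Longrightarrow> norm (h x) \<le> B"
  shows "L2 (lebesgue_on \<Omega>) h"
  unfolding L2_def
proof
  interpret finite_measure "lebesgue_on \<Omega>" using assms(1,2) by (rule finite_measure_lebesgue_on_bounded)
  show "integrable (lebesgue_on \<Omega>) (\<lambda>x. (norm (h x))\<^sup>2)"
  proof (rule integrable_const_bound[where B="B\<^sup>2"])
    show "AE x in lebesgue_on \<Omega>. norm ((norm (h x))\<^sup>2) \<le> B\<^sup>2"
      using assms(4) by (intro AE_I2) (auto simp: power_mono)
    show "(\<lambda>x. (norm (h x))\<^sup>2) \<in> borel_measurable (lebesgue_on \<Omega>)" using assms(3) by measurable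
  qed
qed fact

lemma L2_continuous:
  fixes h :: "real^'d::finite \<Rightarrow> 'b::euclidean_space"
  assumes "open \<Omega>" "bounded \<Omega>" "continuous_on UNIV h"
  shows "L2 (lebesgue_on \<Omega>) h"
proof -
  have "compact (h ` closure \<Omega>)"
    using assms by (intro compact_continuous_image) (auto intro: continuous_on_subset simp: compact_closure)
  then obtain B where "\<forall>y\<in>h ` closure \<Omega>. norm y \<le> B" using compact_imp_bounded bounded_iff by metis
  then have "norm (h x) \<le> B" if "x \<in> \<Omega>" for x using that closure_subset by blast
  moreover have "h \<in> borel_measurable (lebesgue_on \<Omega>)"
    using assms(3) by (intro measurable_restrict_space1 measurable_completion) (simp add: borel_measurable_continuous_onI)
  ultimately show ?thesis using L2_bounded assms by blast
qed

lemma L2_integrable: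
  fixes f :: "real^'d::finite \<Rightarrow> real"
  assumes "open \<Omega>" "bounded \<Omega>" "L2 (lebesgue_on \<Omega>) f" shows "integrable (lebesgue_on \<Omega>) f"
  using L2_mult_integrable[OF assms(3) L2_continuous[OF assms(1,2), of "\<lambda>x. 1"]] by simp

lemma L2_inner_cong_AE:
  assumes "AE x in M. f x = f' x" "f \<in> borel_measurable M" "f' \<in> borel_measurable M" "g \<in> borel_measurable M"
  shows "L2_inner M f g = L2_inner M f' g"
  unfolding L2_inner_def using assms by (intro integral_cong_AE) auto

lemma L2_inner_add_left:
  "L2 M f \<Longrightarrow> L2 M f' \<Longrightarrow> L2 M g \<Longrightarrow> L2_inner M (\<lambda>x. f x + f' x) g = L2_inner M f g + L2_inner M f' g"
  unfolding L2_inner_def by (simp add: distrib_right L2_mult_integrable)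

lemma L2_inner_scale_left: "L2_inner M (\<lambda>x. c * f x) g = c * L2_inner M f g"
  unfolding L2_inner_def by (simp add: mult.assoc)

lemma L2_inner_commute: "L2_inner M f g = L2_inner M g f"
  unfolding L2_inner_def by (simp add: mult.commute)

lemma L2_measurable: "L2 M f \<Longrightarrow> f \<in> borel_measurable M" by (simp add: L2_def)

lemma test_function_smooth: "test_function \<Omega> \<phi> \<Longrightarrow> smooth \<phi>"
  by (simp add: test_function_def)

context
  fixes \<Omega> :: "(real^'d::finite) set"
  assumes \<Omega>: "open \<Omega>" "bounded \<Omega>"
begin

lemma L2_smooth: "smooth \<phi> \<Longrightarrow> L2 (lebesgue_on \<Omega>) \<phi>"
  using L2_continuous[OF \<Omega>] smooth_continuous by blast

lemma L2_grad: "smooth \<phi> \<Longrightarrow> L2 (lebesgue_on \<Omega>) (grad \<phi>)"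
  using L2_continuous[OF \<Omega>] smooth_grad_continuous by blast

lemma has_weak_div_unique:
  assumes "has_weak_div \<Omega> v \<psi>" "has_weak_div \<Omega> v \<psi>'"
  shows "AE x in lebesgue_on \<Omega>. \<psi> x = \<psi>' x"
proof -
  have L: "L2 (lebesgue_on \<Omega>) \<psi>" "L2 (lebesgue_on \<Omega>) \<psi>'" using assms by (auto simp: has_weak_div_def)
  have "AE x in lebesgue_on \<Omega>. \<psi> x - \<psi>' x = 0"
  proof (rule fundamental_lemma[OF \<Omega>(1)])
    show "integrable (lebesgue_on \<Omega>) (\<lambda>x. \<psi> x - \<psi>' x)"
      using L2_integrable[OF \<Omega>] L by simp
    fix \<phi> assume \<phi>: "test_function \<Omega> \<phi>"
    have "(\<integral>x. (\<psi> x - \<psi>' x) * \<phi> x \<partial>lebesgue_on \<Omega>) = (\<integral>x. \<psi> x * \<phi> x \<partial>lebesgue_on \<Omega>) - (\<integral>x. \<psi>' x * \<phi> x \<partial>lebesgue_on \<Omega>)"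
      using L2_mult_integrable[OF _ L2_smooth[OF test_function_smooth[OF \<phi>]]] L
      by (simp add: left_diff_distrib)
    then show "(\<integral>x. (\<psi> x - \<psi>' x) * \<phi> x \<partial>lebesgue_on \<Omega>) = 0"
      using assms \<phi> by (auto simp: has_weak_div_def)
  qed
  then show ?thesis by simp
qed

lemma has_weak_div_add:
  assumes "L2 (lebesgue_on \<Omega>) u" "L2 (lebesgue_on \<Omega>) v" "has_weak_div \<Omega> u \<psi>" "has_weak_div \<Omega> v \<theta>"
  shows "has_weak_div \<Omega> (\<lambda>x. u x + v x) (\<lambda>x. \<psi> x + \<theta> x)"
  unfolding has_weak_div_def
proof (intro conjI allI impI)
  have L: "L2 (lebesgue_on \<Omega>) \<psi>" "L2 (lebesgue_on \<Omega>) \<theta>" using assms by (auto simp: has_weak_div_def)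
  then show "L2 (lebesgue_on \<Omega>) (\<lambda>x. \<psi> x + \<theta> x)" by (rule L2_add)
  fix \<phi> assume \<phi>: "test_function \<Omega> \<phi>"
  note s = test_function_smooth[OF \<phi>]
  have "(\<integral>x. (u x + v x) \<bullet> grad \<phi> x \<partial>lebesgue_on \<Omega>)
      = (\<integral>x. u x \<bullet> grad \<phi> x \<partial>lebesgue_on \<Omega>) + (\<integral>x. v x \<bullet> grad \<phi> x \<partial>lebesgue_on \<Omega>)"
    using L2_inner_integrable'[OF _ L2_grad[OF s]] assms by (simp add: inner_add_left)
  moreover have "(\<integral>x. (\<psi> x + \<theta> x) * \<phi> x \<partial>lebesgue_on \<Omega>)
      = (\<integral>x. \<psi> x * \<phi> x \<partial>lebesgue_on \<Omega>) + (\<integral>x. \<theta> x * \<phi> x \<partial>lebesgue_on \<Omega>)"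
    using L2_mult_integrable[OF _ L2_smooth[OF s]] L by (simp add: distrib_right)
  ultimately show "(\<integral>x. (u x + v x) \<bullet> grad \<phi> x \<partial>lebesgue_on \<Omega>) = - (\<integral>x. (\<psi> x + \<theta> x) * \<phi> x \<partial>lebesgue_on \<Omega>)"
    using assms \<phi> by (auto simp: has_weak_div_def)
qed

lemma has_weak_div_scale:
  assumes "has_weak_div \<Omega> u \<psi>"
  shows "has_weak_div \<Omega> (\<lambda>x. c *\<^sub>R u x) (\<lambda>x. c * \<psi> x)"
  using assms L2_scaleR[of "lebesgue_on \<Omega>" \<psi> c] by (simp add: has_weak_div_def mult.assoc)

lemma has_weak_div_zero: "has_weak_div \<Omega> (\<lambda>x. 0) (\<lambda>x. 0)"
  by (simp add: has_weak_div_def L2_zero)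

lemma has_weak_div_cong_AE:
  assumes "has_weak_div \<Omega> v \<psi>" "L2 (lebesgue_on \<Omega>) u" "L2 (lebesgue_on \<Omega>) v"
    "AE x in lebesgue_on \<Omega>. u x = v x"
  shows "has_weak_div \<Omega> u \<psi>"
proof -
  have "(\<integral>x. u x \<bullet> grad \<phi> x \<partial>lebesgue_on \<Omega>) = (\<integral>x. v x \<bullet> grad \<phi> x \<partial>lebesgue_on \<Omega>)" if "test_function \<Omega> \<phi>" for \<phi>
  proof (rule integral_cong_AE)
    show "AE x in lebesgue_on \<Omega>. u x \<bullet> grad \<phi> x = v x \<bullet> grad \<phi> x"
      using assms(4) by eventually_elim simp
  qed (use L2_inner_integrable'[OF _ L2_grad[OF test_function_smooth[OF that]]] assms in
      \<open>auto intro: borel_measurable_integrable\<close>)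
  then show ?thesis using assms(1) by (simp add: has_weak_div_def)
qed

lemma Hdiv_weak_div: "v \<in> Hdiv \<Omega> \<Longrightarrow> has_weak_div \<Omega> v (weak_div \<Omega> v)"
  using someI_ex[of "has_weak_div \<Omega> v"] by (simp add: Hdiv_def weak_div_def)

lemma Hdiv_L2: "v \<in> Hdiv \<Omega> \<Longrightarrow> L2 (lebesgue_on \<Omega>) v" by (simp add: Hdiv_def)

lemma weak_div_L2: "v \<in> Hdiv \<Omega> \<Longrightarrow> L2 (lebesgue_on \<Omega>) (weak_div \<Omega> v)"
  using Hdiv_weak_div by (simp add: has_weak_div_def)

lemma weak_div_eq: "has_weak_div \<Omega> v \<psi> \<Longrightarrow> AE x in lebesgue_on \<Omega>. weak_div \<Omega> v x = \<psi> x"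
  using has_weak_div_unique[of v "weak_div \<Omega> v" \<psi>] someI[of "has_weak_div \<Omega> v" \<psi>]
  by (simp add: weak_div_def)

lemma lin_space_Hdiv: "lin_space (Hdiv \<Omega>)"
  unfolding lin_space_def
proof (intro conjI ballI allI)
  show "(\<lambda>x. 0) \<in> Hdiv \<Omega>" using has_weak_div_zero L2_zero by (auto simp: Hdiv_def)
next
  fix u v assume "u \<in> Hdiv \<Omega>" "v \<in> Hdiv \<Omega>"
  then show "(\<lambda>x. u x + v x) \<in> Hdiv \<Omega>"
    using has_weak_div_add[OF Hdiv_L2 Hdiv_L2 Hdiv_weak_div Hdiv_weak_div] L2_add[OF Hdiv_L2 Hdiv_L2]
    by (auto simp: Hdiv_def)
next
  fix u c assume "u \<in> Hdiv \<Omega>"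
  then show "(\<lambda>x. c *\<^sub>R u x) \<in> Hdiv \<Omega>"
    using has_weak_div_scale[OF Hdiv_weak_div] L2_scaleR[OF Hdiv_L2] by (auto simp: Hdiv_def)
qed

lemma weak_div_add:
  "u \<in> Hdiv \<Omega> \<Longrightarrow> v \<in> Hdiv \<Omega> \<Longrightarrow>
    AE x in lebesgue_on \<Omega>. weak_div \<Omega> (\<lambda>x. u x + v x) x = weak_div \<Omega> u x + weak_div \<Omega> v x"
  by (intro weak_div_eq has_weak_div_add Hdiv_L2 Hdiv_weak_div)

lemma weak_div_scale:
  "u \<in> Hdiv \<Omega> \<Longrightarrow> AE x in lebesgue_on \<Omega>. weak_div \<Omega> (\<lambda>x. c *\<^sub>R u x) x = c * weak_div \<Omega> u x"
  by (intro weak_div_eq has_weak_div_scale Hdiv_weak_div)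

lemma weak_div_null:
  assumes "u \<in> Hdiv \<Omega>" "AE x in lebesgue_on \<Omega>. u x = 0"
  shows "AE x in lebesgue_on \<Omega>. weak_div \<Omega> u x = 0"
  by (intro weak_div_eq has_weak_div_cong_AE[OF has_weak_div_zero] Hdiv_L2 assms L2_zero)

lemma lin_functional_div:
  assumes w: "L2 (lebesgue_on \<Omega>) w"
  shows "lin_functional (Hdiv \<Omega>) (\<lambda>v. L2_inner (lebesgue_on \<Omega>) (weak_div \<Omega> v) w)"
  unfolding lin_functional_def
proof (intro conjI ballI allI)
  fix u v assume u: "u \<in> Hdiv \<Omega>" and v: "v \<in> Hdiv \<Omega>"
  have uv: "(\<lambda>x. u x + v x) \<in> Hdiv \<Omega>" by (rule lin_space_add[OF lin_space_Hdiv u v])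
  have "L2_inner (lebesgue_on \<Omega>) (weak_div \<Omega> (\<lambda>x. u x + v x)) w =
      L2_inner (lebesgue_on \<Omega>) (\<lambda>x. weak_div \<Omega> u x + weak_div \<Omega> v x) w"
    by (intro L2_inner_cong_AE weak_div_add u v L2_measurable L2_add weak_div_L2 uv w)
  then show "L2_inner (lebesgue_on \<Omega>) (weak_div \<Omega> (\<lambda>x. u x + v x)) w =
      L2_inner (lebesgue_on \<Omega>) (weak_div \<Omega> u) w + L2_inner (lebesgue_on \<Omega>) (weak_div \<Omega> v) w"
    by (simp add: L2_inner_add_left weak_div_L2 u v w)
next
  fix u c assume u: "u \<in> Hdiv \<Omega>"
  have cu: "(\<lambda>x. c *\<^sub>R u x) \<in> Hdiv \<Omega>" by (rule lin_space_scale[OF lin_space_Hdiv u])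
  have "L2_inner (lebesgue_on \<Omega>) (weak_div \<Omega> (\<lambda>x. c *\<^sub>R u x)) w =
      L2_inner (lebesgue_on \<Omega>) (\<lambda>x. c * weak_div \<Omega> u x) w"
    using L2_scaleR[OF weak_div_L2[OF u], of c]
    by (intro L2_inner_cong_AE weak_div_scale u L2_measurable weak_div_L2 cu w) auto
  then show "L2_inner (lebesgue_on \<Omega>) (weak_div \<Omega> (\<lambda>x. c *\<^sub>R u x)) w =
      c * L2_inner (lebesgue_on \<Omega>) (weak_div \<Omega> u) w"
    by (simp add: L2_inner_scale_left)
qed

text \<open>The functional whose values on suitable test functions decide whether the normal trace vanishes.\<close>

lemma lin_functional_green:
  assumes s: "smooth \<phi>"
  shows "lin_functional (Hdiv \<Omega>) (\<lambda>v. \<integral>x. v x \<bullet> grad \<phi> x + weak_div \<Omega> v x * \<phi> x \<partial>lebesgue_on \<Omega>)"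
proof -
  have split: "(\<integral>x. v x \<bullet> grad \<phi> x + weak_div \<Omega> v x * \<phi> x \<partial>lebesgue_on \<Omega>) =
      (\<integral>x. v x \<bullet> grad \<phi> x \<partial>lebesgue_on \<Omega>) + L2_inner (lebesgue_on \<Omega>) (weak_div \<Omega> v) \<phi>"
    if v: "v \<in> Hdiv \<Omega>" for v
    unfolding L2_inner_def
    by (intro Bochner_Integration.integral_add L2_inner_integrable' L2_mult_integrable L2_grad L2_smooth s
        weak_div_L2 Hdiv_L2 v)
  have "lin_functional (Hdiv \<Omega>) (\<lambda>v. \<integral>x. v x \<bullet> grad \<phi> x \<partial>lebesgue_on \<Omega>)"
    unfolding lin_functional_def
    using L2_inner_integrable'[OF Hdiv_L2 L2_grad[OF s]] by (auto simp: inner_add_left)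
  from lin_functional_plus[OF this lin_functional_div[OF L2_smooth[OF s]]] show ?thesis
    by (rule lin_functional_cong[OF lin_space_Hdiv]) (rule split[symmetric])
qed

lemma lin_space_vel_space: "lin_space (vel_space \<Omega> \<Gamma>)"
  unfolding lin_space_def
proof (intro conjI ballI allI)
  have zero: "L (\<lambda>x. 0) = 0" if "lin_functional (Hdiv \<Omega>) L" for L
    using lin_functional_scale[OF that lin_space_zero[OF lin_space_Hdiv], of 0] by simp
  show "(\<lambda>x. 0) \<in> vel_space \<Omega> \<Gamma>"
    using lin_space_zero[OF lin_space_Hdiv] zero[OF lin_functional_green]
    unfolding vel_space_def normal_trace_zero_on_def by blast
next
  fix u v assume "u \<in> vel_space \<Omega> \<Gamma>" "v \<in> vel_space \<Omega> \<Gamma>"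
  then show "(\<lambda>x. u x + v x) \<in> vel_space \<Omega> \<Gamma>"
    using lin_space_add[OF lin_space_Hdiv] lin_functional_add[OF lin_functional_green]
    by (simp add: vel_space_def normal_trace_zero_on_def)
next
  fix u c assume "u \<in> vel_space \<Omega> \<Gamma>"
  then show "(\<lambda>x. c *\<^sub>R u x) \<in> vel_space \<Omega> \<Gamma>"
    using lin_space_scale[OF lin_space_Hdiv] lin_functional_scale[OF lin_functional_green]
    by (simp add: vel_space_def normal_trace_zero_on_def)
qed

text \<open>A field with an explicit Green's formula belongs to the velocity space as soon as the boundary term R
  of the formula vanishes on the test functions concerned.\<close>

lemma vel_spaceI:
  assumes v: "L2 (lebesgue_on \<Omega>) v" and \<psi>: "L2 (lebesgue_on \<Omega>) \<psi>"
    and green: "\<And>\<phi>. smooth \<phi> \<Longrightarrow>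
        (\<integral>x. v x \<bullet> grad \<phi> x + \<psi> x * \<phi> x \<partial>lebesgue_on \<Omega>) = R \<phi>"
    and test: "\<And>\<phi>. test_function \<Omega> \<phi> \<Longrightarrow> R \<phi> = 0"
    and trace: "\<And>\<phi> U. smooth \<phi> \<Longrightarrow> open U \<Longrightarrow> frontier \<Omega> - \<Gamma> \<subseteq> U \<Longrightarrow> \<forall>x\<in>U. \<phi> x = 0 \<Longrightarrow> R \<phi> = 0"
  shows "v \<in> vel_space \<Omega> \<Gamma>" "AE x in lebesgue_on \<Omega>. weak_div \<Omega> v x = \<psi> x"
proof -
  have split: "(\<integral>x. v x \<bullet> grad \<phi> x + \<psi>' x * \<phi> x \<partial>lebesgue_on \<Omega>) =
      (\<integral>x. v x \<bullet> grad \<phi> x \<partial>lebesgue_on \<Omega>) + L2_inner (lebesgue_on \<Omega>) \<psi>' \<phi>"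
    if "smooth \<phi>" "L2 (lebesgue_on \<Omega>) \<psi>'" for \<phi> \<psi>'
    unfolding L2_inner_def
    by (intro Bochner_Integration.integral_add L2_inner_integrable' L2_mult_integrable L2_grad L2_smooth v that)
  have wd: "has_weak_div \<Omega> v \<psi>"
    unfolding has_weak_div_def
  proof (intro conjI allI impI \<psi>)
    fix \<phi> assume \<phi>: "test_function \<Omega> \<phi>"
    show "(\<integral>x. v x \<bullet> grad \<phi> x \<partial>lebesgue_on \<Omega>) = - (\<integral>x. \<psi> x * \<phi> x \<partial>lebesgue_on \<Omega>)"
      using split[OF test_function_smooth[OF \<phi>] \<psi>] green[OF test_function_smooth[OF \<phi>]] test[OF \<phi>]
      by (simp add: L2_inner_def)
  qed
  then show ae: "AE x in lebesgue_on \<Omega>. weak_div \<Omega> v x = \<psi> x" by (rule weak_div_eq)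
  have H: "v \<in> Hdiv \<Omega>" using v wd by (auto simp: Hdiv_def)
  have "(\<integral>x. v x \<bullet> grad \<phi> x + weak_div \<Omega> v x * \<phi> x \<partial>lebesgue_on \<Omega>) = R \<phi>" if "smooth \<phi>" for \<phi>
    using split[OF that weak_div_L2[OF H]] split[OF that \<psi>] green[OF that]
      L2_inner_cong_AE[OF ae L2_measurable L2_measurable L2_measurable, OF weak_div_L2[OF H] \<psi> L2_smooth[OF that]]
    by simp
  then show "v \<in> vel_space \<Omega> \<Gamma>" using H trace unfolding vel_space_def normal_trace_zero_on_def by auto
qed

end

section \<open>Integration by parts on the reference cube\<close>

definition set_coord :: "'d \<Rightarrow> real \<Rightarrow> real^'d \<Rightarrow> real^'d::finite" where
  "set_coord i t x = (\<chi> j. if j = i then t else x $ j)"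

lemma set_coord_nth [simp]: "set_coord i t x $ j = (if j = i then t else x $ j)"
  by (simp add: set_coord_def)

lemma set_coord_eq: "set_coord i t x = (x - (x $ i) *\<^sub>R axis i 1) + t *\<^sub>R axis i 1"
  by (simp add: vec_eq_iff axis_def)

lemma continuous_on_set_coord [continuous_intros]: "continuous_on S (set_coord i t)"
  unfolding set_coord_eq[abs_def] by (intro continuous_intros)

text \<open>Fubini's theorem for the coordinate i. The remaining coordinates are those of the product measure of
  which \<^const>\<open>lborel\<close> is the image.\<close>

lemma lborel_integral_coord:
  fixes f :: "real^'d::finite \<Rightarrow> real"
  assumes f: "integrable lborel f"
  shows "(\<integral>x. f x \<partial>lborel) =
    (\<integral>x. (\<integral>t. f (set_coord i t (\<Sum>b\<in>Basis. x b *\<^sub>R b)) \<partial>lborel)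
       \<partial>(\<Pi>\<^sub>M b\<in>Basis - {axis i 1}. lborel))"
proof -
  let ?b = "axis i (1::real) :: real^'d"
  let ?V = "\<lambda>x::real^'d \<Rightarrow> real. \<Sum>b\<in>Basis. x b *\<^sub>R b"
  interpret P: product_sigma_finite "\<lambda>_::real^'d. lborel :: real measure" ..
  have B: "insert ?b (Basis - {?b}) = Basis" by (auto simp: axis_in_Basis_iff)
  have V: "?V \<in> (\<Pi>\<^sub>M b\<in>Basis. lborel) \<rightarrow>\<^sub>M borel"
    by (intro borel_measurable_sum borel_measurable_scaleR) auto
  have V_upd: "?V (x(?b := t)) = set_coord i t (?V x)" for x t
  proof -
    have "?V y = (\<Sum>b\<in>Basis - {?b}. y b *\<^sub>R b) + y ?b *\<^sub>R ?b" for y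
      by (subst sum.remove[of _ ?b]) (auto simp: axis_in_Basis_iff)
    moreover have "(\<Sum>b\<in>Basis - {?b}. (x(?b := t)) b *\<^sub>R b) = (\<Sum>b\<in>Basis - {?b}. x b *\<^sub>R b)"
      by (intro sum.cong) auto
    moreover have "?V x $ i = x ?b"
      using inner_sum_left_Basis[of ?b x] by (simp add: axis_in_Basis_iff cart_eq_inner_axis)
    ultimately show ?thesis unfolding set_coord_eq by simp
  qed
  have "(\<integral>x. f x \<partial>lborel) = (\<integral>x. f (?V x) \<partial>(\<Pi>\<^sub>M b\<in>Basis. lborel))"
    using V f by (subst lborel_eq) (rule integral_distr, auto dest: borel_measurable_integrable)
  also have "\<dots> = (\<integral>x. f (?V x) \<partial>(\<Pi>\<^sub>M b\<in>insert ?b (Basis - {?b}). lborel))"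
    by (simp only: B)
  also have "\<dots> = (\<integral>x. (\<integral>t. f (?V (x(?b := t))) \<partial>lborel) \<partial>(\<Pi>\<^sub>M b\<in>Basis - {?b}. lborel))"
  proof (rule P.product_integral_insert)
    have "integrable (distr (\<Pi>\<^sub>M b\<in>Basis. lborel) borel ?V) f" using f by (subst lborel_eq[symmetric])
    then show "integrable (\<Pi>\<^sub>M b\<in>insert ?b (Basis - {?b}). lborel) (\<lambda>x. f (?V x))"
      using V f by (simp only: B) (subst (asm) integrable_distr_eq, auto dest: borel_measurable_integrable)
  qed auto
  finally show ?thesis by (simp only: V_upd)
qed

lemma integral_cbox_eq_lborel:
  fixes f :: "real^'d::finite \<Rightarrow> real"
  assumes "continuous_on (cbox a b) f"
  shows "integrable lborel (\<lambda>x. indicator (cbox a b) x * f x)"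
    "integral (cbox a b) f = (\<integral>x. indicator (cbox a b) x * f x \<partial>lborel)"
proof -
  have "set_integrable lborel (cbox a b) f"
    using borel_integrable_compact[OF compact_cbox assms] by (simp add: set_integrable_def)
  then show "integrable lborel (\<lambda>x. indicator (cbox a b) x * f x)"
    "integral (cbox a b) f = (\<integral>x. indicator (cbox a b) x * f x \<partial>lborel)"
    using set_borel_integral_eq_integral(2)[of "cbox a b" f]
    by (simp_all add: set_integrable_def set_lebesgue_integral_def)
qed

lemma integral_box_eq: "integral (box a b) f = integral (cbox a b) (f :: real^'d::finite \<Rightarrow> real)"
  by (rule integral_open_interval)

lemma mem_ref_cube: "x \<in> ref_cube \<longleftrightarrow> (\<forall>i. \<bar>x $ i\<bar> \<le> 1)"
  by (auto simp: ref_cube_def mem_box_cart abs_le_iff minus_le_iff)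

lemma mem_ref_box: "x \<in> box (-1) (1 :: real^'d::finite) \<longleftrightarrow> (\<forall>i. \<bar>x $ i\<bar> < 1)"
  by (auto simp: mem_box_cart abs_less_iff minus_less_iff)

text \<open>Facet integrals are written as integrals over the whole cube of functions that do not depend
  on the coordinate orthogonal to the facet; this is the origin of the factor 1/2.\<close>

lemma integral_partial_derivative:
  fixes g g' :: "real^'d::finite \<Rightarrow> real"
  assumes g: "continuous_on UNIV g" and g': "continuous_on UNIV g'"
    and D: "\<And>x t. ((\<lambda>t. g (set_coord i t x)) has_real_derivative g' (set_coord i t x)) (at t)"
  shows "integral ref_cube g' = (1/2) * integral ref_cube (\<lambda>x. g (set_coord i 1 x) - g (set_coord i (-1) x))"
proof -
  let ?V = "\<lambda>x::real^'d \<Rightarrow> real. \<Sum>b\<in>Basis. x b *\<^sub>R b"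
  let ?h = "\<lambda>x. g (set_coord i 1 x) - g (set_coord i (-1) x)"
  let ?J = "\<lambda>x::real^'d. (\<forall>j. j \<noteq> i \<longrightarrow> \<bar>x $ j\<bar> \<le> 1)"
  let ?I = "\<lambda>x. if ?J x then 1 else (0::real)"
  have ind: "indicator ref_cube (set_coord i t x) = ?I x * indicator {-1..1} t" for t x
    by (auto simp: indicator_def mem_ref_cube abs_le_iff)
  have h: "continuous_on ref_cube ?h"
    by (intro continuous_intros continuous_on_compose2[OF g]) auto
  have "integral ref_cube ?h = (\<integral>x. indicator ref_cube x * ?h x \<partial>lborel)"
    unfolding ref_cube_def by (rule integral_cbox_eq_lborel) (use h in \<open>simp add: ref_cube_def\<close>)
  also have "\<dots> = (\<integral>x. (\<integral>t. indicator ref_cube (set_coord i t (?V x)) * ?h (set_coord i t (?V x)) \<partial>lborel)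
       \<partial>(\<Pi>\<^sub>M b\<in>Basis - {axis i 1}. lborel))"
    using integral_cbox_eq_lborel(1)[of "-1" 1 ?h] h
    by (intro lborel_integral_coord) (simp add: ref_cube_def)
  also have "\<dots> = (\<integral>x. 2 * (?I (?V x) * ?h (?V x)) \<partial>(\<Pi>\<^sub>M b\<in>Basis - {axis i 1}. lborel))"
  proof (intro Bochner_Integration.integral_cong refl)
    fix x
    have sc: "set_coord i s (set_coord i t y) = set_coord i s y" for s t and y :: "real^'d"
      by (simp add: vec_eq_iff)
    have "(\<integral>t. indicator ref_cube (set_coord i t (?V x)) * ?h (set_coord i t (?V x)) \<partial>lborel)
        = (\<integral>t. (?I (?V x) * ?h (?V x)) * indicator {-1..1::real} t \<partial>lborel)"
      by (intro Bochner_Integration.integral_cong refl) (simp add: ind sc mult_ac)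
    also have "\<dots> = (?I (?V x) * ?h (?V x)) * 2" by simp
    finally show "(\<integral>t. indicator ref_cube (set_coord i t (?V x)) * ?h (set_coord i t (?V x)) \<partial>lborel)
        = 2 * (?I (?V x) * ?h (?V x))" by (simp only: mult.commute)
  qed
  also have "\<dots> = 2 * (\<integral>x. ?I (?V x) * ?h (?V x) \<partial>(\<Pi>\<^sub>M b\<in>Basis - {axis i 1}. lborel))" by (rule integral_mult_right_zero)
  finally have 1: "integral ref_cube ?h = \<dots>" .
  have g'c: "continuous_on ref_cube g'" using g' continuous_on_subset by blast
  have "integral ref_cube g' = (\<integral>x. indicator ref_cube x * g' x \<partial>lborel)"
    unfolding ref_cube_def by (rule integral_cbox_eq_lborel) (use g'c in \<open>simp add: ref_cube_def\<close>)
  also have "\<dots> = (\<integral>x. (\<integral>t. indicator ref_cube (set_coord i t (?V x)) * g' (set_coord i t (?V x)) \<partial>lborel)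
       \<partial>(\<Pi>\<^sub>M b\<in>Basis - {axis i 1}. lborel))"
    using integral_cbox_eq_lborel(1)[of "-1" 1 g'] g'c
    by (intro lborel_integral_coord) (simp add: ref_cube_def)
  also have "\<dots> = (\<integral>x. ?I (?V x) * ?h (?V x) \<partial>(\<Pi>\<^sub>M b\<in>Basis - {axis i 1}. lborel))"
  proof (intro Bochner_Integration.integral_cong refl)
    fix x
    have "(\<integral>t. indicator ref_cube (set_coord i t (?V x)) * g' (set_coord i t (?V x)) \<partial>lborel)
        = (\<integral>t. ?I (?V x) * (indicator {-1..1::real} t *\<^sub>R g' (set_coord i t (?V x))) \<partial>lborel)"
      by (intro Bochner_Integration.integral_cong refl) (simp add: ind mult_ac)
    also have "\<dots> = ?I (?V x) * (\<integral>t. indicator {-1..1::real} t *\<^sub>R g' (set_coord i t (?V x)) \<partial>lborel)"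
      by (rule integral_mult_right_zero)
    also have "(\<integral>t. indicator {-1..1::real} t *\<^sub>R g' (set_coord i t (?V x)) \<partial>lborel) = ?h (?V x)"
    proof (rule integral_FTC_atLeastAtMost)
      show "((\<lambda>t. g (set_coord i t (?V x))) has_vector_derivative g' (set_coord i t (?V x))) (at t within {- 1..1})" for t
        using D[of "?V x" t] by (simp add: has_real_derivative_iff_has_vector_derivative has_vector_derivative_at_within)
      show "continuous_on {-1..1} (\<lambda>t. g' (set_coord i t (?V x)))"
        unfolding set_coord_eq by (intro continuous_on_compose2[OF g'] continuous_intros) auto
    qed simp
    finally show "(\<integral>t. indicator ref_cube (set_coord i t (?V x)) * g' (set_coord i t (?V x)) \<partial>lborel)
        = ?I (?V x) * ?h (?V x)" .
  qed
  finally show ?thesis using 1 by simp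
qed

section \<open>Change of variables\<close>

text \<open>The formula for vector-valued integrands, applied in one dimension.\<close>

lemma change_of_variables_real_valued:
  fixes f :: "real^'d::{finite,wellorder} \<Rightarrow> real" and G :: "real^'d::_ \<Rightarrow> real^'d::_"
  assumes S: "S \<in> sets lebesgue" and G: "\<And>x. x \<in> S \<Longrightarrow> (G has_derivative G' x) (at x within S)" and inj: "inj_on G S"
    and f: "(\<lambda>x. \<bar>det (matrix (G' x))\<bar> * f (G x)) absolutely_integrable_on S"
  shows "f absolutely_integrable_on (G ` S)"
    "integral (G ` S) f = integral S (\<lambda>x. \<bar>det (matrix (G' x))\<bar> * f (G x))"
proof -
  let ?v = "\<lambda>t::real. vec t :: real^1"
  have bl: "bounded_linear ?v"
    by (rule linear_conv_bounded_linear[THEN iffD1]) (auto simp: linear_iff vec_eq_iff)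
  have bl': "bounded_linear (\<lambda>x::real^1. x $ 1)" by (rule bounded_linear_vec_nth)
  let ?h = "\<lambda>x. \<bar>det (matrix (G' x))\<bar> * f (G x)"
  have vs: "\<bar>det (matrix (G' x))\<bar> *\<^sub>R ?v (f (G x)) = ?v (?h x)" for x by (simp add: vec_eq_iff)
  have "(\<lambda>x. ?v (?h x)) absolutely_integrable_on S"
    using absolutely_integrable_linear[OF f bl] by (simp add: o_def)
  then have *: "(\<lambda>x. ?v (f x)) absolutely_integrable_on (G ` S)"
    "integral (G ` S) (\<lambda>x. ?v (f x)) = integral S (\<lambda>x. ?v (?h x))"
    using has_absolute_integral_change_of_variables[OF S G inj, where f="\<lambda>x. ?v (f x)" and b="integral S (\<lambda>x. ?v (?h x))"]
    by (simp_all add: vs)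
  show f': "f absolutely_integrable_on (G ` S)"
    using absolutely_integrable_linear[OF *(1) bl'] by (simp add: o_def)
  have "integral T (\<lambda>x. ?v (k x)) = ?v (integral T k)" if "k absolutely_integrable_on T" for T and k :: "real^'d::_ \<Rightarrow> real"
    using integral_linear[OF set_lebesgue_integral_eq_integral(1)[OF that] bl] by (simp add: o_def)
  then have "?v (integral (G ` S) f) = ?v (integral S ?h)" using * f f' by simp
  then show "integral (G ` S) f = integral S ?h" by (simp add: vec_eq_iff)
qed

text \<open>For a bijection \<open>\<pi>\<close> and signs \<open>\<epsilon>\<close> these are the symmetries of the cube.\<close>

definition signed_perm :: "('d \<Rightarrow> 'd) \<Rightarrow> ('d \<Rightarrow> real) \<Rightarrow> real^'d \<Rightarrow> real^'d::finite" where
  "signed_perm \<pi> \<epsilon> x = (\<chi> j. \<epsilon> j * x $ \<pi> j)"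

lemma signed_perm_ref_cube:
  assumes "bij \<pi>" "\<And>j. \<epsilon> j \<in> {-1, 1}"
  shows "signed_perm \<pi> \<epsilon> ` ref_cube = ref_cube"
proof -
  have abs: "\<bar>\<epsilon> j\<bar> = 1" for j using assms(2)[of j] by auto
  have 1: "signed_perm \<pi> \<epsilon> x \<in> ref_cube" if "x \<in> ref_cube" for x
    using that by (simp add: mem_ref_cube signed_perm_def abs_mult abs)
  have sq: "\<epsilon> j * (\<epsilon> j * t) = t" for j t using assms(2)[of j] by auto
  have 2: "x \<in> signed_perm \<pi> \<epsilon> ` ref_cube" if "x \<in> ref_cube" for x
  proof (rule image_eqI)
    show "x = signed_perm \<pi> \<epsilon> (\<chi> j. \<epsilon> (inv \<pi> j) * x $ inv \<pi> j)"
      using assms(1) by (simp add: signed_perm_def vec_eq_iff sq bij_is_inj inv_f_f)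
    show "(\<chi> j. \<epsilon> (inv \<pi> j) * x $ inv \<pi> j) \<in> ref_cube"
      using that by (simp add: mem_ref_cube abs_mult abs)
  qed
  show ?thesis using 1 2 by blast
qed

lemma linear_signed_perm: "linear (signed_perm \<pi> \<epsilon>)"
  by (auto simp: linear_iff signed_perm_def vec_eq_iff algebra_simps)

lemma integral_cube_pos: "integral (ref_cube :: (real^'d::finite) set) (\<lambda>x. 1::real) > 0"
proof -
  have "measure lborel (cbox (-1) (1::real^'d)) > 0"
    by (subst content_pos_lt_eq) (auto simp: Basis_vec_def inner_axis)
  then show ?thesis by (simp add: ref_cube_def)
qed

lemma integral_signed_perm:
  fixes f :: "real^'d::{finite,wellorder} \<Rightarrow> real"
  assumes "bij \<pi>" "\<And>j. \<epsilon> j \<in> {-1, 1}" "continuous_on UNIV f"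
  shows "integral ref_cube (\<lambda>x. f (signed_perm \<pi> \<epsilon> x)) = integral ref_cube f"
proof -
  let ?s = "signed_perm \<pi> \<epsilon> :: real^'d::_ \<Rightarrow> real^'d::_"
  have D: "(?s has_derivative ?s) (at x within ref_cube)" for x
    by (rule linear_imp_has_derivative[OF linear_signed_perm])
  have inj: "inj_on ?s ref_cube"
  proof (rule inj_onI)
    fix x y assume "?s x = ?s y"
    then have "\<epsilon> j * x $ \<pi> j = \<epsilon> j * y $ \<pi> j" for j by (simp add: signed_perm_def vec_eq_iff)
    moreover have "\<epsilon> j \<noteq> 0" for j using assms(2)[of j] by auto
    ultimately have "x $ \<pi> j = y $ \<pi> j" for j by simp
    then have "x $ j = y $ j" for j using assms(1) by (metis bij_pointE)
    then show "x = y" by (simp add: vec_eq_iff)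
  qed
  have c: "continuous_on ref_cube (\<lambda>x. c * k (?s x))" if "continuous_on UNIV k"
    for k :: "real^'d::_ \<Rightarrow> real" and c
    by (intro continuous_on_mult continuous_on_const continuous_on_compose2[OF that]
        linear_continuous_on linear_conv_bounded_linear[THEN iffD1] linear_signed_perm) auto
  have cov: "integral ref_cube k = \<bar>det (matrix ?s)\<bar> * integral ref_cube (\<lambda>x. k (?s x))" if "continuous_on UNIV k"
    for k :: "real^'d::_ \<Rightarrow> real"
  proof -
    have "integral (?s ` ref_cube) k = integral ref_cube (\<lambda>x. \<bar>det (matrix ?s)\<bar> * k (?s x))"
      by (rule change_of_variables_real_valued(2)[OF _ D inj])
        (use absolutely_integrable_continuous[OF c[OF that, unfolded ref_cube_def]] in
          \<open>auto simp: ref_cube_def\<close>)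
    then show ?thesis using signed_perm_ref_cube[OF assms(1,2)] by simp
  qed
  \<comment> \<open>The map preserves the cube, hence its volume.\<close>
  have "integral (ref_cube :: (real^'d::_) set) (\<lambda>x. 1::real) > 0" by (rule integral_cube_pos)
  then have "\<bar>det (matrix ?s)\<bar> = 1" using cov[of "\<lambda>x. 1"] by simp
  then show ?thesis using cov[OF assms(3)] by simp
qed

section \<open>Elements\<close>

lemma has_derivative_grad:
  "f differentiable at x \<Longrightarrow> (f has_derivative (\<lambda>h. h \<bullet> grad f x)) (at x)"
  using frechet_inner_grad[of f x] frechet_derivative_works[of f "at x"] by presburger

lemma Qpoly_differentiable:
  assumes "f \<in> Qpoly m" shows "f differentiable at x"
proof -
  obtain c where "f = (\<lambda>x. \<Sum>\<alpha> | \<forall>i. \<alpha> i \<le> m. c \<alpha> * monom_fun \<alpha> x)" by (rule QpolyE[OF assms])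
  then show ?thesis
    using has_derivative_poly[where A="{\<alpha>. \<forall>i. \<alpha> i \<le> m}" and c=c and g="\<lambda>\<alpha>. \<alpha>" and x=x]
    unfolding differentiable_def by auto
qed

lemma Qpoly_pd:
  assumes "f \<in> Qpoly m" shows "pd j f \<in> Qpoly m"
proof -
  obtain c where "f = (\<lambda>x. \<Sum>\<alpha> | \<forall>i. \<alpha> i \<le> m. c \<alpha> * monom_fun \<alpha> x)" by (rule QpolyE[OF assms])
  then have "pd j f = (\<lambda>x. \<Sum>\<alpha> | \<forall>i. \<alpha> i \<le> m. c \<alpha> * (real (\<alpha> j) * monom_fun (\<alpha>(j := \<alpha> j - 1)) x))"
    using pd_poly[where A="{\<alpha>. \<forall>i. \<alpha> i \<le> m}" and c=c and g="\<lambda>\<alpha>. \<alpha>" and j=j] by (intro ext) auto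
  moreover have "\<forall>i. (\<alpha>(j := \<alpha> j - 1)) i \<le> m" if "\<forall>i. \<alpha> i \<le> m" for \<alpha> :: "'a \<Rightarrow> nat"
    using that le_trans[OF diff_le_self that[rule_format, of j]] by auto
  ultimately show ?thesis by (auto intro!: Qpoly_sum Qpoly_cmult Qpoly_monom simp del: fun_upd_apply)
qed

lemma ref_cube_compact: "compact ref_cube" by (simp add: ref_cube_def)

lemma ref_box_subset: "box (-1) 1 \<subseteq> (ref_cube :: (real^'d::finite) set)"
  unfolding ref_cube_def by (rule box_subset_cbox)

lemma ref_box_nonempty: "box (-1) (1 :: real^'d::finite) \<noteq> {}"
  using mem_ref_box[of "0 :: real^'d"] by auto

lemma closure_ref_box: "closure (box (-1) 1) = (ref_cube :: (real^'d::finite) set)"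
  unfolding ref_cube_def by (rule closure_box[OF ref_box_nonempty])

locale element =
  fixes G :: "real^'d::{finite,wellorder} \<Rightarrow> real^'d::_"
  assumes multilinear: "\<And>i. (\<lambda>x. G x $ i) \<in> Qpoly 1"
    and inj: "inj_on G ref_cube"
    and invertible_jac: "\<And>x. x \<in> ref_cube \<Longrightarrow> invertible (jac G x)"
begin

lemma differentiable: "G differentiable at x"
proof -
  have "\<exists>D. ((\<lambda>x. G x \<bullet> b) has_derivative D) (at x)" if b: "b \<in> Basis" for b
  proof -
    obtain i where "b = axis i 1" using b by (auto simp: Basis_vec_def)
    then show ?thesis
      using Qpoly_differentiable[OF multilinear[of i], of x] by (simp add: differentiable_def inner_axis)
  qed
  then obtain D where D: "\<forall>b\<in>Basis. ((\<lambda>x. G x \<bullet> b) has_derivative D b) (at x)" by metis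
  have "(G has_derivative (\<lambda>h. \<Sum>b\<in>Basis. D b h *\<^sub>R b)) (at x)"
    unfolding has_derivative_componentwise_within[of G]
    using D by simp
  then show ?thesis by (auto simp: differentiable_def)
qed

lemma has_derivative: "(G has_derivative (*v) (jac G x)) (at x)"
proof -
  have "(*v) (jac G x) = frechet_derivative G (at x)"
    unfolding jac_def by (rule matrix_vector_mul(2)[OF linear_frechet_derivative[OF differentiable]])
  then show ?thesis using differentiable frechet_derivative_works by metis
qed

lemma continuous: "continuous_on S G"
  using differentiable by (intro differentiable_imp_continuous_on) (auto simp: differentiable_on_def differentiable_at_withinI)

lemma jac_nth: "jac G x $ i $ j = pd j (\<lambda>x. G x $ i) x"
proof -
  have "((\<lambda>x. G x $ i) has_derivative (\<lambda>h. (jac G x *v h) $ i)) (at x)"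
    using bounded_linear.has_derivative[OF bounded_linear_vec_nth has_derivative] .
  then have "pd j (\<lambda>x. G x $ i) x = (jac G x *v axis j 1) $ i" by (rule pd_eqI)
  then show ?thesis by (simp add: matrix_vector_mult_basis column_def)
qed

lemma continuous_jac: "continuous_on S (jac G)"
proof -
  have "continuous_on S (\<lambda>x. jac G x $ i $ j)" for i j
    unfolding jac_nth by (rule Qpoly_continuous[OF Qpoly_pd[OF multilinear]])
  then have "continuous_on S (\<lambda>x. \<chi> i. \<chi> j. jac G x $ i $ j)" by (intro continuous_on_vec_lambda)
  then show ?thesis by simp
qed

lemma continuous_absdet: "continuous_on S (absdet_jac G)"
proof -
  have "continuous_on S (\<lambda>x. jac G x $ i $ j)" for i j
    unfolding jac_nth by (rule Qpoly_continuous[OF Qpoly_pd[OF multilinear]])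
  then show ?thesis unfolding absdet_jac_def[abs_def] det_def
    by (intro continuous_on_rabs continuous_on_sum continuous_on_mult continuous_on_const continuous_on_prod) auto
qed

lemma absdet_pos: "x \<in> ref_cube \<Longrightarrow> absdet_jac G x > 0"
  using invertible_jac invertible_det_nz by (auto simp: absdet_jac_def)

abbreviation cell where "cell \<equiv> G ` box (-1) 1"
abbreviation pull where "pull \<equiv> inv_into ref_cube G"

lemma pull_G: "y \<in> ref_cube \<Longrightarrow> pull (G y) = y"
  using inj by (rule inv_into_f_f)

lemma inj_box: "inj_on G (box (-1) 1)"
  using inj ref_box_subset inj_on_subset by blast

lemma open_cell: "open cell"
  by (rule invariance_of_domain[OF continuous open_box inj_box])

lemma compact_image: "compact (G ` ref_cube)"
  by (intro compact_continuous_image continuous ref_cube_compact)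

lemma cell_subset: "cell \<subseteq> G ` ref_cube" using ref_box_subset by blast

lemma image_subset_closure_cell: "G ` ref_cube \<subseteq> closure cell"
  unfolding closure_ref_box[symmetric] by (intro image_closure_subset continuous closed_closure closure_subset)

lemma cell_nonempty: "cell \<noteq> {}" using ref_box_nonempty by blast

lemma negligible_image: "negligible S \<Longrightarrow> negligible (G ` S)"
  by (rule negligible_differentiable_image_negligible)
    (auto intro: differentiable_at_withinI differentiable simp: differentiable_on_def)

lemma negligible_boundary: "negligible (G ` ref_cube - cell)"
proof -
  have "negligible (ref_cube - box (-1) 1 :: (real^'d::_) set)"
    using null_sets_cbox_Diff_box[of "-1 :: real^'d::_" 1]
    by (simp add: ref_cube_def negligible_iff_null_sets null_sets_completionI)
  from negligible_image[OF this] show ?thesis by (rule negligible_subset) auto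
qed

lemma continuous_pull: "continuous_on (G ` ref_cube) pull"
  by (rule continuous_on_inv[OF continuous ref_cube_compact]) (use pull_G in blast)

lemma image_lebesgue: "G ` ref_cube \<in> sets lebesgue"
  using compact_image by (simp add: borel_compact lmeasurable_compact fmeasurableD)

text \<open>Functions and fields are transported from the reference cube in the way that preserves integrals
  and fluxes, and extended by zero. They vanish outside the open cell, so that neighbouring elements do
  not interfere.\<close>

definition transport :: "(real^'d::_ \<Rightarrow> real) \<Rightarrow> real^'d::_ \<Rightarrow> real" where
  "transport k x = (if x \<in> cell then k (pull x) / absdet_jac G (pull x) else 0)"

lemma transport_integral:
  assumes k: "continuous_on ref_cube k" and \<Omega>: "open \<Omega>" "cell \<subseteq> \<Omega>"
  shows "integrable (lebesgue_on \<Omega>) (transport k)"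
    "integral\<^sup>L (lebesgue_on \<Omega>) (transport k) = integral ref_cube k"
proof -
  let ?f = "\<lambda>x. k (pull x) / absdet_jac G (pull x)"
  have \<Omega>m: "\<Omega> \<in> sets lebesgue" using \<Omega> by (simp add: borel_open)
  have eq: "\<bar>det (matrix ((*v) (jac G y)))\<bar> * ?f (G y) = k y" if "y \<in> box (-1) 1" for y
    using that absdet_pos[of y] ref_box_subset by (auto simp: pull_G absdet_jac_def subset_iff)
  have "k absolutely_integrable_on cbox (-1) 1"
    using k by (intro absolutely_integrable_continuous) (simp add: ref_cube_def)
  then have "k absolutely_integrable_on box (-1) 1"
    by (rule set_integrable_subset) (auto simp: box_subset_cbox)
  then have ai: "(\<lambda>y. \<bar>det (matrix ((*v) (jac G y)))\<bar> * ?f (G y)) absolutely_integrable_on box (-1) 1"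
    using eq by (simp cong: set_integrable_cong)
  have bm: "box (-1) 1 \<in> sets (lebesgue :: (real^'d::_) measure)" by (simp add: borel_open)
  have f: "?f absolutely_integrable_on cell" "integral cell ?f = integral (box (-1) 1) (\<lambda>y. \<bar>det (matrix ((*v) (jac G y)))\<bar> * ?f (G y))"
    by (rule change_of_variables_real_valued[OF bm has_derivative_at_withinI[OF has_derivative] inj_box ai])+
  have "integral (box (-1) 1) (\<lambda>y. \<bar>det (matrix ((*v) (jac G y)))\<bar> * ?f (G y)) = integral (box (-1) 1) k"
    using eq by (rule Henstock_Kurzweil_Integration.integral_cong)
  also have "\<dots> = integral ref_cube k" unfolding ref_cube_def by (rule integral_box_eq)
  finally have int: "integral cell ?f = integral ref_cube k" using f(2) by simp
  have tr: "(\<lambda>x. indicator \<Omega> x *\<^sub>R transport k x) = (\<lambda>x. indicator cell x *\<^sub>R ?f x)"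
    by (rule ext) (use \<Omega>(2) in \<open>auto simp: transport_def indicator_def\<close>)
  show "integrable (lebesgue_on \<Omega>) (transport k)"
    using f(1) \<Omega>m by (subst integrable_restrict_space) (simp_all only: tr set_integrable_def, simp)
  have "integral\<^sup>L (lebesgue_on \<Omega>) (transport k) = (LINT x : cell | lebesgue. ?f x)"
    using \<Omega>m by (subst integral_restrict_space) (simp_all only: tr set_lebesgue_integral_def, simp)
  also have "\<dots> = integral ref_cube k" using set_lebesgue_integral_eq_integral(2)[OF f(1)] int by simp
  finally show "integral\<^sup>L (lebesgue_on \<Omega>) (transport k) = integral ref_cube k" .
qed

definition cell_field :: "(real^'d::_ \<Rightarrow> real^'d::_) \<Rightarrow> real^'d::_ \<Rightarrow> real^'d::_" where
  "cell_field vh x = (if x \<in> cell then piola G vh x else 0)"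

lemma continuous_piola:
  assumes "continuous_on ref_cube vh" shows "continuous_on (G ` ref_cube) (piola G vh)"
proof -
  have 1: "continuous_on ref_cube (\<lambda>y. (1 / absdet_jac G y) *\<^sub>R (jac G y *v vh y))"
  proof -
    have 2: "continuous_on ref_cube (\<lambda>y. jac G y *v vh y)"
      using continuous_jac assms
      by (auto simp: matrix_vector_mult_def intro!: continuous_intros)
    have 3: "\<forall>y\<in>ref_cube. absdet_jac G y \<noteq> 0" using absdet_pos by (metis less_irrefl)
    show ?thesis
      by (intro continuous_on_scaleR continuous_on_divide continuous_on_const continuous_absdet 2 3)
  qed
  show ?thesis unfolding piola_def[abs_def] Let_def
    by (rule continuous_on_compose2[OF 1 continuous_pull]) (auto simp: pull_G)
qed

lemma bounded_measurable_extension: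
  fixes h :: "real^'d::_ \<Rightarrow> 'b::euclidean_space"
  assumes "continuous_on (G ` ref_cube) h" "open \<Omega>" "bounded \<Omega>"
  shows "L2 (lebesgue_on \<Omega>) (\<lambda>x. if x \<in> cell then h x else 0)"
proof -
  have "compact (h ` G ` ref_cube)" by (rule compact_continuous_image[OF assms(1) compact_image])
  then obtain B where B: "\<forall>y\<in>h ` G ` ref_cube. norm y \<le> B" using compact_imp_bounded bounded_iff by metis
  have "continuous_on cell h" using assms(1) cell_subset continuous_on_subset by blast
  then have "(\<lambda>x. indicator cell x *\<^sub>R h x) \<in> borel_measurable borel"
    by (intro borel_measurable_continuous_on_indicator) (use open_cell in auto)
  moreover have "(\<lambda>x. indicator cell x *\<^sub>R h x) = (\<lambda>x. if x \<in> cell then h x else 0)"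
    by (auto simp: indicator_def)
  ultimately have "(\<lambda>x. if x \<in> cell then h x else 0) \<in> borel_measurable lborel" by simp
  then have "(\<lambda>x. if x \<in> cell then h x else 0) \<in> borel_measurable (lebesgue_on \<Omega>)"
    by (intro measurable_restrict_space1 measurable_completion)
  moreover have "norm (if x \<in> cell then h x else 0) \<le> max B 0" for x
    using B cell_subset by (auto simp: le_max_iff_disj)
  ultimately show ?thesis by (intro L2_bounded assms)
qed

lemma L2_cell_field:
  "continuous_on ref_cube vh \<Longrightarrow> open \<Omega> \<Longrightarrow> bounded \<Omega> \<Longrightarrow> L2 (lebesgue_on \<Omega>) (cell_field vh)"
  unfolding cell_field_def[abs_def] by (intro bounded_measurable_extension continuous_piola)

lemma L2_transport:
  assumes "continuous_on ref_cube k" "open \<Omega>" "bounded \<Omega>" shows "L2 (lebesgue_on \<Omega>) (transport k)"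
proof -
  have 3: "\<forall>y\<in>ref_cube. absdet_jac G y \<noteq> 0" using absdet_pos by (metis less_irrefl)
  have "continuous_on ref_cube (\<lambda>y. k y / absdet_jac G y)"
    by (intro continuous_on_divide assms continuous_absdet 3)
  then have "continuous_on (G ` ref_cube) (\<lambda>x. k (pull x) / absdet_jac G (pull x))"
    by (rule continuous_on_compose2[OF _ continuous_pull]) (auto simp: pull_G)
  then show ?thesis unfolding transport_def[abs_def] by (intro bounded_measurable_extension assms)
qed

text \<open>As in \<open>integral_partial_derivative\<close>, the integral over the facet is spread over the whole cube.\<close>

definition facet_integral :: "'d \<Rightarrow> real \<Rightarrow> (real^'d::_ \<Rightarrow> real) \<Rightarrow> (real^'d::_ \<Rightarrow> real) \<Rightarrow> real" where
  "facet_integral i s b \<phi> = (1/2) * integral ref_cube (\<lambda>y. b (set_coord i s y) * \<phi> (G (set_coord i s y)))"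

text \<open>Green's formula on an element for the Piola transform of \<open>b e\<^sub>i\<close>. The Jacobian factors of the
  Piola transform and of the change of variables cancel, so only the reference cube enters.\<close>

lemma green_cell:
  assumes b: "b \<in> Qpoly n" and \<phi>: "smooth \<phi>" and \<Omega>: "open \<Omega>" "cell \<subseteq> \<Omega>"
  shows "integrable (lebesgue_on \<Omega>)
      (\<lambda>x. cell_field (\<lambda>y. axis i (b y)) x \<bullet> grad \<phi> x + transport (pd i b) x * \<phi> x)"
    "(\<integral>x. cell_field (\<lambda>y. axis i (b y)) x \<bullet> grad \<phi> x + transport (pd i b) x * \<phi> x \<partial>lebesgue_on \<Omega>) =
      facet_integral i 1 b \<phi> - facet_integral i (-1) b \<phi>"
proof -
  let ?g = "\<lambda>y. b y * \<phi> (G y)"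
  let ?g' = "\<lambda>y. b y * ((jac G y *v axis i 1) \<bullet> grad \<phi> (G y)) + pd i b y * \<phi> (G y)"
  have cb: "continuous_on S b" "continuous_on S (pd i b)" for S
    using Qpoly_continuous[OF b] Qpoly_continuous[OF Qpoly_pd[OF b]] by auto
  have c\<phi>: "continuous_on S (\<lambda>y. \<phi> (G y))" for S
    by (rule continuous_on_compose2[OF smooth_continuous[OF \<phi>, of UNIV] continuous]) simp
  have cg\<phi>: "continuous_on S (\<lambda>y. grad \<phi> (G y))" for S
    by (rule continuous_on_compose2[OF smooth_grad_continuous[OF \<phi>, of UNIV] continuous]) simp
  have cj: "continuous_on S (\<lambda>y. jac G y *v axis i 1)" for S
    using continuous_jac by (auto simp: matrix_vector_mult_def intro!: continuous_intros)
  have cg: "continuous_on S ?g" "continuous_on S ?g'" for S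
    by (intro continuous_intros cb c\<phi> cg\<phi> cj)+
  have D: "(?g has_derivative (\<lambda>h. b y * ((jac G y *v h) \<bullet> grad \<phi> (G y)) + (h \<bullet> grad b y) * \<phi> (G y))) (at y)" for y
    by (intro has_derivative_mult has_derivative_grad Qpoly_differentiable[OF b]
        has_derivative_compose[OF has_derivative has_derivative_grad[OF smooth_differentiable[OF \<phi>]]])
  have line: "((\<lambda>t. ?g (set_coord i t x)) has_real_derivative ?g' (set_coord i t x)) (at t)" for x t
  proof -
    have "((\<lambda>t. set_coord i t x) has_derivative (\<lambda>t. t *\<^sub>R axis i 1)) (at t)"
      unfolding set_coord_eq by (auto intro!: derivative_eq_intros)
    from has_derivative_compose[OF this D] show ?thesis
      unfolding has_field_derivative_def
      by (rule has_derivative_eq_rhs)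
        (auto simp: fun_eq_iff matrix_vector_mult_scaleR grad_def inner_axis' algebra_simps)
  qed
  have eq: "cell_field (\<lambda>y. axis i (b y)) x \<bullet> grad \<phi> x + transport (pd i b) x * \<phi> x = transport ?g' x" for x
  proof (cases "x \<in> cell")
    case True
    then obtain y where y: "y \<in> box (-1) 1" "x = G y" by blast
    then have py: "pull x = y" using ref_box_subset pull_G by blast
    have "axis i (b y) = b y *\<^sub>R axis i 1" by (simp add: vec_eq_iff axis_def)
    then have "jac G y *v axis i (b y) = b y *\<^sub>R (jac G y *v axis i 1)" by (simp add: matrix_vector_mult_scaleR)
    then show ?thesis
      using True py y(2) by (simp add: cell_field_def transport_def piola_def Let_def add_divide_distrib)
  qed (simp add: cell_field_def transport_def)
  show "integrable (lebesgue_on \<Omega>)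
      (\<lambda>x. cell_field (\<lambda>y. axis i (b y)) x \<bullet> grad \<phi> x + transport (pd i b) x * \<phi> x)"
    unfolding eq by (rule transport_integral(1)[OF cg(2) \<Omega>])
  have "(\<integral>x. cell_field (\<lambda>y. axis i (b y)) x \<bullet> grad \<phi> x + transport (pd i b) x * \<phi> x \<partial>lebesgue_on \<Omega>)
      = integral ref_cube ?g'"
    unfolding eq by (rule transport_integral(2)[OF cg(2) \<Omega>])
  also have "\<dots> = (1/2) * integral ref_cube (\<lambda>x. ?g (set_coord i 1 x) - ?g (set_coord i (-1) x))"
    by (rule integral_partial_derivative[OF cg(1) cg(2) line])
  also have "\<dots> = facet_integral i 1 b \<phi> - facet_integral i (-1) b \<phi>"
  proof -
    have "(\<lambda>x. ?g (set_coord i s x)) integrable_on ref_cube" for s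
      unfolding ref_cube_def
      by (intro integrable_continuous continuous_on_compose2[OF cg(1) continuous_on_set_coord]) auto
    then show ?thesis
      unfolding facet_integral_def
      by (subst Henstock_Kurzweil_Integration.integral_diff) (auto simp: algebra_simps)
  qed
  finally show "(\<integral>x. cell_field (\<lambda>y. axis i (b y)) x \<bullet> grad \<phi> x + transport (pd i b) x * \<phi> x \<partial>lebesgue_on \<Omega>) =
      facet_integral i 1 b \<phi> - facet_integral i (-1) b \<phi>" .
qed

lemma transport_inner:
  assumes k: "continuous_on ref_cube k" and wh: "continuous_on ref_cube wh"
    and \<Omega>: "open \<Omega>" "bounded \<Omega>" "cell \<subseteq> \<Omega>" and w: "L2 (lebesgue_on \<Omega>) w"
    and eq: "AE x in lebesgue_on (G ` ref_cube). w x = wh (pull x)"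
  shows "L2_inner (lebesgue_on \<Omega>) (transport k) w = integral ref_cube (\<lambda>y. k y * wh y)"
proof -
  have \<Omega>m: "\<Omega> \<in> sets lebesgue" using \<Omega> by (simp add: borel_open)
  have c: "continuous_on ref_cube (\<lambda>y. k y * wh y)" by (intro continuous_on_mult k wh)
  have "AE x in lebesgue. x \<in> G ` ref_cube \<longrightarrow> w x = wh (pull x)"
    using eq image_lebesgue by (simp add: AE_restrict_space_iff)
  then have "AE x in lebesgue_on \<Omega>. transport k x * w x = transport (\<lambda>y. k y * wh y) x"
    unfolding AE_restrict_space_iff[of \<Omega> lebesgue, simplified, OF \<Omega>m]
    by eventually_elim (use cell_subset in \<open>auto simp: transport_def\<close>)
  then have "L2_inner (lebesgue_on \<Omega>) (transport k) w = integral\<^sup>L (lebesgue_on \<Omega>) (transport (\<lambda>y. k y * wh y))"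
    unfolding L2_inner_def
    using w L2_transport[OF k \<Omega>(1,2)] L2_transport[OF c \<Omega>(1,2)]
    by (intro integral_cong_AE) (auto simp: L2_def)
  also have "\<dots> = integral ref_cube (\<lambda>y. k y * wh y)" by (rule transport_integral(2)[OF c \<Omega>(1,3)])
  finally show ?thesis .
qed

text \<open>The open subset of the cube where two continuous functions differ has an open image, and this is a
  null set only if it is empty. So polynomials and fields on the reference cube are determined by
  almost all values of their transforms.\<close>

lemma AE_image_eq_imp_eq:
  fixes u v :: "real^'d::_ \<Rightarrow> 'b::t2_space"
  assumes c: "continuous_on UNIV u" "continuous_on UNIV v"
    and ae: "AE x in lebesgue_on (G ` ref_cube). u (pull x) = v (pull x)"
    and y: "y \<in> ref_cube"
  shows "u y = v y"
proof -
  let ?O = "{y. u y \<noteq> v y} \<inter> box (-1) 1"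
  have "open {y. u y \<noteq> v y}" using open_Collect_neq[OF c] .
  then have O: "open ?O" by auto
  have inj': "inj_on G ?O" using inj_box inj_on_subset by blast
  have "open (G ` ?O)" by (rule invariance_of_domain[OF continuous O inj'])
  have "AE x in lebesgue. x \<in> G ` ref_cube \<longrightarrow> u (pull x) = v (pull x)"
    using ae image_lebesgue by (simp add: AE_restrict_space_iff)
  then have "AE x in lebesgue. x \<notin> G ` ?O"
    by eventually_elim (use ref_box_subset in \<open>auto simp: pull_G subset_iff\<close>)
  then have "negligible (G ` ?O)"
    using AE_iff_null_sets[of "G ` ?O" lebesgue] \<open>open (G ` ?O)\<close>
    by (simp add: negligible_iff_null_sets borel_open)
  then have "?O = {}" using open_not_negligible[OF \<open>open (G ` ?O)\<close>] by blast
  then have "box (-1) 1 \<subseteq> {y. u y = v y}" by blast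
  then have "closure (box (-1) 1) \<subseteq> {y. u y = v y}"
    by (rule closure_minimal) (rule closed_Collect_eq[OF c])
  then show ?thesis using y unfolding closure_ref_box by blast
qed

lemma piola_eq_iff:
  assumes "x \<in> G ` ref_cube" shows "piola G u x = piola G v x \<longleftrightarrow> u (pull x) = v (pull x)"
proof -
  have p: "pull x \<in> ref_cube" using assms by (rule inv_into_into)
  obtain B where B: "B ** jac G (pull x) = mat 1" using invertible_jac[OF p] by (auto simp: invertible_def)
  have "u (pull x) = v (pull x)" if "jac G (pull x) *v u (pull x) = jac G (pull x) *v v (pull x)"
    using arg_cong[OF that, of "(*v) B"] by (simp add: matrix_vector_mul_assoc B)
  then show ?thesis using absdet_pos[OF p] by (auto simp: piola_def Let_def)
qed

lemma AE_piola_eq_imp_eq: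
  assumes "continuous_on UNIV u" "continuous_on UNIV v"
    "AE x in lebesgue_on (G ` ref_cube). piola G u x = piola G v x" "y \<in> ref_cube"
  shows "u y = v y"
proof (rule AE_image_eq_imp_eq[OF assms(1,2) _ assms(4)])
  show "AE x in lebesgue_on (G ` ref_cube). u (pull x) = v (pull x)"
    using assms(3) by (rule AE_mp) (auto intro!: AE_I2 simp: piola_eq_iff)
qed

end

section \<open>Common facets of two elements\<close>

text \<open>Reverse inclusion of faces: the smaller face fixes more coordinates.\<close>

definition face_le :: "real^'d \<Rightarrow> real^'d::finite \<Rightarrow> bool" where
  "face_le s t \<longleftrightarrow> (\<forall>i. s $ i \<noteq> 0 \<longrightarrow> t $ i = s $ i)"

lemma face_index_abs: "s \<in> face_index \<Longrightarrow> \<bar>s $ i\<bar> \<le> 1"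
  unfolding face_index_def by (auto dest!: spec[of _ i])

lemma face_index_cases: "s \<in> face_index \<Longrightarrow> s $ i = -1 \<or> s $ i = 0 \<or> s $ i = 1"
  unfolding face_index_def by (auto dest!: spec[of _ i])

lemma center_in_ref_face: "s \<in> face_index \<Longrightarrow> s \<in> ref_face s"
  by (simp add: ref_face_def mem_ref_cube face_index_abs)

lemma ref_face_subset_iff: "t \<in> face_index \<Longrightarrow> ref_face t \<subseteq> ref_face s \<longleftrightarrow> face_le s t"
  using center_in_ref_face[of t] by (auto simp: ref_face_def face_le_def)

lemma face_le_antisym: "face_le s t \<Longrightarrow> face_le t s \<Longrightarrow> s = t"
  unfolding face_le_def vec_eq_iff by metis

lemma face_le_refl: "face_le s s" by (simp add: face_le_def)

lemma ref_face_inj: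
  assumes "s \<in> face_index" "t \<in> face_index" "ref_face s = ref_face t" shows "s = t"
  using ref_face_subset_iff[OF assms(1), of t] ref_face_subset_iff[OF assms(2), of s] assms(3)
  by (simp add: face_le_antisym)

lemma ref_face_subset_cube: "ref_face s \<subseteq> ref_cube" by (auto simp: ref_face_def)

definition compatible :: "real^'d \<Rightarrow> real^'d::finite \<Rightarrow> bool" where
  "compatible s t \<longleftrightarrow> (\<forall>i. s $ i \<noteq> 0 \<longrightarrow> t $ i \<noteq> 0 \<longrightarrow> s $ i = t $ i)"

lemma ref_faces_meet_iff:
  assumes "s \<in> face_index" "t \<in> face_index"
  shows "ref_face s \<inter> ref_face t \<noteq> {} \<longleftrightarrow> compatible s t"
proof
  assume "compatible s t"
  then have "(\<chi> i. if s $ i \<noteq> 0 then s $ i else t $ i) \<in> ref_face s \<inter> ref_face t"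
    using assms by (auto simp: ref_face_def mem_ref_cube face_index_abs compatible_def)
  then show "ref_face s \<inter> ref_face t \<noteq> {}" by blast
next
  assume "ref_face s \<inter> ref_face t \<noteq> {}"
  then obtain x where "x \<in> ref_face s" "x \<in> ref_face t" by blast
  then have "\<forall>i. s $ i \<noteq> 0 \<longrightarrow> x $ i = s $ i" "\<forall>i. t $ i \<noteq> 0 \<longrightarrow> x $ i = t $ i" by (auto simp: ref_face_def)
  then show "compatible s t" unfolding compatible_def by metis
qed

text \<open>The facet of the face p on the side e in a direction j that p leaves free.\<close>

definition sub_face :: "'d \<Rightarrow> real \<Rightarrow> real^'d \<Rightarrow> real^'d::finite" where
  "sub_face j e p = set_coord j e p"

lemma sub_face_index: "p \<in> face_index \<Longrightarrow> e \<in> {-1, 1} \<Longrightarrow> sub_face j e p \<in> face_index"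
  by (auto simp: sub_face_def face_index_def)

lemma sub_face_le: "p $ j = 0 \<Longrightarrow> face_le p (sub_face j e p)"
  by (auto simp: sub_face_def face_le_def)

lemma sub_face_minimal:
  assumes "p $ j = 0" "face_le p r" "face_le r (sub_face j e p)" shows "r = p \<or> r = sub_face j e p"
proof (cases "r $ j = 0")
  case True
  then have "face_le r p" using assms unfolding face_le_def sub_face_def by (auto split: if_splits)
  then show ?thesis using assms(2) face_le_antisym by blast
next
  case False
  then have "r $ j = e" using assms(3) unfolding face_le_def sub_face_def by auto
  then have "face_le (sub_face j e p) r" using assms(2) unfolding face_le_def sub_face_def by auto
  then show ?thesis using assms(3) face_le_antisym by blast
qed

text \<open>An isomorphism of the face lattices of two faces p and q of the cube respects facets and pairs
  of opposite facets. Hence it comes from a bijection of the free coordinates together with signs.\<close>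

lemma face_lattice_iso:
  fixes p q :: "real^'d::finite"
  assumes p: "p \<in> face_index" and q: "q \<in> face_index"
    and \<tau>: "\<And>t. t \<in> face_index \<Longrightarrow> face_le p t \<Longrightarrow> \<tau> t \<in> face_index \<and> face_le q (\<tau> t)"
    and \<tau>p: "\<tau> p = q"
    and surj: "\<And>u. u \<in> face_index \<Longrightarrow> face_le q u \<Longrightarrow> \<exists>t\<in>face_index. face_le p t \<and> \<tau> t = u"
    and le: "\<And>t u. t \<in> face_index \<Longrightarrow> face_le p t \<Longrightarrow> u \<in> face_index \<Longrightarrow> face_le p u \<Longrightarrow>
        face_le (\<tau> t) (\<tau> u) \<longleftrightarrow> face_le t u"
    and meet: "\<And>t u. t \<in> face_index \<Longrightarrow> face_le p t \<Longrightarrow> u \<in> face_index \<Longrightarrow> face_le p u \<Longrightarrow>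
        compatible (\<tau> t) (\<tau> u) \<longleftrightarrow> compatible t u"
  shows "\<exists>\<pi> \<delta>. inj_on \<pi> {j. p $ j = 0} \<and> \<pi> ` {j. p $ j = 0} \<subseteq> {j. q $ j = 0} \<and>
     (\<forall>j. p $ j = 0 \<longrightarrow> \<delta> j \<in> {-1, 1} \<and> (\<forall>e\<in>{-1, 1}. \<tau> (sub_face j e p) = sub_face (\<pi> j) (e * \<delta> j) q))"
proof -
  have inj: "t = u" if "t \<in> face_index" "face_le p t" "u \<in> face_index" "face_le p u" "\<tau> t = \<tau> u" for t u
    using le[OF that(1-4)] le[OF that(3,4,1,2)] that(5) face_le_refl face_le_antisym by metis
  have facet: "\<exists>a d. q $ a = 0 \<and> d \<in> {-1, 1} \<and> \<tau> (sub_face j e p) = sub_face a d q"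
    if j: "p $ j = 0" and e: "e \<in> {-1, 1}" for j e
  proof -
    let ?t = "sub_face j e p"
    have t: "?t \<in> face_index" "face_le p ?t" using sub_face_index[OF p e] sub_face_le[OF j] by auto
    have qt: "\<tau> ?t \<in> face_index" "face_le q (\<tau> ?t)" using \<tau>[OF t] by auto
    have "?t \<noteq> p" using j e by (auto simp: sub_face_def vec_eq_iff)
    then have "\<tau> ?t \<noteq> q" using inj[OF t p face_le_refl] \<tau>p by metis
    then have "\<not> face_le (\<tau> ?t) q" using qt face_le_antisym by blast
    then obtain a where a: "\<tau> ?t $ a \<noteq> 0" "q $ a \<noteq> \<tau> ?t $ a" unfolding face_le_def by blast
    then have qa: "q $ a = 0" using qt(2) unfolding face_le_def by metis
    have d: "\<tau> ?t $ a \<in> {-1, 1}" using face_index_cases[OF qt(1), of a] a by auto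
    let ?r = "sub_face a (\<tau> ?t $ a) q"
    have r: "?r \<in> face_index" "face_le q ?r" using sub_face_index[OF q d] sub_face_le[OF qa] by auto
    have rt: "face_le ?r (\<tau> ?t)" using qt(2) by (auto simp: face_le_def sub_face_def)
    obtain u where u: "u \<in> face_index" "face_le p u" "\<tau> u = ?r" using surj[OF r] by blast
    have "face_le u ?t" using le[OF u(1,2) t] u(3) rt by simp
    then have "u = p \<or> u = ?t" using sub_face_minimal[OF j u(2)] by blast
    moreover have "u \<noteq> p"
    proof
      assume "u = p"
      then have "?r $ a = q $ a" using u(3) \<tau>p by simp
      then show False using a by (simp add: sub_face_def)
    qed
    ultimately have "u = ?t" by blast
    then have "\<tau> ?t = ?r" using u(3) by (simp only:)
    then show ?thesis using qa d by blast
  qed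
  then have "\<forall>j. \<exists>a d. p $ j = 0 \<longrightarrow> q $ a = 0 \<and> d \<in> {-1, 1} \<and> \<tau> (sub_face j 1 p) = sub_face a d q" by blast
  then obtain \<pi> \<delta> where pos: "\<And>j. p $ j = 0 \<Longrightarrow> q $ \<pi> j = 0 \<and> \<delta> j \<in> {-1, 1} \<and> \<tau> (sub_face j 1 p) = sub_face (\<pi> j) (\<delta> j) q"
    by metis
  have comp: "compatible (\<tau> (sub_face j e p)) (\<tau> (sub_face j' e' p)) \<longleftrightarrow> compatible (sub_face j e p) (sub_face j' e' p)"
    if "p $ j = 0" "e \<in> {-1, 1}" "p $ j' = 0" "e' \<in> {-1, 1}" for j e j' e'
    using that by (intro meet sub_face_index sub_face_le p)
  have neg: "\<tau> (sub_face j (-1) p) = sub_face (\<pi> j) (- \<delta> j) q" if j: "p $ j = 0" for j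
  proof -
    obtain a d where a: "q $ a = 0" "d \<in> {-1, 1}" "\<tau> (sub_face j (-1) p) = sub_face a d q"
      using facet[OF j, of "-1"] by auto
    have "\<not> compatible (sub_face j 1 p) (sub_face j (-1) p)"
      unfolding compatible_def sub_face_def by (auto intro!: exI[of _ j])
    then have "\<not> compatible (sub_face (\<pi> j) (\<delta> j) q) (sub_face a d q)"
      using comp[OF j _ j, of 1 "-1"] pos[OF j] a(3) by auto
    then have "a = \<pi> j \<and> d \<noteq> \<delta> j"
      using a(1) pos[OF j] unfolding compatible_def sub_face_def by (auto split: if_splits)
    then show ?thesis using a pos[OF j] by auto
  qed
  have "inj_on \<pi> {j. p $ j = 0}"
  proof (rule inj_onI, clarsimp)
    fix j j' assume j: "p $ j = 0" "p $ j' = 0" "\<pi> j = \<pi> j'"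
    show "j = j'"
    proof (rule ccontr)
      assume ne: "j \<noteq> j'"
      have "compatible (sub_face j 1 p) (sub_face j' 1 p)"
        using j ne unfolding compatible_def sub_face_def by auto
      then have "compatible (sub_face (\<pi> j) (\<delta> j) q) (sub_face (\<pi> j') (\<delta> j') q)"
        using comp[OF j(1) _ j(2), of 1 1] pos[OF j(1)] pos[OF j(2)] by auto
      then have "\<delta> j = \<delta> j'"
        using pos[OF j(1)] pos[OF j(2)] j(3) unfolding compatible_def sub_face_def
        by (auto dest!: spec[of _ "\<pi> j'"])
      then have "\<tau> (sub_face j 1 p) = \<tau> (sub_face j' 1 p)" using pos[OF j(1)] pos[OF j(2)] j(3) by simp
      then have "sub_face j 1 p = sub_face j' 1 p"
        using inj[OF sub_face_index[OF p, of 1 j] sub_face_le[OF j(1)]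
            sub_face_index[OF p, of 1 j'] sub_face_le[OF j(2)]] by simp
      then have "sub_face j 1 p $ j = sub_face j' 1 p $ j" by simp
      then show False using ne j by (simp add: sub_face_def)
    qed
  qed
  moreover have "\<pi> ` {j. p $ j = 0} \<subseteq> {j. q $ j = 0}" using pos by blast
  moreover have "\<forall>j. p $ j = 0 \<longrightarrow> \<delta> j \<in> {-1, 1} \<and> (\<forall>e\<in>{-1, 1}. \<tau> (sub_face j e p) = sub_face (\<pi> j) (e * \<delta> j) q)"
    using pos neg by auto
  ultimately show ?thesis by blast
qed

lemma monom_fun_signed_perm:
  assumes "bij \<pi>"
  shows "monom_fun \<alpha> (signed_perm \<pi> \<epsilon> x) = (\<Prod>i\<in>UNIV. \<epsilon> i ^ \<alpha> i) * monom_fun (\<alpha> \<circ> inv \<pi>) x"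
proof -
  have "(\<Prod>i\<in>UNIV. x $ \<pi> i ^ \<alpha> i) = (\<Prod>i\<in>UNIV. x $ i ^ \<alpha> (inv \<pi> i))"
    using prod.reindex_bij_betw[OF assms, of "\<lambda>i. x $ i ^ \<alpha> (inv \<pi> i)"] assms
    by (simp add: bij_is_inj inv_f_f)
  then show ?thesis by (simp add: monom_fun_def signed_perm_def power_mult_distrib prod.distrib)
qed

lemma Qpoly_signed_perm:
  assumes "f \<in> Qpoly m" "bij \<pi>" shows "(\<lambda>x. f (signed_perm \<pi> \<epsilon> x)) \<in> Qpoly m"
proof -
  obtain c where "f = (\<lambda>x. \<Sum>\<alpha> | \<forall>i. \<alpha> i \<le> m. c \<alpha> * monom_fun \<alpha> x)" by (rule QpolyE[OF assms(1)])
  then show ?thesis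
    by (auto simp: monom_fun_signed_perm[OF assms(2)] intro!: Qpoly_sum Qpoly_cmult Qpoly_monom)
qed

lemma monom_fun_set_coord: "monom_fun \<alpha> (set_coord i s x) = s ^ \<alpha> i * monom_fun (\<alpha>(i := 0)) x"
proof -
  have "(\<Prod>j\<in>UNIV - {i}. set_coord i s x $ j ^ \<alpha> j) = (\<Prod>j\<in>UNIV - {i}. x $ j ^ (\<alpha>(i := 0)) j)"
    by (intro prod.cong) auto
  then show ?thesis unfolding monom_fun_def by (simp add: prod.remove[of UNIV i])
qed

lemma Qpoly_set_coord:
  assumes "f \<in> Qpoly m" shows "(\<lambda>x. f (set_coord i s x)) \<in> Qpoly m"
proof -
  obtain c where "f = (\<lambda>x. \<Sum>\<alpha> | \<forall>i. \<alpha> i \<le> m. c \<alpha> * monom_fun \<alpha> x)" by (rule QpolyE[OF assms(1)])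
  then show ?thesis
    by (auto simp: monom_fun_set_coord intro!: Qpoly_sum Qpoly_cmult Qpoly_monom)
qed

lemma Qpoly_diff: "f \<in> Qpoly m \<Longrightarrow> g \<in> Qpoly m \<Longrightarrow> (\<lambda>x. f x - g x) \<in> Qpoly m"
  using Qpoly_add[OF _ Qpoly_cmult[of g m "-1"], of f] by simp

lemma multilinear_eq_if_vertices:
  assumes "f \<in> Qpoly 1" "g \<in> Qpoly 1" "\<And>v. (\<forall>j. v $ j \<in> {-1, 1}) \<Longrightarrow> f v = g v"
  shows "f x = g (x :: real^'d::finite)"
proof -
  let ?\<xi> = "\<lambda>n::nat. if n = 0 then -1 else (1::real)"
  have "inj_on ?\<xi> {..1}" by (auto simp: inj_on_def le_Suc_eq)
  then have "f x - g x = 0"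
    by (rule Qpoly_eq_0_if_grid[where f="\<lambda>x. f x - g x"]) (use assms in \<open>auto intro!: Qpoly_diff\<close>)
  then show ?thesis by simp
qed

text \<open>By conformity the elements meet in a common face, which is the given facet because it is proper and
  contains a relatively interior point of this facet. The two parametrisations have the same subfaces,
  so the correspondence of subfaces is an isomorphism of face lattices, which comes from a signed
  permutation of the coordinates. It matches the vertices, since a vertex is the intersection of the
  facets that contain it, and multilinear maps that agree at the vertices are equal.\<close>

lemma common_facet:
  fixes G G' :: "real^'d::{finite,wellorder} \<Rightarrow> real^'d::_"
  assumes G: "element G" and G': "element G'" and conf: "conforming G G'"
    and disj: "G ` box (-1) 1 \<inter> G' ` box (-1) 1 = {}"
    and s: "s \<in> {-1, 1}" and y: "y \<in> ref_facet_int i s" and Gy: "G y \<in> G' ` ref_cube"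
  shows "\<exists>i' s' \<rho> \<epsilon>. s' \<in> {-1, 1} \<and> bij \<rho> \<and> (\<forall>a. \<epsilon> a \<in> {-1, 1}) \<and>
     (\<forall>x. G' (set_coord i' s' x) = G (set_coord i s (signed_perm \<rho> \<epsilon> x)))"
proof -
  interpret G: element G by (rule G)
  interpret G': element G' by (rule G')
  have yc: "y \<in> ref_cube" "y $ i = s" "\<And>j. j \<noteq> i \<Longrightarrow> \<bar>y $ j\<bar> < 1"
    using y by (auto simp: ref_facet_int_def ref_facet_def)
  obtain p p' where p: "p \<in> face_index" and p': "p' \<in> face_index"
    and I: "G ` ref_cube \<inter> G' ` ref_cube = G ` ref_face p" "G ` ref_cube \<inter> G' ` ref_cube = G' ` ref_face p'"
    and sub: "subfaces G p = subfaces G' p'"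
    using conf Gy yc(1) unfolding conforming_def by blast
  have imG: "G ` A \<subseteq> G ` B \<longleftrightarrow> A \<subseteq> B" if "A \<subseteq> ref_cube" "B \<subseteq> ref_cube" for A B
    using inj_on_image_subset_iff[OF G.inj that] .
  have imG': "G' ` A \<subseteq> G' ` B \<longleftrightarrow> A \<subseteq> B" if "A \<subseteq> ref_cube" "B \<subseteq> ref_cube" for A B
    using inj_on_image_subset_iff[OF G'.inj that] .
  have y_in: "y \<in> ref_face p"
  proof -
    have "G y \<in> G ` ref_face p" using I(1) yc(1) Gy by blast
    then show ?thesis using G.inj yc(1) ref_face_subset_cube by (auto dest!: inj_onD)
  qed
  \<comment> \<open>The common face is not the whole element, since the cells are disjoint.\<close>
  have "p \<noteq> 0"
  proof
    assume "p = 0"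
    then have "ref_face p = ref_cube" by (auto simp: ref_face_def)
    then have "G ` ref_cube \<subseteq> G' ` ref_cube" using I(1) by (simp add: inf.absorb_iff1)
    then have "G.cell \<subseteq> closure G'.cell"
      using G.cell_subset G'.image_subset_closure_cell by (meson order_trans)
    moreover have "G.cell \<inter> closure G'.cell = {}"
      using disj open_Int_closure_eq_empty[OF G.open_cell] by simp
    ultimately show False using G.cell_nonempty by blast
  qed
  moreover have pj: "p $ j = 0" if "j \<noteq> i" for j
  proof (rule ccontr)
    assume *: "p $ j \<noteq> 0"
    then have "y $ j = p $ j" using y_in by (simp add: ref_face_def)
    then show False using yc(3)[OF that] face_index_cases[OF p, of j] * by auto
  qed
  ultimately have pi0: "p $ i \<noteq> 0" by (metis vec_eq_iff zero_index)
  then have pi: "p $ i = s" using y_in yc(2) by (simp add: ref_face_def)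
  \<comment> \<open>Below, \<open>\<tau>\<close> and \<open>\<tau>'\<close> are the lattice isomorphism and its inverse.\<close>
  have sub_iff: "face_le p t \<longleftrightarrow> ref_face t \<subseteq> ref_face p" if "t \<in> face_index" for t p :: "real^'d::_"
    using ref_face_subset_iff[OF that] by simp
  have ex1: "\<exists>u\<in>face_index. face_le p u \<and> G' ` ref_face t = G ` ref_face u"
    if "t \<in> face_index" "face_le p' t" for t
  proof -
    have "G' ` ref_face t \<in> subfaces G' p'" unfolding subfaces_def using that sub_iff by blast
    then have "G' ` ref_face t \<in> subfaces G p" using sub by simp
    then show ?thesis unfolding subfaces_def using sub_iff by blast
  qed
  have ex2: "\<exists>u\<in>face_index. face_le p' u \<and> G ` ref_face t = G' ` ref_face u"
    if "t \<in> face_index" "face_le p t" for t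
  proof -
    have "G ` ref_face t \<in> subfaces G p" unfolding subfaces_def using that sub_iff by blast
    then have "G ` ref_face t \<in> subfaces G' p'" using sub by simp
    then show ?thesis unfolding subfaces_def using sub_iff by blast
  qed
  obtain \<tau> where \<tau>: "\<And>t. t \<in> face_index \<Longrightarrow> face_le p' t \<Longrightarrow>
      \<tau> t \<in> face_index \<and> face_le p (\<tau> t) \<and> G' ` ref_face t = G ` ref_face (\<tau> t)"
    using ex1 by metis
  obtain \<tau>' where \<tau>': "\<And>t. t \<in> face_index \<Longrightarrow> face_le p t \<Longrightarrow>
      \<tau>' t \<in> face_index \<and> face_le p' (\<tau>' t) \<and> G ` ref_face t = G' ` ref_face (\<tau>' t)"
    using ex2 by metis
  have eqG: "t = u" if "t \<in> face_index" "u \<in> face_index" "G ` ref_face t = G ` ref_face u" for t u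
    using ref_face_inj[OF that(1,2)] that(3)
      inj_on_image_eq_iff[OF G.inj ref_face_subset_cube ref_face_subset_cube] by simp
  have eqG': "t = u" if "t \<in> face_index" "u \<in> face_index" "G' ` ref_face t = G' ` ref_face u" for t u
    using ref_face_inj[OF that(1,2)] that(3)
      inj_on_image_eq_iff[OF G'.inj ref_face_subset_cube ref_face_subset_cube] by simp
  have pp: "G' ` ref_face p' = G ` ref_face p" using I by simp
  have \<tau>p: "\<tau> p' = p" using \<tau>[OF p' face_le_refl] pp eqG p by metis
  have \<tau>'p: "\<tau>' p = p'" using \<tau>'[OF p face_le_refl] pp eqG' p' by metis
  have inv1: "\<tau> (\<tau>' t) = t" if "t \<in> face_index" "face_le p t" for t
    using \<tau>'[OF that] \<tau> eqG that by metis
  have inv2: "\<tau>' (\<tau> t) = t" if "t \<in> face_index" "face_le p' t" for t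
    using \<tau>[OF that] \<tau>' eqG' that by metis
  have le: "face_le (\<tau> t) (\<tau> u) \<longleftrightarrow> face_le t u"
    if "t \<in> face_index" "face_le p' t" "u \<in> face_index" "face_le p' u" for t u
    using \<tau>[OF that(1,2)] \<tau>[OF that(3,4)] sub_iff[of "\<tau> u" "\<tau> t"] sub_iff[of u t] that(3)
      imG[OF ref_face_subset_cube ref_face_subset_cube, of "\<tau> u" "\<tau> t"]
      imG'[OF ref_face_subset_cube ref_face_subset_cube, of u t] by simp
  have le': "face_le (\<tau>' t) (\<tau>' u) \<longleftrightarrow> face_le t u"
    if "t \<in> face_index" "face_le p t" "u \<in> face_index" "face_le p u" for t u
    using \<tau>'[OF that(1,2)] \<tau>'[OF that(3,4)] sub_iff[of "\<tau>' u" "\<tau>' t"] sub_iff[of u t] that(3)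
      imG'[OF ref_face_subset_cube ref_face_subset_cube, of "\<tau>' u" "\<tau>' t"]
      imG[OF ref_face_subset_cube ref_face_subset_cube, of u t] by simp
  have meetG: "G ` ref_face t \<inter> G ` ref_face u \<noteq> {} \<longleftrightarrow> compatible t u" if "t \<in> face_index" "u \<in> face_index" for t u
    using ref_faces_meet_iff[OF that] inj_on_image_Int[OF G.inj ref_face_subset_cube ref_face_subset_cube, of t u] by auto
  have meetG': "G' ` ref_face t \<inter> G' ` ref_face u \<noteq> {} \<longleftrightarrow> compatible t u" if "t \<in> face_index" "u \<in> face_index" for t u
    using ref_faces_meet_iff[OF that] inj_on_image_Int[OF G'.inj ref_face_subset_cube ref_face_subset_cube, of t u] by auto
  have meet: "compatible (\<tau> t) (\<tau> u) \<longleftrightarrow> compatible t u"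
    if "t \<in> face_index" "face_le p' t" "u \<in> face_index" "face_le p' u" for t u
    using \<tau>[OF that(1,2)] \<tau>[OF that(3,4)] meetG[of "\<tau> t" "\<tau> u"] meetG'[OF that(1,3)] by simp
  have meet': "compatible (\<tau>' t) (\<tau>' u) \<longleftrightarrow> compatible t u"
    if "t \<in> face_index" "face_le p t" "u \<in> face_index" "face_le p u" for t u
    using \<tau>'[OF that(1,2)] \<tau>'[OF that(3,4)] meetG'[of "\<tau>' t" "\<tau>' u"] meetG[OF that(1,3)] by simp
  have surj1: "\<exists>t\<in>face_index. face_le p' t \<and> \<tau> t = u" if "u \<in> face_index" "face_le p u" for u
    using \<tau>'[OF that] inv1[OF that] by blast
  have surj2: "\<exists>t\<in>face_index. face_le p t \<and> \<tau>' t = u" if "u \<in> face_index" "face_le p' u" for u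
    using \<tau>[OF that] inv2[OF that] by blast
  have \<tau>1: "\<tau> t \<in> face_index \<and> face_le p (\<tau> t)" if "t \<in> face_index" "face_le p' t" for t
    using \<tau>[OF that] by simp
  have \<tau>'1: "\<tau>' t \<in> face_index \<and> face_le p' (\<tau>' t)" if "t \<in> face_index" "face_le p t" for t
    using \<tau>'[OF that] by simp
  have "\<exists>\<pi> \<delta>. inj_on \<pi> {j. p' $ j = 0} \<and> \<pi> ` {j. p' $ j = 0} \<subseteq> {j. p $ j = 0} \<and>
     (\<forall>j. p' $ j = 0 \<longrightarrow> \<delta> j \<in> {-1, 1} \<and> (\<forall>e\<in>{-1, 1}. \<tau> (sub_face j e p') = sub_face (\<pi> j) (e * \<delta> j) p))"
  proof (rule face_lattice_iso[OF p' p])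
    show "\<tau> p' = p" by (rule \<tau>p)
  qed ((rule \<tau>1; assumption), (rule surj1; assumption), (rule le; assumption), (rule meet; assumption))
  then obtain \<pi> \<delta> where \<pi>: "inj_on \<pi> {j. p' $ j = 0}" "\<pi> ` {j. p' $ j = 0} \<subseteq> {j. p $ j = 0}"
    and \<pi>\<delta>: "\<forall>j. p' $ j = 0 \<longrightarrow> \<delta> j \<in> {-1, 1} \<and> (\<forall>e\<in>{-1, 1}. \<tau> (sub_face j e p') = sub_face (\<pi> j) (e * \<delta> j) p)"
    by (elim exE conjE) (rule that)
  have \<delta>: "\<delta> j \<in> {-1, 1}" if "p' $ j = 0" for j using \<pi>\<delta> that by blast
  have \<tau>sub: "\<tau> (sub_face j e p') = sub_face (\<pi> j) (e * \<delta> j) p" if "p' $ j = 0" "e \<in> {-1, 1}" for j e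
    using \<pi>\<delta> that by blast
  have "\<exists>\<pi> \<delta>. inj_on \<pi> {j. p $ j = 0} \<and> \<pi> ` {j. p $ j = 0} \<subseteq> {j. p' $ j = 0} \<and>
     (\<forall>j. p $ j = 0 \<longrightarrow> \<delta> j \<in> {-1, 1} \<and> (\<forall>e\<in>{-1, 1}. \<tau>' (sub_face j e p) = sub_face (\<pi> j) (e * \<delta> j) p'))"
  proof (rule face_lattice_iso[OF p p'])
    show "\<tau>' p = p'" by (rule \<tau>'p)
  qed ((rule \<tau>'1; assumption), (rule surj2; assumption), (rule le'; assumption), (rule meet'; assumption))
  then obtain \<pi>' where \<pi>': "inj_on \<pi>' {j. p $ j = 0}" "\<pi>' ` {j. p $ j = 0} \<subseteq> {j. p' $ j = 0}"
    by blast
  \<comment> \<open>Injections in both directions: the second element sees the common face as a facet, too.\<close>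
  have card_eq: "card {j. p' $ j = 0} = card {j. p $ j = 0}"
    using card_inj_on_le[OF \<pi>] card_inj_on_le[OF \<pi>'] by simp
  have free_p: "{j. p $ j = 0} = UNIV - {i}" using pj pi0 by auto
  have "card (UNIV - {j. p' $ j = 0}) = 1"
  proof -
    have "card {j. p' $ j = 0} = CARD('d) - 1"
      using card_eq unfolding free_p by (simp add: card_Diff_subset)
    then show ?thesis using zero_less_card_finite[where 'a='d] by (simp add: card_Diff_subset)
  qed
  then obtain i' where i': "UNIV - {j. p' $ j = 0} = {i'}" by (auto simp: card_1_singleton_iff)
  then have free_p': "{j. p' $ j = 0} = UNIV - {i'}" by auto
  let ?s' = "p' $ i'"
  have s': "?s' \<in> {-1, 1}" using face_index_cases[OF p', of i'] i' by auto
  have \<pi>_onto: "\<pi> ` (UNIV - {i'}) = UNIV - {i}"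
    using card_subset_eq[of "{j. p $ j = 0}" "\<pi> ` {j. p' $ j = 0}"] \<pi> card_eq card_image[OF \<pi>(1)]
    unfolding free_p free_p' by simp
  let ?\<sigma> = "\<pi>(i' := i)"
  have bij\<sigma>: "bij ?\<sigma>"
  proof -
    have "inj ?\<sigma>"
    proof (rule injI)
      fix a b assume "?\<sigma> a = ?\<sigma> b"
      then show "a = b"
        using \<pi>(1) \<pi>_onto unfolding free_p' by (auto simp: inj_on_def split: if_splits)
    qed
    then show ?thesis
      using finite_UNIV_inj_surj[OF finite_class.finite_UNIV] unfolding bij_def by blast
  qed
  let ?\<rho> = "inv ?\<sigma>"
  have bij\<rho>: "bij ?\<rho>" using bij\<sigma> by (rule bij_imp_bij_inv)
  let ?\<epsilon> = "\<lambda>a. if a = i then s * ?s' else \<delta> (?\<rho> a)"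
  have \<rho>\<sigma>: "?\<rho> (?\<sigma> a) = a" for a by (rule inv_f_f[OF bij_is_inj[OF bij\<sigma>]])
  have \<rho>i: "?\<rho> i = i'" using \<rho>\<sigma>[of i'] by simp
  have \<epsilon>: "\<forall>a. ?\<epsilon> a \<in> {-1, 1}"
  proof
    fix a
    show "?\<epsilon> a \<in> {-1, 1}"
    proof (cases "a = i")
      case True
      then show ?thesis using s s' by auto
    next
      case False
      then have "?\<rho> a \<noteq> i'" using bij\<rho> \<rho>i by (metis bij_pointE)
      then show ?thesis using False \<delta>[of "?\<rho> a"] free_p' by auto
    qed
  qed
  have vert: "G' (set_coord i' ?s' v) = G (set_coord i s (signed_perm ?\<rho> ?\<epsilon> v))" if v: "\<forall>j. v $ j \<in> {-1, 1}" for v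
  proof -
    let ?v = "set_coord i' ?s' v"
    have vp: "?v \<in> ref_face p'"
    proof -
      have "\<bar>v $ j\<bar> \<le> 1" for j using v[rule_format, of j] by auto
      then show ?thesis using free_p' s' by (auto simp: ref_face_def mem_ref_cube)
    qed
    then have "G' ?v \<in> G ` ref_face p" using pp by blast
    then obtain w where w: "w \<in> ref_face p" "G' ?v = G w" by blast
    have "w $ a = set_coord i s (signed_perm ?\<rho> ?\<epsilon> v) $ a" for a
    proof (cases "a = i")
      case True
      then show ?thesis using w(1) pi pi0 by (auto simp: ref_face_def)
    next
      case False
      then obtain j where j: "a = \<pi> j" "j \<noteq> i'" using \<pi>_onto by blast
      have pj0: "p' $ j = 0" using j free_p' by blast
      have vj: "v $ j \<in> {-1, 1}" using v by blast
      have "?v \<in> ref_face (sub_face j (v $ j) p')"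
        using vp j by (auto simp: ref_face_def sub_face_def)
      moreover have "sub_face j (v $ j) p' \<in> face_index" "face_le p' (sub_face j (v $ j) p')"
        using sub_face_index[OF p' vj] sub_face_le[OF pj0] by auto
      ultimately have "G' ?v \<in> G ` ref_face (sub_face (\<pi> j) (v $ j * \<delta> j) p)"
        using \<tau> \<tau>sub[OF pj0 vj] by (metis imageI)
      then have "w \<in> ref_face (sub_face (\<pi> j) (v $ j * \<delta> j) p)"
        using w G.inj ref_face_subset_cube by (auto dest!: inj_onD)
      then have "w $ a = v $ j * \<delta> j"
        using j vj \<delta>[OF pj0] by (auto simp: ref_face_def sub_face_def split: if_splits)
      moreover have "?\<rho> a = j" using \<rho>\<sigma>[of j] j by simp
      ultimately show ?thesis using False by (simp add: signed_perm_def)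
    qed
    then have "w = set_coord i s (signed_perm ?\<rho> ?\<epsilon> v)" by (simp add: vec_eq_iff)
    then show ?thesis using w by simp
  qed
  have all: "\<forall>x. G' (set_coord i' ?s' x) = G (set_coord i s (signed_perm ?\<rho> ?\<epsilon> x))"
  proof
    fix x
    have "G' (set_coord i' ?s' x) $ c = G (set_coord i s (signed_perm ?\<rho> ?\<epsilon> x)) $ c" for c
    proof (rule multilinear_eq_if_vertices[where f="\<lambda>x. G' (set_coord i' ?s' x) $ c"])
      show "(\<lambda>x. G' (set_coord i' ?s' x) $ c) \<in> Qpoly 1"
        by (rule Qpoly_set_coord[OF G'.multilinear])
      show "(\<lambda>x. G (set_coord i s (signed_perm ?\<rho> ?\<epsilon> x)) $ c) \<in> Qpoly 1"
        by (rule Qpoly_signed_perm[OF Qpoly_set_coord[OF G.multilinear] bij\<rho>])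
    next
      fix v :: "real^'d::_" assume v: "\<forall>j. v $ j \<in> {-1, 1}"
      show "G' (set_coord i' ?s' v) $ c = G (set_coord i s (signed_perm ?\<rho> ?\<epsilon> v)) $ c"
        by (intro arg_cong[where f="\<lambda>x. x $ c"] vert v)
    qed
    then show "G' (set_coord i' ?s' x) = G (set_coord i s (signed_perm ?\<rho> ?\<epsilon> x))"
      unfolding vec_eq_iff by (rule allI)
  qed
  show ?thesis
    by (rule exI[of _ i'], rule exI[of _ ?s'], rule exI[of _ ?\<rho>], rule exI[of _ ?\<epsilon>])
      (intro conjI s' bij\<rho> \<epsilon> all)
qed

lemma ref_facet_eq: "s \<in> {-1, 1} \<Longrightarrow> ref_facet i s = set_coord i s ` ref_cube"
proof (intro equalityI subsetI)
  fix x assume "s \<in> {-1, 1}" "x \<in> ref_facet i s"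
  then show "x \<in> set_coord i s ` ref_cube"
    by (intro image_eqI[of _ _ x]) (auto simp: ref_facet_def vec_eq_iff)
qed (auto simp: ref_facet_def mem_ref_cube)

lemma ref_facet_int_eq: "s \<in> {-1, 1} \<Longrightarrow> ref_facet_int i s = set_coord i s ` box (-1) 1"
proof (intro equalityI subsetI)
  fix x assume "s \<in> {-1, 1}" "x \<in> ref_facet_int i s"
  then show "x \<in> set_coord i s ` box (-1) 1"
    by (intro image_eqI[of _ _ "set_coord i 0 x"]) (auto simp: ref_facet_int_def ref_facet_def mem_ref_box vec_eq_iff)
qed (auto simp: ref_facet_int_def ref_facet_def mem_ref_cube mem_ref_box less_imp_le)

lemma signed_perm_ref_box:
  assumes "bij \<pi>" "\<And>j. \<epsilon> j \<in> {-1, 1}"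
  shows "signed_perm \<pi> \<epsilon> ` box (-1) 1 = box (-1) (1::real^'d::finite)"
proof -
  have abs: "\<bar>\<epsilon> j\<bar> = 1" for j using assms(2)[of j] by auto
  have sq: "\<epsilon> j * (\<epsilon> j * t) = t" for j t using assms(2)[of j] by auto
  have "x \<in> signed_perm \<pi> \<epsilon> ` box (-1) 1" if "x \<in> box (-1) 1" for x
  proof (rule image_eqI)
    show "x = signed_perm \<pi> \<epsilon> (\<chi> j. \<epsilon> (inv \<pi> j) * x $ inv \<pi> j)"
      using assms(1) by (simp add: signed_perm_def vec_eq_iff sq bij_is_inj inv_f_f)
    show "(\<chi> j. \<epsilon> (inv \<pi> j) * x $ inv \<pi> j) \<in> box (-1) 1"
      using that by (simp add: mem_ref_box abs_mult abs)
  qed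
  moreover have "signed_perm \<pi> \<epsilon> x \<in> box (-1) 1" if "x \<in> box (-1) 1" for x
    using that by (simp add: mem_ref_box signed_perm_def abs_mult abs)
  ultimately show ?thesis by blast
qed

lemma common_facet_images:
  assumes "s \<in> {-1, 1}" "s' \<in> {-1, 1}" "bij \<rho>" "\<forall>a. \<epsilon> a \<in> {-1, 1}"
    "\<forall>x. G' (set_coord i' s' x) = G (set_coord i s (signed_perm \<rho> \<epsilon> x))"
  shows "G' ` ref_facet i' s' = G ` ref_facet i s" "G' ` ref_facet_int i' s' = G ` ref_facet_int i s"
proof -
  have "G' ` set_coord i' s' ` A = G ` set_coord i s ` signed_perm \<rho> \<epsilon> ` A" for A
    using assms(5) by (auto simp: image_image)
  then show "G' ` ref_facet i' s' = G ` ref_facet i s" "G' ` ref_facet_int i' s' = G ` ref_facet_int i s"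
    using signed_perm_ref_cube[OF assms(3), of \<epsilon>] signed_perm_ref_box[OF assms(3), of \<epsilon>] assms(4)
    by (simp_all add: ref_facet_eq[OF assms(1)] ref_facet_eq[OF assms(2)]
        ref_facet_int_eq[OF assms(1)] ref_facet_int_eq[OF assms(2)])
qed

section \<open>The topology of the mesh\<close>

text \<open>A map with continuous invertible derivative is injective near every point, also at the boundary
  of the cube, where the parametrisation continues beyond the element.\<close>

lemma (in element) locally_injective:
  assumes "y \<in> ref_cube" obtains r where "r > 0" "inj_on G (ball y r)"
proof -
  obtain B where B: "B ** jac G y = mat 1" using invertible_jac[OF assms] by (auto simp: invertible_def)
  have "\<exists>d>0. \<forall>x. dist y x < d \<longrightarrow> onorm (\<lambda>v. jac G x *v v - jac G y *v v) < e" if e: "e > 0" for e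
  proof -
    let ?f = "\<lambda>x. \<Sum>i\<in>UNIV. \<Sum>j\<in>UNIV. \<bar>(jac G x - jac G y) $ i $ j\<bar>"
    have "continuous_on UNIV ?f"
      by (intro continuous_intros continuous_jac)
    then have "isCont ?f y" by (simp add: continuous_on_eq_continuous_at)
    then obtain d where d: "d > 0" "\<And>x. dist x y < d \<Longrightarrow> dist (?f x) (?f y) < e"
      using e unfolding continuous_at_eps_delta by blast
    have "onorm (\<lambda>v. jac G x *v v - jac G y *v v) < e" if "dist y x < d" for x
    proof -
      have "(\<lambda>v. jac G x *v v - jac G y *v v) = (*v) (jac G x - jac G y)"
        by (rule ext) (rule matrix_vector_mult_diff_rdistrib[symmetric])
      then have "onorm (\<lambda>v. jac G x *v v - jac G y *v v) = onorm ((*v) (jac G x - jac G y))"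
        by (rule arg_cong)
      also have "\<dots> \<le> ?f x" by (rule onorm_le_matrix_component_sum)
      also have "\<dots> < e" using d(2)[of x] that by (auto simp: dist_real_def dist_commute)
      finally show ?thesis .
    qed
    then show ?thesis using d(1) by blast
  qed
  then obtain r where "r > 0" "inj_on G (ball y r)"
    using has_derivative_locally_injective[of y UNIV "(*v) B" "\<lambda>x. (*v) (jac G x)" G] has_derivative
    by (auto simp: o_def id_def matrix_vector_mul_assoc B)
  then show thesis using that by blast
qed

lemma (in element) pull_near:
  assumes "y \<in> ref_cube" "e > 0"
  obtains d where "d > 0" "\<And>z. z \<in> ref_cube \<Longrightarrow> dist (G z) (G y) < d \<Longrightarrow> dist z y < e"
proof -
  obtain d where d: "d > 0" "\<And>x. x \<in> G ` ref_cube \<Longrightarrow> dist x (G y) < d \<Longrightarrow> dist (pull x) (pull (G y)) < e"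
    using continuous_pull assms unfolding continuous_on_iff by blast
  have "dist z y < e" if "z \<in> ref_cube" "dist (G z) (G y) < d" for z
    using d(2)[of "G z"] that assms(1) by (simp add: pull_G)
  then show thesis using that d(1) by blast
qed

lemma (in element) closure_cell: "closure cell = G ` ref_cube"
  using image_subset_closure_cell closure_minimal[OF cell_subset] compact_imp_closed[OF compact_image] by blast

text \<open>Invariance of domain for the inverse of the parametrisation.\<close>

lemma (in element) boundary_not_interior:
  assumes "y \<in> ref_cube" "G y \<in> interior (G ` ref_cube)" shows "y \<in> box (-1) 1"
proof -
  let ?I = "interior (G ` ref_cube)"
  have "open (pull ` ?I)"
  proof (rule invariance_of_domain)
    show "continuous_on ?I pull" using continuous_pull interior_subset continuous_on_subset by blast
    show "inj_on pull ?I" by (rule inj_on_subset[OF inj_on_inv_into[OF order_refl]]) (rule interior_subset)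
  qed simp
  moreover have "pull ` ?I \<subseteq> ref_cube" using inv_into_into[of _ G ref_cube] interior_subset[of "G ` ref_cube"] by blast
  ultimately have "pull ` ?I \<subseteq> interior ref_cube" by (rule interior_maximal[rotated])
  moreover have "y \<in> pull ` ?I" using assms pull_G by (metis imageI)
  ultimately show ?thesis by (auto simp: ref_cube_def interior_cbox)
qed

text \<open>The coordinates of G continue a little beyond the facet. There, the points that belong to the second
  element form a set that is both open and closed in a half ball, so it is everything or nothing. If it
  were nothing, then cell points of the second element close to the facet would lie in the first one.\<close>

lemma common_facet_nbhd:
  fixes G G' :: "real^'d::{finite,wellorder} \<Rightarrow> real^'d::_"
  assumes G: "element G" and G': "element G'"
    and disj: "G ` box (-1) 1 \<inter> G' ` box (-1) 1 = {}"
    and s: "s \<in> {-1, 1}" and s': "s' \<in> {-1, 1}"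
    and facet: "G' ` ref_facet i' s' = G ` ref_facet i s" "G' ` ref_facet_int i' s' = G ` ref_facet_int i s"
    and y: "y \<in> ref_facet_int i s"
  shows "G y \<in> interior (G ` ref_cube \<union> G' ` ref_cube)"
proof -
  interpret G: element G by (rule G)
  interpret G': element G' by (rule G')
  have yc: "y \<in> ref_cube" "y $ i = s" "\<And>j. j \<noteq> i \<Longrightarrow> \<bar>y $ j\<bar> < 1"
    using y by (auto simp: ref_facet_int_def ref_facet_def)
  obtain y' where y': "y' \<in> ref_facet_int i' s'" "G y = G' y'" using facet(2) y by (metis imageE imageI)
  have yc': "y' \<in> ref_cube" "y' $ i' = s'" "\<And>j. j \<noteq> i' \<Longrightarrow> \<bar>y' $ j\<bar> < 1"
    using y' by (auto simp: ref_facet_int_def ref_facet_def)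
  \<comment> \<open>Near a relatively interior point of a facet no other facet of the cube matters.\<close>
  have only: "\<exists>e>0. \<forall>z. dist z y < e \<longrightarrow> (\<forall>j. j \<noteq> i \<longrightarrow> \<bar>z $ j\<bar> < 1) \<and> s * z $ i > - 1"
    if yc: "y $ i = s" "\<And>j. j \<noteq> i \<Longrightarrow> \<bar>y $ j\<bar> < 1" and s: "s \<in> {-1, 1}" for y :: "real^'d::_" and i s
  proof -
    have "open ((\<Inter>j\<in>UNIV - {i}. {z::real^'d::_. \<bar>z $ j\<bar> < 1}) \<inter> {z. s * z $ i > - 1})"
      by (intro open_Int open_INT ballI open_Collect_less continuous_intros) auto
    moreover have "(\<Inter>j\<in>UNIV - {i}. {z::real^'d::_. \<bar>z $ j\<bar> < 1}) \<inter> {z. s * z $ i > - 1} =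
        {z. (\<forall>j\<in>UNIV - {i}. \<bar>z $ j\<bar> < 1) \<and> s * z $ i > - 1}" by auto
    ultimately have "open {z::real^'d::_. (\<forall>j\<in>UNIV - {i}. \<bar>z $ j\<bar> < 1) \<and> s * z $ i > - 1}" by simp
    moreover have "y \<in> {z. (\<forall>j\<in>UNIV - {i}. \<bar>z $ j\<bar> < 1) \<and> s * z $ i > - 1}" using yc s by auto
    ultimately obtain e where "e > 0" "ball y e \<subseteq> {z. (\<forall>j\<in>UNIV - {i}. \<bar>z $ j\<bar> < 1) \<and> s * z $ i > - 1}"
      by (meson open_contains_ball)
    then show ?thesis by (intro exI[of _ e]) (auto simp: subset_iff dist_commute)
  qed
  obtain e where e: "e > 0" "\<And>z. dist z y < e \<Longrightarrow> (\<forall>j. j \<noteq> i \<longrightarrow> \<bar>z $ j\<bar> < 1) \<and> s * z $ i > - 1"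
    using only[OF yc(2,3) s] by blast
  obtain e' where e': "e' > 0" "\<And>z. dist z y' < e' \<Longrightarrow> (\<forall>j. j \<noteq> i' \<longrightarrow> \<bar>z $ j\<bar> < 1) \<and> s' * z $ i' > - 1"
    using only[OF yc'(2,3) s'] by blast
  obtain r where r: "r > 0" "inj_on G (ball y r)" using G.locally_injective[OF yc(1)] .
  obtain d' where d': "d' > 0" "\<And>z. z \<in> ref_cube \<Longrightarrow> dist (G' z) (G' y') < d' \<Longrightarrow> dist z y' < e'"
    using G'.pull_near[OF yc'(1) e'(1)] by blast
  obtain d where d: "d > 0" "\<And>z. z \<in> ref_cube \<Longrightarrow> dist (G z) (G y) < d \<Longrightarrow> dist z y < min r e"
    using G.pull_near[OF yc(1), of "min r e"] r(1) e(1) by auto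
  have "isCont G y" using G.continuous[of UNIV] by (simp add: continuous_on_eq_continuous_at)
  moreover have "min d d' > 0" using d(1) d'(1) by simp
  ultimately obtain \<rho>0 where \<rho>0: "\<rho>0 > 0" "\<And>z. dist z y < \<rho>0 \<Longrightarrow> dist (G z) (G y) < min d d'"
    unfolding continuous_at_eps_delta by blast
  define \<rho> where "\<rho> = min \<rho>0 (min r e)"
  have \<rho>: "\<rho> > 0" "\<rho> \<le> \<rho>0" "\<rho> \<le> r" "\<rho> \<le> e" using \<rho>0 r e by (auto simp: \<rho>_def)
  let ?B = "ball y \<rho>"
  have injB: "inj_on G ?B" using r(2) \<rho>(3) by (meson inj_on_subset subset_ball)
  have openGB: "open (G ` A)" if "open A" "A \<subseteq> ?B" for A
    by (rule invariance_of_domain[OF G.continuous that(1)]) (use injB that(2) inj_on_subset in blast)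
  have B_cube: "z \<in> ref_cube \<longleftrightarrow> s * z $ i \<le> 1" if "z \<in> ?B" for z
  proof -
    have *: "\<forall>j. j \<noteq> i \<longrightarrow> \<bar>z $ j\<bar> < 1" "s * z $ i > - 1"
      using e(2)[of z] that \<rho> by (auto simp: dist_commute)
    have "\<bar>z $ i\<bar> \<le> 1 \<longleftrightarrow> s * z $ i \<le> 1" using * s by auto
    moreover have "z \<in> ref_cube \<longleftrightarrow> \<bar>z $ i\<bar> \<le> 1"
    proof
      assume "\<bar>z $ i\<bar> \<le> 1"
      then have "\<bar>z $ j\<bar> \<le> 1" for j using *(1) by (cases "j = i") (auto intro: less_imp_le)
      then show "z \<in> ref_cube" by (simp add: mem_ref_cube)
    qed (simp add: mem_ref_cube)
    ultimately show ?thesis by simp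
  qed
  \<comment> \<open>The half ball beyond the facet.\<close>
  let ?P = "{z \<in> ?B. s * z $ i > 1}"
  have openP: "open ?P"
  proof -
    have "open {z::real^'d::_. s * z $ i > 1}" by (intro open_Collect_less continuous_intros)
    moreover have "?P = ?B \<inter> {z. s * z $ i > 1}" by auto
    ultimately show ?thesis by auto
  qed
  have connP: "connected ?P"
  proof (rule convex_connected)
    have "convex {z::real^'d::_. s * z $ i > 1}"
    proof -
      have eq: "{z::real^'d::_. s * z $ i > 1} = {z. inner (s *\<^sub>R axis i 1) z > 1}" by (simp add: inner_axis')
      show ?thesis unfolding eq by (rule convex_halfspace_gt)
    qed
    moreover have "?P = ?B \<inter> {z. s * z $ i > 1}" by auto
    ultimately show "convex ?P" by (simp add: convex_Int)
  qed
  let ?X = "{z \<in> ?P. G z \<in> G' ` ref_cube}"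
  have closedX: "closedin (top_of_set ?P) ?X"
  proof -
    have "closed (G' ` ref_cube)" by (rule compact_imp_closed[OF G'.compact_image])
    from continuous_closedin_preimage[OF G.continuous[of ?P] this] show ?thesis
      by (simp add: vimage_def Int_def)
  qed
  \<comment> \<open>A point of the half ball on the boundary of the second element would be on the common facet, against
    the local injectivity of G.\<close>
  have X_int: "G z \<in> G'.cell" if z: "z \<in> ?X" for z
  proof -
    obtain w where w: "w \<in> ref_cube" "G z = G' w" using z by auto
    have "dist (G' w) (G' y') < d'" using \<rho>0(2)[of z] z w y'(2) \<rho> by (auto simp: dist_commute)
    then have "dist w y' < e'" using d'(2) w(1) by blast
    then have *: "\<forall>j. j \<noteq> i' \<longrightarrow> \<bar>w $ j\<bar> < 1" "s' * w $ i' > - 1" using e'(2)[of w] by blast+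
    have "\<bar>w $ i'\<bar> < 1"
    proof (rule ccontr)
      assume "\<not> \<bar>w $ i'\<bar> < 1"
      then have "\<bar>w $ i'\<bar> = 1" using w(1) mem_ref_cube[of w] by (metis less_le)
      then have "w $ i' = s'" using * s' by auto
      then have "w \<in> ref_facet i' s'" using w by (simp add: ref_facet_def)
      then obtain v where v: "v \<in> ref_facet i s" "G z = G v" using facet(1) w(2) by (metis imageE imageI)
      have vc: "v \<in> ref_cube" "v $ i = s" using v by (auto simp: ref_facet_def)
      have "dist (G v) (G y) < d" using \<rho>0(2)[of z] z v(2) \<rho> by (auto simp: dist_commute)
      then have "dist v y < r" using d(2)[OF vc(1)] by simp
      moreover have "z \<in> ball y r" using z \<rho> by auto
      ultimately have "z = v" by (intro inj_onD[OF r(2) v(2)]) (auto simp: dist_commute)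
      then show False using z vc s by auto
    qed
    then have "\<bar>w $ j\<bar> < 1" for j using *(1) by (cases "j = i'") auto
    then have "w \<in> box (-1) 1" by (simp add: mem_ref_box)
    then show ?thesis using w by blast
  qed
  have openX: "openin (top_of_set ?P) ?X"
  proof -
    have "?X = ?P \<inter> G -` G'.cell" using X_int G'.cell_subset by blast
    then show ?thesis using continuous_openin_preimage_gen[OF G.continuous[of ?P] G'.open_cell] by simp
  qed
  have "?X = {} \<or> ?X = ?P" using connP openX closedX unfolding connected_clopen by blast
  then show ?thesis
  proof
    assume XP: "?X = ?P"
    have "G ` ?B \<subseteq> G ` ref_cube \<union> G' ` ref_cube"
    proof (intro image_subsetI)
      fix z assume z: "z \<in> ?B"
      show "G z \<in> G ` ref_cube \<union> G' ` ref_cube"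
      proof (cases "s * z $ i \<le> 1")
        case True
        then show ?thesis using B_cube[OF z] by blast
      next
        case False
        then have "z \<in> ?X" using z XP by auto
        then show ?thesis by blast
      qed
    qed
    moreover have "open (G ` ?B)" by (rule openGB) auto
    moreover have "G y \<in> G ` ?B" using \<rho> by auto
    ultimately show ?thesis unfolding interior_def by blast
  next
    assume X0: "?X = {}"
    have "open (G ` ?B)" by (rule openGB) auto
    moreover have "G y \<in> G ` ?B" using \<rho> by auto
    moreover have "G y \<in> closure G'.cell" using y' yc' by (simp add: G'.closure_cell)
    ultimately have "G ` ?B \<inter> G'.cell \<noteq> {}" using open_Int_closure_eq_empty[of "G ` ?B" G'.cell] by blast
    then obtain z where z: "z \<in> ?B" "G z \<in> G'.cell" by blast
    have "z \<notin> ?P" using X0 z G'.cell_subset by blast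
    then have "G z \<in> G ` ref_cube" using z B_cube[OF z(1)] by auto
    then have "G'.cell \<inter> closure G.cell \<noteq> {}" using z G.closure_cell by blast
    then have "G'.cell \<inter> G.cell \<noteq> {}" using open_Int_closure_eq_empty[OF G'.open_cell] by blast
    then show ?thesis using disj by blast
  qed
qed

lemma scaled_less:
  fixes n e :: real
  assumes "0 \<le> n" "0 < e" shows "e / (2 * (n + 1)) * n < e"
proof -
  have "n < 2 * (n + 1)" using assms(1) by simp
  then have "e * n < e * (2 * (n + 1))" using assms(2) by (rule mult_strict_left_mono)
  moreover have "2 * (n + 1) > 0" using assms(1) by simp
  ultimately show ?thesis by (simp add: pos_divide_less_eq)
qed

locale mesh =
  fixes \<Omega> :: "(real^'d::{finite,wellorder}) set" and T :: "(real^'d::_) set set"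
    and F :: "(real^'d::_) set \<Rightarrow> real^'d::_ \<Rightarrow> real^'d::_"
  assumes domain: "polytopal_domain \<Omega>" and partition: "fe_partition \<Omega> T F"
    and jac_invertible: "\<And>E x. E \<in> T \<Longrightarrow> x \<in> ref_cube \<Longrightarrow> invertible (jac (F E) x)"
begin

lemma open_domain: "open \<Omega>" and connected_domain: "connected \<Omega>" and bounded_domain: "bounded \<Omega>"
  and interior_closure_domain: "interior (closure \<Omega>) = \<Omega>"
  using domain by (auto simp: polytopal_domain_def)

lemma finite_mesh: "finite T" and Union_mesh: "\<Union>T = closure \<Omega>"
  using partition by (auto simp: fe_partition_def)

lemma image_cube: "E \<in> T \<Longrightarrow> F E ` ref_cube = E"
  using partition by (auto simp: fe_partition_def bij_betw_def)

lemma element: "E \<in> T \<Longrightarrow> element (F E)"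
  using partition jac_invertible by unfold_locales (auto simp: fe_partition_def bij_betw_def)

abbreviation cell where "cell E \<equiv> F E ` box (-1) 1"

lemma open_cell: "E \<in> T \<Longrightarrow> open (cell E)" using element.open_cell[OF element] .

lemma cell_subset_element: "E \<in> T \<Longrightarrow> cell E \<subseteq> E"
  using element.cell_subset[OF element] image_cube by blast

lemma closure_cell: "E \<in> T \<Longrightarrow> closure (cell E) = E"
  using element.closure_cell[OF element] image_cube by simp

lemma cell_subset_interior: "E \<in> T \<Longrightarrow> cell E \<subseteq> interior E"
  using open_cell cell_subset_element by (simp add: interior_maximal)

lemma element_subset_closure: "E \<in> T \<Longrightarrow> E \<subseteq> closure \<Omega>" using Union_mesh by blast

lemma cell_subset_domain: "E \<in> T \<Longrightarrow> cell E \<subseteq> \<Omega>"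
  using cell_subset_interior interior_mono[OF element_subset_closure] interior_closure_domain by blast

lemma cells_disjoint: "E \<in> T \<Longrightarrow> E' \<in> T \<Longrightarrow> E \<noteq> E' \<Longrightarrow> cell E \<inter> cell E' = {}"
  using cell_subset_interior partition unfolding fe_partition_def by blast

lemma cell_disjoint_element: "E \<in> T \<Longrightarrow> E' \<in> T \<Longrightarrow> E \<noteq> E' \<Longrightarrow> cell E \<inter> E' = {}"
  using open_Int_closure_eq_empty[OF open_cell, of E "cell E'"] cells_disjoint closure_cell by simp

lemma closed_element: "E \<in> T \<Longrightarrow> closed E"
  using element.compact_image[OF element] image_cube compact_imp_closed by metis

lemma conforming_elements: "E \<in> T \<Longrightarrow> E' \<in> T \<Longrightarrow> E \<noteq> E' \<Longrightarrow> conforming (F E) (F E')"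
  using partition unfolding fe_partition_def by blast

lemma shared_facet:
  assumes "E \<in> T" "E' \<in> T" "E \<noteq> E'" "s \<in> {-1, 1}" "y \<in> ref_facet_int i s" "F E y \<in> E'"
  shows "\<exists>i' s' \<rho> \<epsilon>. s' \<in> {-1, 1} \<and> bij \<rho> \<and> (\<forall>a. \<epsilon> a \<in> {-1, 1}) \<and>
     (\<forall>x. F E' (set_coord i' s' x) = F E (set_coord i s (signed_perm \<rho> \<epsilon> x)))"
  by (rule common_facet[OF element[OF assms(1)] element[OF assms(2)] conforming_elements[OF assms(1-3)]
        cells_disjoint[OF assms(1-3)] assms(4,5)]) (simp add: image_cube assms)

text \<open>The union of the faces of codimension two of all elements.\<close>

definition skeleton :: "(real^'d::_) set" where
  "skeleton = {x. \<exists>E y i j. E \<in> T \<and> y \<in> ref_cube \<and> i \<noteq> j \<and> \<bar>y $ i\<bar> = 1 \<and> \<bar>y $ j\<bar> = 1 \<and> x = F E y}"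

lemma skeletonI:
  "E \<in> T \<Longrightarrow> y \<in> ref_cube \<Longrightarrow> i \<noteq> j \<Longrightarrow> \<bar>y $ i\<bar> = 1 \<Longrightarrow> \<bar>y $ j\<bar> = 1 \<Longrightarrow> F E y \<in> skeleton"
  unfolding skeleton_def by blast

lemma skeletonE:
  assumes "x \<in> skeleton"
  obtains E y i j where "E \<in> T" "y \<in> ref_cube" "i \<noteq> j" "\<bar>y $ i\<bar> = 1" "\<bar>y $ j\<bar> = 1" "x = F E y"
  using assms unfolding skeleton_def by blast

lemma element_point_cases:
  assumes "E \<in> T" "x \<in> E" "x \<notin> skeleton" "x \<notin> cell E"
  obtains i s y where "s \<in> {-1, 1}" "y \<in> ref_facet_int i s" "x = F E y"
proof -
  obtain y where y: "y \<in> ref_cube" "x = F E y" using assms(1,2) image_cube by blast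
  then have "y \<notin> box (-1) 1" using assms(4) by blast
  then obtain i where "\<not> \<bar>y $ i\<bar> < 1" by (auto simp: mem_ref_box)
  then have i: "\<bar>y $ i\<bar> = 1" using y(1) mem_ref_cube[of y] by (metis less_le)
  have "\<bar>y $ j\<bar> < 1" if "j \<noteq> i" for j
  proof (rule ccontr)
    assume "\<not> \<bar>y $ j\<bar> < 1"
    then have "\<bar>y $ j\<bar> = 1" using y(1) mem_ref_cube[of y] by (metis less_le)
    then show False using skeletonI[OF assms(1) y(1) that _ i] assms(3) y(2) by blast
  qed
  then have "y \<in> ref_facet_int i (y $ i)" using y(1) by (simp add: ref_facet_int_def ref_facet_def)
  then show thesis using that[of "y $ i" y i] i y(2) by (auto simp: abs_if split: if_splits)
qed

text \<open>The cone over a face of codimension two is the image of a hyperplane under a differentiable map: the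
  coordinate i is fixed on the face, and so is the coordinate j, which is free to serve as the parameter
  of the cone.\<close>

lemma negligible_cone:
  "negligible {x. \<exists>t p. p \<in> skeleton \<and> x = a + t *\<^sub>R (p - a)}"
proof -
  let ?c = "\<lambda>E i j c b. (\<lambda>z. a + (z $ j) *\<^sub>R (F E (set_coord j b z) - a)) ` {z::real^'d::_. z $ i = c}"
  let ?I = "{(i, j, c, b). i \<noteq> j \<and> c \<in> {-1, 1::real} \<and> b \<in> {-1, 1::real}} :: ('d \<times> 'd \<times> real \<times> real) set"
  have fin: "finite ?I"
    by (rule finite_subset[of _ "UNIV \<times> UNIV \<times> {-1, 1} \<times> {-1, 1}"]) auto
  have "negligible (?c E i j c b)" if "E \<in> T" for E i j c b
  proof (rule negligible_differentiable_image_negligible[OF order_refl])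
    have "{z::real^'d::_. z $ i = c} = {z. axis i 1 \<bullet> z = c}" by (simp add: inner_axis')
    then show "negligible {z::real^'d::_. z $ i = c}"
      using negligible_hyperplane[of "axis i 1 :: real^'d::_" c] by simp
    have d1: "(\<lambda>z. F E (set_coord j b z)) differentiable at z" for z
      unfolding set_coord_eq
      by (rule differentiable_compose[OF element.differentiable[OF element[OF that]]])
        (intro differentiable_add differentiable_diff differentiable_scaleR differentiable_const
          differentiable_ident bounded_linear_imp_differentiable[OF bounded_linear_vec_nth])
    have d2: "(\<lambda>z::real^'d::_. z $ j) differentiable at z" for z
      by (rule bounded_linear_imp_differentiable[OF bounded_linear_vec_nth])
    show "(\<lambda>z. a + (z $ j) *\<^sub>R (F E (set_coord j b z) - a)) differentiable_on {z. z $ i = c}"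
      unfolding differentiable_on_def
      by (rule ballI, rule differentiable_at_withinI)
        (intro differentiable_add differentiable_const differentiable_scaleR differentiable_diff d1 d2)
  qed
  note neg = this
  have "negligible (\<Union>((\<lambda>(E, i, j, c, b). ?c E i j c b) ` (T \<times> ?I)))"
  proof (rule negligible_Union)
    show "finite ((\<lambda>(E, i, j, c, b). ?c E i j c b) ` (T \<times> ?I))"
      using finite_mesh fin by (intro finite_imageI finite_cartesian_product)
    fix S assume "S \<in> (\<lambda>(E, i, j, c, b). ?c E i j c b) ` (T \<times> ?I)"
    then obtain q where q: "q \<in> T \<times> ?I" "S = (\<lambda>(E, i, j, c, b). ?c E i j c b) q" by (elim imageE)
    obtain E i j c b where "q = (E, i, j, c, b)" by (metis prod_cases5)
    then have "E \<in> T" "S = ?c E i j c b" using q by simp_all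
    then show "negligible S" by (simp only: neg)
  qed
  then show ?thesis
  proof (rule negligible_subset, safe)
    fix t p assume "p \<in> skeleton"
    then obtain E y i j where *: "E \<in> T" "y \<in> ref_cube" "i \<noteq> j" "\<bar>y $ i\<bar> = 1" "\<bar>y $ j\<bar> = 1" "p = F E y"
      by (rule skeletonE)
    have "set_coord j (y $ j) (set_coord j t y) = y" by (auto simp: vec_eq_iff)
    then have "a + t *\<^sub>R (p - a) \<in> ?c E i j (y $ i) (y $ j)"
      using * by (intro image_eqI[of _ _ "set_coord j t y"]) auto
    moreover have "?c E i j (y $ i) (y $ j) \<in> (\<lambda>(E, i, j, c, b). ?c E i j c b) ` (T \<times> ?I)"
      using * by (intro image_eqI[of _ _ "(E, i, j, y $ i, y $ j)"]) (auto simp: abs_if split: if_splits)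
    ultimately show "a + t *\<^sub>R (p - a) \<in> \<Union>((\<lambda>(E, i, j, c, b). ?c E i j c b) ` (T \<times> ?I))"
      by (rule UnionI[rotated])
  qed
qed

lemma skeleton_disjoint_cell: "E \<in> T \<Longrightarrow> cell E \<inter> skeleton = {}"
proof (rule ccontr)
  assume E: "E \<in> T" and "cell E \<inter> skeleton \<noteq> {}"
  then obtain x where xc: "x \<in> cell E" "x \<in> skeleton" by blast
  from xc(2) obtain E' y i j where x: "E' \<in> T" "y \<in> ref_cube" "i \<noteq> j" "\<bar>y $ i\<bar> = 1" "\<bar>y $ j\<bar> = 1" "x = F E' y"
    by (rule skeletonE)
  show False
  proof (cases "E = E'")
    case True
    then obtain z where z: "z \<in> box (-1) 1" "F E z = F E y" using xc(1) x(6) by (metis imageE)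
    then have "z \<in> ref_cube" using ref_box_subset by blast
    then have "z = y" using inj_onD[OF element.inj[OF element[OF E]] z(2)] x(2) by blast
    then have "\<bar>y $ i\<bar> < 1" using z(1) mem_ref_box by blast
    then show False using x(4) by simp
  next
    case False
    have "x \<in> E'" using x(2,6) image_cube[OF x(1)] by blast
    then show False using cell_disjoint_element[OF E x(1) False] xc(1) by blast
  qed
qed

text \<open>The domain is connected through facets: a generic segment between two cells avoids the skeleton
  of codimension two, since the cone over the skeleton is a null set.\<close>

lemma facet_connected:
  assumes A: "A \<subseteq> T" "A \<noteq> {}" "A \<noteq> T"
  shows "\<exists>E\<in>A. \<exists>E'\<in>T - A. \<exists>i s y. s \<in> {-1, 1} \<and> y \<in> ref_facet_int i s \<and> F E y \<in> E'"
proof -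
  let ?A = "\<Union>A" and ?B = "\<Union>(T - A)"
  have fin: "finite A" "finite (T - A)" using A(1) finite_mesh finite_subset by auto
  have closed: "closed ?A" "closed ?B" using fin closed_element A(1) by (auto intro!: closed_Union)
  have cover: "\<Omega> \<subseteq> ?A \<union> ?B" using closure_subset[of \<Omega>] Union_mesh A(1) by blast
  have meetA: "\<Union>A' \<inter> \<Omega> \<noteq> {}" if "A' \<subseteq> T" and ne: "A' \<noteq> {}" for A'
  proof -
    obtain E where "E \<in> A'" using ne by blast
    then have ET: "E \<in> T" using \<open>A' \<subseteq> T\<close> by blast
    obtain x where "x \<in> cell E" using element.cell_nonempty[OF element[OF ET]] by blast
    then have "x \<in> E" "x \<in> \<Omega>" using cell_subset_element[OF ET] cell_subset_domain[OF ET] by auto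
    then show ?thesis using \<open>E \<in> A'\<close> by blast
  qed
  have "?A \<inter> ?B \<inter> \<Omega> \<noteq> {}"
  proof
    assume "?A \<inter> ?B \<inter> \<Omega> = {}"
    then have "?A \<inter> \<Omega> = {} \<or> ?B \<inter> \<Omega> = {}"
      by (rule connected_closedD[OF connected_domain _ cover closed])
    then show False using meetA[of A] meetA[of "T - A"] A by blast
  qed
  then obtain x E E' where x: "x \<in> \<Omega>" "E \<in> A" "x \<in> E" "E' \<in> T - A" "x \<in> E'" by blast
  obtain r where r: "r > 0" "ball x r \<subseteq> \<Omega>" using open_domain x(1) open_contains_ball by blast
  have ET: "E \<in> T" "E' \<in> T" using x A(1) by auto
  have near: "ball x r \<inter> cell E1 \<noteq> {}" if "x \<in> E1" "E1 \<in> T" for E1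
    using open_Int_closure_eq_empty[of "ball x r" "cell E1"] closure_cell[OF that(2)] that(1) r(1)
    by (metis IntI centre_in_ball empty_iff open_ball)
  obtain a where a: "a \<in> ball x r" "a \<in> cell E" using near[OF x(3) ET(1)] by blast
  have "open (ball x r \<inter> cell E')" "ball x r \<inter> cell E' \<noteq> {}"
    using open_cell[OF ET(2)] near[OF x(5) ET(2)] by auto
  then have "\<not> negligible (ball x r \<inter> cell E')" by (rule open_not_negligible)
  then have "\<not> (ball x r \<inter> cell E') \<subseteq> {x. \<exists>t p. p \<in> skeleton \<and> x = a + t *\<^sub>R (p - a)}"
    using negligible_cone negligible_subset by blast
  then obtain b where b: "b \<in> ball x r" "b \<in> cell E'" "\<And>t p. p \<in> skeleton \<Longrightarrow> b \<noteq> a + t *\<^sub>R (p - a)" by blast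
  let ?S = "closed_segment a b"
  have S\<Omega>: "?S \<subseteq> \<Omega>" using r(2) a(1) b(1) closed_segment_subset[OF a(1) b(1) convex_ball] by blast
  have Ssk: "p \<notin> skeleton" if p: "p \<in> ?S" for p
  proof
    assume sk: "p \<in> skeleton"
    obtain u where u: "0 \<le> u" "u \<le> 1" "p = (1 - u) *\<^sub>R a + u *\<^sub>R b" using p by (auto simp: in_segment)
    show False
    proof (cases "u = 0")
      case True
      then show False using u sk a(2) skeleton_disjoint_cell[OF ET(1)] by auto
    next
      case False
      have "p - a = u *\<^sub>R (b - a)" using u(3) by (simp add: algebra_simps)
      then have "b = a + (1 / u) *\<^sub>R (p - a)" using False by simp
      then show False using b(3)[OF sk] by blast
    qed
  qed
  have "?A \<inter> ?B \<inter> ?S \<noteq> {}"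
  proof
    assume "?A \<inter> ?B \<inter> ?S = {}"
    then have "?A \<inter> ?S = {} \<or> ?B \<inter> ?S = {}"
      using cover S\<Omega> by (intro connected_closedD[OF connected_segment _ _ closed]) auto
    moreover have "a \<in> E" "b \<in> E'"
      using a(2) b(2) cell_subset_element[OF ET(1)] cell_subset_element[OF ET(2)] by auto
    then have "a \<in> ?A" "b \<in> ?B" using x by auto
    moreover have "a \<in> ?S" "b \<in> ?S" by auto
    ultimately show False by blast
  qed
  then obtain z E1 E2 where z: "z \<in> ?S" "E1 \<in> A" "z \<in> E1" "E2 \<in> T - A" "z \<in> E2" by blast
  have E12: "E1 \<in> T" "E2 \<in> T" "E1 \<noteq> E2" using z A(1) by auto
  have "z \<notin> cell E1" using cell_disjoint_element[OF E12] z by blast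
  then obtain i s y where "s \<in> {-1, 1}" "y \<in> ref_facet_int i s" "z = F E1 y"
    by (rule element_point_cases[OF E12(1) z(3) Ssk[OF z(1)]])
  then show ?thesis using z by blast
qed

text \<open>A point x of the boundary off the skeleton lies in the relative interior of a facet. If this facet
  had a point inside the domain, then so would its relative interior, and there a second element would
  have to meet it. This element shares the facet, so both together fill a neighbourhood of x, and x would
  be an interior point of the closed domain.\<close>

lemma boundary_facet:
  assumes x: "x \<in> frontier \<Omega>" "x \<notin> skeleton"
  shows "\<exists>E\<in>T. \<exists>i s y. s \<in> {-1, 1} \<and> y \<in> ref_facet_int i s \<and> x = F E y \<and> F E ` ref_facet i s \<subseteq> frontier \<Omega>"
proof -
  have x\<Omega>: "x \<notin> \<Omega>" "x \<in> closure \<Omega>" using x(1) open_domain by (auto simp: frontier_def interior_open)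
  then obtain E where E: "E \<in> T" "x \<in> E" using Union_mesh by blast
  have "x \<notin> cell E" using cell_subset_domain[OF E(1)] x\<Omega> by blast
  then obtain i s y where y: "s \<in> {-1, 1}" "y \<in> ref_facet_int i s" "x = F E y"
    by (rule element_point_cases[OF E x(2)])
  interpret E: element "F E" by (rule element[OF E(1)])
  have "F E ` ref_facet i s \<subseteq> frontier \<Omega>"
  proof (rule ccontr)
    assume "\<not> F E ` ref_facet i s \<subseteq> frontier \<Omega>"
    moreover have "F E ` ref_facet i s \<subseteq> closure \<Omega>"
      using element_subset_closure[OF E(1)] image_cube[OF E(1)] by (auto simp: ref_facet_def)
    ultimately obtain z where z: "z \<in> ref_facet i s" "F E z \<in> \<Omega>"
      using open_domain by (auto simp: frontier_def interior_open)
    \<comment> \<open>Moving z slightly, it becomes a relatively interior point of the facet.\<close>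
    have "open (F E -` \<Omega>)" by (rule open_vimage[OF open_domain E.continuous])
    moreover have "z \<in> F E -` \<Omega>" using z by simp
    ultimately obtain e where e: "e > 0" "ball z e \<subseteq> F E -` \<Omega>" using open_contains_ball by metis
    have zc: "z \<in> ref_cube" "z $ i = s" using z by (auto simp: ref_facet_def)
    define t where "t = min 1 (e / (2 * (norm (y - z) + 1)))"
    have t: "0 < t" "t \<le> 1" using e(1) by (auto simp: t_def add_nonneg_pos)
    let ?z = "z + t *\<^sub>R (y - z)"
    have "t * norm (y - z) < e"
    proof -
      have "t * norm (y - z) \<le> (e / (2 * (norm (y - z) + 1))) * norm (y - z)"
        by (intro mult_right_mono) (auto simp: t_def)
      also have "\<dots> < e"
        by (rule scaled_less[OF norm_ge_zero e(1)])
      finally show ?thesis .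
    qed
    then have "?z \<in> ball z e" using t by (simp add: dist_norm)
    then have z\<Omega>: "F E ?z \<in> \<Omega>" using e(2) by blast
    have yc: "y \<in> ref_cube" "y $ i = s" "\<And>j. j \<noteq> i \<Longrightarrow> \<bar>y $ j\<bar> < 1"
      using y(2) by (auto simp: ref_facet_int_def ref_facet_def)
    have zi: "?z $ i = s" using zc yc by simp
    have zj: "\<bar>?z $ j\<bar> < 1" if "j \<noteq> i" for j
    proof -
      have "\<bar>?z $ j\<bar> = \<bar>(1 - t) * z $ j + t * y $ j\<bar>" by (simp add: algebra_simps)
      also have "\<dots> \<le> (1 - t) * \<bar>z $ j\<bar> + t * \<bar>y $ j\<bar>"
        using t by (intro order_trans[OF abs_triangle_ineq]) (simp add: abs_mult)
      also have "\<dots> < (1 - t) * 1 + t * 1"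
        using t zc(1) yc(3)[OF that] by (intro add_le_less_mono mult_left_mono mult_strict_left_mono) (auto simp: mem_ref_cube)
      finally show ?thesis by simp
    qed
    have "\<bar>?z $ j\<bar> \<le> 1" for j
      using zi zj[of j] y(1) by (cases "j = i") auto
    then have zint: "?z \<in> ref_facet_int i s"
      using zi zj unfolding ref_facet_int_def ref_facet_def mem_ref_cube by blast
    have z_cube: "?z \<in> ref_cube" using zint by (auto simp: ref_facet_int_def ref_facet_def)
    have "\<exists>E'\<in>T. E' \<noteq> E \<and> F E ?z \<in> E'"
    proof (rule ccontr)
      assume none: "\<not> (\<exists>E'\<in>T. E' \<noteq> E \<and> F E ?z \<in> E')"
      let ?U = "\<Omega> - \<Union>(T - {E})"
      have "open ?U" using finite_mesh closed_element by (intro open_Diff open_domain closed_Union) auto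
      moreover have "F E ?z \<in> ?U" using none z\<Omega> by blast
      moreover have "?U \<subseteq> E" using closure_subset[of \<Omega>] Union_mesh by blast
      ultimately have "F E ?z \<in> interior (F E ` ref_cube)" unfolding image_cube[OF E(1)] interior_def by blast
      then have "?z \<in> box (-1) 1" using E.boundary_not_interior[OF z_cube] by blast
      then show False using zi y(1) unfolding mem_ref_box by (auto dest!: spec[of _ i])
    qed
    then obtain E' where E': "E' \<in> T" "E \<noteq> E'" "F E ?z \<in> E'" by blast
    from shared_facet[OF E(1) E'(1,2) y(1) zint E'(3)] obtain i' s' \<rho> \<epsilon> where
      sf: "s' \<in> {-1, 1}" "bij \<rho>" "\<forall>a. \<epsilon> a \<in> {-1, 1}"
        "\<forall>x. F E' (set_coord i' s' x) = F E (set_coord i s (signed_perm \<rho> \<epsilon> x))" by blast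
    have "F E y \<in> interior (F E ` ref_cube \<union> F E' ` ref_cube)"
      by (rule common_facet_nbhd[OF element[OF E(1)] element[OF E'(1)] cells_disjoint[OF E(1) E'(1,2)] y(1) sf(1)
            common_facet_images[OF y(1) sf] y(2)])
    then have "x \<in> interior (E \<union> E')" using y(3) by (simp add: image_cube E(1) E'(1))
    then have "x \<in> interior (closure \<Omega>)"
      using interior_mono[of "E \<union> E'" "closure \<Omega>"] element_subset_closure E(1) E'(1) by blast
    then show False using interior_closure_domain x\<Omega> by simp
  qed
  then show ?thesis using E y by blast
qed

end

section \<open>Discrete pressures orthogonal to all divergences\<close>

lemma L2_sum: "(\<And>i. i \<in> I \<Longrightarrow> L2 M (f i)) \<Longrightarrow> L2 M (\<lambda>x. \<Sum>i\<in>I. f i x)"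
  by (induction I rule: infinite_finite_induct) (auto intro: L2_add simp: L2_zero)

text \<open>For \<open>s = 1\<close> or \<open>s = - 1\<close> the field \<open>c (s + y\<^sub>i) / 2\<close> in direction i has no flux except through the facet
  \<open>y\<^sub>i = s\<close>.\<close>

lemma ref_facet_function_RT:
  "(\<lambda>y. axis i (c * (s + y $ i) / 2)) \<in> RT m"
  unfolding RT_def
proof (intro CollectI allI)
  fix j
  show "\<exists>a\<in>Qpoly m. \<exists>b\<in>Qpoly m. \<forall>x. axis i (c * (s + x $ i) / 2) $ j = a x + x $ j * b x"
    by (rule bexI[of _ "\<lambda>x. if j = i then c * s / 2 else 0"], rule bexI[of _ "\<lambda>x. if j = i then c / 2 else 0"])
      (auto simp: axis_def algebra_simps add_divide_distrib Qpoly_const)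
qed

lemma Qpoly_coord: "(\<lambda>y. y $ i) \<in> Qpoly 1"
  using Qpoly_mult_coord[OF Qpoly_const[of 1 0], of i] by simp

lemma ref_facet_function_Qpoly: "(\<lambda>y. c * (s + y $ i) / 2) \<in> Qpoly 1"
proof -
  have "(\<lambda>y::real^'a. c * s / 2 + c / 2 * y $ i) \<in> Qpoly 1"
    by (intro Qpoly_add Qpoly_const Qpoly_cmult Qpoly_coord)
  then show ?thesis by (simp add: algebra_simps add_divide_distrib)
qed

lemma ref_facet_function_pd: "pd i (\<lambda>y. c * (s + y $ i) / 2) y = c / 2"
proof -
  have "((\<lambda>y. c * (s + y $ i) / 2) has_derivative (\<lambda>h. c * (h $ i) / 2)) (at y)"
    by (auto intro!: derivative_eq_intros bounded_linear.has_derivative[OF bounded_linear_vec_nth])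
  from pd_eqI[OF this] show ?thesis by simp
qed

text \<open>The bubble \<open>(1 - y\<^sub>i\<^sup>2) \<partial>\<^sub>i w\<close> has degree at most m + 1 in \<open>y\<^sub>i\<close> and m in the other variables, as the
  Raviart-Thomas space permits.\<close>

lemma bubble_decomposition:
  assumes "w \<in> Qpoly m"
  obtains b where "b \<in> Qpoly m" "\<And>y. (1 - (y $ i)\<^sup>2) * pd i w y = pd i w y + y $ i * b y"
proof -
  obtain c where c: "w = (\<lambda>x. \<Sum>\<alpha> | \<forall>i. \<alpha> i \<le> m. c \<alpha> * monom_fun \<alpha> x)" by (rule QpolyE[OF assms])
  have pdw: "pd i w y = (\<Sum>\<alpha> | \<forall>i. \<alpha> i \<le> m. c \<alpha> * (real (\<alpha> i) * monom_fun (\<alpha>(i := \<alpha> i - 1)) y))" for y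
    unfolding c by (rule pd_poly)
  let ?b = "\<lambda>y. \<Sum>\<alpha> | \<forall>i. \<alpha> i \<le> m. - (c \<alpha> * real (\<alpha> i)) * monom_fun \<alpha> y"
  have "y $ i * (real (\<alpha> i) * monom_fun (\<alpha>(i := \<alpha> i - 1)) y) = real (\<alpha> i) * monom_fun \<alpha> y" for \<alpha> and y :: "real^'a"
  proof (cases "\<alpha> i = 0")
    case False
    then have "y $ i * monom_fun (\<alpha>(i := \<alpha> i - 1)) y = monom_fun \<alpha> y"
      by (subst monom_fun_mult_coord) (simp add: fun_upd_idem)
    then show ?thesis by (metis mult.left_commute)
  qed simp
  then have t: "y $ i * (c \<alpha> * (real (\<alpha> i) * monom_fun (\<alpha>(i := \<alpha> i - 1)) y)) = (c \<alpha> * real (\<alpha> i)) * monom_fun \<alpha> y" for \<alpha> y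
    by (metis mult.assoc mult.left_commute)
  have "y $ i * pd i w y = - ?b y" for y
  proof -
    have "y $ i * pd i w y = (\<Sum>\<alpha> | \<forall>i. \<alpha> i \<le> m. (c \<alpha> * real (\<alpha> i)) * monom_fun \<alpha> y)"
      unfolding pdw sum_distrib_left by (intro sum.cong refl t)
    also have "\<dots> = - ?b y" by (simp add: sum_negf)
    finally show ?thesis .
  qed
  then have "(1 - (y $ i)\<^sup>2) * pd i w y = pd i w y + y $ i * ?b y" for y
    by (simp add: algebra_simps power2_eq_square)
  moreover have "?b \<in> Qpoly m" by (intro Qpoly_sum Qpoly_cmult Qpoly_monom) auto
  ultimately show thesis using that by blast
qed

lemma bubble_RT:
  assumes "w \<in> Qpoly m"
  shows "(\<lambda>y. axis i ((1 - (y $ i)\<^sup>2) * pd i w y)) \<in> RT m" "(\<lambda>y. (1 - (y $ i)\<^sup>2) * pd i w y) \<in> Qpoly (Suc m)"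
proof -
  obtain b where b: "b \<in> Qpoly m" "\<And>y. (1 - (y $ i)\<^sup>2) * pd i w y = pd i w y + y $ i * b y"
    using bubble_decomposition[OF assms, where i=i] by blast
  show "(\<lambda>y. axis i ((1 - (y $ i)\<^sup>2) * pd i w y)) \<in> RT m"
    unfolding RT_def b(2)
  proof (intro CollectI allI)
    fix j
    show "\<exists>a\<in>Qpoly m. \<exists>b'\<in>Qpoly m. \<forall>x. axis i (pd i w x + x $ i * b x) $ j = a x + x $ j * b' x"
    proof (cases "j = i")
      case True
      then show ?thesis using b(1) Qpoly_pd[OF assms, of i]
        by (intro bexI[of _ "pd i w"] bexI[of _ b]) auto
    next
      case False
      then show ?thesis
        by (intro bexI[of _ "\<lambda>x. 0"] bexI[of _ "\<lambda>x. 0"]) (auto simp: axis_def Qpoly_const)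
    qed
  qed
  show "(\<lambda>y. (1 - (y $ i)\<^sup>2) * pd i w y) \<in> Qpoly (Suc m)"
    unfolding b(2) by (intro Qpoly_add Qpoly_mult_coord b Qpoly_mono[OF Qpoly_pd[OF assms]]) simp
qed

text \<open>The bubble vanishes where \<open>y\<^sub>i = 1\<close> or \<open>y\<^sub>i = - 1\<close>, so integration by parts has no boundary term and
  turns the condition into \<open>\<integral> (1 - y\<^sub>i\<^sup>2) (\<partial>\<^sub>i w)\<^sup>2 = 0\<close>.\<close>

lemma constant_if_orthogonal_to_bubbles:
  assumes w: "w \<in> Qpoly m"
    and orth: "\<And>i. integral ref_cube (\<lambda>y. pd i (\<lambda>y. (1 - (y $ i)\<^sup>2) * pd i w y) y * w y) = 0"
  obtains c where "\<And>y. y \<in> ref_cube \<Longrightarrow> w y = c"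
proof -
  have cw: "continuous_on S w" "continuous_on S (pd i w)" for S i
    using Qpoly_continuous[OF w] Qpoly_continuous[OF Qpoly_pd[OF w]] by auto
  have "pd i w y = 0" if y: "y \<in> box (-1) 1" for i y
  proof -
    let ?b = "\<lambda>y. (1 - (y $ i)\<^sup>2) * pd i w y"
    note bQ = bubble_RT(2)[OF w, of i]
    have cb: "continuous_on S ?b" "continuous_on S (pd i ?b)" for S
      using Qpoly_continuous[OF bQ] Qpoly_continuous[OF Qpoly_pd[OF bQ]] by auto
    let ?g = "\<lambda>y. ?b y * w y" and ?g' = "\<lambda>y. ?b y * pd i w y + pd i ?b y * w y"
    have "integral ref_cube ?g' = (1/2) * integral ref_cube (\<lambda>x. ?g (set_coord i 1 x) - ?g (set_coord i (-1) x))"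
    proof (rule integral_partial_derivative)
      show "continuous_on UNIV ?g" "continuous_on UNIV ?g'" by (intro continuous_intros cb cw)+
      fix x t
      have D: "(?g has_derivative (\<lambda>h. ?b y * (h \<bullet> grad w y) + (h \<bullet> grad ?b y) * w y)) (at y)" for y
        by (intro has_derivative_mult has_derivative_grad Qpoly_differentiable[OF bQ] Qpoly_differentiable[OF w])
      have "((\<lambda>t. set_coord i t x) has_derivative (\<lambda>t. t *\<^sub>R axis i 1)) (at t)"
        unfolding set_coord_eq by (auto intro!: derivative_eq_intros)
      from has_derivative_compose[OF this D]
      show "((\<lambda>t. ?g (set_coord i t x)) has_real_derivative ?g' (set_coord i t x)) (at t)"
        unfolding has_field_derivative_def
        by (rule has_derivative_eq_rhs) (auto simp: fun_eq_iff grad_def inner_axis' algebra_simps)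
    qed
    also have "\<dots> = 0" by simp
    finally have "integral ref_cube (\<lambda>y. ?b y * pd i w y) + integral ref_cube (\<lambda>y. pd i ?b y * w y) = 0"
      by (subst Henstock_Kurzweil_Integration.integral_add[symmetric])
        (auto simp: ref_cube_def intro!: integrable_continuous continuous_intros cb cw)
    then have 0: "integral ref_cube (\<lambda>y. ?b y * pd i w y) = 0" using orth[of i] by simp
    have c2: "continuous_on ref_cube (\<lambda>y. ?b y * pd i w y)" by (intro continuous_intros cb cw)
    have nn: "0 \<le> ?b y * pd i w y" if "y \<in> ref_cube" for y
    proof -
      have "(y $ i)\<^sup>2 \<le> 1" using that by (simp add: mem_ref_cube abs_square_le_1)
      then have "0 \<le> (1 - (y $ i)\<^sup>2) * (pd i w y)\<^sup>2" by simp
      then show ?thesis by (simp add: power2_eq_square mult.assoc)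
    qed
    have "((\<lambda>y. ?b y * pd i w y) has_integral 0) ref_cube"
      using 0 integrable_integral[of "\<lambda>y. ?b y * pd i w y" ref_cube] integrable_continuous[of "-1" 1 "\<lambda>y. ?b y * pd i w y"] c2
      by (simp add: ref_cube_def)
    then have "?b y * pd i w y = 0"
      using has_integral_0_cbox_imp_0[of "-1" 1 "\<lambda>y. ?b y * pd i w y" y] c2 nn y ref_box_subset ref_box_nonempty
      by (auto simp: ref_cube_def)
    moreover have "(y $ i)\<^sup>2 < 1" using y by (simp add: mem_ref_box abs_square_less_1)
    ultimately show ?thesis by simp
  qed
  then have "(w has_derivative (\<lambda>h. 0)) (at y within box (-1) 1)" if "y \<in> box (-1) 1" for y
    using has_derivative_at_withinI[OF has_derivative_grad[OF Qpoly_differentiable[OF w, of y]], of "box (-1) 1"] that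
    by (simp add: grad_def inner_vec_def)
  then obtain c where c: "\<And>y. y \<in> box (-1) 1 \<Longrightarrow> w y = c"
    using has_derivative_zero_constant[OF convex_box(2), of "-1" 1 w] by blast
  have "closure (box (-1) 1) \<subseteq> {y. w y = c}"
    by (rule closure_minimal) (use c in \<open>auto intro!: closed_Collect_eq cw continuous_on_const\<close>)
  then show thesis using that unfolding closure_ref_box by blast
qed

context mesh
begin

lemma AE_mesh:
  assumes "\<And>E. E \<in> T \<Longrightarrow> AE x in lebesgue_on E. P x"
  shows "AE x in lebesgue_on \<Omega>. P x"
proof -
  have EM: "E \<in> sets lebesgue" if "E \<in> T" for E
    using closed_element[OF that] by (simp add: borel_closed)
  have "AE x in lebesgue. \<forall>E\<in>T. x \<in> E \<longrightarrow> P x"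
    using assms EM finite_mesh by (intro AE_finite_allI) (auto simp: AE_restrict_space_iff)
  then have "AE x in lebesgue. x \<in> \<Omega> \<longrightarrow> P x"
    by eventually_elim (use closure_subset[of \<Omega>] Union_mesh in blast)
  then show ?thesis using open_domain by (simp add: AE_restrict_space_iff borel_open)
qed

lemma AE_element_cell:
  assumes "E \<in> T" "\<And>x. x \<in> cell E \<Longrightarrow> P x"
  shows "AE x in lebesgue_on E. P x"
proof -
  have EM: "E \<in> sets lebesgue" using closed_element[OF assms(1)] by (simp add: borel_closed)
  have "negligible (E - cell E)"
    using element.negligible_boundary[OF element[OF assms(1)]] image_cube[OF assms(1)] by simp
  then have "AE x in lebesgue. x \<notin> E - cell E"
    by (intro AE_not_in) (simp add: negligible_iff_null_sets)
  then have "AE x in lebesgue. x \<in> E \<longrightarrow> P x" by eventually_elim (use assms(2) in blast)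
  then show ?thesis using EM by (simp add: AE_restrict_space_iff)
qed

abbreviation cell_field where "cell_field E \<equiv> element.cell_field (F E)"
abbreviation transport where "transport E \<equiv> element.transport (F E)"

lemma cell_field_outside: "E \<in> T \<Longrightarrow> x \<notin> cell E \<Longrightarrow> cell_field E vh x = 0"
  by (simp add: element.cell_field_def[OF element])

text \<open>A field composed of one transported component per element satisfies Green's formula with the sum R of
  the facet integrals as boundary term, so it is a discrete velocity if these cancel.\<close>

lemma composed_field:
  fixes b :: "(real^'d::_) set \<Rightarrow> real^'d::_ \<Rightarrow> real" and dir :: "(real^'d::_) set \<Rightarrow> 'd"
  assumes A: "A \<subseteq> T" and b: "\<And>E. E \<in> A \<Longrightarrow> b E \<in> Qpoly n"
    and V: "\<And>E. E \<in> A \<Longrightarrow> (\<lambda>y. axis (dir E) (b E y)) \<in> Vhat" and V0: "(\<lambda>y. 0) \<in> Vhat"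
    and R: "\<And>\<phi>. R \<phi> = (\<Sum>E\<in>A. element.facet_integral (F E) (dir E) 1 (b E) \<phi>
        - element.facet_integral (F E) (dir E) (-1) (b E) \<phi>)"
    and test: "\<And>\<phi>. test_function \<Omega> \<phi> \<Longrightarrow> R \<phi> = 0"
    and trace: "\<And>\<phi> U. smooth \<phi> \<Longrightarrow> open U \<Longrightarrow> frontier \<Omega> - \<Gamma>N \<subseteq> U \<Longrightarrow> \<forall>x\<in>U. \<phi> x = 0 \<Longrightarrow> R \<phi> = 0"
    and w: "L2 (lebesgue_on \<Omega>) w" and wh: "\<And>E. E \<in> A \<Longrightarrow> continuous_on ref_cube (wh E)"
    and w_wh: "\<And>E. E \<in> A \<Longrightarrow> AE x in lebesgue_on E. w x = wh E (inv_into ref_cube (F E) x)"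
  shows "\<exists>v\<in>Vh Vhat \<Omega> \<Gamma>N T F. L2_inner (lebesgue_on \<Omega>) (weak_div \<Omega> v) w =
     (\<Sum>E\<in>A. integral ref_cube (\<lambda>y. pd (dir E) (b E) y * wh E y))"
proof -
  let ?v = "\<lambda>x. \<Sum>E\<in>A. cell_field E (\<lambda>y. axis (dir E) (b E y)) x"
  let ?\<psi> = "\<lambda>x. \<Sum>E\<in>A. transport E (pd (dir E) (b E)) x"
  have finA: "finite A" using A finite_mesh finite_subset by blast
  have AT: "E \<in> T" if "E \<in> A" for E using that A by blast
  have cb: "continuous_on S (b E)" "continuous_on S (pd i (b E))" if "E \<in> A" for E S i
    using Qpoly_continuous[OF b[OF that]] Qpoly_continuous[OF Qpoly_pd[OF b[OF that]]] by auto
  have cab: "continuous_on S (\<lambda>y. axis (dir E) (b E y))" if "E \<in> A" for E and S :: "(real^'d::_) set"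
  proof -
    have eq: "(\<lambda>y. axis (dir E) (b E y)) = (\<lambda>y. b E y *\<^sub>R axis (dir E) 1)" by (auto simp: vec_eq_iff axis_def)
    show ?thesis unfolding eq by (intro continuous_on_scaleR cb(1)[OF that] continuous_on_const)
  qed
  have Lv: "L2 (lebesgue_on \<Omega>) ?v"
    by (intro L2_sum element.L2_cell_field[OF element[OF AT]] cab open_domain bounded_domain)
  have L\<psi>E: "L2 (lebesgue_on \<Omega>) (transport E (pd (dir E) (b E)))" if "E \<in> A" for E
    by (intro element.L2_transport[OF element[OF AT[OF that]]] cb[OF that] open_domain bounded_domain)
  have L\<psi>: "L2 (lebesgue_on \<Omega>) ?\<psi>" by (intro L2_sum L\<psi>E)
  have green: "(\<integral>x. ?v x \<bullet> grad \<phi> x + ?\<psi> x * \<phi> x \<partial>lebesgue_on \<Omega>) = R \<phi>" if \<phi>: "smooth \<phi>" for \<phi>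
  proof -
    have "(\<integral>x. ?v x \<bullet> grad \<phi> x + ?\<psi> x * \<phi> x \<partial>lebesgue_on \<Omega>) =
       (\<integral>x. (\<Sum>E\<in>A. cell_field E (\<lambda>y. axis (dir E) (b E y)) x \<bullet> grad \<phi> x
          + transport E (pd (dir E) (b E)) x * \<phi> x) \<partial>lebesgue_on \<Omega>)"
      by (simp add: inner_sum_left sum_distrib_right sum.distrib)
    also have "\<dots> = (\<Sum>E\<in>A. \<integral>x. cell_field E (\<lambda>y. axis (dir E) (b E y)) x \<bullet> grad \<phi> x
          + transport E (pd (dir E) (b E)) x * \<phi> x \<partial>lebesgue_on \<Omega>)"
      by (intro Bochner_Integration.integral_sum element.green_cell(1)[OF element[OF AT] b \<phi> open_domain cell_subset_domain[OF AT]])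
    also have "\<dots> = R \<phi>" unfolding R
      by (intro sum.cong refl element.green_cell(2)[OF element[OF AT] b \<phi> open_domain cell_subset_domain[OF AT]])
    finally show ?thesis .
  qed
  have vs: "?v \<in> vel_space \<Omega> \<Gamma>N" "AE x in lebesgue_on \<Omega>. weak_div \<Omega> ?v x = ?\<psi> x"
    by (rule vel_spaceI[OF open_domain bounded_domain Lv L\<psi> green test trace]; assumption)+
  have "?v \<in> Vh Vhat \<Omega> \<Gamma>N T F"
    unfolding Vh_def
  proof (intro CollectI conjI ballI vs(1))
    fix E assume E: "E \<in> T"
    let ?vh = "if E \<in> A then (\<lambda>y. axis (dir E) (b E y)) else (\<lambda>y. 0)"
    have vh: "?vh \<in> Vhat" using V V0 by auto
    have vv: "?v x = piola (F E) ?vh x" if x: "x \<in> cell E" for x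
    proof -
      have out: "cell_field E' (\<lambda>y. axis (dir E') (b E' y)) x = 0" if "E' \<in> A" "E' \<noteq> E" for E'
        using cells_disjoint[OF AT[OF that(1)] E that(2)] x by (intro cell_field_outside AT that) blast
      show ?thesis
      proof (cases "E \<in> A")
        case True
        have "?v x = cell_field E (\<lambda>y. axis (dir E) (b E y)) x"
          using True out finA by (subst sum.remove[of _ E]) (auto intro!: sum.neutral)
        then show ?thesis using True x by (simp add: element.cell_field_def[OF element[OF E]])
      next
        case False
        then have "?v x = 0" using out by (intro sum.neutral ballI) auto
        then show ?thesis using False by (simp add: piola_def Let_def)
      qed
    qed
    show "\<exists>vh\<in>Vhat. AE x in lebesgue_on E. ?v x = piola (F E) vh x"
      by (rule bexI[OF _ vh], rule AE_element_cell[OF E]) (rule vv)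
  qed
  moreover have "L2_inner (lebesgue_on \<Omega>) (weak_div \<Omega> ?v) w = L2_inner (lebesgue_on \<Omega>) ?\<psi> w"
  proof (rule L2_inner_cong_AE[OF vs(2)])
    have "?v \<in> Hdiv \<Omega>" using vs(1) by (simp add: vel_space_def)
    then show "weak_div \<Omega> ?v \<in> borel_measurable (lebesgue_on \<Omega>)"
      using weak_div_L2[OF open_domain bounded_domain] L2_measurable by blast
  qed (use L\<psi> w L2_measurable in auto)
  moreover have "L2_inner (lebesgue_on \<Omega>) ?\<psi> w = (\<Sum>E\<in>A. L2_inner (lebesgue_on \<Omega>) (transport E (pd (dir E) (b E))) w)"
    unfolding L2_inner_def sum_distrib_right
    by (intro Bochner_Integration.integral_sum L2_mult_integrable L\<psi>E w)
  moreover have "\<dots> = (\<Sum>E\<in>A. integral ref_cube (\<lambda>y. pd (dir E) (b E) y * wh E y))"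
  proof (intro sum.cong refl)
    fix E assume E: "E \<in> A"
    show "L2_inner (lebesgue_on \<Omega>) (transport E (pd (dir E) (b E))) w =
        integral ref_cube (\<lambda>y. pd (dir E) (b E) y * wh E y)"
    proof (rule element.transport_inner[OF element[OF AT[OF E]] _ _ open_domain bounded_domain
          cell_subset_domain[OF AT[OF E]] w])
      show "AE x in lebesgue_on (F E ` ref_cube). w x = wh E (inv_into ref_cube (F E) x)"
        unfolding image_cube[OF AT[OF E]] by (rule w_wh[OF E])
    qed (rule cb[OF E] wh[OF E])+
  qed
  ultimately show ?thesis by (intro bexI[of _ ?v]) simp_all
qed

lemma facet_function_flux:
  assumes "E \<in> T" "s \<in> {-1, 1}"
  shows "element.facet_integral (F E) i 1 (\<lambda>y. c * (s + y $ i) / 2) \<phi>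
      - element.facet_integral (F E) i (-1) (\<lambda>y. c * (s + y $ i) / 2) \<phi>
      = c / 2 * integral ref_cube (\<lambda>y. \<phi> (F E (set_coord i s y)))"
  using assms(2) by (auto simp: element.facet_integral_def[OF element[OF assms(1)]])

text \<open>The elementwise bubbles force such a pressure to be constant on every element, the facet
  functions force equal values on neighbours, and the value at a Dirichlet facet is zero.\<close>

lemma pressure_zero:
  assumes RT: "RT (k - 1) \<subseteq> Vhat" and w: "w \<in> Wh (k - 1) \<Omega> T F"
    and orth: "\<And>v. v \<in> Vh Vhat \<Omega> \<Gamma>N T F \<Longrightarrow> L2_inner (lebesgue_on \<Omega>) (weak_div \<Omega> v) w = 0"
    and D: "E0 \<in> T" "s0 \<in> {-1, 1}" "F E0 ` ref_facet i0 s0 \<subseteq> frontier \<Omega>" "F E0 ` ref_facet_int i0 s0 \<inter> \<Gamma>N = {}"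
  shows "AE x in lebesgue_on \<Omega>. w x = 0"
proof -
  have wL: "L2 (lebesgue_on \<Omega>) w" using w by (simp add: Wh_def)
  have "\<forall>E\<in>T. \<exists>wh. wh \<in> Qpoly (k - 1) \<and> (AE x in lebesgue_on E. w x = wh (inv_into ref_cube (F E) x))"
    using w unfolding Wh_def by blast
  then obtain wh where wh: "\<And>E. E \<in> T \<Longrightarrow> wh E \<in> Qpoly (k - 1)"
    and w_wh: "\<And>E. E \<in> T \<Longrightarrow> AE x in lebesgue_on E. w x = wh E (inv_into ref_cube (F E) x)"
    by metis
  have cwh: "continuous_on S (wh E)" if "E \<in> T" for E S using Qpoly_continuous[OF wh[OF that]] .
  have V0: "(\<lambda>y. 0) \<in> Vhat" using RT lin_space_zero[OF lin_space_RT] by blast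
  have "\<exists>c. \<forall>y\<in>ref_cube. wh E y = c" if E: "E \<in> T" for E
  proof -
    have "integral ref_cube (\<lambda>y. pd i (\<lambda>y. (1 - (y $ i)\<^sup>2) * pd i (wh E) y) y * wh E y) = 0" for i
    proof -
      let ?b = "\<lambda>y::real^'d::_. (1 - (y $ i)\<^sup>2) * pd i (wh E) y"
      have R0: "0 = (\<Sum>E'\<in>{E}. element.facet_integral (F E') i 1 ?b \<phi> - element.facet_integral (F E') i (-1) ?b \<phi>)" for \<phi>
        by (simp add: element.facet_integral_def[OF element[OF E]])
      have "\<exists>v\<in>Vh Vhat \<Omega> \<Gamma>N T F. L2_inner (lebesgue_on \<Omega>) (weak_div \<Omega> v) w =
          (\<Sum>E'\<in>{E}. integral ref_cube (\<lambda>y. pd i ?b y * wh E' y))"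
        by (rule composed_field[where n="Suc (k - 1)" and R="\<lambda>_. 0" and dir="\<lambda>_. i" and b="\<lambda>_. ?b"])
          (use E bubble_RT[OF wh[OF E], of i] RT V0 R0 wL cwh w_wh in auto)
      then show ?thesis using orth by auto
    qed
    from constant_if_orthogonal_to_bubbles[OF wh[OF E] this] show ?thesis by blast
  qed
  then obtain p where p: "\<And>E y. E \<in> T \<Longrightarrow> y \<in> ref_cube \<Longrightarrow> wh E y = p E" by metis
  let ?vol = "integral (ref_cube :: (real^'d::_) set) (\<lambda>x. 1::real)"
  have div_int: "integral ref_cube (\<lambda>y. pd i (\<lambda>y. c * (s + y $ i) / 2) y * wh E y) = c / 2 * p E * ?vol"
    if "E \<in> T" for i c s E
  proof -
    have "integral ref_cube (\<lambda>y. pd i (\<lambda>y. c * (s + y $ i) / 2) y * wh E y) =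
        integral ref_cube (\<lambda>y::real^'d::_. (c / 2 * p E) * 1)"
      by (rule Henstock_Kurzweil_Integration.integral_cong) (simp only: ref_facet_function_pd p[OF that] mult_1_right)
    then show ?thesis by (simp only: Henstock_Kurzweil_Integration.integral_mult_right)
  qed
  have neighbours: "p E = p E'" if E: "E \<in> T" "E' \<in> T" "E \<noteq> E'" and s: "s \<in> {-1, 1}" and y: "y \<in> ref_facet_int i s" "F E y \<in> E'"
    for E E' i s y
  proof -
    from shared_facet[OF E s y] obtain i' s' \<rho> \<epsilon> where s': "s' \<in> {-1, 1}" and \<rho>: "bij \<rho>" "\<forall>a. \<epsilon> a \<in> {-1, 1}"
      and eq: "\<forall>x. F E' (set_coord i' s' x) = F E (set_coord i s (signed_perm \<rho> \<epsilon> x))"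
      by (elim exE conjE) (rule that)
    \<comment> \<open>Opposite signs: what flows out of E through the common facet flows into the neighbour.\<close>
    let ?c = "\<lambda>X. if X = E then 1 else (-1::real)" and ?s = "\<lambda>X. if X = E then s else s'"
      and ?i = "\<lambda>X. if X = E then i else i'"
    let ?b = "\<lambda>X y. ?c X * (?s X + y $ (?i X)) / 2"
    have flux: "integral ref_cube (\<lambda>y. \<phi> (F E' (set_coord i' s' y))) = integral ref_cube (\<lambda>y. \<phi> (F E (set_coord i s y)))"
      if \<phi>: "continuous_on UNIV \<phi>" for \<phi> :: "real^'d::_ \<Rightarrow> real"
    proof -
      have "continuous_on UNIV (\<lambda>y. F E (set_coord i s y))"
        by (rule continuous_on_compose2[OF element.continuous[OF element[OF E(1)], of UNIV] continuous_on_set_coord]) simp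
      then have "continuous_on UNIV (\<lambda>y. \<phi> (F E (set_coord i s y)))"
        by (rule continuous_on_compose2[OF \<phi>]) simp
      from integral_signed_perm[OF \<rho>(1) _ this, of \<epsilon>] \<rho>(2) show ?thesis by (simp add: eq)
    qed
    have R: "(\<Sum>X\<in>{E, E'}. element.facet_integral (F X) (?i X) 1 (?b X) \<phi> - element.facet_integral (F X) (?i X) (-1) (?b X) \<phi>)
        = 1/2 * integral ref_cube (\<lambda>y. \<phi> (F E (set_coord i s y))) - 1/2 * integral ref_cube (\<lambda>y. \<phi> (F E' (set_coord i' s' y)))" for \<phi>
      using E(3) facet_function_flux[OF E(1) s, of i 1 \<phi>] facet_function_flux[OF E(2) s', of i' "-1" \<phi>] by simp
    have "\<exists>v\<in>Vh Vhat \<Omega> \<Gamma>N T F. L2_inner (lebesgue_on \<Omega>) (weak_div \<Omega> v) w =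
        (\<Sum>X\<in>{E, E'}. integral ref_cube (\<lambda>y. pd (?i X) (?b X) y * wh X y))"
    proof (rule composed_field[where n=1 and dir="?i" and b="?b" and R="\<lambda>\<phi>. 1/2 * integral ref_cube (\<lambda>y. \<phi> (F E (set_coord i s y)))
          - 1/2 * integral ref_cube (\<lambda>y. \<phi> (F E' (set_coord i' s' y)))"])
      show "?b X \<in> Qpoly 1" for X by (rule ref_facet_function_Qpoly)
      show "(\<lambda>y. axis (?i X) (?b X y)) \<in> Vhat" for X using RT ref_facet_function_RT by blast
    next
      fix \<phi> assume "test_function \<Omega> \<phi>"
      then show "1/2 * integral ref_cube (\<lambda>y. \<phi> (F E (set_coord i s y)))
          - 1/2 * integral ref_cube (\<lambda>y. \<phi> (F E' (set_coord i' s' y))) = 0"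
        using flux[OF smooth_continuous[OF test_function_smooth]] by simp
    next
      fix \<phi> :: "real^'d::_ \<Rightarrow> real" assume "smooth \<phi>"
      then show "1/2 * integral ref_cube (\<lambda>y. \<phi> (F E (set_coord i s y)))
          - 1/2 * integral ref_cube (\<lambda>y. \<phi> (F E' (set_coord i' s' y))) = 0"
        using flux[OF smooth_continuous] by simp
    next
      show "1/2 * integral ref_cube (\<lambda>y. \<phi> (F E (set_coord i s y)))
          - 1/2 * integral ref_cube (\<lambda>y. \<phi> (F E' (set_coord i' s' y))) =
        (\<Sum>X\<in>{E, E'}. element.facet_integral (F X) (?i X) 1 (?b X) \<phi> - element.facet_integral (F X) (?i X) (-1) (?b X) \<phi>)" for \<phi>
        by (rule R[symmetric])
    qed (use E V0 wL cwh w_wh in auto)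
    then have "(\<Sum>X\<in>{E, E'}. integral ref_cube (\<lambda>y. pd (?i X) (?b X) y * wh X y)) = 0" using orth by auto
    then have "1 / 2 * p E * ?vol + (-1) / 2 * p E' * ?vol = 0"
      using E(3) div_int[OF E(1), of i 1 s] div_int[OF E(2), of i' "-1" s'] by simp
    then have "(p E - p E') * ?vol = 0" by (simp add: algebra_simps)
    then show ?thesis using integral_cube_pos[where 'd='d] by simp
  qed
  have all: "p E = p E0" if "E \<in> T" for E
  proof (rule ccontr)
    assume ne: "p E \<noteq> p E0"
    let ?A = "{E \<in> T. p E = p E0}"
    have "\<exists>E\<in>?A. \<exists>E'\<in>T - ?A. \<exists>i s y. s \<in> {-1, 1} \<and> y \<in> ref_facet_int i s \<and> F E y \<in> E'"
      by (rule facet_connected) (use D(1) ne that in auto)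
    then obtain E1 E2 i s y where "E1 \<in> T" "p E1 = p E0" "E2 \<in> T" "p E2 \<noteq> p E0" "s \<in> {-1, 1}" "y \<in> ref_facet_int i s" "F E1 y \<in> E2"
      by blast
    then show False using neighbours[of E1 E2 s y i] by metis
  qed
  \<comment> \<open>The functions that test the trace vanish near the part of the boundary outside \<open>\<Gamma>N\<close>, so flux through
    the Dirichlet facet is allowed.\<close>
  have "p E0 = 0"
  proof -
    let ?b = "\<lambda>y::real^'d::_. 1 * (s0 + y $ i0) / 2"
    let ?R = "\<lambda>\<phi>. 1 / 2 * integral ref_cube (\<lambda>y. \<phi> (F E0 (set_coord i0 s0 y)))"
    have "\<exists>v\<in>Vh Vhat \<Omega> \<Gamma>N T F. L2_inner (lebesgue_on \<Omega>) (weak_div \<Omega> v) w =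
        (\<Sum>X\<in>{E0}. integral ref_cube (\<lambda>y. pd i0 ?b y * wh X y))"
    proof (rule composed_field[where n=1 and dir="\<lambda>_. i0" and b="\<lambda>_. ?b" and R="?R"])
      show "?b \<in> Qpoly 1" by (rule ref_facet_function_Qpoly)
      show "(\<lambda>y. axis i0 (?b y)) \<in> Vhat" using RT ref_facet_function_RT by blast
      show "?R \<phi> = (\<Sum>E\<in>{E0}. element.facet_integral (F E) i0 1 ?b \<phi> - element.facet_integral (F E) i0 (-1) ?b \<phi>)" for \<phi>
        using facet_function_flux[OF D(1,2), of i0 1 \<phi>] by simp
    next
      fix \<phi> assume \<phi>: "test_function \<Omega> \<phi>"
      have "\<phi> (F E0 (set_coord i0 s0 y)) = 0" if "y \<in> ref_cube" for y
      proof -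
        have "F E0 (set_coord i0 s0 y) \<in> frontier \<Omega>" using D(3) that ref_facet_eq[OF D(2)] by blast
        then have "F E0 (set_coord i0 s0 y) \<notin> \<Omega>" using open_domain by (simp add: frontier_def interior_open)
        then show ?thesis using \<phi> closure_subset[of "{x. \<phi> x \<noteq> 0}"] unfolding test_function_def by blast
      qed
      then show "?R \<phi> = 0" by (simp cong: Henstock_Kurzweil_Integration.integral_cong)
    next
      fix \<phi> :: "real^'d::_ \<Rightarrow> real" and U assume U: "frontier \<Omega> - \<Gamma>N \<subseteq> U" "\<forall>x\<in>U. \<phi> x = 0"
      have "\<phi> (F E0 (set_coord i0 s0 y)) = 0" if "y \<in> box (-1) 1" for y
      proof -
        have "F E0 (set_coord i0 s0 y) \<in> F E0 ` ref_facet_int i0 s0" using that ref_facet_int_eq[OF D(2)] by blast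
        moreover have "F E0 (set_coord i0 s0 y) \<in> frontier \<Omega>"
          using D(3) that ref_facet_eq[OF D(2)] ref_box_subset by blast
        ultimately show ?thesis using D(4) U by blast
      qed
      then have "integral (box (-1) 1) (\<lambda>y. \<phi> (F E0 (set_coord i0 s0 y))) = integral (box (-1) 1) (\<lambda>y::real^'d::_. 0)"
        by (rule Henstock_Kurzweil_Integration.integral_cong)
      then show "?R \<phi> = 0" unfolding ref_cube_def by (simp add: integral_box_eq)
    qed (use D V0 wL cwh w_wh in auto)
    then have "integral ref_cube (\<lambda>y. pd i0 ?b y * wh E0 y) = 0" using orth by auto
    then show ?thesis using div_int[OF D(1), of i0 1 s0] integral_cube_pos[where 'd='d] by simp
  qed
  then have wh0: "wh E y = 0" if "E \<in> T" "y \<in> ref_cube" for E y using p[OF that] all[OF that(1)] by simp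
  have "AE x in lebesgue_on E. w x = 0" if E: "E \<in> T" for E
  proof (rule AE_mp[OF w_wh[OF E]], rule AE_I2, rule impI)
    fix x assume x: "x \<in> space (lebesgue_on E)" "w x = wh E (inv_into ref_cube (F E) x)"
    then have "x \<in> F E ` ref_cube" using image_cube[OF E] by simp
    then show "w x = 0" using x(2) wh0[OF E inv_into_into] by simp
  qed
  then show ?thesis by (rule AE_mesh)
qed

end

section \<open>Surface measure of facets and of lower-dimensional faces\<close>

text \<open>A finite cover is made a sequence by adding empty sets, which contribute nothing as m is positive.\<close>

lemma hausdorff_outer_le_cover:
  assumes m: "m \<ge> 1" and n: "n \<ge> 1" and d: "0 \<le> d" "d \<le> \<delta>"
    and \<U>: "finite \<U>" "card \<U> \<le> N" "A \<subseteq> \<Union>\<U>" "\<And>U. U \<in> \<U> \<Longrightarrow> bounded U \<and> diameter U \<le> d"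
  shows "(INF U\<in>{U :: nat \<Rightarrow> 'a::metric_space set. A \<subseteq> (\<Union>n. U n) \<and> (\<forall>n. bounded (U n) \<and> diameter (U n) \<le> \<delta>)}.
       (\<Sum>n. ennreal (unit_ball_vol (real m) / 2 ^ m * diameter (U n) ^ m)))
    \<le> ennreal (real N * (unit_ball_vol (real m) / 2 ^ m * d ^ m))"
proof -
  let ?C = "unit_ball_vol (real m) / 2 ^ m"
  have C: "?C \<ge> 0" by simp
  obtain h where h: "bij_betw h {0..<card \<U>} \<U>" using ex_bij_betw_nat_finite[OF \<U>(1)] by blast
  define U where "U = (\<lambda>j. if j < card \<U> then h j else {})"
  have hU: "h j \<in> \<U>" if "j < card \<U>" for j using h that by (auto simp: bij_betw_def)
  have "A \<subseteq> (\<Union>j. U j)"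
  proof
    fix x assume "x \<in> A"
    then obtain V where "V \<in> \<U>" "x \<in> V" using \<U>(3) by blast
    moreover have "\<U> = h ` {0..<card \<U>}" using h by (simp add: bij_betw_def)
    ultimately have "V \<in> h ` {0..<card \<U>}" by simp
    then obtain j where "V = h j" "j \<in> {0..<card \<U>}" by (rule imageE)
    then have j: "j < card \<U>" "V = h j" by simp_all
    then have "x \<in> U j" using \<open>x \<in> V\<close> by (simp add: U_def)
    then show "x \<in> (\<Union>j. U j)" by (rule UN_I[OF UNIV_I])
  qed
  moreover have Ub: "bounded (U j)" "diameter (U j) \<le> d" for j
    using \<U>(4)[OF hU, of j] d by (simp_all add: U_def)
  ultimately have "U \<in> {U. A \<subseteq> (\<Union>n. U n) \<and> (\<forall>n. bounded (U n) \<and> diameter (U n) \<le> \<delta>)}"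
    using order_trans[OF Ub(2) d(2)] by simp
  then have "(INF U\<in>{U. A \<subseteq> (\<Union>n. U n) \<and> (\<forall>n. bounded (U n) \<and> diameter (U n) \<le> \<delta>)}.
       (\<Sum>n. ennreal (?C * diameter (U n) ^ m))) \<le> (\<Sum>n. ennreal (?C * diameter (U n) ^ m))"
    by (rule INF_lower)
  also have "\<dots> = (\<Sum>n<card \<U>. ennreal (?C * diameter (U n) ^ m))"
    using m by (intro suminf_finite) (auto simp: U_def)
  also have "\<dots> \<le> (\<Sum>n<card \<U>. ennreal (?C * d ^ m))"
    using Ub C by (intro sum_mono ennreal_leI mult_left_mono power_mono) (auto simp: diameter_ge_0)
  also have "\<dots> = ennreal (real (card \<U>) * (?C * d ^ m))"
    using d C by (subst sum_ennreal) auto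
  also have "\<dots> \<le> ennreal (real N * (?C * d ^ m))"
    using \<U>(2) d C by (intro ennreal_leI mult_right_mono mult_nonneg_nonneg zero_le_power) auto
  finally show ?thesis .
qed

text \<open>The \<open>n\<^sup>p\<close> pieces contribute a multiple of \<open>n\<^sup>p (L / n)\<^sup>m\<close>, which is bounded for \<open>p \<le> m\<close> and tends to zero for
  \<open>p < m\<close>.\<close>

lemma hausdorff_outer_grid:
  assumes m: "m \<ge> 1" and L: "L \<ge> 0" and p: "p \<le> m"
    and cover: "\<And>n::nat. n \<ge> 1 \<Longrightarrow> \<exists>\<U>. finite \<U> \<and> card \<U> \<le> n ^ p \<and> A \<subseteq> \<Union>\<U> \<and>
        (\<forall>U\<in>\<U>. bounded U \<and> diameter U \<le> L / real n)"
  shows "hausdorff_outer m A < \<infinity>" "p < m \<Longrightarrow> hausdorff_outer m A = 0"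
proof -
  let ?C = "unit_ball_vol (real m) / 2 ^ m"
  let ?I = "\<lambda>\<delta>. INF U\<in>{U. A \<subseteq> (\<Union>n. U n) \<and> (\<forall>n. bounded (U n) \<and> diameter (U n) \<le> \<delta>)}.
       (\<Sum>n. ennreal (?C * diameter (U n) ^ m))"
  have C: "?C \<ge> 0" by simp
  have bound: "?I \<delta> \<le> ennreal (?C * L ^ m * (real n ^ p / real n ^ m))" if n1: "n \<ge> 1" and nd: "L / real n \<le> \<delta>" for n \<delta>
  proof -
    obtain \<U> where U: "finite \<U> \<and> card \<U> \<le> n ^ p \<and> A \<subseteq> \<Union>\<U> \<and> (\<forall>U\<in>\<U>. bounded U \<and> diameter U \<le> L / real n)"
      using cover[OF n1] by (rule exE)
    have "0 \<le> L / real n" using L by simp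
    from hausdorff_outer_le_cover[OF m n1 this nd, of \<U> "n ^ p" A] U L
    show ?thesis by (simp add: power_divide mult_ac)
  qed
  have ev: "\<exists>n0\<ge>1. \<forall>n\<ge>n0. L / real n \<le> \<delta>" if "\<delta> > 0" for \<delta> :: real
  proof -
    obtain n0 :: nat where n0: "L / \<delta> \<le> real n0" using real_arch_simple[of "L / \<delta>"] by (rule exE)
    have "L / real n \<le> \<delta>" if n: "n \<ge> max 1 n0" for n
    proof -
      have "L / \<delta> \<le> real n" using n0 n by linarith
      then show ?thesis using n \<open>\<delta> > 0\<close> by (simp add: field_simps)
    qed
    then show ?thesis by (intro exI[of _ "max 1 n0"]) auto
  qed
  have "?I \<delta> \<le> ennreal (?C * L ^ m)" if "\<delta> > 0" for \<delta>
  proof -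
    obtain n0 where n0: "n0 \<ge> 1" "\<And>n. n \<ge> n0 \<Longrightarrow> L / real n \<le> \<delta>" using ev[OF \<open>\<delta> > 0\<close>] by blast
    have "?I \<delta> \<le> ennreal (?C * L ^ m * (real n0 ^ p / real n0 ^ m))" using bound[OF n0(1) n0(2)] by simp
    also have "\<dots> \<le> ennreal (?C * L ^ m * 1)"
      using n0(1) p L C by (intro ennreal_leI mult_left_mono mult_nonneg_nonneg) (auto simp: divide_le_eq intro!: power_increasing)
    finally show ?thesis by simp
  qed
  then have "hausdorff_outer m A \<le> ennreal (?C * L ^ m)"
    unfolding hausdorff_outer_def by (intro SUP_least) auto
  then show "hausdorff_outer m A < \<infinity>" using le_less_trans ennreal_less_top by fastforce
  assume "p < m"
  have "?I \<delta> \<le> 0" if "\<delta> > 0" for \<delta>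
  proof (rule tendsto_lowerbound)
    have "(\<lambda>n. ?C * L ^ m * (1 / real n)) \<longlonglongrightarrow> ?C * L ^ m * 0"
      by (intro tendsto_mult tendsto_const lim_1_over_n)
    then show "(\<lambda>n. ennreal (?C * L ^ m * (1 / real n))) \<longlonglongrightarrow> 0"
      using tendsto_ennrealI by fastforce
    obtain n0 where n0: "n0 \<ge> 1" "\<And>n. n \<ge> n0 \<Longrightarrow> L / real n \<le> \<delta>" using ev[OF \<open>\<delta> > 0\<close>] by blast
    have "?I \<delta> \<le> ennreal (?C * L ^ m * (1 / real n))" if n: "n \<ge> n0" for n
    proof -
      have n1: "n \<ge> 1" using n n0(1) by simp
      have "real n ^ p / real n ^ m \<le> 1 / real n"
      proof -
        have "real n ^ p * real n \<le> real n ^ m"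
          using n1 \<open>p < m\<close> power_increasing[of "Suc p" m "real n"] by (simp add: mult.commute)
        then show ?thesis using n1 by (simp add: field_simps)
      qed
      then have "ennreal (?C * L ^ m * (real n ^ p / real n ^ m)) \<le> ennreal (?C * L ^ m * (1 / real n))"
        using L C by (intro ennreal_leI mult_left_mono mult_nonneg_nonneg) auto
      then show ?thesis using bound[OF n1 n0(2)[OF n]] by (rule order_trans[rotated])
    qed
    then show "eventually (\<lambda>n. ?I \<delta> \<le> ennreal (?C * L ^ m * (1 / real n))) sequentially"
      by (auto simp: eventually_sequentially)
  qed simp
  then have "hausdorff_outer m A \<le> 0" unfolding hausdorff_outer_def by (intro SUP_least) auto
  then show "hausdorff_outer m A = 0" by simp
qed

lemma unit_subdivision:
  assumes "\<bar>t\<bar> \<le> 1" "n \<ge> 1"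
  shows "\<exists>k<n. -1 + 2 * real k / real n \<le> t \<and> t \<le> -1 + 2 * (real k + 1) / real n"
proof (cases "t = 1")
  case True
  then show ?thesis using assms(2) by (intro exI[of _ "n - 1"]) (auto simp: field_simps of_nat_diff)
next
  case False
  let ?u = "(t + 1) * real n / 2"
  have u: "0 \<le> ?u" "?u < real n"
  proof -
    show "0 \<le> ?u" using assms by (auto simp: abs_le_iff intro!: divide_nonneg_pos mult_nonneg_nonneg)
    have "(t + 1) * real n < 2 * real n" using assms False by (intro mult_strict_right_mono) auto
    then show "?u < real n" by simp
  qed
  define k where "k = nat \<lfloor>?u\<rfloor>"
  have k: "real k \<le> ?u" "?u < real k + 1" using u(1) unfolding k_def by linarith+
  then have "k < n" using u(2) by linarith
  moreover have "-1 + 2 * real k / real n \<le> t" "t \<le> -1 + 2 * (real k + 1) / real n"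
    using k assms(2) by (simp_all add: field_simps)
  ultimately show ?thesis by blast
qed

text \<open>A face of dimension p of the cube is covered by \<open>n\<^sup>p\<close> subcubes of side \<open>2 / n\<close>.\<close>

lemma hausdorff_outer_face_image:
  fixes G :: "real^'d::finite \<Rightarrow> 'b::metric_space"
  assumes d: "CARD('d) \<ge> 2" and L: "L \<ge> 0"
    and lip: "\<And>x y. x \<in> ref_cube \<Longrightarrow> y \<in> ref_cube \<Longrightarrow> dist (G x) (G y) \<le> L * dist x y" and I: "I \<noteq> {}"
  shows "hausdorff_outer (CARD('d) - 1) (G ` {y \<in> ref_cube. \<forall>i\<in>I. y $ i = a i}) < \<infinity>"
    "card I \<ge> 2 \<Longrightarrow> hausdorff_outer (CARD('d) - 1) (G ` {y \<in> ref_cube. \<forall>i\<in>I. y $ i = a i}) = 0"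
proof -
  let ?A = "G ` {y \<in> ref_cube. \<forall>i\<in>I. y $ i = a i}"
  let ?m = "CARD('d) - 1" and ?p = "card (UNIV - I)" and ?L = "L * (2 * real CARD('d))"
  have cardI: "card I \<ge> 1" using I by (simp add: Suc_leI card_gt_0_iff)
  have p: "?p = CARD('d) - card I" by (simp add: card_Diff_subset)
  have "\<exists>\<U>. finite \<U> \<and> card \<U> \<le> n ^ ?p \<and> ?A \<subseteq> \<Union>\<U> \<and> (\<forall>U\<in>\<U>. bounded U \<and> diameter U \<le> ?L / real n)"
    if n: "n \<ge> 1" for n :: nat
  proof -
    let ?P = "\<lambda>\<kappa>::'d \<Rightarrow> nat. {y \<in> ref_cube. (\<forall>i\<in>I. y $ i = a i) \<and>
        (\<forall>j\<in>UNIV - I. -1 + 2 * real (\<kappa> j) / real n \<le> y $ j \<and> y $ j \<le> -1 + 2 * (real (\<kappa> j) + 1) / real n)}"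
    let ?K = "(UNIV - I) \<rightarrow>\<^sub>E {..<n}"
    let ?\<U> = "(\<lambda>\<kappa>. G ` ?P \<kappa>) ` ?K"
    have finK: "finite ?K" by (intro finite_PiE) auto
    have "card ?\<U> \<le> card ?K" by (rule card_image_le[OF finK])
    also have "\<dots> = n ^ ?p" by (simp add: card_PiE)
    finally have card: "card ?\<U> \<le> n ^ ?p" .
    have cov: "?A \<subseteq> \<Union>?\<U>"
    proof (intro subsetI, elim imageE CollectE conjE)
      fix x y assume y: "x = G y" "y \<in> ref_cube" "\<forall>i\<in>I. y $ i = a i"
      have "\<forall>j. \<exists>k<n. -1 + 2 * real k / real n \<le> y $ j \<and> y $ j \<le> -1 + 2 * (real k + 1) / real n"
        using unit_subdivision[OF _ n] y(2) by (simp add: mem_ref_cube)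
      then obtain \<kappa> where \<kappa>: "\<And>j. \<kappa> j < n \<and> -1 + 2 * real (\<kappa> j) / real n \<le> y $ j \<and> y $ j \<le> -1 + 2 * (real (\<kappa> j) + 1) / real n"
        by metis
      let ?\<kappa> = "restrict \<kappa> (UNIV - I)"
      have "?\<kappa> \<in> ?K" using \<kappa> by auto
      moreover have "y \<in> ?P ?\<kappa>" using y \<kappa> by simp
      ultimately show "x \<in> \<Union>?\<U>" using y(1) by blast
    qed
    have piece: "dist x y \<le> 2 * real CARD('d) / real n" if "x \<in> ?P \<kappa>" "y \<in> ?P \<kappa>" for x y \<kappa>
    proof -
      have "\<bar>(x - y) $ j\<bar> \<le> 2 / real n" for j
      proof (cases "j \<in> I")
        case True
        then show ?thesis using that by simp
      next
        case False
        then have "-1 + 2 * real (\<kappa> j) / real n \<le> x $ j" "x $ j \<le> -1 + 2 * (real (\<kappa> j) + 1) / real n"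
          "-1 + 2 * real (\<kappa> j) / real n \<le> y $ j" "y $ j \<le> -1 + 2 * (real (\<kappa> j) + 1) / real n"
          using that by auto
        then show ?thesis by (simp add: abs_le_iff add_divide_distrib)
      qed
      then have "(\<Sum>j\<in>UNIV. \<bar>(x - y) $ j\<bar>) \<le> (\<Sum>j\<in>(UNIV::'d set). 2 / real n)" by (intro sum_mono)
      then show ?thesis using norm_le_l1_cart[of "x - y"] by (simp add: dist_norm mult.commute)
    qed
    have dG: "dist u v \<le> ?L / real n" if "u \<in> G ` ?P \<kappa>" "v \<in> G ` ?P \<kappa>" for u v \<kappa>
    proof -
      obtain x y where xy: "x \<in> ?P \<kappa>" "y \<in> ?P \<kappa>" "u = G x" "v = G y" using \<open>u \<in> G ` ?P \<kappa>\<close> \<open>v \<in> G ` ?P \<kappa>\<close> by blast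
      have "dist u v \<le> L * dist x y" using lip xy by auto
      also have "\<dots> \<le> L * (2 * real CARD('d) / real n)" using piece[OF xy(1,2)] L by (rule mult_left_mono)
      finally show ?thesis by simp
    qed
    have "bounded U \<and> diameter U \<le> ?L / real n" if Um: "U \<in> ?\<U>" for U
    proof
      obtain \<kappa> where U: "U = G ` ?P \<kappa>" using Um by (rule imageE)
      have dU: "dist u v \<le> ?L / real n" if "u \<in> U" "v \<in> U" for u v
        using dG[of u \<kappa> v] that unfolding U by blast
      then show "bounded U" unfolding bounded_two_points by blast
      show "diameter U \<le> ?L / real n"
      proof (cases "U = {}")
        case True
        then show ?thesis using L by simp
      next
        case False
        have "(SUP (x, y)\<in>U \<times> U. dist x y) \<le> ?L / real n"
        proof (rule cSUP_least)
          show "U \<times> U \<noteq> {}" using False by simp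
          show "(case q of (x, y) \<Rightarrow> dist x y) \<le> ?L / real n" if "q \<in> U \<times> U" for q
            using dU that by (cases q) simp
        qed
        then show ?thesis using False by (simp add: diameter_def)
      qed
    qed
    then show ?thesis using finK card cov by (intro exI[of _ ?\<U>]) blast
  qed
  note grid = hausdorff_outer_grid[where A="?A" and L="?L" and p="?p" and m="?m", OF _ _ _ this]
  have m: "?m \<ge> 1" "?p \<le> ?m" "?L \<ge> 0" using d cardI p L by auto
  show "hausdorff_outer ?m ?A < \<infinity>" by (rule grid(1)[OF m(1,3,2)])
  show "hausdorff_outer ?m ?A = 0" if "card I \<ge> 2"
    by (rule grid(2)[OF m(1,3,2)]) (use p d that in auto)
qed

lemma sets_surface_measureI: "A \<in> sets borel \<Longrightarrow> A \<in> sets surface_measure"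
  unfolding surface_measure_def by (intro sets_completionI_sets) (simp add: sets.sigma_sets_eq[of borel, simplified])

lemma space_surface_measure [simp]: "space surface_measure = UNIV"
  by (simp add: surface_measure_def space_completion space_measure_of_conv)

text \<open>By definition \<^const>\<open>measure_of\<close> is either the given set function or zero, so upper bounds carry over
  without a proof of countable additivity.\<close>

lemma emeasure_surface_le:
  fixes A :: "(real^'d::finite) set"
  assumes "A \<in> sets borel" shows "emeasure surface_measure A \<le> hausdorff_outer (CARD('d) - 1) A"
proof -
  let ?M = "measure_of UNIV (sets borel) (hausdorff_outer (CARD('d) - 1)) :: (real^'d) measure"
  have "A \<in> sets ?M" using assms by (simp add: sets.sigma_sets_eq[of borel, simplified])
  then have "emeasure surface_measure A = emeasure ?M A"
    unfolding surface_measure_def by simp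
  also have "\<dots> \<le> hausdorff_outer (CARD('d) - 1) A"
    by (simp add: emeasure_measure_of_conv)
  finally show ?thesis .
qed

lemma (in element) lipschitz_on_cube:
  obtains L where "L \<ge> 0" "\<And>x y. x \<in> ref_cube \<Longrightarrow> y \<in> ref_cube \<Longrightarrow> dist (G x) (G y) \<le> L * dist x y"
proof -
  let ?f = "\<lambda>x. \<Sum>i\<in>UNIV. \<Sum>j\<in>UNIV. \<bar>jac G x $ i $ j\<bar>"
  have "continuous_on ref_cube ?f" by (intro continuous_intros continuous_jac)
  then have "compact (?f ` ref_cube)" using ref_cube_compact by (rule compact_continuous_image)
  then obtain B where B: "\<forall>z\<in>?f ` ref_cube. norm z \<le> B" using compact_imp_bounded bounded_iff by metis
  have on: "onorm ((*v) (jac G x)) \<le> B" if "x \<in> ref_cube" for x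
  proof -
    have "onorm ((*v) (jac G x)) \<le> ?f x" by (rule onorm_le_matrix_component_sum)
    also have "\<dots> \<le> B" using B that by force
    finally show ?thesis .
  qed
  have "norm (G x - G y) \<le> B * norm (x - y)" if "x \<in> ref_cube" "y \<in> ref_cube" for x y
    by (rule differentiable_bound[OF _ has_derivative_at_withinI[OF has_derivative] on that])
      (auto simp: ref_cube_def)
  then have "dist (G x) (G y) \<le> max B 0 * dist x y" if "x \<in> ref_cube" "y \<in> ref_cube" for x y
    unfolding dist_norm using order_trans[OF _ mult_right_mono[of B "max B 0" "norm (x - y)"]] that by simp
  then show thesis by (intro that[of "max B 0"]) simp
qed

lemma (in element) facet_measure_finite:
  assumes "CARD('d) \<ge> 2"
  shows "emeasure surface_measure (G ` ref_facet i s) < \<infinity>" "compact (G ` ref_facet i s)"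
proof -
  have eq: "ref_facet i s = {y \<in> ref_cube. \<forall>j\<in>{i}. y $ j = s}" by (auto simp: ref_facet_def)
  have "ref_facet i s = ref_cube \<inter> {y. y $ i = s}" by (auto simp: ref_facet_def)
  moreover have "closed {y::real^'d::_. y $ i = s}" by (intro closed_Collect_eq continuous_intros)
  ultimately have "compact (ref_facet i s)" using compact_Int_closed[OF ref_cube_compact] by metis
  then show c: "compact (G ` ref_facet i s)" by (intro compact_continuous_image continuous)
  obtain L where L: "L \<ge> 0" "\<And>x y. x \<in> ref_cube \<Longrightarrow> y \<in> ref_cube \<Longrightarrow> dist (G x) (G y) \<le> L * dist x y"
    using lipschitz_on_cube by blast
  have "hausdorff_outer (CARD('d) - 1) (G ` ref_facet i s) < \<infinity>"
    unfolding eq by (rule hausdorff_outer_face_image(1)[OF assms L]) auto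
  then show "emeasure surface_measure (G ` ref_facet i s) < \<infinity>"
    using emeasure_surface_le[OF borel_compact[OF c]] by (rule le_less_trans[rotated])
qed

lemma ref_facet_measure_finite:
  assumes "CARD('d::finite) \<ge> 2"
  shows "emeasure surface_measure (ref_facet i s :: (real^'d) set) < \<infinity>" "ref_facet i s \<in> sets (borel :: (real^'d) measure)"
proof -
  have eq: "ref_facet i s = (\<lambda>y. y) ` {y \<in> ref_cube. \<forall>j\<in>{i}. y $ j = s}" by (auto simp: ref_facet_def)
  have "ref_facet i s = ref_cube \<inter> {y. y $ i = s}" by (auto simp: ref_facet_def)
  moreover have "closed {y::real^'d. y $ i = s}" by (intro closed_Collect_eq continuous_intros)
  ultimately show b: "ref_facet i s \<in> sets (borel :: (real^'d) measure)"
    by (simp add: ref_cube_def borel_closed closed_Int)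
  have "hausdorff_outer (CARD('d) - 1) (ref_facet i s :: (real^'d) set) < \<infinity>"
    unfolding eq by (rule hausdorff_outer_face_image(1)[OF assms, of 1]) auto
  then show "emeasure surface_measure (ref_facet i s :: (real^'d) set) < \<infinity>"
    using emeasure_surface_le[OF b] by (rule le_less_trans[rotated])
qed

context mesh
begin

lemma skeleton_null:
  assumes d: "CARD('d) \<ge> 2" shows "\<exists>N\<in>null_sets surface_measure. skeleton \<subseteq> N"
proof -
  let ?e = "\<lambda>(E, i, j, a, b). F E ` {y \<in> ref_cube. y $ i = a \<and> y $ j = b}"
  let ?I = "{(E, i, j, a, b). E \<in> T \<and> i \<noteq> j \<and> a \<in> {-1, 1::real} \<and> b \<in> {-1, 1::real}}
    :: ((real^'d::_) set \<times> 'd \<times> 'd \<times> real \<times> real) set"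
  have fin: "finite ?I"
    by (rule finite_subset[of _ "T \<times> UNIV \<times> UNIV \<times> {-1, 1} \<times> {-1, 1}"]) (auto simp: finite_mesh)
  have null: "?e q \<in> null_sets surface_measure" if "q \<in> ?I" for q
  proof -
    obtain E i j a b where q: "q = (E, i, j, a, b)" by (metis prod_cases5)
    then have E: "E \<in> T" "i \<noteq> j" using that by auto
    let ?f = "{y \<in> ref_cube. y $ i = a \<and> y $ j = b} :: (real^'d::_) set"
    have eq: "?f = {y \<in> ref_cube. \<forall>l\<in>{i, j}. y $ l = (if l = i then a else b)}" using E(2) by auto
    have "?f = ref_cube \<inter> ({y. y $ i = a} \<inter> {y. y $ j = b})" by auto
    moreover have "closed ({y::real^'d::_. y $ i = a} \<inter> {y. y $ j = b})"
      by (intro closed_Int closed_Collect_eq continuous_intros)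
    ultimately have "compact ?f" using compact_Int_closed[OF ref_cube_compact] by metis
    then have "compact (F E ` ?f)" by (intro compact_continuous_image element.continuous[OF element[OF E(1)]])
    then have b: "F E ` ?f \<in> sets borel" by (rule borel_compact)
    obtain L where L: "L \<ge> 0" "\<And>x y. x \<in> ref_cube \<Longrightarrow> y \<in> ref_cube \<Longrightarrow> dist (F E x) (F E y) \<le> L * dist x y"
      using element.lipschitz_on_cube[OF element[OF E(1)]] by blast
    have "hausdorff_outer (CARD('d) - 1) (F E ` ?f) = 0"
      unfolding eq by (rule hausdorff_outer_face_image(2)[OF d L]) (use E(2) in auto)
    then have "emeasure surface_measure (F E ` ?f) = 0" using emeasure_surface_le[OF b] by simp
    then show ?thesis unfolding q using sets_surface_measureI[OF b] by (simp add: null_setsI)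
  qed
  have "(\<Union>q\<in>?I. ?e q) \<in> null_sets surface_measure"
    using fin null by (intro null_sets.finite_UN) auto
  moreover have "skeleton \<subseteq> (\<Union>q\<in>?I. ?e q)"
  proof
    fix x assume "x \<in> skeleton"
    then obtain E y i j where *: "E \<in> T" "y \<in> ref_cube" "i \<noteq> j" "\<bar>y $ i\<bar> = 1" "\<bar>y $ j\<bar> = 1" "x = F E y"
      by (rule skeletonE)
    then have "(E, i, j, y $ i, y $ j) \<in> ?I" by (auto simp: abs_if split: if_splits)
    moreover have "x \<in> ?e (E, i, j, y $ i, y $ j)" using * by auto
    ultimately show "x \<in> (\<Union>q\<in>?I. ?e q)" by (rule UN_I)
  qed
  ultimately show ?thesis by blast
qed

text \<open>Since the skeleton is a null set, a Dirichlet boundary of positive measure contains a facet.\<close>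

lemma dirichlet_facet_exists:
  assumes d: "CARD('d) \<ge> 2" and pos: "emeasure surface_measure \<Gamma>D > 0" and sub: "\<Gamma>D \<subseteq> frontier \<Omega>"
    and disj: "\<Gamma>D \<inter> \<Gamma>N = {}"
    and resolved: "\<And>E i s. E \<in> T \<Longrightarrow> s \<in> {-1, 1} \<Longrightarrow> F E ` ref_facet i s \<subseteq> frontier \<Omega> \<Longrightarrow>
      F E ` ref_facet_int i s \<subseteq> \<Gamma>D \<or> F E ` ref_facet_int i s \<subseteq> \<Gamma>N"
  shows "\<exists>E\<in>T. \<exists>i s. s \<in> {-1, 1} \<and> F E ` ref_facet i s \<subseteq> frontier \<Omega> \<and> F E ` ref_facet_int i s \<inter> \<Gamma>N = {}"
proof -
  obtain N where N: "N \<in> null_sets surface_measure" "skeleton \<subseteq> N" using skeleton_null[OF d] by blast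
  have "\<not> \<Gamma>D \<subseteq> skeleton"
  proof
    assume "\<Gamma>D \<subseteq> skeleton"
    then have "emeasure surface_measure \<Gamma>D \<le> emeasure surface_measure N"
      using N by (intro emeasure_mono) auto
    then show False using pos N(1) by auto
  qed
  then obtain x where x: "x \<in> \<Gamma>D" "x \<notin> skeleton" by blast
  from boundary_facet[of x] x sub obtain E i s y where E: "E \<in> T" "s \<in> {-1, 1}" "y \<in> ref_facet_int i s" "x = F E y"
    "F E ` ref_facet i s \<subseteq> frontier \<Omega>" by blast
  have "x \<in> F E ` ref_facet_int i s" using E(3,4) by blast
  then have "F E ` ref_facet_int i s \<subseteq> \<Gamma>D" using resolved[OF E(1,2,5)] x(1) disj by blast
  then show ?thesis using E disj by blast
qed

end

section \<open>The boundary pairing\<close>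

lemma surface_integrable:
  fixes h :: "real^'d::finite \<Rightarrow> real"
  assumes A: "A \<in> sets borel" "emeasure surface_measure A < \<infinity>"
    and h: "(\<lambda>x. indicator A x *\<^sub>R h x) \<in> borel_measurable borel" and B: "\<And>x. x \<in> A \<Longrightarrow> \<bar>h x\<bar> \<le> B"
  shows "integrable (restrict_space surface_measure A) h"
proof -
  have "(\<lambda>x. indicator A x *\<^sub>R h x) \<in> borel_measurable surface_measure"
  proof (rule measurableI)
    fix S :: "real set" assume "S \<in> sets borel"
    then have "(\<lambda>x. indicator A x *\<^sub>R h x) -` S \<inter> space borel \<in> sets borel" by (rule measurable_sets[OF h])
    then show "(\<lambda>x. indicator A x *\<^sub>R h x) -` S \<inter> space surface_measure \<in> sets surface_measure"
      by (simp add: sets_surface_measureI)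
  qed simp
  moreover have "\<bar>indicator A x * h x\<bar> \<le> B" if "x \<in> A" for x using B[OF that] that by simp
  ultimately have "integrable surface_measure (\<lambda>x. indicator A x *\<^sub>R h x)"
    using sets_surface_measureI[OF A(1)] A(2) by (intro integrableI_bounded_set[where A=A and B=B]) auto
  then show ?thesis using sets_surface_measureI[OF A(1)] by (subst integrable_restrict_space) auto
qed

lemma surface_integrable_continuous:
  fixes h :: "real^'d::finite \<Rightarrow> real"
  assumes A: "compact A" "emeasure surface_measure A < \<infinity>" and h: "continuous_on A h"
  shows "integrable (restrict_space surface_measure A) h"
proof -
  have "compact (h ` A)" using h A(1) by (rule compact_continuous_image)
  then obtain B where B: "\<forall>z\<in>h ` A. norm z \<le> B" using compact_imp_bounded bounded_iff by metis
  show ?thesis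
  proof (rule surface_integrable[OF borel_compact[OF A(1)] A(2)])
    show "(\<lambda>x. indicator A x *\<^sub>R h x) \<in> borel_measurable borel"
      by (rule borel_measurable_continuous_on_indicator[OF borel_compact[OF A(1)] h])
    show "\<bar>h x\<bar> \<le> B" if "x \<in> A" for x using B that by simp
  qed
qed

text \<open>The function \<open>\<phi>\<close> is arbitrary. The projection is taken onto the space of those
  polynomials r for which \<open>\<phi> r\<close> is integrable.\<close>

lemma L2_projection_exists:
  fixes \<phi> :: "real^'d::finite \<Rightarrow> real"
  assumes int: "\<And>p q. p \<in> Qpoly m \<Longrightarrow> q \<in> Qpoly m \<Longrightarrow> integrable M (\<lambda>x. p x * q x)"
  shows "\<exists>q\<in>Qpoly m. \<forall>r\<in>Qpoly m. L2_inner M (\<lambda>x. \<phi> x - q x) r = 0"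
proof -
  let ?J = "{\<alpha> :: 'd \<Rightarrow> nat. \<forall>i. \<alpha> i \<le> m}"
  define Z where "Z = {r \<in> Qpoly m. integrable M (\<lambda>x. \<phi> x * r x)}"
  have ZQ: "r \<in> Qpoly m" and Zi: "integrable M (\<lambda>x. \<phi> x * r x)" if "r \<in> Z" for r
    using that by (auto simp: Z_def)
  have monom: "monom_fun \<alpha> \<in> Qpoly m" if "\<alpha> \<in> ?J" for \<alpha> using that by (auto intro: Qpoly_monom)
  have lin: "lin_functional Z (\<lambda>z. \<integral>x. z x * y x \<partial>M)" if "y \<in> Qpoly m" for y
    unfolding lin_functional_def using int[OF ZQ that] by (auto simp: distrib_right mult.assoc)
  have zero: "(\<integral>x. y x * z x \<partial>M) = 0" "(\<integral>x. z x * y x \<partial>M) = 0"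
    if y: "y \<in> Qpoly m" and 0: "(\<integral>x. y x * y x \<partial>M) = 0" for y z
  proof -
    have "AE x in M. y x * y x = 0"
      using integral_nonneg_eq_0_iff_AE[OF int[OF y y]] 0 by simp
    then have ae: "AE x in M. y x = 0" by simp
    show "(\<integral>x. y x * z x \<partial>M) = 0" by (rule integral_eq_zero_AE) (use ae in auto)
    show "(\<integral>x. z x * y x \<partial>M) = 0" by (rule integral_eq_zero_AE) (use ae in auto)
  qed
  have self: "(\<integral>x. y x * y x \<partial>M) = 0" if y: "y \<in> Qpoly m" and 0: "\<forall>\<alpha>\<in>?J. (\<integral>x. y x * monom_fun \<alpha> x \<partial>M) = 0" for y
  proof -
    obtain c where c: "y = (\<lambda>x. \<Sum>\<alpha>\<in>?J. c \<alpha> * monom_fun \<alpha> x)" using y by (rule QpolyE)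
    have "(\<integral>x. y x * y x \<partial>M) = (\<integral>x. (\<Sum>\<alpha>\<in>?J. c \<alpha> * (y x * monom_fun \<alpha> x)) \<partial>M)"
      by (subst (2) c) (simp add: sum_distrib_left mult.left_commute)
    also have "\<dots> = (\<Sum>\<alpha>\<in>?J. c \<alpha> * (\<integral>x. y x * monom_fun \<alpha> x \<partial>M))"
      using int[OF y monom] by (subst Bochner_Integration.integral_sum) auto
    also have "\<dots> = 0" using 0 by (intro sum.neutral) simp
    finally show ?thesis .
  qed
  have linZ: "lin_space Z"
    unfolding lin_space_def Z_def
    using Qpoly_add Qpoly_cmult Qpoly_const[of 0]
    by (auto simp: distrib_left mult.left_commute)
  have "\<exists>z\<in>Z. \<forall>y\<in>Z. (\<integral>x. z x * y x \<partial>M) = (\<integral>x. \<phi> x * y x \<partial>M)"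
  proof (rule bilinear_system_solvable[where J="?J" and L="\<lambda>\<alpha> z. \<integral>x. z x * monom_fun \<alpha> x \<partial>M"])
    show "lin_functional Z (\<lambda>y. \<integral>x. z x * y x \<partial>M)" if "z \<in> Z" for z
      using lin[OF ZQ[OF that]] by (simp add: mult.commute)
    show "lin_functional Z (\<lambda>y. \<integral>x. \<phi> x * y x \<partial>M)"
      unfolding lin_functional_def using Zi
      by (auto simp: distrib_left mult.left_commute)
    show "(\<integral>x. \<phi> x * y x \<partial>M) = 0 \<and> (\<forall>z\<in>Z. (\<integral>x. z x * y x \<partial>M) = 0)"
      if "y \<in> Z" "\<forall>\<alpha>\<in>?J. (\<integral>x. y x * monom_fun \<alpha> x \<partial>M) = 0" for y
      using zero(2)[OF ZQ[OF that(1)] self[OF ZQ[OF that(1)] that(2)]] by blast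
    show "(\<integral>x. y x * monom_fun \<alpha> x \<partial>M) = 0"
      if "y \<in> Z" "\<forall>z\<in>Z. (\<integral>x. z x * y x \<partial>M) = 0" for y \<alpha>
      using zero(1)[OF ZQ[OF that(1)]] that by blast
  qed (use linZ lin[OF monom] lin[OF ZQ] in auto)
  then obtain q where q: "q \<in> Z" "\<And>y. y \<in> Z \<Longrightarrow> (\<integral>x. q x * y x \<partial>M) = (\<integral>x. \<phi> x * y x \<partial>M)" by blast
  \<comment> \<open>If \<open>\<phi> r\<close> is not integrable, neither is \<open>(\<phi> - q) r\<close>, and the pairing is zero by convention.\<close>
  have "L2_inner M (\<lambda>x. \<phi> x - q x) r = 0" if r: "r \<in> Qpoly m" for r
  proof (cases "integrable M (\<lambda>x. \<phi> x * r x)")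
    case True
    then have "r \<in> Z" using r by (simp add: Z_def)
    then show ?thesis
      using q(2) True int[OF ZQ[OF q(1)] r] by (simp add: L2_inner_def left_diff_distrib)
  next
    case False
    have "\<not> integrable M (\<lambda>x. (\<phi> x - q x) * r x)"
    proof
      assume "integrable M (\<lambda>x. (\<phi> x - q x) * r x)"
      from Bochner_Integration.integrable_add[OF this int[OF ZQ[OF q(1)] r]]
      show False using False by (simp add: left_diff_distrib)
    qed
    then show ?thesis by (simp add: L2_inner_def not_integrable_integral_eq)
  qed
  then show ?thesis using ZQ[OF q(1)] by blast
qed

lemma ref_facet_proj_Qpoly:
  fixes \<phi> :: "real^'d::finite \<Rightarrow> real"
  assumes d: "CARD('d) \<ge> 2" shows "ref_facet_proj m i s \<phi> \<in> Qpoly m"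
proof -
  let ?M = "restrict_space surface_measure (ref_facet i s) :: (real^'d) measure"
  have eq: "ref_facet i s = ref_cube \<inter> {y::real^'d. y $ i = s}" by (auto simp: ref_facet_def)
  have "compact (ref_facet i s :: (real^'d) set)"
    unfolding eq by (intro compact_Int_closed ref_cube_compact closed_Collect_eq continuous_intros)
  then have "integrable ?M (\<lambda>x. p x * q x)" if "p \<in> Qpoly m" "q \<in> Qpoly m" for p q
    by (rule surface_integrable_continuous[OF _ ref_facet_measure_finite(1)[OF d]])
      (intro continuous_on_mult Qpoly_continuous[OF that(1)] Qpoly_continuous[OF that(2)])
  then have "\<exists>q\<in>Qpoly m. \<forall>r\<in>Qpoly m. L2_inner ?M (\<lambda>x. \<phi> x - q x) r = 0" by (rule L2_projection_exists)
  then have "\<exists>q. q \<in> Qpoly m \<and> (\<forall>r\<in>Qpoly m. L2_inner ?M (\<lambda>x. \<phi> x - q x) r = 0)" by blast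
  from someI_ex[OF this] show ?thesis unfolding ref_facet_proj_def by blast
qed

text \<open>The condition that determines the outward normal, with an explicit radius.\<close>

definition flat_at :: "(real^'d::finite) set \<Rightarrow> real^'d \<Rightarrow> real^'d \<Rightarrow> real \<Rightarrow> bool" where
  "flat_at \<Omega> x n r \<longleftrightarrow> norm n = 1 \<and> r > 0 \<and> (\<forall>y\<in>ball x r. y \<in> \<Omega> \<longleftrightarrow> (y - x) \<bullet> n < 0)"

lemma outward_normal_flat_at: "outward_normal \<Omega> x = (THE n. \<exists>r. flat_at \<Omega> x n r)"
  unfolding outward_normal_def flat_at_def by (rule arg_cong[of _ _ The]) auto

text \<open>Moving from x in the direction \<open>n' - n\<close> leads into one half space and out of the other.\<close>

lemma flat_at_unique:
  assumes "flat_at \<Omega> x n r" "flat_at \<Omega> x n' r'" shows "n = n'"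
proof (rule ccontr)
  assume ne: "n \<noteq> n'"
  have nn: "n \<bullet> n = 1" "n' \<bullet> n' = 1" using assms by (auto simp: flat_at_def dot_square_norm)
  have "(n - n') \<bullet> (n - n') > 0" using ne by simp
  then have c: "n \<bullet> n' < 1" using nn by (simp add: algebra_simps inner_commute)
  define \<rho> where "\<rho> = min r r'"
  have \<rho>: "\<rho> > 0" "\<rho> \<le> r" "\<rho> \<le> r'" using assms by (auto simp: flat_at_def \<rho>_def)
  define t where "t = \<rho> / (2 * norm (n' - n))"
  have t: "t > 0" using \<rho> ne by (simp add: t_def)
  have "norm (t *\<^sub>R (n' - n)) = \<rho> / 2" using \<rho> ne by (simp add: t_def)
  then have b: "x + t *\<^sub>R (n' - n) \<in> ball x r" "x + t *\<^sub>R (n' - n) \<in> ball x r'"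
    using \<rho> by (simp_all add: dist_norm)
  have "(x + t *\<^sub>R (n' - n) - x) \<bullet> n < 0"
    using t c nn by (simp add: inner_diff_left inner_diff_right inner_commute mult_pos_neg)
  then have "x + t *\<^sub>R (n' - n) \<in> \<Omega>" using assms(1) b(1) unfolding flat_at_def by blast
  then have "(x + t *\<^sub>R (n' - n) - x) \<bullet> n' < 0" using assms(2) b(2) unfolding flat_at_def by blast
  then have "t * (1 - n \<bullet> n') < 0" using nn by (simp add: inner_diff_left inner_diff_right inner_commute)
  then show False using t c by (simp add: mult_less_0_iff)
qed

lemma outward_normal_eq: "flat_at \<Omega> x n r \<Longrightarrow> outward_normal \<Omega> x = n"
  unfolding outward_normal_flat_at using flat_at_unique by (intro the_equality) blast+

text \<open>Inside the ball the boundary is the hyperplane through x orthogonal to n.\<close>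

lemma flat_at_nearby:
  assumes flat: "flat_at \<Omega> x n r" and x': "x' \<in> frontier \<Omega>" "x' \<in> ball x r" and \<Omega>: "open \<Omega>"
  shows "flat_at \<Omega> x' n (r - dist x x')"
proof -
  have x'\<Omega>: "x' \<notin> \<Omega>" "x' \<in> closure \<Omega>" using x'(1) \<Omega> by (auto simp: frontier_def interior_open)
  have ge: "(x' - x) \<bullet> n \<ge> 0" using x'\<Omega>(1) flat x'(2) by (force simp: flat_at_def)
  have "\<not> (x' - x) \<bullet> n > 0"
  proof
    assume pos: "(x' - x) \<bullet> n > 0"
    let ?U = "ball x r \<inter> {y. (y - x) \<bullet> n > 0}"
    have "open ?U" by (intro open_Int open_ball open_Collect_less continuous_intros)
    moreover have "x' \<in> ?U" using pos x'(2) by simp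
    ultimately have "?U \<inter> \<Omega> \<noteq> {}" using x'\<Omega>(2) by (metis IntI empty_iff open_Int_closure_eq_empty)
    then obtain y where y: "y \<in> ball x r" "(y - x) \<bullet> n > 0" "y \<in> \<Omega>" by blast
    then have "(y - x) \<bullet> n < 0" using flat unfolding flat_at_def by blast
    then show False using y by simp
  qed
  then have 0: "(x' - x) \<bullet> n = 0" using ge by simp
  show ?thesis unfolding flat_at_def
  proof (intro conjI ballI)
    show "norm n = 1" using flat by (simp add: flat_at_def)
    show "0 < r - dist x x'" using x'(2) by simp
    fix y assume "y \<in> ball x' (r - dist x x')"
    then have "y \<in> ball x r" using dist_triangle[of x y x'] by simp
    then have "y \<in> \<Omega> \<longleftrightarrow> (y - x) \<bullet> n < 0" using flat by (simp add: flat_at_def)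
    also have "(y - x) \<bullet> n = (y - x') \<bullet> n" using 0 by (simp add: inner_diff_left)
    finally show "y \<in> \<Omega> \<longleftrightarrow> (y - x') \<bullet> n < 0" .
  qed
qed

text \<open>The normal is locally constant along the locally flat part of the boundary, which is relatively open.
  Elsewhere the description in its definition has no solution, and its value is a constant.\<close>

lemma outward_normal_measurable:
  assumes \<Omega>: "open \<Omega>" and A: "A \<in> sets borel" "A \<subseteq> frontier \<Omega>"
  shows "(\<lambda>x. indicator A x *\<^sub>R outward_normal \<Omega> x) \<in> borel_measurable borel"
    "\<exists>B. \<forall>x. norm (outward_normal \<Omega> x) \<le> B"
proof -
  define U where "U = \<Union>{ball x r | x r. \<exists>n. flat_at \<Omega> x n r}"
  define c where "c = (THE n::real^'a. False)"
  have "open U" unfolding U_def by (rule open_Union) auto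
  then have U: "U \<in> sets borel" by simp
  have off: "outward_normal \<Omega> x = c" if "\<nexists>n r. flat_at \<Omega> x n r" for x
  proof -
    have "(\<lambda>n. \<exists>r. flat_at \<Omega> x n r) = (\<lambda>n. False)" using that by auto
    then show ?thesis by (simp add: outward_normal_flat_at c_def)
  qed
  have mem: "x \<in> U" if "flat_at \<Omega> x n r" for x n r
  proof -
    have "x \<in> ball x r" using that by (simp add: flat_at_def)
    then show ?thesis using that unfolding U_def by blast
  qed
  have "norm (outward_normal \<Omega> x) \<le> max 1 (norm c)" for x
  proof (cases "\<exists>n r. flat_at \<Omega> x n r")
    case True
    then obtain n r where "flat_at \<Omega> x n r" by blast
    then show ?thesis using outward_normal_eq[of \<Omega> x n r] by (simp add: flat_at_def)
  next
    case False
    then show ?thesis using off by simp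
  qed
  then show "\<exists>B. \<forall>x. norm (outward_normal \<Omega> x) \<le> B" by blast
  have "continuous_on (A \<inter> U) (outward_normal \<Omega>)"
    unfolding continuous_on_topological
  proof (intro ballI allI impI)
    fix x B assume x: "x \<in> A \<inter> U" and B: "open B" "outward_normal \<Omega> x \<in> B"
    from x obtain z r n where z: "x \<in> ball z r" "flat_at \<Omega> z n r" unfolding U_def by blast
    have "outward_normal \<Omega> y = n" if "y \<in> A" "y \<in> ball z r" for y
      using flat_at_nearby[OF z(2) _ that(2) \<Omega>] that(1) A(2) by (blast intro: outward_normal_eq)
    then have "\<forall>y\<in>A \<inter> U. y \<in> ball z r \<longrightarrow> outward_normal \<Omega> y \<in> B" using B(2) x z(1) by auto
    then show "\<exists>S. open S \<and> x \<in> S \<and> (\<forall>y\<in>A \<inter> U. y \<in> S \<longrightarrow> outward_normal \<Omega> y \<in> B)"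
      using z(1) by (intro exI[of _ "ball z r"]) simp
  qed
  then have 1: "(\<lambda>x. indicator (A \<inter> U) x *\<^sub>R outward_normal \<Omega> x) \<in> borel_measurable borel"
    using A U by (intro borel_measurable_continuous_on_indicator) auto
  have 2: "(\<lambda>x. indicator (A - U) x *\<^sub>R c) \<in> borel_measurable borel" using A U by auto
  have "indicator A x *\<^sub>R outward_normal \<Omega> x =
      indicator (A \<inter> U) x *\<^sub>R outward_normal \<Omega> x + indicator (A - U) x *\<^sub>R c" for x
  proof (cases "x \<in> A - U")
    case True
    then show ?thesis using off[of x] mem by auto
  next
    case False
    then show ?thesis by (simp add: indicator_def)
  qed
  then show "(\<lambda>x. indicator A x *\<^sub>R outward_normal \<Omega> x) \<in> borel_measurable borel"
    using borel_measurable_add[OF 1 2] by presburger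
qed

context element
begin

text \<open>The projected data and the field are continuous on the facet, which is compact and has finite measure,
  and the normal is bounded and measurable.\<close>

lemma boundary_pairing_integrable:
  assumes d: "CARD('d) \<ge> 2" and \<Omega>: "open \<Omega>" "G ` ref_facet i s \<subseteq> frontier \<Omega>" and u: "continuous_on ref_cube u"
  shows "integrable (restrict_space surface_measure (G ` ref_facet i s))
    (\<lambda>x. Rh m G i s g x * (piola G u x \<bullet> outward_normal \<Omega> x))"
proof -
  define A where "A = G ` ref_facet i s"
  have A: "emeasure surface_measure A < \<infinity>" "compact A" "A \<subseteq> G ` ref_cube"
    using facet_measure_finite[OF d] by (auto simp: A_def ref_facet_def)
  then have b: "A \<in> sets borel" by (simp add: borel_compact)
  let ?R = "Rh m G i s g" and ?P = "piola G u"
  have R: "continuous_on A ?R"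
    unfolding Rh_def
    by (rule continuous_on_compose2[OF Qpoly_continuous[OF ref_facet_proj_Qpoly[OF d]] continuous_on_subset[OF continuous_pull A(3)]]) auto
  have P: "continuous_on A ?P" using continuous_piola[OF u] A(3) by (rule continuous_on_subset)
  obtain BR where BR: "\<forall>z\<in>?R ` A. norm z \<le> BR"
    using compact_imp_bounded[OF compact_continuous_image[OF R A(2)]] bounded_iff by metis
  obtain BP where BP: "\<forall>z\<in>?P ` A. norm z \<le> BP"
    using compact_imp_bounded[OF compact_continuous_image[OF P A(2)]] bounded_iff by metis
  obtain BN where BN: "\<forall>x. norm (outward_normal \<Omega> x) \<le> BN"
    using outward_normal_measurable(2)[OF \<Omega>(1) b] \<Omega>(2) A_def by blast
  have "integrable (restrict_space surface_measure A) (\<lambda>x. ?R x * (?P x \<bullet> outward_normal \<Omega> x))"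
  proof (rule surface_integrable[OF b A(1)])
    have "(\<lambda>x. (indicator A x *\<^sub>R ?R x) * ((indicator A x *\<^sub>R ?P x) \<bullet> (indicator A x *\<^sub>R outward_normal \<Omega> x))) \<in> borel_measurable borel"
      by (intro borel_measurable_times borel_measurable_inner borel_measurable_continuous_on_indicator b R P
          outward_normal_measurable(1)[OF \<Omega>(1) b]) (use \<Omega>(2) A_def in simp)
    also have "(\<lambda>x. (indicator A x *\<^sub>R ?R x) * ((indicator A x *\<^sub>R ?P x) \<bullet> (indicator A x *\<^sub>R outward_normal \<Omega> x))) =
        (\<lambda>x. indicator A x *\<^sub>R (?R x * (?P x \<bullet> outward_normal \<Omega> x)))"
      by (rule ext) (simp add: indicator_def)
    finally show "(\<lambda>x. indicator A x *\<^sub>R (?R x * (?P x \<bullet> outward_normal \<Omega> x))) \<in> borel_measurable borel" .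
    fix x assume x: "x \<in> A"
    have "\<bar>?P x \<bullet> outward_normal \<Omega> x\<bar> \<le> norm (?P x) * norm (outward_normal \<Omega> x)" by (rule Cauchy_Schwarz_ineq2)
    also have "\<dots> \<le> BP * BN" using BP BN x order_trans[OF norm_ge_zero] by (intro mult_mono) auto
    finally have 1: "\<bar>?P x \<bullet> outward_normal \<Omega> x\<bar> \<le> BP * BN" .
    have 2: "\<bar>?R x\<bar> \<le> BR" using BR x by simp
    show "\<bar>?R x * (?P x \<bullet> outward_normal \<Omega> x)\<bar> \<le> BR * (BP * BN)"
      unfolding abs_mult by (rule mult_mono[OF 2 1 order_trans[OF abs_ge_zero 2] abs_ge_zero])
  qed
  then show ?thesis by (simp add: A_def)
qed

lemma boundary_pairing_linear:
  assumes d: "CARD('d) \<ge> 2" and \<Omega>: "open \<Omega>" "G ` ref_facet i s \<subseteq> frontier \<Omega>"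
    and u: "continuous_on ref_cube u" and v: "continuous_on ref_cube v"
    and w: "\<And>y. y \<in> ref_cube \<Longrightarrow> w y = a *\<^sub>R u y + b *\<^sub>R v y"
  shows "L2_inner (restrict_space surface_measure (G ` ref_facet i s)) (Rh m G i s g)
      (\<lambda>x. piola G w x \<bullet> outward_normal \<Omega> x) =
    a * L2_inner (restrict_space surface_measure (G ` ref_facet i s)) (Rh m G i s g)
      (\<lambda>x. piola G u x \<bullet> outward_normal \<Omega> x) +
    b * L2_inner (restrict_space surface_measure (G ` ref_facet i s)) (Rh m G i s g)
      (\<lambda>x. piola G v x \<bullet> outward_normal \<Omega> x)"
proof -
  let ?M = "restrict_space surface_measure (G ` ref_facet i s)"
  note int = boundary_pairing_integrable[OF d \<Omega>, of _ m g]
  have "(\<integral>x. Rh m G i s g x * (piola G w x \<bullet> outward_normal \<Omega> x) \<partial>?M) =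
     (\<integral>x. a * (Rh m G i s g x * (piola G u x \<bullet> outward_normal \<Omega> x)) +
       b * (Rh m G i s g x * (piola G v x \<bullet> outward_normal \<Omega> x)) \<partial>?M)"
  proof (rule Bochner_Integration.integral_cong[OF refl])
    fix x assume "x \<in> space ?M"
    then obtain y where y: "x = G y" "y \<in> ref_cube" by (auto simp: space_restrict_space ref_facet_def)
    have "piola G w x = a *\<^sub>R piola G u x + b *\<^sub>R piola G v x"
      using y by (simp add: piola_def pull_G w Let_def matrix_vector_right_distrib matrix_vector_mult_scaleR scaleR_add_right)
    then show "Rh m G i s g x * (piola G w x \<bullet> outward_normal \<Omega> x) = a * (Rh m G i s g x * (piola G u x \<bullet> outward_normal \<Omega> x)) +
       b * (Rh m G i s g x * (piola G v x \<bullet> outward_normal \<Omega> x))"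
      by (simp add: inner_add_left algebra_simps)
  qed
  also have "\<dots> = a * (\<integral>x. Rh m G i s g x * (piola G u x \<bullet> outward_normal \<Omega> x) \<partial>?M) +
       b * (\<integral>x. Rh m G i s g x * (piola G v x \<bullet> outward_normal \<Omega> x) \<partial>?M)"
    using int[OF u] int[OF v] by (subst Bochner_Integration.integral_add) auto
  finally show ?thesis by (simp add: L2_inner_def)
qed

end

section \<open>The discrete problem\<close>

lemma matrix_inv_mult_right: "invertible A \<Longrightarrow> A ** matrix_inv A = mat 1" for A :: "real^'n^'n"
  unfolding invertible_def matrix_inv_def by (rule someI2_ex) auto

text \<open>With \<open>A = DF\<close> and \<open>y = K\<^sup>-\<^sup>1 A z\<close> the form is \<open>y \<bullet> K y\<close>, divided by the Jacobian.\<close>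

lemma calK_inv_positive_definite:
  fixes K :: "real^'d::finite \<Rightarrow> real^'d^'d"
  assumes inv: "invertible (jac G x)" and k0: "k0 > 0" "\<And>y. k0 * (y \<bullet> y) \<le> y \<bullet> (K (G x) *v y)"
    and z: "z \<noteq> 0"
  shows "(calK_inv K G x *v z) \<bullet> z > 0"
proof -
  define M where "M = K (G x)"
  have ker: "y = 0" if "M *v y = 0" for y
  proof (rule ccontr)
    assume "y \<noteq> 0"
    then have "k0 * (y \<bullet> y) > 0" using k0(1) by simp
    then show False using k0(2)[of y] that by (simp add: M_def)
  qed
  have "invertible M" using ker by (simp add: invertible_left_inverse matrix_left_invertible_ker)
  then have MM: "M *v (matrix_inv M *v y) = y" for y
    by (simp add: matrix_vector_mul_assoc matrix_inv_mult_right)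
  have "jac G x *v z \<noteq> 0"
    using inv z unfolding invertible_left_inverse matrix_left_invertible_ker by blast
  define y where "y = matrix_inv M *v (jac G x *v z)"
  have My: "M *v y = jac G x *v z" unfolding y_def by (rule MM)
  then have "y \<noteq> 0" using \<open>jac G x *v z \<noteq> 0\<close> by auto
  then have "0 < k0 * (y \<bullet> y)" using k0(1) by simp
  also have "\<dots> \<le> y \<bullet> (M *v y)" using k0(2) by (simp add: M_def)
  also have "\<dots> = (transpose (jac G x) *v y) \<bullet> z" by (simp add: My dot_lmul_matrix)
  also have "\<dots> = ((transpose (jac G x) ** matrix_inv M ** jac G x) *v z) \<bullet> z"
    by (simp add: y_def matrix_vector_mul_assoc[symmetric] del: transpose_matrix_vector)
  finally have pos: "0 < ((transpose (jac G x) ** matrix_inv M ** jac G x) *v z) \<bullet> z" .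
  have "absdet_jac G x > 0" using inv by (simp add: absdet_jac_def invertible_det_nz)
  then show ?thesis
    using pos by (simp add: calK_inv_def M_def scaleR_matrix_vector_assoc[symmetric])
qed

lemma piola_add: "piola G (\<lambda>y. u y + v y) x = piola G u x + piola G v x"
  by (simp add: piola_def Let_def matrix_vector_right_distrib scaleR_add_right)

lemma piola_scale: "piola G (\<lambda>y. c *\<^sub>R u y) x = c *\<^sub>R piola G u x"
  by (simp add: piola_def Let_def matrix_vector_mult_scaleR mult.commute)

lemma piola_zero: "piola G (\<lambda>y. 0) x = 0" by (simp add: piola_def Let_def)

text \<open>One mesh with the data of the problem. The two- and the three-dimensional case differ only in the
  reference space.\<close>

locale discrete_problem = mesh \<Omega> T F
  for \<Omega> :: "(real^'d::{finite,wellorder}) set" and T F +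
  fixes Vhat :: "(real^'d::_ \<Rightarrow> real^'d::_) set" and k :: nat and \<xi> \<omega> :: "nat \<Rightarrow> real"
    and \<Gamma>D \<Gamma>N :: "(real^'d::_) set" and K :: "(real, 'd) vec \<Rightarrow> ((real, 'd) vec, 'd) vec" and k0 :: real
    and f g :: "real^'d::_ \<Rightarrow> real"
  assumes dim: "CARD('d) \<ge> 2" and k: "k \<ge> 1" and Vhat: "ref_space k Vhat" and gl: "gauss_lobatto k \<xi> \<omega>"
    and K_lower: "k0 > 0" "\<And>x y. x \<in> closure \<Omega> \<Longrightarrow> k0 * (y \<bullet> y) \<le> y \<bullet> (K x *v y)"
    and f: "L2 (lebesgue_on \<Omega>) f"
    and dirichlet_pos: "emeasure surface_measure \<Gamma>D > 0" and \<Gamma>D: "\<Gamma>D \<subseteq> frontier \<Omega>" and disj: "\<Gamma>D \<inter> \<Gamma>N = {}"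
    and resolved: "\<And>E i s. E \<in> T \<Longrightarrow> s \<in> {-1, 1} \<Longrightarrow> F E ` ref_facet i s \<subseteq> frontier \<Omega> \<Longrightarrow>
      F E ` ref_facet_int i s \<subseteq> \<Gamma>D \<or> F E ` ref_facet_int i s \<subseteq> \<Gamma>N"
begin

abbreviation V where "V \<equiv> Vh Vhat \<Omega> \<Gamma>N T F"
abbreviation W where "W \<equiv> Wh (k - 1) \<Omega> T F"
abbreviation vref where "vref \<equiv> ref_field Vhat F"
abbreviation grid :: "('d \<Rightarrow> nat) set" where "grid \<equiv> {\<iota>. \<forall>j. \<iota> j \<le> k}"
abbreviation node :: "('d \<Rightarrow> nat) \<Rightarrow> real^'d::_" where "node \<iota> \<equiv> \<chi> j. \<xi> (\<iota> j)"
abbreviation quad where "quad \<equiv> quad_form Vhat k \<xi> \<omega> K T F"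
abbreviation dir where "dir \<equiv> dirichlet_term Vhat k \<Omega> \<Gamma>D T F g"
abbreviation ip where "ip \<equiv> L2_inner (lebesgue_on \<Omega>)"

lemma Vhat_lin: "lin_space Vhat" and Vhat_RT: "RT (k - 1) \<subseteq> Vhat"
  and Vhat_cont: "v \<in> Vhat \<Longrightarrow> continuous_on UNIV v"
  and Vhat_unisolvent: "v \<in> Vhat \<Longrightarrow> (\<And>\<iota>. \<iota> \<in> grid \<Longrightarrow> v (node \<iota>) = 0) \<Longrightarrow> v x = 0"
  using Vhat gauss_lobatto_inj[OF gl] by (simp_all add: ref_space_def)

lemma node_in_cube: "\<iota> \<in> grid \<Longrightarrow> node \<iota> \<in> ref_cube"
  using gauss_lobatto_range[OF gl] by (simp add: mem_ref_cube abs_le_iff minus_le_iff)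

lemma AE_mesh_element:
  assumes "AE x in lebesgue_on \<Omega>. P x" "E \<in> T" shows "AE x in lebesgue_on E. P x"
proof -
  have EM: "E \<in> sets lebesgue" using closed_element[OF assms(2)] by (simp add: borel_closed)
  have "AE x in lebesgue. x \<in> \<Omega> \<longrightarrow> P x"
    using assms(1) open_domain by (simp add: AE_restrict_space_iff borel_open)
  moreover have "negligible (E - cell E)"
    using element.negligible_boundary[OF element[OF assms(2)]] image_cube[OF assms(2)] by simp
  then have "AE x in lebesgue. x \<notin> E - cell E"
    by (intro AE_not_in) (simp add: negligible_iff_null_sets)
  ultimately have "AE x in lebesgue. x \<in> E \<longrightarrow> P x"
    by eventually_elim (use cell_subset_domain[OF assms(2)] in blast)
  then show ?thesis using EM by (simp add: AE_restrict_space_iff)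
qed

lemma V_vel: "v \<in> V \<Longrightarrow> v \<in> vel_space \<Omega> \<Gamma>N" and V_Hdiv: "v \<in> V \<Longrightarrow> v \<in> Hdiv \<Omega>"
  by (simp_all add: Vh_def vel_space_def)

lemma W_L2: "w \<in> W \<Longrightarrow> L2 (lebesgue_on \<Omega>) w" by (simp add: Wh_def)

lemma vref:
  assumes "v \<in> V" "E \<in> T"
  shows "vref v E \<in> Vhat" "AE x in lebesgue_on E. v x = piola (F E) (vref v E) x"
proof -
  have "\<exists>vh. vh \<in> Vhat \<and> (AE x in lebesgue_on E. v x = piola (F E) vh x)"
    using assms by (auto simp: Vh_def)
  from someI_ex[OF this] show "vref v E \<in> Vhat" "AE x in lebesgue_on E. v x = piola (F E) (vref v E) x"
    by (simp_all add: ref_field_def)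
qed

lemma vref_eq:
  assumes "v \<in> V" "E \<in> T" "vh \<in> Vhat" "AE x in lebesgue_on E. v x = piola (F E) vh x" "y \<in> ref_cube"
  shows "vref v E y = vh y"
proof (rule element.AE_piola_eq_imp_eq[OF element[OF assms(2)] _ _ _ assms(5)])
  have "AE x in lebesgue_on E. piola (F E) (vref v E) x = piola (F E) vh x"
    using vref(2)[OF assms(1,2)] assms(4) by eventually_elim simp
  then show "AE x in lebesgue_on (F E ` ref_cube). piola (F E) (vref v E) x = piola (F E) vh x"
    unfolding image_cube[OF assms(2)] .
qed (use Vhat_cont vref(1) assms in auto)

lemma AE_add:
  assumes "u \<in> V" "v \<in> V" "E \<in> T"
  shows "AE x in lebesgue_on E. u x + v x = piola (F E) (\<lambda>y. vref u E y + vref v E y) x"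
  using vref(2)[OF assms(1,3)] vref(2)[OF assms(2,3)] by eventually_elim (simp add: piola_add)

lemma AE_scale:
  assumes "u \<in> V" "E \<in> T"
  shows "AE x in lebesgue_on E. c *\<^sub>R u x = piola (F E) (\<lambda>y. c *\<^sub>R vref u E y) x"
  using vref(2)[OF assms] by eventually_elim (simp add: piola_scale)

lemma lin_space_V: "lin_space V"
  unfolding lin_space_def
proof (intro conjI ballI allI)
  have "\<forall>E\<in>T. \<exists>vh\<in>Vhat. AE x in lebesgue_on E. 0 = piola (F E) vh x"
    by (intro ballI bexI[OF _ lin_space_zero[OF Vhat_lin]] AE_I2) (simp add: piola_zero)
  then show "(\<lambda>x. 0) \<in> V" using lin_space_zero[OF lin_space_vel_space[OF open_domain bounded_domain]]
    by (simp add: Vh_def)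
next
  fix u v assume u: "u \<in> V" and v: "v \<in> V"
  have "\<forall>E\<in>T. \<exists>vh\<in>Vhat. AE x in lebesgue_on E. u x + v x = piola (F E) vh x"
    using AE_add[OF u v] lin_space_add[OF Vhat_lin vref(1)[OF u] vref(1)[OF v]] by blast
  then show "(\<lambda>x. u x + v x) \<in> V"
    using lin_space_add[OF lin_space_vel_space[OF open_domain bounded_domain] V_vel[OF u] V_vel[OF v]]
    by (simp add: Vh_def)
next
  fix u c assume u: "u \<in> V"
  have "\<forall>E\<in>T. \<exists>vh\<in>Vhat. AE x in lebesgue_on E. c *\<^sub>R u x = piola (F E) vh x"
    using AE_scale[OF u] lin_space_scale[OF Vhat_lin vref(1)[OF u]] by blast
  then show "(\<lambda>x. c *\<^sub>R u x) \<in> V"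
    using lin_space_scale[OF lin_space_vel_space[OF open_domain bounded_domain] V_vel[OF u]]
    by (simp add: Vh_def)
qed

lemma vref_add:
  assumes "u \<in> V" "v \<in> V" "E \<in> T" "y \<in> ref_cube"
  shows "vref (\<lambda>x. u x + v x) E y = vref u E y + vref v E y"
  by (rule vref_eq[OF lin_space_add[OF lin_space_V assms(1,2)] assms(3) _ AE_add[OF assms(1-3)] assms(4)])
    (intro lin_space_add Vhat_lin vref(1) assms)

lemma vref_scale:
  assumes "u \<in> V" "E \<in> T" "y \<in> ref_cube"
  shows "vref (\<lambda>x. c *\<^sub>R u x) E y = c *\<^sub>R vref u E y"
  by (rule vref_eq[OF lin_space_scale[OF lin_space_V assms(1)] assms(2) _ AE_scale[OF assms(1,2)] assms(3)])
    (intro lin_space_scale Vhat_lin vref(1) assms)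

text \<open>Here unisolvence enters: the nodal values are coordinates of a discrete velocity.\<close>

lemma velocity_zero:
  assumes v: "v \<in> V" and 0: "\<And>E \<iota>. E \<in> T \<Longrightarrow> \<iota> \<in> grid \<Longrightarrow> vref v E (node \<iota>) = 0"
  shows "E \<in> T \<Longrightarrow> vref v E = (\<lambda>x. 0)" "AE x in lebesgue_on \<Omega>. v x = 0"
proof -
  show *: "vref v E = (\<lambda>x. 0)" if "E \<in> T" for E
    using Vhat_unisolvent[OF vref(1)[OF v that]] 0[OF that] by blast
  show "AE x in lebesgue_on \<Omega>. v x = 0"
  proof (rule AE_mesh)
    fix E assume E: "E \<in> T"
    show "AE x in lebesgue_on E. v x = 0" using vref(2)[OF v E] unfolding *[OF E] piola_zero .
  qed
qed

text \<open>The counterpart of \<^const>\<open>ref_field\<close> for pressures.\<close>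

definition pref :: "(real^'d::_ \<Rightarrow> real) \<Rightarrow> (real^'d::_) set \<Rightarrow> real^'d::_ \<Rightarrow> real" where
  "pref w E = (SOME wh. wh \<in> Qpoly (k - 1) \<and> (AE x in lebesgue_on E. w x = wh (inv_into ref_cube (F E) x)))"

lemma pref:
  assumes "w \<in> W" "E \<in> T"
  shows "pref w E \<in> Qpoly (k - 1)" "AE x in lebesgue_on E. w x = pref w E (inv_into ref_cube (F E) x)"
proof -
  have "\<exists>wh. wh \<in> Qpoly (k - 1) \<and> (AE x in lebesgue_on E. w x = wh (inv_into ref_cube (F E) x))"
    using assms by (auto simp: Wh_def)
  from someI_ex[OF this] show "pref w E \<in> Qpoly (k - 1)"
    "AE x in lebesgue_on E. w x = pref w E (inv_into ref_cube (F E) x)"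
    by (simp_all add: pref_def)
qed

lemma pref_eq:
  assumes "w \<in> W" "E \<in> T" "wh \<in> Qpoly (k - 1)" "AE x in lebesgue_on E. w x = wh (inv_into ref_cube (F E) x)"
    "y \<in> ref_cube"
  shows "pref w E y = wh y"
proof (rule element.AE_image_eq_imp_eq[OF element[OF assms(2)] _ _ _ assms(5)])
  have "AE x in lebesgue_on E. pref w E (inv_into ref_cube (F E) x) = wh (inv_into ref_cube (F E) x)"
    using pref(2)[OF assms(1,2)] assms(4) by eventually_elim simp
  then show "AE x in lebesgue_on (F E ` ref_cube). pref w E (inv_into ref_cube (F E) x) = wh (inv_into ref_cube (F E) x)"
    unfolding image_cube[OF assms(2)] .
qed (rule Qpoly_continuous[OF pref(1)[OF assms(1,2)]] Qpoly_continuous[OF assms(3)])+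

lemma pref_AE_add:
  assumes "u \<in> W" "v \<in> W" "E \<in> T"
  shows "AE x in lebesgue_on E. u x + v x =
    pref u E (inv_into ref_cube (F E) x) + pref v E (inv_into ref_cube (F E) x)"
  using pref(2)[OF assms(1,3)] pref(2)[OF assms(2,3)] by eventually_elim simp

lemma pref_AE_scale:
  assumes "u \<in> W" "E \<in> T"
  shows "AE x in lebesgue_on E. c * u x = c * pref u E (inv_into ref_cube (F E) x)"
  using pref(2)[OF assms] by eventually_elim simp

lemma lin_space_W: "lin_space W"
  unfolding lin_space_def
proof (intro conjI ballI allI)
  have "\<forall>E\<in>T. \<exists>wh\<in>Qpoly (k - 1). AE x in lebesgue_on E. 0 = wh (inv_into ref_cube (F E) x)"
    using Qpoly_const[of 0 "k - 1"] by (intro ballI bexI[of _ "\<lambda>x. 0"]) simp_all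
  then show "(\<lambda>x. 0) \<in> W" by (simp add: Wh_def L2_zero)
next
  fix u v assume u: "u \<in> W" and v: "v \<in> W"
  have "\<exists>wh\<in>Qpoly (k - 1). AE x in lebesgue_on E. u x + v x = wh (inv_into ref_cube (F E) x)" if E: "E \<in> T" for E
    using pref_AE_add[OF u v E] Qpoly_add[OF pref(1)[OF u E] pref(1)[OF v E]]
    by (intro bexI[of _ "\<lambda>y. pref u E y + pref v E y"])
  then show "(\<lambda>x. u x + v x) \<in> W" using L2_add[OF W_L2[OF u] W_L2[OF v]] by (simp add: Wh_def)
next
  fix u and c :: real assume u: "u \<in> W"
  have "\<exists>wh\<in>Qpoly (k - 1). AE x in lebesgue_on E. c * u x = wh (inv_into ref_cube (F E) x)" if E: "E \<in> T" for E
    using pref_AE_scale[OF u E] Qpoly_cmult[OF pref(1)[OF u E]]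
    by (intro bexI[of _ "\<lambda>y. c * pref u E y"])
  then show "(\<lambda>x. c *\<^sub>R u x) \<in> W" using L2_scaleR[OF W_L2[OF u]] by (simp add: Wh_def)
qed

lemma pref_add:
  assumes "u \<in> W" "v \<in> W" "E \<in> T" "y \<in> ref_cube"
  shows "pref (\<lambda>x. u x + v x) E y = pref u E y + pref v E y"
  by (rule pref_eq[OF lin_space_add[OF lin_space_W assms(1,2)] assms(3) _ pref_AE_add[OF assms(1-3)] assms(4)])
    (intro Qpoly_add pref(1) assms)

lemma pref_scale:
  assumes "u \<in> W" "E \<in> T" "y \<in> ref_cube"
  shows "pref (\<lambda>x. c * u x) E y = c * pref u E y"
  by (rule pref_eq[OF _ assms(2) _ pref_AE_scale[OF assms(1,2)] assms(3)])
    (use lin_space_scale[OF lin_space_W assms(1), of c] Qpoly_cmult[OF pref(1)[OF assms(1,2)]] in auto)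

text \<open>The velocity nodes also determine a pressure, whose degree is one less than that of the grid.\<close>

lemma pressure_AE_zero:
  assumes w: "w \<in> W" and 0: "\<And>E \<iota>. E \<in> T \<Longrightarrow> \<iota> \<in> grid \<Longrightarrow> pref w E (node \<iota>) = 0"
  shows "AE x in lebesgue_on \<Omega>. w x = 0"
proof (rule AE_mesh)
  fix E assume E: "E \<in> T"
  have "pref w E \<in> Qpoly k" by (rule Qpoly_mono[OF pref(1)[OF w E]]) simp
  then have "pref w E x = 0" for x
    by (rule Qpoly_eq_0_if_grid[OF gauss_lobatto_inj[OF gl]]) (use 0[OF E] in auto)
  then show "AE x in lebesgue_on E. w x = 0" using pref(2)[OF w E] by simp
qed

lemma pref_zero:
  assumes w: "w \<in> W" "AE x in lebesgue_on \<Omega>. w x = 0" and E: "E \<in> T" "y \<in> ref_cube"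
  shows "pref w E y = 0"
  using pref_eq[OF w(1) E(1) Qpoly_const[of 0] _ E(2)] AE_mesh_element[OF w(2) E(1)] by simp

lemma quad_add_left:
  assumes "u \<in> V" "u' \<in> V" shows "quad (\<lambda>x. u x + u' x) v = quad u v + quad u' v"
  unfolding quad_form_def sum.distrib[symmetric] Let_def
  by (intro sum.cong refl) (simp add: vref_add[OF assms] node_in_cube matrix_vector_right_distrib inner_add_left distrib_left)

lemma quad_scale_left:
  assumes "u \<in> V" shows "quad (\<lambda>x. c *\<^sub>R u x) v = c * quad u v"
  unfolding quad_form_def sum_distrib_left Let_def
  by (intro sum.cong refl) (simp add: vref_scale[OF assms] node_in_cube matrix_vector_mult_scaleR)

lemma quad_add_right:
  assumes "u \<in> V" "u' \<in> V" shows "quad v (\<lambda>x. u x + u' x) = quad v u + quad v u'"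
  unfolding quad_form_def sum.distrib[symmetric] Let_def
  by (intro sum.cong refl) (simp add: vref_add[OF assms] node_in_cube inner_add_right distrib_left)

lemma quad_scale_right:
  assumes "u \<in> V" shows "quad v (\<lambda>x. c *\<^sub>R u x) = c * quad v u"
  unfolding quad_form_def sum_distrib_left Let_def
  by (intro sum.cong refl) (simp add: vref_scale[OF assms] node_in_cube)

lemma lin_functional_quad: "lin_functional V (\<lambda>u. quad u v)" "lin_functional V (quad v)"
  unfolding lin_functional_def
  by (simp_all add: quad_add_left quad_scale_left quad_add_right quad_scale_right)

text \<open>Each term of the sum over elements and nodes is nonnegative and definite in its nodal value.\<close>

lemma quad_definite:
  assumes v: "v \<in> V" and 0: "quad v v = 0" and E: "E \<in> T" "\<iota> \<in> grid"
  shows "vref v E (node \<iota>) = 0"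
proof -
  define t where "t = (\<lambda>E \<iota>. (\<Prod>j\<in>UNIV. \<omega> (\<iota> j)) * ((calK_inv K (F E) (node \<iota>) *v vref v E (node \<iota>)) \<bullet> vref v E (node \<iota>)))"
  have weight: "(\<Prod>j\<in>UNIV. \<omega> (\<iota> j)) > 0" if "\<iota> \<in> grid" for \<iota> :: "'d \<Rightarrow> nat"
    using gauss_lobatto_weight_pos[OF gl k] that by (intro prod_pos) simp
  have pos: "(calK_inv K (F E) (node \<iota>) *v z) \<bullet> z > 0" if "E \<in> T" "\<iota> \<in> grid" "z \<noteq> 0" for E \<iota> z
  proof (rule calK_inv_positive_definite[OF jac_invertible[OF that(1) node_in_cube[OF that(2)]] K_lower(1) _ that(3)])
    have "F E (node \<iota>) \<in> closure \<Omega>"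
      using node_in_cube[OF that(2)] image_cube[OF that(1)] element_subset_closure[OF that(1)] by blast
    then show "k0 * (y \<bullet> y) \<le> y \<bullet> (K (F E (node \<iota>)) *v y)" for y by (rule K_lower(2))
  qed
  have nonneg: "t E \<iota> \<ge> 0" if "E \<in> T" "\<iota> \<in> grid" for E \<iota>
    using weight[OF that(2)] pos[OF that, of "vref v E (node \<iota>)"]
    by (cases "vref v E (node \<iota>) = 0") (simp_all add: t_def)
  have "(\<Sum>E\<in>T. \<Sum>\<iota>\<in>grid. t E \<iota>) = 0" using 0 by (simp add: quad_form_def t_def Let_def)
  then have "(\<Sum>\<iota>\<in>grid. t E \<iota>) = 0"
    using E(1) nonneg by (subst (asm) sum_nonneg_eq_0_iff[OF finite_mesh]) (auto intro!: sum_nonneg)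
  then have "t E \<iota> = 0"
    using E nonneg[OF E(1)] by (subst (asm) sum_nonneg_eq_0_iff[OF finite_multi_index]) auto
  then show ?thesis
    using mult_pos_pos[OF weight[OF E(2)] pos[OF E, of "vref v E (node \<iota>)"]] unfolding t_def by (metis less_irrefl)
qed

lemma lin_functional_dir: "lin_functional V dir"
proof -
  define t where "t = (\<lambda>v q. case q of (E, i, s) \<Rightarrow>
    L2_inner (restrict_space surface_measure (F E ` ref_facet i s)) (Rh (k - 1) (F E) i s g)
      (\<lambda>x. piola (F E) (vref v E) x \<bullet> outward_normal \<Omega> x))"
  have dir: "dir v = (\<Sum>q\<in>boundary_facets \<Omega> \<Gamma>D T F. t v q)" for v
    unfolding dirichlet_term_def t_def ..
  have c: "continuous_on ref_cube (vref u E)" if "u \<in> V" "E \<in> T" for u E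
    using Vhat_cont[OF vref(1)[OF that]] by (rule continuous_on_subset) simp
  have lin: "t w q = a * t u q + b * t v q"
    if q: "q \<in> boundary_facets \<Omega> \<Gamma>D T F" and uv: "u \<in> V" "v \<in> V"
      and w: "\<And>E y. E \<in> T \<Longrightarrow> y \<in> ref_cube \<Longrightarrow> vref w E y = a *\<^sub>R vref u E y + b *\<^sub>R vref v E y" for w u v q a b
  proof -
    obtain E i s where E: "q = (E, i, s)" by (cases q)
    then have E1: "E \<in> T" "F E ` ref_facet i s \<subseteq> frontier \<Omega>" using q by (auto simp: boundary_facets_def)
    show ?thesis unfolding E t_def prod.case
      by (rule element.boundary_pairing_linear[OF element[OF E1(1)] dim open_domain E1(2) c[OF uv(1) E1(1)] c[OF uv(2) E1(1)] w[OF E1(1)]])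
  qed
  show ?thesis unfolding lin_functional_def
  proof (intro conjI ballI allI)
    fix u v assume uv: "u \<in> V" "v \<in> V"
    show "dir (\<lambda>x. u x + v x) = dir u + dir v"
      unfolding dir sum.distrib[symmetric]
      by (intro sum.cong refl trans[OF lin[OF _ uv, where a=1 and b=1]]) (simp_all add: vref_add[OF uv])
  next
    fix u and c :: real assume u: "u \<in> V"
    show "dir (\<lambda>x. c *\<^sub>R u x) = c * dir u"
      unfolding dir sum_distrib_left
      by (intro sum.cong refl trans[OF lin[OF _ u u, where a=c and b=0]]) (simp_all add: vref_scale[OF u])
  qed
qed

lemma lin_functional_ip: "L2 (lebesgue_on \<Omega>) h \<Longrightarrow> lin_functional W (\<lambda>w. ip w h)"
  unfolding lin_functional_def by (simp add: L2_inner_add_left W_L2 L2_inner_scale_left)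

lemma lin_functional_wdiv: "w \<in> W \<Longrightarrow> lin_functional V (\<lambda>v. ip (weak_div \<Omega> v) w)"
  using lin_functional_div[OF open_domain bounded_domain W_L2[of w]] V_Hdiv by (simp add: lin_functional_def)

lemma ip_null: "AE x in lebesgue_on \<Omega>. w x = 0 \<Longrightarrow> ip w h = 0"
  unfolding L2_inner_def by (rule integral_eq_zero_AE) auto

lemma discrete_pressure_zero:
  assumes "w \<in> W" "\<And>v. v \<in> V \<Longrightarrow> ip (weak_div \<Omega> v) w = 0"
  shows "AE x in lebesgue_on \<Omega>. w x = 0"
proof -
  obtain E i s where "E \<in> T" "s \<in> {-1, 1}" "F E ` ref_facet i s \<subseteq> frontier \<Omega>" "F E ` ref_facet_int i s \<inter> \<Gamma>N = {}"
    using dirichlet_facet_exists[OF dim dirichlet_pos \<Gamma>D disj resolved] by blast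
  then show ?thesis using pressure_zero[OF Vhat_RT assms] by blast
qed

text \<open>Velocity and pressure together form one function with values in a product space.\<close>

abbreviation Z :: "(real^'d::_ \<Rightarrow> (real^'d::_) \<times> real) set" where
  "Z \<equiv> {z. (\<lambda>x. fst (z x)) \<in> V \<and> (\<lambda>x. snd (z x)) \<in> W}"

lemma lin_space_Z: "lin_space Z"
  using lin_space_V lin_space_W by (simp add: lin_space_def)

lemma lin_functional_fst: "lin_functional V L \<Longrightarrow> lin_functional Z (\<lambda>z. L (\<lambda>x. fst (z x)))"
  by (simp add: lin_functional_def)

lemma lin_functional_snd: "lin_functional W L \<Longrightarrow> lin_functional Z (\<lambda>z. L (\<lambda>x. snd (z x)))"
  by (simp add: lin_functional_def)

lemma lin_functional_vref:
  "E \<in> T \<Longrightarrow> \<iota> \<in> grid \<Longrightarrow> lin_functional V (\<lambda>v. vref v E (node \<iota>) $ j)"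
  by (simp add: lin_functional_def vref_add vref_scale node_in_cube)

lemma lin_functional_pref:
  "E \<in> T \<Longrightarrow> \<iota> \<in> grid \<Longrightarrow> lin_functional W (\<lambda>w. pref w E (node \<iota>))"
  by (simp add: lin_functional_def pref_add pref_scale node_in_cube)

text \<open>The sum of the two equations of the method. For z = y the mixed terms cancel.\<close>

definition saddle_form :: "(real^'d::_ \<Rightarrow> (real^'d::_) \<times> real) \<Rightarrow> (real^'d::_ \<Rightarrow> (real^'d::_) \<times> real) \<Rightarrow> real" where
  "saddle_form z y = quad (\<lambda>x. fst (z x)) (\<lambda>x. fst (y x)) + - ip (\<lambda>x. snd (z x)) (weak_div \<Omega> (\<lambda>x. fst (y x)))
     + ip (weak_div \<Omega> (\<lambda>x. fst (z x))) (\<lambda>x. snd (y x))"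

text \<open>The coordinates are the nodal values of the velocity and of the pressure on the reference cube. That
  they determine the solution is used for the transposed problem, which differs from the given one only
  in the signs of the mixed terms.\<close>

lemma saddle_solvable:
  "\<exists>z\<in>Z. \<forall>y\<in>Z. saddle_form z y = - dir (\<lambda>x. fst (y x)) + ip f (\<lambda>x. snd (y x))"
proof -
  let ?J = "((T \<times> grid) \<times> (UNIV :: 'd set)) <+> (T \<times> grid)"
  define L where "L = (\<lambda>c z. case c of Inl ((E, \<iota>), j) \<Rightarrow> (vref (\<lambda>x. fst (z x)) E (node \<iota>)) $ j
      | Inr (E, \<iota>) \<Rightarrow> pref (\<lambda>x. snd (z x)) E (node \<iota>))"
  have ipf: "lin_functional W (ip h)" if "L2 (lebesgue_on \<Omega>) h" for h
  proof -
    have "ip h = (\<lambda>w. ip w h)" by (rule ext) (rule L2_inner_commute)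
    then show ?thesis using lin_functional_ip[OF that] by simp
  qed
  have ipd: "lin_functional V (\<lambda>v. ip w (weak_div \<Omega> v))" if "w \<in> W" for w
    using lin_functional_wdiv[OF that] by (simp add: L2_inner_commute[of _ w])
  show ?thesis
  proof (rule bilinear_system_solvable[where J="?J" and L=L, OF lin_space_Z])
    show "finite ?J" by (intro finite_Plus finite_cartesian_product finite_mesh finite_multi_index finite_class.finite_UNIV)
    show "lin_functional Z (L c)" if "c \<in> ?J" for c
    proof (cases c)
      case (Inl a)
      then obtain E \<iota> j where a: "c = Inl ((E, \<iota>), j)" by (metis surj_pair)
      then have "E \<in> T" "\<iota> \<in> grid" using that by auto
      from lin_functional_fst[OF lin_functional_vref[OF this]] show ?thesis by (simp add: L_def a)
    next
      case (Inr b)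
      then obtain E \<iota> where b: "c = Inr (E, \<iota>)" by (metis surj_pair)
      then have "E \<in> T" "\<iota> \<in> grid" using that by auto
      from lin_functional_snd[OF lin_functional_pref[OF this]] show ?thesis by (simp add: L_def b)
    qed
    show "lin_functional Z (\<lambda>z. saddle_form z y)" if "y \<in> Z" for y
      unfolding saddle_form_def using that
      by (intro lin_functional_plus lin_functional_uminus lin_functional_fst[OF lin_functional_quad(1)]
          lin_functional_snd[OF lin_functional_ip] lin_functional_fst[OF lin_functional_wdiv]
          weak_div_L2 open_domain bounded_domain V_Hdiv) auto
    show "lin_functional Z (saddle_form z)" if "z \<in> Z" for z
      unfolding saddle_form_def[abs_def] using that
      by (intro lin_functional_plus lin_functional_uminus lin_functional_fst[OF lin_functional_quad(2)]
          lin_functional_snd[OF ipf] lin_functional_fst[OF ipd]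
          weak_div_L2 open_domain bounded_domain V_Hdiv) auto
    show "lin_functional Z (\<lambda>y. - dir (\<lambda>x. fst (y x)) + ip f (\<lambda>x. snd (y x)))"
      by (intro lin_functional_plus lin_functional_uminus lin_functional_fst[OF lin_functional_dir]
          lin_functional_snd[OF ipf] f)
  next
    fix y assume y: "y \<in> Z" and 0: "\<forall>c\<in>?J. L c y = 0"
    let ?v = "\<lambda>x. fst (y x)" and ?w = "\<lambda>x. snd (y x)"
    have yV: "?v \<in> V" and yW: "?w \<in> W" using y by auto
    have v0: "vref ?v E (node \<iota>) = 0" if "E \<in> T" "\<iota> \<in> grid" for E \<iota>
    proof (rule vec_eq_iff[THEN iffD2], rule allI)
      fix j
      have "Inl ((E, \<iota>), j) \<in> ?J" by (intro InlI SigmaI UNIV_I that)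
      from bspec[OF 0 this] show "vref ?v E (node \<iota>) $ j = 0 $ j" by (simp add: L_def)
    qed
    have w0: "pref ?w E (node \<iota>) = 0" if "E \<in> T" "\<iota> \<in> grid" for E \<iota>
    proof -
      have "Inr (E, \<iota>) \<in> ?J" by (intro InrI SigmaI that)
      from bspec[OF 0 this] show ?thesis by (simp add: L_def)
    qed
    note vz = velocity_zero[OF yV v0]
    have d: "AE x in lebesgue_on \<Omega>. weak_div \<Omega> ?v x = 0"
      by (rule weak_div_null[OF open_domain bounded_domain V_Hdiv[OF yV] vz(2)])
    have w: "ip h ?w = 0" for h
      using ip_null[OF pressure_AE_zero[OF yW w0]] by (simp add: L2_inner_commute[of _ h])
    have q: "quad u ?v = 0" for u
      unfolding quad_form_def Let_def by (intro sum.neutral ballI) (simp add: v0)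
    have "dir ?v = 0" unfolding dirichlet_term_def
    proof (intro sum.neutral ballI)
      fix q assume "q \<in> boundary_facets \<Omega> \<Gamma>D T F"
      then obtain E i s where "q = (E, i, s)" "E \<in> T" by (auto simp: boundary_facets_def)
      then show "(case q of (E, i, s) \<Rightarrow> L2_inner (restrict_space surface_measure (F E ` ref_facet i s)) (Rh (k - 1) (F E) i s g)
          (\<lambda>x. piola (F E) (vref ?v E) x \<bullet> outward_normal \<Omega> x)) = 0"
        using vz(1) by (simp add: piola_zero L2_inner_def)
    qed
    moreover have "saddle_form z y = 0" for z
      unfolding saddle_form_def using q w ip_null[OF d] by (simp add: L2_inner_commute[of _ "\<lambda>x. snd (z x)"])
    ultimately show "- dir ?v + ip f ?w = 0 \<and> (\<forall>z\<in>Z. saddle_form z y = 0)" using w by simp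
  next
    fix y c assume y: "y \<in> Z" and 0: "\<forall>z\<in>Z. saddle_form z y = 0" and c: "c \<in> ?J"
    let ?v = "\<lambda>x. fst (y x)" and ?w = "\<lambda>x. snd (y x)"
    have yV: "?v \<in> V" and yW: "?w \<in> W" using y by auto
    have "quad ?v ?v = 0" using bspec[OF 0 y] by (simp add: saddle_form_def L2_inner_commute)
    note v0 = quad_definite[OF yV this]
    have "ip (weak_div \<Omega> v) ?w = 0" if v: "v \<in> V" for v
    proof -
      have "(\<lambda>x. (v x, 0)) \<in> Z" using v lin_space_zero[OF lin_space_W] by simp
      from bspec[OF 0 this] have "quad v ?v + ip (weak_div \<Omega> v) ?w = 0"
        by (simp add: saddle_form_def ip_null)
      moreover have "quad v ?v = 0"
        unfolding quad_form_def Let_def by (intro sum.neutral ballI) (simp add: v0)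
      ultimately show ?thesis by simp
    qed
    then have "AE x in lebesgue_on \<Omega>. ?w x = 0" by (rule discrete_pressure_zero[OF yW])
    note w0 = pref_zero[OF yW this]
    show "L c y = 0" using c v0 w0 node_in_cube by (auto simp: L_def)
  qed
qed

text \<open>Testing with a pair whose other component is zero separates the two equations.\<close>

lemma uniquely_solvable: "mfmfe_uniquely_solvable Vhat k \<xi> \<omega> \<Omega> \<Gamma>D \<Gamma>N K f g T F"
  unfolding mfmfe_uniquely_solvable_def
proof (intro conjI allI impI)
  from saddle_solvable obtain z where z: "(\<lambda>x. fst (z x)) \<in> V" "(\<lambda>x. snd (z x)) \<in> W"
    and eq: "\<And>y. y \<in> Z \<Longrightarrow> saddle_form z y = - dir (\<lambda>x. fst (y x)) + ip f (\<lambda>x. snd (y x))" by blast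
  let ?u = "\<lambda>x. fst (z x)" and ?p = "\<lambda>x. snd (z x)"
  have "quad ?u v - ip ?p (weak_div \<Omega> v) = - dir v" if v: "v \<in> V" for v
  proof -
    have "(\<lambda>x. (v x, 0)) \<in> Z" using v lin_space_zero[OF lin_space_W] by simp
    from eq[OF this] show ?thesis by (simp add: saddle_form_def L2_inner_def)
  qed
  moreover have "ip (weak_div \<Omega> ?u) w = ip f w" if w: "w \<in> W" for w
  proof -
    have "(\<lambda>x. (0, w x)) \<in> Z" using w lin_space_zero[OF lin_space_V] by simp
    from eq[OF this] show ?thesis
      using lin_functional_zero[OF lin_space_V lin_functional_quad(2), of ?u]
        lin_functional_zero[OF lin_space_V lin_functional_dir]
        lin_functional_zero[OF lin_space_V lin_functional_wdiv[OF z(2)]]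
      by (simp add: saddle_form_def L2_inner_commute[of _ ?p])
  qed
  ultimately show "\<exists>u p. mfmfe_solution Vhat k \<xi> \<omega> \<Omega> \<Gamma>D \<Gamma>N K f g T F u p"
    using z by (intro exI[of _ ?u] exI[of _ ?p]) (simp add: mfmfe_solution_def)
next
  fix u p u' p'
  assume "mfmfe_solution Vhat k \<xi> \<omega> \<Omega> \<Gamma>D \<Gamma>N K f g T F u p \<and> mfmfe_solution Vhat k \<xi> \<omega> \<Omega> \<Gamma>D \<Gamma>N K f g T F u' p'"
  then have u: "u \<in> V" "u' \<in> V" and p: "p \<in> W" "p' \<in> W"
    and 1: "\<And>v. v \<in> V \<Longrightarrow> quad u v - ip p (weak_div \<Omega> v) = quad u' v - ip p' (weak_div \<Omega> v)"
    and 2: "\<And>w. w \<in> W \<Longrightarrow> ip (weak_div \<Omega> u) w = ip (weak_div \<Omega> u') w"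
    by (simp_all add: mfmfe_solution_def)
  define d where "d = (\<lambda>x. u x - u' x)"
  define e where "e = (\<lambda>x. p x - p' x)"
  have d: "d \<in> V" and e: "e \<in> W"
    unfolding d_def e_def by (intro lin_space_diff lin_space_V lin_space_W u p)+
  have 1: "quad d v = ip e (weak_div \<Omega> v)" if v: "v \<in> V" for v
    using 1[OF v] lin_functional_diff[OF lin_space_V lin_functional_quad(1) u, of v]
      lin_functional_diff[OF lin_space_W lin_functional_ip p, OF weak_div_L2[OF open_domain bounded_domain V_Hdiv[OF v]]]
    by (simp add: d_def e_def)
  have "ip (weak_div \<Omega> d) w = 0" if w: "w \<in> W" for w
    using 2[OF w] lin_functional_diff[OF lin_space_V lin_functional_wdiv[OF w] u] by (simp add: d_def)
  then have "quad d d = 0" using 1[OF d] e by (simp add: L2_inner_commute[of _ e])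
  note d0 = quad_definite[OF d this]
  have "quad d v = 0" for v
    unfolding quad_form_def Let_def by (intro sum.neutral ballI) (simp add: d0)
  then have "ip (weak_div \<Omega> v) e = 0" if "v \<in> V" for v using 1[OF that] by (simp add: L2_inner_commute[of _ e])
  then have "AE x in lebesgue_on \<Omega>. e x = 0" by (rule discrete_pressure_zero[OF e])
  then show "AE x in lebesgue_on \<Omega>. p x = p' x" by (simp add: e_def)
  show "AE x in lebesgue_on \<Omega>. u x = u' x" using velocity_zero(2)[OF d d0] by (simp add: d_def)
qed

end

lemma mfmfe_setting_uniquely_solvable:
  fixes \<Omega> :: "(real^'d::{finite,wellorder}) set"
  assumes "k \<ge> 1" "gauss_lobatto k \<xi> \<omega>" "CARD('d) \<ge> 2" "ref_space k Vhat" "mfmfe_setting \<Omega> \<Gamma>D \<Gamma>N K f g H T F" "h \<in> H"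
  shows "mfmfe_uniquely_solvable Vhat k \<xi> \<omega> \<Omega> \<Gamma>D \<Gamma>N K f g (T h) (F h)"
proof -
  interpret S: mfmfe_setting \<Omega> \<Gamma>D \<Gamma>N K f g H T F by fact
  obtain k0 where k0: "0 < k0" "\<And>x y. x \<in> closure \<Omega> \<Longrightarrow> k0 * (y \<bullet> y) \<le> y \<bullet> (K x *v y)"
    using S.K_bounds by blast
  have jac: "invertible (jac (F h E) x)" if "E \<in> T h" "x \<in> ref_cube" for E x
    using S.regular assms(6) that unfolding regular_mesh_def by blast
  have "\<Gamma>D \<subseteq> frontier \<Omega>" using S.boundary(1) closure_subset[of \<Gamma>D] by blast
  then interpret discrete_problem \<Omega> "T h" "F h" Vhat k \<xi> \<omega> \<Gamma>D \<Gamma>N K k0 f g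
    using assms S.domain S.partition S.boundary(2) S.dirichlet_pos S.f_L2 S.resolved k0 jac
    by unfold_locales auto
  show ?thesis by (rule uniquely_solvable)
qed

theorem theorem2p3:
  fixes k :: nat and \<xi> \<omega> :: "nat \<Rightarrow> real"
  assumes "k \<ge> 1"
    and "gauss_lobatto k \<xi> \<omega>"
  shows
    "(\<forall>(\<Omega> :: (real^2) set) \<Gamma>D \<Gamma>N K f g H T F.
        mfmfe_setting \<Omega> \<Gamma>D \<Gamma>N K f g H T F \<longrightarrow>
        (\<forall>h\<in>H. mfmfe_uniquely_solvable (Vhat2 k) k \<xi> \<omega> \<Omega> \<Gamma>D \<Gamma>N K f g (T h) (F h))) \<and>
     (\<forall>(\<Omega> :: (real^3) set) \<Gamma>D \<Gamma>N K f g H T F.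
        mfmfe_setting \<Omega> \<Gamma>D \<Gamma>N K f g H T F \<longrightarrow>
        (\<forall>h\<in>H. mfmfe_uniquely_solvable (Vhat3 k) k \<xi> \<omega> \<Omega> \<Gamma>D \<Gamma>N K f g (T h) (F h)))"
proof (intro conjI allI impI ballI)
  fix \<Omega> :: "(real^2) set" and \<Gamma>D \<Gamma>N K f g H T F h
  assume *: "mfmfe_setting \<Omega> \<Gamma>D \<Gamma>N K f g H T F" "h \<in> H"
  have "ref_space k (Vhat2 k)" unfolding Vhat2_eq by (rule ref_space_enh_space[OF assms(1)]) simp
  then show "mfmfe_uniquely_solvable (Vhat2 k) k \<xi> \<omega> \<Omega> \<Gamma>D \<Gamma>N K f g (T h) (F h)"
    by (intro mfmfe_setting_uniquely_solvable[OF assms _ _ *]) simp_all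
next
  fix \<Omega> :: "(real^3) set" and \<Gamma>D \<Gamma>N K f g H T F h
  assume *: "mfmfe_setting \<Omega> \<Gamma>D \<Gamma>N K f g H T F" "h \<in> H"
  have "ref_space k (Vhat3 k)" unfolding Vhat3_eq by (rule ref_space_enh_space[OF assms(1)]) simp
  then show "mfmfe_uniquely_solvable (Vhat3 k) k \<xi> \<omega> \<Omega> \<Gamma>D \<Gamma>N K f g (T h) (F h)"
    by (intro mfmfe_setting_uniquely_solvable[OF assms _ _ *]) simp_all
qed

end
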